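(* Let $z\in\mathbb{C}$ with $\Re(z)>0$ and let $\alpha>2$ be fixed. With $y=x^{1/\alpha}$ and $x^{*}=x\log\log x$, as $x\to\infty$, $$ S_{z}(x,y)=\frac{x\,m_{z}(\alpha)}{\log^{1-z}y}+O\!\left(\frac{x^{*}}{\log^{2-z}y}+\frac{x^{*}}{\log y}\right), $$ where for $\alpha>2$, $$ m_{z}(\alpha)=\frac{2^{1-z}m_{z}(2)}{\alpha^{1-z}}+\frac{1-z}{\alpha^{1-z}}\int_{2}^{\alpha}\frac{m_{z}(u-1)}{u^{z}}\,du . $$
   Context: For $y>1$ and a positive integer $n$, $\omega_y(n)$ denotes the number of distinct primes $p<y$ dividing $n$; $S_z(x,y)=\sum_{n\le x}z^{\omega_y(n)}$. $g(1,z)=\prod_p\left(1+\frac{z}{p-1}\right)\left(1-\frac1p\right)^{z}$, $\Gamma$ is the Gamma function, and powers of positive reals are $a^{w}=e^{w\log a}$. For $1\le\alpha\le 2$, $m_z(\alpha)=\frac{g(1,z)}{\Gamma(z)}\left(\alpha^{z-1}+(1-z)\alpha^{z-1}\int_1^\alpha \frac{du}{u^{z}(u-1)^{1-z}}\right)$; the displayed formula then defines $m_z$ recursively on $(2,\infty)$. The $O$-term bounds the modulus of the difference. *)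

theory Defs
  imports "HOL-Analysis.Analysis" "HOL-Computational_Algebra.Primes" "HOL-Library.Landau_Symbols"
begin

definition omega_lt :: "real \<Rightarrow> nat \<Rightarrow> nat" where
  "omega_lt y n = card {p. prime p \<and> real p < y \<and> p dvd n}"

definition S_sum :: "complex \<Rightarrow> real \<Rightarrow> real \<Rightarrow> complex" where
  "S_sum z x y = (\<Sum>n\<in>{n::nat. 1 \<le> n \<and> real n \<le> x}. z ^ omega_lt y n)"

definition g_one :: "complex \<Rightarrow> complex" where
  "g_one z = (\<Prod>p::nat. if prime p
       then (1 + z / (of_nat p - 1)) * complex_of_real (1 - 1 / real p) powr z
       else 1)"

context
  notes integral_cong [fundef_cong]
begin

text \<open>
  The intended domain is \<open>\<alpha> \<ge> 1\<close>; the recursion, started from any \<open>\<alpha> \<ge> 1\<close>, never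
  leaves it, so the values produced by the first branch for \<open>\<alpha> < 1\<close> play no role.
\<close>

function m_fun :: "complex \<Rightarrow> real \<Rightarrow> complex" where
  "m_fun z \<alpha> =
     (if \<alpha> \<le> 2 then
        g_one z / Gamma z *
          (of_real \<alpha> powr (z - 1) +
           (1 - z) * of_real \<alpha> powr (z - 1) *
             integral {1..\<alpha>} (\<lambda>u. 1 / (of_real u powr z * of_real (u - 1) powr (1 - z))))
      else
        2 powr (1 - z) * m_fun z 2 / of_real \<alpha> powr (1 - z) +
        (1 - z) / of_real \<alpha> powr (1 - z) *
          integral {2..\<alpha>} (\<lambda>u. m_fun z (u - 1) / of_real u powr z))"
  by auto
termination
  by (relation "Wellfounded.measure (\<lambda>(z, \<alpha>). nat \<lceil>\<alpha>\<rceil>)") (auto, linarith+)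

end

declare m_fun.simps [simp del]

end

theory Submission
  imports Defs "HOL-Complex_Analysis.Complex_Analysis" "HOL-Probability.Probability"
begin

text \<open>
  For $y > x$ the sum $S_z(x,y)$ is the summatory function $D(x)$ of $z^{\omega(n)}$, whose Dirichlet
  series is $\zeta(s)^z G(s)$ with $G$ holomorphic beyond the line $\sigma = 1$ and $G(1) = g(1,z)$.
  The 3-4-1 inequality gives bounds $O(|t|^\epsilon)$ for $\zeta^{\pm 1}$, $\log\zeta$ and derivatives up to
  that line. The second derivative of $\zeta(s)^z G(s)/s$ is the Laplace transform of
  $u^2 D(e^u)$; subtracting the transform of a power of $u$ with the same singularity at $s = 1$ and smoothing
  with a Gaussian yields $D(x) = x\,(g(1,z)/\Gamma(z)) (\log x)^{z-1} + O(x (\log x)^{\kappa-2} + x/\log x)$, where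
  $\kappa = \Re z$; the smoothing is undone by a Cauchy--Schwarz bound for short sums.

  Buchstab's identity $S_z(x,y) = S_z(x,y') + (1-z) \sum_{y \le p < y'} S_z(x/p,p)$ then reduces the range
  $y \ge \sqrt x$ to $D$, and the range $x \le y^{A+1}$ to $x \le y^A$ (with $y' = \sqrt x$). In both cases the
  main terms are summed over primes by Mertens' theorem and partial summation, and the resulting integral is
  the increment of $\alpha^{1-z} m_z(\alpha)$.
\<close>

section \<open>The zeta function on the right half plane\<close>

text \<open>Why two derivatives: after the leading singularity is subtracted, the second derivative
  near s = 1 is O(|s - 1|^(-\<kappa>-1)), and since \<kappa> + 1 > 1 its integral over the line of
  real part 1 + \<delta> is O(\<delta>^(-\<kappa>)) for every \<kappa> > 0. With \<delta> of order
  1/u this is u^\<kappa>, which becomes (log x)^(\<kappa>-2) after division by u^2. Away from s = 1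
  only |t|^(e-1) is available, so a Gaussian cut-off at height T costs T^e. Here T is a power of u,
  because undoing the smoothing loses only powers of u, and e is then chosen so small that T^e =
  O(u). This is the source of the term x / log x; no zero-free region left of the line enters. The
  factor log log x arises in the base case: the relative errors at x/p have size 1/log(x/p), and the
  sum of 1/(p log(x/p)) over primes is of order log log x / log x. The main term at x/p is singular
  at p = x if \<kappa> < 1, so the primes above x/2 are split off and bounded trivially. Each
  further unit step in \<alpha> multiplies the error only by a constant.\<close>

lemma holomorphic_suminf:
  fixes f :: "nat \<Rightarrow> complex \<Rightarrow> complex"
  assumes "open S" and hol: "\<And>n. f n holomorphic_on S"
    and bd: "\<And>x. x \<in> S \<Longrightarrow> \<exists>d>0. \<exists>M. cball x d \<subseteq> S \<and> summable M \<and> (\<forall>n. \<forall>y\<in>cball x d. norm (f n y) \<le> M n)"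
  shows "(\<lambda>x. \<Sum>n. f n x) holomorphic_on S"
proof (rule holomorphic_uniform_sequence[OF \<open>open S\<close>])
  show "(\<lambda>x. \<Sum>i<n. f i x) holomorphic_on S" for n
    by (intro holomorphic_intros hol)
  fix x assume "x \<in> S"
  from bd[OF this] obtain d M where dM: "d > 0" "cball x d \<subseteq> S" "summable M"
    "\<And>n y. y \<in> cball x d \<Longrightarrow> norm (f n y) \<le> M n" by auto
  have "uniform_limit (cball x d) (\<lambda>n x. \<Sum>i<n. f i x) (\<lambda>x. \<Sum>n. f n x) sequentially"
    by (rule Weierstrass_m_test) (use dM in auto)
  with dM show "\<exists>d>0. cball x d \<subseteq> S \<and> uniform_limit (cball x d) (\<lambda>n x. \<Sum>i<n. f i x) (\<lambda>x. \<Sum>n. f n x) sequentially"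
    by auto
qed

lemma summable_Suc_powr: "a < -1 \<Longrightarrow> summable (\<lambda>n. real (Suc n) powr a)"
  using summable_real_powr_iff[of a] by (subst summable_Suc_iff) simp

lemma norm_Suc_powr: "norm (of_nat (Suc n) powr s :: complex) = real (Suc n) powr (Re s)"
  using norm_powr_real_powr[of "of_nat (Suc n)" s] by (simp del: of_nat_Suc)

text \<open>
  Summing $(s-1)n^{-s} + (n+1)^{1-s} - n^{1-s}$ over $n$ telescopes to $(s-1)\zeta(s) - 1$ for real part
  above 1, and the terms decay like $n^{-1-\sigma}$, which continues $(s-1)\zeta(s)$ to $\sigma > 0$.
\<close>

definition zeta_summand :: "nat \<Rightarrow> complex \<Rightarrow> complex" where
  "zeta_summand n s = (s - 1) * of_nat (Suc n) powr (-s) + of_nat (Suc (Suc n)) powr (1 - s) - of_nat (Suc n) powr (1 - s)"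

text \<open>\<open>zeta_summand n s\<close> is the remainder of the first-order Taylor expansion of
  u^(1-s) at u = n + 1, evaluated at u = n + 2. The second derivative has modulus |s| |s - 1| u^(-Re
  s - 1), which for Re s > -1 is largest at the left end.\<close>

lemma zeta_summand_bound:
  assumes "Re s > -1"
  shows "norm (zeta_summand n s) \<le> norm s * norm (s - 1) * real (Suc n) powr (- Re s - 1)"
proof -
  define f where "f = (\<lambda>i::nat. \<lambda>u::complex. if i = 0 then u powr (1 - s)
     else if i = 1 then (1 - s) * u powr (-s) else (1 - s) * (-s) * u powr (-s - 1))"
  define a b where "a = real (Suc n)" and "b = real (Suc (Suc n))"
  define S where "S = closed_segment (complex_of_real a) (complex_of_real b)"
  define B where "B = norm s * norm (s - 1) * real (Suc n) powr (- Re s - 1)"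
  have ab: "a > 0" "a \<le> b" "b - a = 1" by (auto simp: a_def b_def)
  have S_eq: "S = complex_of_real ` {a..b}"
    unfolding S_def using ab by (simp add: closed_segment_of_real closed_segment_eq_real_ivl)
  have "cmod (f 0 (of_real b) - (\<Sum>i\<le>1. f i (of_real a) * (of_real b - of_real a) ^ i / (fact i))) \<le>
          B * cmod (of_real b - of_real a) ^ (Suc 1) / fact 1"
  proof (rule complex_Taylor)
    show "convex S" by (simp add: S_def)
    fix i :: nat and x assume x: "x \<in> S" "i \<le> 1"
    then obtain u where u: "x = of_real u" "a \<le> u" by (auto simp: S_eq)
    have nx: "x \<notin> \<real>\<^sub>\<le>\<^sub>0" using u ab by (auto simp: complex_nonpos_Reals_iff)
    have "i = 0 \<or> i = 1" using x by auto
    thus "(f i has_field_derivative f (Suc i) x) (at x within S)"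
    proof
      assume i: "i = 0"
      have "((\<lambda>u. u powr (1 - s)) has_field_derivative (1 - s) * x powr (1 - s - 1)) (at x within S)"
        using nx by (rule has_field_derivative_powr[THEN has_field_derivative_at_within])
      thus ?thesis by (simp add: f_def i)
    next
      assume i: "i = 1"
      have "((\<lambda>u. (1 - s) * u powr (-s)) has_field_derivative (1 - s) * ((-s) * x powr (-s - 1))) (at x within S)"
        using nx by (rule has_field_derivative_powr[THEN DERIV_cmult, THEN has_field_derivative_at_within])
      thus ?thesis by (simp add: f_def i mult.assoc)
    qed
  next
    fix x assume x: "x \<in> S"
    then obtain u where u: "x = of_real u" "a \<le> u" by (auto simp: S_eq)
    have "norm (x powr (-s - 1)) = u powr (- Re s - 1)"
      using u ab norm_powr_real_powr[of x "-s-1"] by simp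
    also have "\<dots> \<le> a powr (- Re s - 1)"
      using u ab assms by (intro powr_mono2') auto
    finally have "norm (x powr (-s - 1)) \<le> a powr (- Re s - 1)" .
    hence "norm s * norm (s - 1) * norm (x powr (-s - 1)) \<le> norm s * norm (s - 1) * a powr (- Re s - 1)"
      by (intro mult_left_mono) auto
    thus "cmod (f (Suc 1) x) \<le> B"
      by (simp add: f_def B_def a_def norm_mult norm_minus_commute mult_ac)
  qed (auto simp: S_def)
  moreover have "complex_of_real b - of_real a = 1" using ab(3) by (metis of_real_1 of_real_diff)
  ultimately have "cmod (f 0 (of_real b) - (f 0 (of_real a) + f 1 (of_real a))) \<le> B"
    by simp
  also have "f 0 (of_real b) - (f 0 (of_real a) + f 1 (of_real a)) = zeta_summand n s"
    by (simp add: f_def zeta_summand_def a_def b_def algebra_simps)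
  finally show ?thesis by (simp add: B_def)
qed

definition zeta_num :: "complex \<Rightarrow> complex" where
  "zeta_num s = 1 + (\<Sum>n. zeta_summand n s)"

text \<open>At s = 1 the quotient takes the default value 0, so analytic statements about
  \<open>zeta\<close> exclude that point.\<close>

definition zeta :: "complex \<Rightarrow> complex" where
  "zeta s = zeta_num s / (s - 1)"

lemma zeta_summand_holomorphic [holomorphic_intros]: "zeta_summand n holomorphic_on S"
  unfolding zeta_summand_def by (intro holomorphic_intros) (auto simp del: of_nat_Suc)

lemma holomorphic_zeta_num: "zeta_num holomorphic_on {s. Re s > 0}"
proof -
  have "(\<lambda>x. \<Sum>n. zeta_summand n x) holomorphic_on {s. Re s > 0}"
  proof (rule holomorphic_suminf)
    show "open {s. Re s > 0}" by (simp add: open_halfspace_Re_gt)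
    fix x assume x: "x \<in> {s. Re s > 0}"
    define d where "d = Re x / 2"
    define M where "M = (\<lambda>n. (norm x + d) * (norm x + d + 1) * real (Suc n) powr (- d - 1))"
    have d: "d > 0" using x by (simp add: d_def)
    have yb: "norm y \<le> norm x + d" "Re y \<ge> d" if "y \<in> cball x d" for y
    proof -
      have *: "norm (x - y) \<le> d" using that by (simp add: dist_norm)
      show "norm y \<le> norm x + d" using * norm_triangle_sub[of y x] by (simp add: norm_minus_commute)
      have "Re (x - y) \<le> d" using * complex_Re_le_cmod[of "x - y"] by linarith
      thus "Re y \<ge> d" by (simp add: d_def)
    qed
    have "norm (zeta_summand n y) \<le> M n" if "y \<in> cball x d" for n y
    proof -
      have "norm (y - 1) \<le> norm x + d + 1"
        using norm_triangle_ineq4[of y 1] yb(1)[OF that] by simp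
      moreover have "real (Suc n) powr (- Re y - 1) \<le> real (Suc n) powr (- d - 1)"
        using yb[OF that] by (intro powr_mono) auto
      ultimately have "norm y * norm (y - 1) * real (Suc n) powr (- Re y - 1) \<le> M n"
        unfolding M_def using yb(1)[OF that] d by (intro mult_mono) auto
      moreover have "Re y > -1" using yb(2)[OF that] d by linarith
      ultimately show ?thesis using zeta_summand_bound[of y n] by linarith
    qed
    moreover have "summable M" unfolding M_def using d by (intro summable_mult summable_Suc_powr) auto
    moreover have "cball x d \<subseteq> {s. Re s > 0}" using yb(2) d by force
    ultimately show "\<exists>d>0. \<exists>M. cball x d \<subseteq> {s. Re s > 0} \<and> summable M \<and> (\<forall>n. \<forall>y\<in>cball x d. norm (zeta_summand n y) \<le> M n)"
      using d by blast
  qed (intro holomorphic_intros)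
  thus ?thesis unfolding zeta_num_def by (intro holomorphic_intros)
qed

lemma summable_zeta_summand: "Re s > 0 \<Longrightarrow> summable (\<lambda>n. norm (zeta_summand n s))"
proof (rule summable_comparison_test'[where N = 0])
  assume "Re s > 0"
  thus "summable (\<lambda>n. norm s * norm (s - 1) * real (Suc n) powr (- Re s - 1))"
    by (intro summable_mult summable_Suc_powr) auto
  show "norm (norm (zeta_summand n s)) \<le> norm s * norm (s - 1) * real (Suc n) powr (- Re s - 1)" for n
    using zeta_summand_bound[of s n] \<open>Re s > 0\<close> by simp
qed

lemma zeta_num_1: "zeta_num 1 = 1"
  by (simp add: zeta_num_def zeta_summand_def del: of_nat_Suc)

lemma sum_zeta_summand:
  "(\<Sum>n<N. zeta_summand n s) = (s - 1) * (\<Sum>n<N. of_nat (Suc n) powr (-s)) + of_nat (Suc N) powr (1 - s) - 1"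
  by (induction N) (simp_all add: zeta_summand_def algebra_simps del: of_nat_Suc, simp)

lemma summable_dirichlet_one: "Re s > 1 \<Longrightarrow> summable (\<lambda>n. norm (of_nat (Suc n) powr (-s) :: complex))"
  unfolding norm_Suc_powr by (intro summable_Suc_powr) auto

text \<open>For Re s > 1 the boundary term (N+1)^(1-s) of the telescoped sum tends to 0, which
  identifies the continuation with the Dirichlet series.\<close>

lemma zeta_sums:
  assumes "Re s > 1"
  shows "(\<lambda>n. of_nat (Suc n) powr (-s)) sums zeta s"
proof -
  define S where "S = (\<Sum>n. of_nat (Suc n) powr (-s) :: complex)"
  have s1: "(\<lambda>n. of_nat (Suc n) powr (-s) :: complex) sums S"
    unfolding S_def using summable_norm_cancel[OF summable_dirichlet_one[OF assms]] by (rule summable_sums)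
  have "(\<lambda>N. of_nat (Suc N) powr (1 - s) :: complex) \<longlonglongrightarrow> 0"
  proof (rule tendsto_norm_zero_cancel)
    have "(\<lambda>N. real N powr (1 - Re s)) \<longlonglongrightarrow> 0"
      using assms by (intro tendsto_neg_powr filterlim_real_sequentially) auto
    thus "(\<lambda>N. norm (of_nat (Suc N) powr (1 - s) :: complex)) \<longlonglongrightarrow> 0"
      unfolding norm_Suc_powr by (subst filterlim_sequentially_Suc) simp
  qed
  with s1 have "(\<lambda>N. (s - 1) * (\<Sum>n<N. of_nat (Suc n) powr (-s)) + of_nat (Suc N) powr (1 - s) - 1)
     \<longlonglongrightarrow> (s - 1) * S + 0 - 1"
    unfolding sums_def by (intro tendsto_intros)
  hence "(\<lambda>n. zeta_summand n s) sums ((s - 1) * S - 1)" unfolding sums_def sum_zeta_summand by simp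
  hence "zeta_num s = (s - 1) * S" unfolding zeta_num_def by (simp add: sums_iff)
  moreover have "s \<noteq> 1" using assms by auto
  ultimately have "zeta s = S" by (simp add: zeta_def)
  with s1 show ?thesis by simp
qed

text \<open>Truncating the telescoped series at N, the integer just above |Im s|, leaves a Dirichlet
  polynomial, a boundary term and a tail, each O(N^(3e)). The exponent is 2e for the distance to the
  line of real part 1, plus e to replace 1/n by the summable n^(-1-e).\<close>

lemma zeta_strip_bound:
  assumes e: "0 < e" "e \<le> 1/4" and tau: "\<tau> > 0"
  shows "\<exists>C>0. \<forall>s. 1 - 2 * e \<le> Re s \<and> Re s \<le> 3 \<and> \<bar>Im s\<bar> \<ge> \<tau> \<longrightarrow> norm (zeta s) \<le> C * \<bar>Im s\<bar> powr (3 * e)"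
proof -
  define K where "K = (\<Sum>n. real (Suc n) powr (- 1 - e))"
  have sK: "summable (\<lambda>n. real (Suc n) powr (- 1 - e))" using e by (intro summable_Suc_powr) auto
  have K0: "K \<ge> 0" unfolding K_def by (intro suminf_nonneg sK) auto
  \<comment> \<open>The last factor converts (N+1)^(3e) into |Im s|^(3e), since N + 1 is at most |Im
    s| + 2, hence at most (1 + 2/\<tau>) |Im s|.\<close>
  define C where "C = (K + 1/\<tau> + (3/\<tau> + 1) * K + 1) * (1 + 2/\<tau>) powr (3*e)"
  have "K + 1/\<tau> + (3/\<tau> + 1) * K + 1 > 0" using K0 tau by (simp add: add_nonneg_pos)
  moreover have "1 + 2/\<tau> > 0" using tau by (simp add: add_pos_pos)
  ultimately have C0: "C > 0" unfolding C_def by simp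
  have "norm (zeta s) \<le> C * \<bar>Im s\<bar> powr (3 * e)"
    if s: "1 - 2 * e \<le> Re s" "Re s \<le> 3" "\<bar>Im s\<bar> \<ge> \<tau>" for s
  proof -
    define t where "t = \<bar>Im s\<bar>"
    define N where "N = nat \<lceil>t\<rceil>"
    define A where "A = real (Suc N) powr (3*e)"
    have t: "t > 0" "t \<ge> \<tau>" using s tau by (auto simp: t_def)
    have N1: "real (Suc N) \<ge> t" and N2: "real (Suc N) \<le> t + 2" unfolding N_def using t by linarith+
    have N2': "real (Suc N) \<le> (1 + 2/\<tau>) * t"
    proof -
      have "2 \<le> 2/\<tau> * t" using t tau by (simp add: field_simps)
      thus ?thesis using N2 by (simp add: algebra_simps)
    qed
    have Res: "Re s > 0" using s e by linarith
    have s1: "norm (s - 1) \<ge> \<tau>" using s abs_Im_le_cmod[of "s-1"] by simp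
    hence sn1: "s \<noteq> 1" using tau by auto
    have summ: "summable (\<lambda>n. zeta_summand n s)" using summable_norm_cancel[OF summable_zeta_summand[OF Res]] .
    have "(\<Sum>n. zeta_summand n s) = (\<Sum>n. zeta_summand (n + N) s) + (\<Sum>n<N. zeta_summand n s)"
      by (rule suminf_split_initial_segment[OF summ])
    hence "zeta_num s = (\<Sum>n. zeta_summand (n + N) s) + (s - 1) * (\<Sum>n<N. of_nat (Suc n) powr (-s)) + of_nat (Suc N) powr (1 - s)"
      by (simp add: zeta_num_def sum_zeta_summand)
    hence zeq: "zeta s = (\<Sum>n. zeta_summand (n + N) s) / (s - 1) + (\<Sum>n<N. of_nat (Suc n) powr (-s)) + of_nat (Suc N) powr (1 - s) / (s - 1)"
      using sn1 by (simp add: zeta_def add_divide_distrib)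
    have b2: "norm (\<Sum>n<N. of_nat (Suc n) powr (-s) :: complex) \<le> A * K"
    proof -
      have "norm (\<Sum>n<N. of_nat (Suc n) powr (-s) :: complex) \<le> (\<Sum>n<N. real (Suc n) powr (- Re s))"
        by (rule order_trans[OF norm_sum]) (simp add: norm_Suc_powr del: of_nat_Suc)
      also have "\<dots> \<le> (\<Sum>n<N. A * real (Suc n) powr (- 1 - e))"
      proof (rule sum_mono)
        fix n assume n: "n \<in> {..<N}"
        have "real (Suc n) powr (- Re s) \<le> real (Suc n) powr (3*e + (- 1 - e))"
          using s by (intro powr_mono) auto
        also have "\<dots> = real (Suc n) powr (3*e) * real (Suc n) powr (- 1 - e)" by (rule powr_add)
        also have "\<dots> \<le> A * real (Suc n) powr (- 1 - e)"
          unfolding A_def using n e by (intro mult_right_mono powr_mono2) auto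
        finally show "real (Suc n) powr (- Re s) \<le> A * real (Suc n) powr (- 1 - e)" .
      qed
      also have "\<dots> = A * (\<Sum>n<N. real (Suc n) powr (- 1 - e))" by (simp add: sum_distrib_left)
      also have "\<dots> \<le> A * K"
        unfolding K_def A_def by (intro mult_left_mono sum_le_suminf sK) auto
      finally show ?thesis .
    qed
    have b3: "norm (of_nat (Suc N) powr (1 - s) / (s - 1)) \<le> A * (1/\<tau>)"
    proof -
      have "real (Suc N) powr (1 - Re s) \<le> A" unfolding A_def using s e by (intro powr_mono) auto
      hence "real (Suc N) powr (1 - Re s) / norm (s - 1) \<le> A / \<tau>"
        using s1 tau by (intro frac_le) (auto simp: A_def)
      thus ?thesis using norm_Suc_powr[of N "1 - s"] by (simp add: norm_divide del: of_nat_Suc)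
    qed
    have b1: "norm ((\<Sum>n. zeta_summand (n + N) s) / (s - 1)) \<le> A * ((3/\<tau> + 1) * K)"
    proof -
      \<comment> \<open>The decay is split as n^(3e-1) times n^(-1-e): the first factor, taken at n
        = N, offsets |s| = O(N), and the second keeps the series convergent.\<close>
      have bnd: "norm (zeta_summand (n + N) s) \<le> norm s * norm (s - 1) * (real (Suc N) powr (3*e - 1) * real (Suc n) powr (- 1 - e))" for n
      proof -
        have "real (Suc (n+N)) powr (- Re s - 1) \<le> real (Suc (n+N)) powr ((3*e - 1) + (- 1 - e))"
          using s by (intro powr_mono) auto
        also have "\<dots> = real (Suc (n+N)) powr (3*e - 1) * real (Suc (n+N)) powr (- 1 - e)" by (rule powr_add)
        also have "\<dots> \<le> real (Suc N) powr (3*e - 1) * real (Suc n) powr (- 1 - e)"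
          using e by (intro mult_mono powr_mono2') auto
        finally have "norm s * norm (s - 1) * real (Suc (n+N)) powr (- Re s - 1) \<le>
           norm s * norm (s - 1) * (real (Suc N) powr (3*e - 1) * real (Suc n) powr (- 1 - e))"
          by (intro mult_left_mono) auto
        thus ?thesis using zeta_summand_bound[of s "n+N"] Res by linarith
      qed
      have "norm (\<Sum>n. zeta_summand (n + N) s) \<le> (\<Sum>n. norm s * norm (s - 1) * (real (Suc N) powr (3*e - 1) * real (Suc n) powr (- 1 - e)))"
        by (rule norm_suminf_le[OF bnd]) (intro summable_mult sK)
      also have "\<dots> = norm s * norm (s - 1) * (real (Suc N) powr (3*e - 1) * K)"
        unfolding K_def by (simp only: suminf_mult[OF sK] suminf_mult[OF summable_mult[OF sK]])
      finally have "norm ((\<Sum>n. zeta_summand (n + N) s) / (s - 1)) \<le> norm s * (real (Suc N) powr (3*e - 1) * K)"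
        using sn1 by (simp add: norm_divide field_simps)
      also have "norm s \<le> (3/\<tau> + 1) * real (Suc N)"
      proof -
        have "norm s \<le> \<bar>Re s\<bar> + \<bar>Im s\<bar>" by (rule cmod_le)
        also have "\<dots> \<le> 3 + t" using s Res by (simp add: t_def)
        also have "3 \<le> 3/\<tau> * t" using t tau by (simp add: field_simps)
        finally have "norm s \<le> (3/\<tau> + 1) * t" by (simp add: algebra_simps)
        also have "\<dots> \<le> (3/\<tau> + 1) * real (Suc N)" using N1 tau by (intro mult_left_mono) auto
        finally show ?thesis .
      qed
      also have "(3/\<tau> + 1) * real (Suc N) * (real (Suc N) powr (3*e - 1) * K) = A * ((3/\<tau> + 1) * K)"
        unfolding A_def by (simp add: powr_diff field_simps)
      finally show ?thesis using K0 by (simp add: mult_right_mono)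
    qed
    have "norm (zeta s) \<le> A * ((3/\<tau> + 1) * K) + A * K + A * (1/\<tau>)"
      unfolding zeq by (intro norm_triangle_le add_mono b1 b2 b3)
    also have "\<dots> \<le> A * (K + 1/\<tau> + (3/\<tau> + 1) * K + 1)"
      by (simp add: algebra_simps A_def)
    also have "\<dots> \<le> ((1 + 2/\<tau>) * t) powr (3*e) * (K + 1/\<tau> + (3/\<tau> + 1) * K + 1)"
      unfolding A_def using N2' e K0 tau by (intro mult_right_mono powr_mono2) auto
    also have "\<dots> = C * t powr (3*e)"
      unfolding C_def using tau t by (subst powr_mult) auto
    finally show ?thesis by (simp add: t_def)
  qed
  with C0 show ?thesis by blast
qed

lemma holomorphic_zeta: "zeta holomorphic_on {s. Re s > 0} - {1}"
  unfolding zeta_def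
  by (intro holomorphic_intros holomorphic_on_subset[OF holomorphic_zeta_num]) auto

text \<open>Cauchy estimates on discs of fixed radius. The discs cross the line of real part 1,
  which is why \<open>zeta_strip_bound\<close> reaches to the left of it.\<close>

lemma zeta_deriv_bound:
  assumes e: "0 < e" and tau: "\<tau> > 0"
  shows "\<exists>C>0. \<forall>s j. 1 \<le> Re s \<and> Re s \<le> 2 \<and> \<bar>Im s\<bar> \<ge> \<tau> \<and> j \<le> 2 \<longrightarrow> norm ((deriv ^^ j) zeta s) \<le> C * \<bar>Im s\<bar> powr e"
proof -
  define d where "d = min (e/3) (1/4)"
  have d: "0 < d" "d \<le> 1/4" "3 * d \<le> e" using e by (auto simp: d_def)
  obtain C where C: "C > 0" and bd: "\<And>s. 1 - 2*d \<le> Re s \<Longrightarrow> Re s \<le> 3 \<Longrightarrow> \<bar>Im s\<bar> \<ge> \<tau>/2 \<Longrightarrow> norm (zeta s) \<le> C * \<bar>Im s\<bar> powr (3*d)"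
    using zeta_strip_bound[OF d(1,2), of "\<tau>/2"] tau by auto
  define r where "r = min (\<tau>/2) d"
  have r: "r > 0" "r \<le> \<tau>/2" "r \<le> d" "r \<le> 1" using tau d by (auto simp: r_def)
  define K where "K = C * 2 powr (3*d) * \<tau> powr (3*d) / \<tau> powr e"
  define C' where "C' = 2 * (K + 1) / r^2"
  have K: "K > 0" unfolding K_def using C tau by simp
  have C': "C' > 0" unfolding C'_def using K r by (intro divide_pos_pos) auto
  have "norm ((deriv ^^ j) zeta s) \<le> C' * \<bar>Im s\<bar> powr e"
    if s: "1 \<le> Re s" "Re s \<le> 2" "\<bar>Im s\<bar> \<ge> \<tau>" and j: "j \<le> 2" for s j
  proof -
    define B where "B = K * \<bar>Im s\<bar> powr e"
    have t0: "\<bar>Im s\<bar> > 0" using s tau by linarith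
    have wb: "norm (zeta w) \<le> B" if "w \<in> cball s r" for w
    proof -
      have *: "norm (s - w) \<le> r" using that by (simp add: dist_norm)
      have re: "\<bar>Re s - Re w\<bar> \<le> r" and im: "\<bar>Im s - Im w\<bar> \<le> r"
        using * abs_Re_le_cmod[of "s-w"] abs_Im_le_cmod[of "s-w"] by auto
      have "norm (zeta w) \<le> C * \<bar>Im w\<bar> powr (3*d)"
        using re im r d s by (intro bd) linarith+
      also have "\<dots> \<le> C * (2 * \<bar>Im s\<bar>) powr (3*d)"
        using im r s C d by (intro mult_left_mono powr_mono2) linarith+
      \<comment> \<open>|Im s| may be below 1, so the exponent is raised from 3d to e only after
        division by \<tau>, which makes the base at least 1.\<close>
      also have "(2 * \<bar>Im s\<bar>) powr (3*d) = 2 powr (3*d) * \<tau> powr (3*d) * (\<bar>Im s\<bar> / \<tau>) powr (3*d)"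
        using tau t0 by (simp add: powr_mult powr_divide)
      also have "\<dots> \<le> 2 powr (3*d) * \<tau> powr (3*d) * (\<bar>Im s\<bar> / \<tau>) powr e"
        using tau s d by (intro mult_left_mono powr_mono) (auto simp: field_simps)
      also have "C * (2 powr (3*d) * \<tau> powr (3*d) * (\<bar>Im s\<bar> / \<tau>) powr e) =
          C * 2 powr (3*d) * \<tau> powr (3*d) / \<tau> powr e * \<bar>Im s\<bar> powr e"
        using tau t0 by (simp add: powr_divide)
      finally have "norm (zeta w) \<le> C * 2 powr (3*d) * \<tau> powr (3*d) / \<tau> powr e * \<bar>Im s\<bar> powr e"
        using C by (simp add: mult_left_mono)
      thus ?thesis by (simp add: B_def K_def)
    qed
    have B0: "B < (K + 1) * \<bar>Im s\<bar> powr e" unfolding B_def using t0 by (simp add: algebra_simps)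
    have sub: "cball s r \<subseteq> {s. Re s > 0} - {1}"
    proof
      fix w assume "w \<in> cball s r"
      hence *: "norm (s - w) \<le> r" by (simp add: dist_norm)
      have "\<bar>Re s - Re w\<bar> \<le> r" "\<bar>Im s - Im w\<bar> \<le> r"
        using * abs_Re_le_cmod[of "s-w"] abs_Im_le_cmod[of "s-w"] by auto
      hence "Re w > 0" "\<bar>Im w\<bar> > 0" using r d s tau by linarith+
      thus "w \<in> {s. Re s > 0} - {1}" by auto
    qed
    have hol: "zeta holomorphic_on cball s r" by (rule holomorphic_on_subset[OF holomorphic_zeta sub])
    show ?thesis
    proof (cases "j = 0")
      case True
      have "norm (zeta s) \<le> B" using r by (intro wb) auto
      also have "\<dots> \<le> C' * \<bar>Im s\<bar> powr e"
      proof -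
        have "K * r^2 \<le> K * 1" using r K by (intro mult_left_mono power_le_one) auto
        hence "K * r^2 \<le> 2 * (K + 1)" using K unfolding mult_1_right distrib_left by linarith
        hence "K \<le> C'" unfolding C'_def using r K by (simp add: field_simps del: mult_le_cancel_left1)
        thus ?thesis unfolding B_def by (intro mult_right_mono) auto
      qed
      finally show ?thesis using True by simp
    next
      case False
      have "norm ((deriv ^^ j) zeta s) \<le> fact j * ((K + 1) * \<bar>Im s\<bar> powr e) / r ^ j"
      proof (rule Cauchy_higher_deriv_bound[where y = 0])
        show "zeta holomorphic_on ball s r" using hol by (rule holomorphic_on_subset) auto
        show "continuous_on (cball s r) zeta" using hol by (rule holomorphic_on_imp_continuous_on)
        show "zeta w \<in> ball 0 ((K + 1) * \<bar>Im s\<bar> powr e)" if "w \<in> ball s r" for w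
          using wb[of w] that B0 by auto
      qed (use r False in auto)
      also have "\<dots> \<le> 2 * ((K + 1) * \<bar>Im s\<bar> powr e) / r ^ 2"
      proof (rule frac_le)
        have "fact j \<le> (fact 2 :: real)" using j by (intro fact_mono)
        thus "fact j * ((K + 1) * \<bar>Im s\<bar> powr e) \<le> 2 * ((K + 1) * \<bar>Im s\<bar> powr e)"
          using K by (intro mult_right_mono) auto
        show "r ^ 2 \<le> r ^ j" using r j by (intro power_decreasing) auto
      qed (use r K in auto)
      also have "\<dots> = C' * \<bar>Im s\<bar> powr e" unfolding C'_def by (simp only: mult.assoc times_divide_eq_left)
      finally show ?thesis .
    qed
  qed
  with C' show ?thesis by blast
qed

section \<open>Dirichlet series of powers of omega\<close>

text \<open>Version of \<open>omega_lt\<close> with an integer cut-off, so that identities can be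
  proved by induction on k, one prime at a time.\<close>

definition omega_below :: "nat \<Rightarrow> nat \<Rightarrow> nat" where
  "omega_below k n = card {p. prime p \<and> p < k \<and> p dvd n}"

definition omega :: "nat \<Rightarrow> nat" where
  "omega n = omega_below (Suc n) n"

lemma omega_below_Suc: "omega_below (Suc k) n = omega_below k n + (if prime k \<and> k dvd n then 1 else 0)"
proof -
  have "{p. prime p \<and> p < Suc k \<and> p dvd n} =
     {p. prime p \<and> p < k \<and> p dvd n} \<union> (if prime k \<and> k dvd n then {k} else {})"
    by (auto simp: less_Suc_eq)
  thus ?thesis unfolding omega_below_def by (auto simp: card_insert_if)
qed

lemma omega_below_0 [simp]: "omega_below 0 n = 0"
  by (simp add: omega_below_def)

lemma omega_below_1 [simp]: "omega_below k (Suc 0) = 0"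
  by (auto simp: omega_below_def)

lemma omega_below_times_prime:
  assumes "prime p" "k \<le> p"
  shows "omega_below k (p * m) = omega_below k m"
proof -
  have "\<not> q dvd p" if "prime q" "q < k" for q
    using that assms primes_dvd_imp_eq[of q p] by auto
  hence "{q. prime q \<and> q < k \<and> q dvd p * m} = {q. prime q \<and> q < k \<and> q dvd m}"
    by (auto simp: prime_dvd_mult_iff)
  thus ?thesis by (simp add: omega_below_def)
qed

lemma omega_below_eq_omega: "n > 0 \<Longrightarrow> n < k \<Longrightarrow> omega_below k n = omega n"
  unfolding omega_def omega_below_def
  by (rule arg_cong[where f = card]) (auto dest: dvd_imp_le)

lemma omega_below_le_omega: "n > 0 \<Longrightarrow> omega_below k n \<le> omega n"
  unfolding omega_def omega_below_def
  by (intro card_mono) (auto dest: dvd_imp_le)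

lemma omega_eq_0_iff: "n > 0 \<Longrightarrow> omega n = 0 \<longleftrightarrow> n = 1"
proof
  assume n: "n > 0" "omega n = 0"
  have "finite {p. prime p \<and> p < Suc n \<and> p dvd n}" by (rule finite_subset[of _ "{..n}"]) auto
  with n have "{p. prime p \<and> p < Suc n \<and> p dvd n} = {}" by (simp add: omega_def omega_below_def)
  thus "n = 1" using prime_factor_nat[of n] n(1) by (auto dest: dvd_imp_le simp: less_Suc_eq_le)
qed (simp add: omega_def)

text \<open>With w = p^(-s) the local factor of the series is (1 + (z-1) w) / (1 - w) for p < k and
  1 / (1 - w) otherwise; this finite product is what remains after division by zeta.\<close>

definition partial_euler :: "nat \<Rightarrow> complex \<Rightarrow> complex \<Rightarrow> complex" where
  "partial_euler k z s = (\<Prod>p<k. if prime p then 1 + (z - 1) * of_nat p powr (-s) else 1)"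

lemma of_nat_mult_powr: "of_nat (a * b) powr s = of_nat a powr s * (of_nat b powr s :: complex)"
  by (simp add: powr_times_real)

text \<open>Admitting a prime k multiplies the terms with k | n by z, that is, adds z - 1 times the
  subseries over multiples of k. That subseries is k^(-s) times the whole series, because the
  cut-off k ignores the factor k.\<close>

lemma omega_below_dirichlet_sums:
  assumes s: "Re s > 1"
  shows "(\<lambda>n. z ^ omega_below k (Suc n) * of_nat (Suc n) powr (-s)) sums (zeta s * partial_euler k z s)"
proof (induction k)
  case 0
  show ?case using zeta_sums[OF s] by (simp add: partial_euler_def del: of_nat_Suc)
next
  case (Suc k)
  show ?case
  proof (cases "prime k")
    case False
    thus ?thesis using Suc by (simp add: omega_below_Suc partial_euler_def del: of_nat_Suc)
  next
    case True
    define h where "h = (\<lambda>n. z ^ omega_below k n * of_nat n powr (-s))"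
    define g where "g = (\<lambda>j. k * Suc j - 1)"
    define c where "c = zeta s * partial_euler k z s"
    have kpos: "k \<ge> 1" using True prime_ge_1_nat by blast
    have Sg: "Suc (g j) = k * Suc j" for j using kpos unfolding g_def by simp
    have "strict_mono g"
    proof (rule strict_monoI)
      fix i j :: nat assume "i < j"
      hence "Suc (g i) < Suc (g j)" unfolding Sg using kpos by auto
      thus "g i < g j" by simp
    qed
    moreover have "(if k dvd Suc n then h (Suc n) else 0) = 0" if "n \<notin> range g" for n
    proof (rule ccontr)
      assume "\<not> ?thesis"
      then obtain m where m: "Suc n = k * m" by (auto split: if_splits)
      then obtain j where "m = Suc j" by (cases m) auto
      with m Sg[of j] have "n = g j" by simp
      with that show False by auto
    qed
    ultimately have iff: "(\<lambda>j. if k dvd Suc (g j) then h (Suc (g j)) else 0) sums (of_nat k powr (-s) * c) \<longleftrightarrow>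
       (\<lambda>n. if k dvd Suc n then h (Suc n) else 0) sums (of_nat k powr (-s) * c)"
      by (rule sums_mono_reindex)
    have "h (Suc (g j)) = of_nat k powr (-s) * h (Suc j)" for j
      unfolding Sg h_def using True by (subst omega_below_times_prime) (auto simp: of_nat_mult_powr simp del: of_nat_Suc of_nat_mult mult_Suc_right)
    hence "(\<lambda>j. if k dvd Suc (g j) then h (Suc (g j)) else 0) = (\<lambda>j. of_nat k powr (-s) * h (Suc j))"
      unfolding Sg by (auto simp: fun_eq_iff)
    moreover have "(\<lambda>j. of_nat k powr (-s) * h (Suc j)) sums (of_nat k powr (-s) * c)"
      using Suc unfolding h_def c_def by (intro sums_mult)
    ultimately have 1: "(\<lambda>n. if k dvd Suc n then h (Suc n) else 0) sums (of_nat k powr (-s) * c)"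
      using iff by simp
    have 2: "(\<lambda>n. h (Suc n)) sums c" using Suc unfolding h_def c_def .
    have "(\<lambda>n. h (Suc n) + (z - 1) * (if k dvd Suc n then h (Suc n) else 0)) sums (c + (z - 1) * (of_nat k powr (-s) * c))"
      by (intro sums_add sums_mult 1 2)
    also have "(\<lambda>n. h (Suc n) + (z - 1) * (if k dvd Suc n then h (Suc n) else 0)) =
        (\<lambda>n. z ^ omega_below (Suc k) (Suc n) * of_nat (Suc n) powr (-s))"
      using True by (auto simp: h_def omega_below_Suc fun_eq_iff algebra_simps simp del: of_nat_Suc)
    also have "c + (z - 1) * (of_nat k powr (-s) * c) = zeta s * partial_euler (Suc k) z s"
      using True by (simp add: c_def partial_euler_def algebra_simps)
    finally show ?thesis .
  qed
qed

lemma norm_of_nat_powr: "norm (of_nat n powr s :: complex) = real n powr (Re s)"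
  using norm_powr_real_powr[of "of_nat n" s] by simp

lemma of_nat_powr_of_real: "of_nat n powr (complex_of_real a) = complex_of_real (real n powr a)"
  using powr_of_real[of "real n" a] by simp

lemma prime_powr_bounds:
  assumes "prime p" "\<sigma> > 0"
  shows "0 < real p powr (-\<sigma>)" "real p powr (-\<sigma>) < 1" "real p powr (-\<sigma>) \<le> 2 powr (-\<sigma>)"
proof -
  have p: "p \<ge> 2" using assms prime_ge_2_nat by blast
  show "0 < real p powr (-\<sigma>)" using p by simp
  show le: "real p powr (-\<sigma>) \<le> 2 powr (-\<sigma>)" using p assms by (intro powr_mono2') auto
  have "2 powr (-\<sigma>) < (2::real) powr 0" using assms by (intro powr_less_mono) auto
  thus "real p powr (-\<sigma>) < 1" using le by simp
qed

text \<open>At z = 0 the series has nonnegative terms, being supported on the n without prime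
  factors below k, and n = 1 alone contributes 1.\<close>

lemma norm_zeta_partial_euler_0:
  assumes "\<sigma> > 1"
  shows "norm (zeta (of_real \<sigma>)) * (\<Prod>p<k. if prime p then 1 - real p powr (-\<sigma>) else 1) \<ge> 1"
proof -
  have "(\<lambda>n. 0 ^ omega_below k (Suc n) * of_nat (Suc n) powr (- complex_of_real \<sigma>)) sums (zeta (of_real \<sigma>) * partial_euler k 0 (of_real \<sigma>))"
    using omega_below_dirichlet_sums[of "of_real \<sigma>" 0 k] assms by simp
  hence "(\<lambda>n. Re (0 ^ omega_below k (Suc n) * of_nat (Suc n) powr (- complex_of_real \<sigma>))) sums Re (zeta (of_real \<sigma>) * partial_euler k 0 (of_real \<sigma>))"
    by (rule sums_Re)
  also have "(\<lambda>n. Re (0 ^ omega_below k (Suc n) * of_nat (Suc n) powr (- complex_of_real \<sigma>))) =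
     (\<lambda>n. 0 ^ omega_below k (Suc n) * real (Suc n) powr (- \<sigma>))"
  proof
    fix n
    have "0 ^ omega_below k (Suc n) * of_nat (Suc n) powr (- complex_of_real \<sigma>) = complex_of_real (0 ^ omega_below k (Suc n) * real (Suc n) powr (- \<sigma>))"
      using of_nat_powr_of_real[of "Suc n" "-\<sigma>"] by (simp del: of_nat_Suc)
    thus "Re (0 ^ omega_below k (Suc n) * of_nat (Suc n) powr (- complex_of_real \<sigma>)) = 0 ^ omega_below k (Suc n) * real (Suc n) powr (- \<sigma>)"
      by (metis Re_complex_of_real)
  qed
  finally have s: "(\<lambda>n. 0 ^ omega_below k (Suc n) * real (Suc n) powr (- \<sigma>)) sums Re (zeta (of_real \<sigma>) * partial_euler k 0 (of_real \<sigma>))" .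
  have "(\<Sum>n<Suc 0. 0 ^ omega_below k (Suc n) * real (Suc n) powr (- \<sigma>)) \<le> (\<Sum>n. 0 ^ omega_below k (Suc n) * real (Suc n) powr (- \<sigma>))"
    using s by (intro sum_le_suminf) (auto simp: sums_iff)
  hence "1 \<le> Re (zeta (of_real \<sigma>) * partial_euler k 0 (of_real \<sigma>))"
    using s by (simp add: sums_iff)
  also have "\<dots> \<le> norm (zeta (of_real \<sigma>)) * norm (partial_euler k 0 (of_real \<sigma>))"
    using complex_Re_le_cmod norm_mult by metis
  also have "norm (partial_euler k 0 (of_real \<sigma>)) = (\<Prod>p<k. if prime p then 1 - real p powr (-\<sigma>) else 1)"
    unfolding partial_euler_def prod_norm[symmetric]
  proof (intro prod.cong refl)
    fix p
    show "norm (if prime p then 1 + (0 - 1) * of_nat p powr - complex_of_real \<sigma> else 1) =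
        (if prime p then 1 - real p powr (-\<sigma>) else 1)"
    proof (cases "prime p")
      case True
      have "1 + (0 - 1) * of_nat p powr - complex_of_real \<sigma> = complex_of_real (1 - real p powr (-\<sigma>))"
        using of_nat_powr_of_real[of p "-\<sigma>"] by simp
      hence "norm (1 + (0 - 1) * of_nat p powr - complex_of_real \<sigma>) = \<bar>1 - real p powr (-\<sigma>)\<bar>"
        by (metis norm_of_real)
      thus ?thesis using True prime_powr_bounds[of p \<sigma>] assms by simp
    qed auto
  qed
  finally show ?thesis .
qed

text \<open>With k = N + 1 the truncated and the full omega agree for all n <= N. Each local factor
  satisfies 1 + (r-1) w <= (1-w)^(1-r), so the partial product is at most P^(1-r), and P >= 1/Z by
  the case z = 0; together with the factor zeta this gives Z^r.\<close>

lemma sum_omega_le: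
  assumes r: "r \<ge> 1" and sg: "\<sigma> > 1"
  shows "(\<Sum>n<N. r ^ omega (Suc n) * real (Suc n) powr (- \<sigma>)) \<le> norm (zeta (of_real \<sigma>)) powr r"
proof -
  define k where "k = Suc N"
  define Z where "Z = norm (zeta (of_real \<sigma>))"
  define P where "P = (\<Prod>p<k. if prime p then 1 - real p powr (-\<sigma>) else 1)"
  have P0: "P > 0" unfolding P_def using prime_powr_bounds[of _ \<sigma>] sg
    by (intro prod_pos) (auto simp: algebra_simps)
  have ZP: "Z * P \<ge> 1" unfolding Z_def P_def by (rule norm_zeta_partial_euler_0[OF sg])
  hence Z0: "Z > 0" using P0 by (smt (verit) mult_nonpos_nonneg)
  have t: "complex_of_real r ^ omega_below k (Suc n) * of_nat (Suc n) powr (- complex_of_real \<sigma>) =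
     complex_of_real (r ^ omega_below k (Suc n) * real (Suc n) powr (- \<sigma>))" for n
    using of_nat_powr_of_real[of "Suc n" "-\<sigma>"] by (simp del: of_nat_Suc)
  have "(\<lambda>n. complex_of_real r ^ omega_below k (Suc n) * of_nat (Suc n) powr (- complex_of_real \<sigma>)) sums (zeta (of_real \<sigma>) * partial_euler k (of_real r) (of_real \<sigma>))"
    using omega_below_dirichlet_sums[of "of_real \<sigma>" "of_real r" k] sg by simp
  from sums_Re[OF this] have s: "(\<lambda>n. r ^ omega_below k (Suc n) * real (Suc n) powr (- \<sigma>)) sums Re (zeta (of_real \<sigma>) * partial_euler k (of_real r) (of_real \<sigma>))"
    unfolding t Re_complex_of_real .
  have "(\<Sum>n<N. r ^ omega (Suc n) * real (Suc n) powr (- \<sigma>)) = (\<Sum>n<N. r ^ omega_below k (Suc n) * real (Suc n) powr (- \<sigma>))"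
    by (intro sum.cong refl) (simp add: omega_below_eq_omega k_def)
  also have "\<dots> \<le> (\<Sum>n. r ^ omega_below k (Suc n) * real (Suc n) powr (- \<sigma>))"
    using s r by (intro sum_le_suminf) (auto simp: sums_iff)
  also have "\<dots> = Re (zeta (of_real \<sigma>) * partial_euler k (of_real r) (of_real \<sigma>))"
    using s by (simp add: sums_iff)
  also have "\<dots> \<le> Z * norm (partial_euler k (of_real r) (of_real \<sigma>))"
    unfolding Z_def using complex_Re_le_cmod norm_mult by metis
  also have "norm (partial_euler k (of_real r) (of_real \<sigma>)) \<le> P powr (1 - r)"
  proof -
    have "norm (partial_euler k (of_real r) (of_real \<sigma>)) \<le> (\<Prod>p<k. norm (if prime p then 1 + (of_real r - 1) * of_nat p powr (- complex_of_real \<sigma>) else 1))"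
      unfolding partial_euler_def by (rule norm_prod_le)
    also have "\<dots> \<le> (\<Prod>p<k. (if prime p then 1 - real p powr (-\<sigma>) else 1) powr (1 - r))"
    proof (intro prod_mono conjI)
      fix p
      show "norm (if prime p then 1 + (of_real r - 1) * of_nat p powr (- complex_of_real \<sigma>) else 1)
         \<le> (if prime p then 1 - real p powr (-\<sigma>) else 1) powr (1 - r)"
      proof (cases "prime p")
        case True
        define w where "w = real p powr (-\<sigma>)"
        have w: "0 < w" "w < 1" using prime_powr_bounds[OF True, of \<sigma>] sg by (auto simp: w_def)
        have "1 + (of_real r - 1) * of_nat p powr (- complex_of_real \<sigma>) = complex_of_real (1 + (r - 1) * w)"
          using of_nat_powr_of_real[of p "-\<sigma>"] by (simp add: w_def)
        hence "norm (1 + (of_real r - 1) * of_nat p powr (- complex_of_real \<sigma>)) = \<bar>1 + (r - 1) * w\<bar>"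
          by (metis norm_of_real)
        also have "\<dots> = 1 + (r - 1) * w" using r w by simp
        also have "\<dots> \<le> exp ((r - 1) * w)" by (rule exp_ge_add_one_self)
        also have "(r - 1) * w \<le> (1 - r) * ln (1 - w)"
        proof -
          have "ln (1 - w) \<le> - w" using ln_one_minus_pos_upper_bound[of w] w by simp
          hence "(r - 1) * ln (1 - w) \<le> (r - 1) * (- w)" using r by (intro mult_left_mono) auto
          thus ?thesis by (simp add: algebra_simps)
        qed
        hence "exp ((r - 1) * w) \<le> (1 - w) powr (1 - r)" using w by (simp add: powr_def)
        finally show ?thesis using True by (simp add: w_def)
      qed auto
    qed auto
    also have "\<dots> = P powr (1 - r)" unfolding P_def
      by (induction k) (auto simp: powr_mult less_imp_le[OF prime_powr_bounds(2)] sg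
          order.strict_trans[OF _ sg] intro!: prod_nonneg)
    finally show ?thesis .
  qed
  also have "Z * P powr (1 - r) \<le> Z * Z powr (r - 1)"
  proof -
    have "P \<ge> 1 / Z" using ZP Z0 by (simp add: field_simps)
    hence "P powr (1 - r) \<le> (1/Z) powr (1 - r)" using r Z0 by (intro powr_mono2') auto
    also have "\<dots> = Z powr (r - 1)" using Z0 by (simp add: powr_divide powr_minus_divide[symmetric] powr_diff field_simps)
    finally show ?thesis using Z0 by simp
  qed
  also have "Z * Z powr (r - 1) = Z powr r" using Z0 by (simp add: powr_diff)
  finally show ?thesis using Z0 by (simp add: Z_def)
qed

lemma summable_omega_dirichlet:
  assumes "Re s > 1"
  shows "summable (\<lambda>n. norm (z ^ omega (Suc n) * of_nat (Suc n) powr (-s)))"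
proof -
  define r where "r = max 1 (norm z)"
  have r: "r \<ge> 1" "norm z \<le> r" by (auto simp: r_def)
  have "summable (\<lambda>n. r ^ omega (Suc n) * real (Suc n) powr (- Re s))"
    by (rule bounded_imp_summable[where B = "norm (zeta (of_real (Re s))) powr r"])
       (use r sum_omega_le[of r "Re s"] assms in \<open>auto simp: lessThan_Suc_atMost[symmetric] simp del: of_nat_Suc sum.lessThan_Suc\<close>)
  thus ?thesis
  proof (rule summable_comparison_test'[where N = 0])
    fix n
    show "norm (norm (z ^ omega (Suc n) * of_nat (Suc n) powr (-s))) \<le> r ^ omega (Suc n) * real (Suc n) powr (- Re s)"
      using r by (auto simp: norm_mult norm_power norm_of_nat_powr simp del: of_nat_Suc intro!: mult_right_mono power_mono)
  qed
qed

definition omega_dirichlet :: "complex \<Rightarrow> complex \<Rightarrow> complex" where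
  "omega_dirichlet z s = (\<Sum>n. z ^ omega (Suc n) * of_nat (Suc n) powr (-s))"

text \<open>Dominated convergence for series. The majorant uses max 1 |z| because only for a base at
  least 1 does enlarging \<open>omega_below\<close> to \<open>omega\<close> enlarge the
  power.\<close>

lemma euler_product_LIMSEQ:
  assumes s: "Re s > 1"
  shows "(\<lambda>k. zeta s * partial_euler k z s) \<longlonglongrightarrow> omega_dirichlet z s"
proof -
  define r where "r = max 1 (norm z)"
  have r: "r \<ge> 1" "norm z \<le> r" by (auto simp: r_def)
  have sm: "summable (\<lambda>n. norm (complex_of_real r ^ omega (Suc n) * of_nat (Suc n) powr (-s)))"
    by (rule summable_omega_dirichlet[OF s])
  have "(\<lambda>k. \<Sum>n. z ^ omega_below k (Suc n) * of_nat (Suc n) powr (-s)) \<longlonglongrightarrow> omega_dirichlet z s"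
    unfolding omega_dirichlet_def
  proof (rule tannerys_theorem[THEN conjunct2, THEN conjunct2])
    show "((\<lambda>k. z ^ omega_below k (Suc n) * of_nat (Suc n) powr (-s)) \<longlongrightarrow> z ^ omega (Suc n) * of_nat (Suc n) powr (-s)) sequentially" for n
    proof (rule tendsto_eventually)
      show "\<forall>\<^sub>F k in sequentially. z ^ omega_below k (Suc n) * of_nat (Suc n) powr (-s) = z ^ omega (Suc n) * of_nat (Suc n) powr (-s)"
        using eventually_gt_at_top[of "Suc n"] by eventually_elim (simp add: omega_below_eq_omega del: of_nat_Suc)
    qed
    show "\<forall>\<^sub>F (n,k) in at_top \<times>\<^sub>F sequentially. norm (z ^ omega_below k (Suc n) * of_nat (Suc n) powr (-s)) \<le>
       norm (complex_of_real r ^ omega (Suc n) * of_nat (Suc n) powr (-s))"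
    proof (rule always_eventually, clarify)
      fix n k
      have "norm z ^ omega_below k (Suc n) \<le> r ^ omega_below k (Suc n)" using r by (intro power_mono) auto
      also have "\<dots> \<le> r ^ omega (Suc n)" using r by (intro power_increasing omega_below_le_omega) auto
      finally show "norm (z ^ omega_below k (Suc n) * of_nat (Suc n) powr (-s)) \<le>
       norm (complex_of_real r ^ omega (Suc n) * of_nat (Suc n) powr (-s))"
        using r by (auto simp: norm_mult norm_power simp del: of_nat_Suc intro!: mult_right_mono)
    qed
  qed (use sm in auto)
  moreover have "(\<Sum>n. z ^ omega_below k (Suc n) * of_nat (Suc n) powr (-s)) = zeta s * partial_euler k z s" for k
    using omega_below_dirichlet_sums[OF s, of z k] by (simp add: sums_iff)
  ultimately show ?thesis by simp
qed

text \<open>Specialised to z = 0, \<open>euler_product_LIMSEQ\<close> becomes the Euler product of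
  zeta itself.\<close>

lemma omega_dirichlet_0: "omega_dirichlet 0 s = 1"
proof -
  have "(\<lambda>n. 0 ^ omega (Suc n) * of_nat (Suc n) powr (-s)) = (\<lambda>n. if n = 0 then 1 else 0 :: complex)"
  proof
    fix n :: nat
    show "0 ^ omega (Suc n) * of_nat (Suc n) powr (-s) = (if n = 0 then 1 else 0 :: complex)"
      using omega_eq_0_iff[of "Suc n"] by (auto simp: power_0_left)
  qed
  moreover have "(\<lambda>n. if n = 0 then 1 else 0 :: complex) sums 1" by (rule sums_single)
  ultimately show ?thesis unfolding omega_dirichlet_def by (simp add: sums_iff)
qed

text \<open>The integral test in telescoped form: by the mean value theorem (N+1)^(-\<sigma>) is at
  most the increment of u^(1-\<sigma>) / (1-\<sigma>) over [N, N+1].\<close>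

lemma zeta_real_bound:
  assumes "\<sigma> > 1"
  shows "norm (zeta (of_real \<sigma>)) \<le> \<sigma> / (\<sigma> - 1)"
proof -
  define u where "u = (\<lambda>n. real (Suc n) powr (-\<sigma>))"
  have "(\<lambda>n. of_nat (Suc n) powr (- complex_of_real \<sigma>)) sums zeta (of_real \<sigma>)"
    using zeta_sums[of "of_real \<sigma>"] assms by simp
  hence "norm (zeta (of_real \<sigma>)) \<le> (\<Sum>n. u n)"
    using norm_suminf_le[of "\<lambda>n. of_nat (Suc n) powr (- complex_of_real \<sigma>)" u] summable_Suc_powr[of "-\<sigma>"] assms
    by (simp add: sums_iff norm_of_nat_powr u_def del: of_nat_Suc)
  also have "\<dots> \<le> \<sigma> / (\<sigma> - 1)"
  proof (rule suminf_le_const)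
    show "summable u" unfolding u_def using assms by (intro summable_Suc_powr) auto
    fix N
    have "(\<Sum>n<N. u n) \<le> (if N = 0 then 0 else 1 + (1 - real N powr (1 - \<sigma>)) / (\<sigma> - 1))"
    proof (induction N)
      case (Suc N)
      show ?case
      proof (cases "N = 0")
        case False
        have "\<exists>x>real N. x < real (Suc N) \<and> real (Suc N) powr (1-\<sigma>) - real N powr (1-\<sigma>) = (real (Suc N) - real N) * ((1 - \<sigma>) * x powr (-\<sigma>))"
        proof (rule MVT2)
          fix x assume "real N \<le> x" "x \<le> real (Suc N)"
          hence "x > 0" using False by simp
          from has_real_derivative_powr[OF this, of "1-\<sigma>"]
          show "((\<lambda>x. x powr (1-\<sigma>)) has_real_derivative (1 - \<sigma>) * x powr (-\<sigma>)) (at x)" by simp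
        qed simp
        then obtain x where x: "x > real N" "x < real (Suc N)" "real (Suc N) powr (1-\<sigma>) - real N powr (1-\<sigma>) = (1 - \<sigma>) * x powr (-\<sigma>)"
          by auto
        have "u N \<le> x powr (-\<sigma>)" unfolding u_def using x assms False by (intro powr_mono2') auto
        also have "\<dots> = (real N powr (1-\<sigma>) - real (Suc N) powr (1-\<sigma>)) / (\<sigma> - 1)" using x(3) assms by (simp add: field_simps)
        finally show ?thesis using Suc False by (simp add: diff_divide_distrib del: of_nat_Suc)
      qed (simp add: u_def)
    qed simp
    also have "\<dots> \<le> 1 + 1 / (\<sigma> - 1)"
      using assms by (auto intro!: divide_right_mono)
    also have "\<dots> = \<sigma> / (\<sigma> - 1)" using assms by (simp add: field_simps)
    finally show "(\<Sum>n<N. u n) \<le> \<sigma> / (\<sigma> - 1)" .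
  qed
  finally show ?thesis .
qed

section \<open>The logarithm of zeta and the singularity at 1\<close>

definition log_zeta_term :: "nat \<Rightarrow> complex \<Rightarrow> complex" where
  "log_zeta_term p s = (if prime p then - Ln (1 - of_nat p powr (-s)) else 0)"

text \<open>The branch given by the Euler product, which is real on the real axis. Throughout,
  zeta(s)^z means the exponential of z times this branch.\<close>

definition log_zeta :: "complex \<Rightarrow> complex" where
  "log_zeta s = (\<Sum>p. log_zeta_term p s)"

lemma norm_prime_powr_less: "prime p \<Longrightarrow> Re s > 0 \<Longrightarrow> norm (of_nat p powr (-s) :: complex) < 1"
  by (simp add: norm_of_nat_powr prime_powr_bounds)

lemma one_minus_notin_nonpos: "norm (w :: complex) < 1 \<Longrightarrow> 1 - w \<notin> \<real>\<^sub>\<le>\<^sub>0"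
  using complex_Re_le_cmod[of w] by (auto simp: complex_nonpos_Reals_iff)

lemma norm_log_zeta_term_le:
  assumes "Re s > 1"
  shows "norm (log_zeta_term p s) \<le> 2 * real p powr (- Re s)"
proof (cases "prime p")
  case True
  have "norm (of_nat p powr (-s) :: complex) \<le> 2 powr (- Re s)"
    using prime_powr_bounds[OF True, of "Re s"] assms by (simp add: norm_of_nat_powr)
  also have "\<dots> < 2 powr (-1)" using assms by (intro powr_less_mono) auto
  finally have "norm (of_nat p powr (-s) :: complex) < 1/2" by (simp add: powr_minus)
  hence "norm (Ln (1 + (- (of_nat p powr (-s))))) \<le> 2 * norm (- (of_nat p powr (-s) :: complex))"
    by (intro norm_Ln_le) auto
  thus ?thesis using True by (simp add: log_zeta_term_def norm_of_nat_powr)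
qed (auto simp: log_zeta_term_def)

lemma summable_log_zeta: "Re s > 1 \<Longrightarrow> summable (\<lambda>p. norm (log_zeta_term p s))"
  by (rule summable_comparison_test'[where N = 0 and g = "\<lambda>p. 2 * real p powr (- Re s)"])
     (auto simp: norm_log_zeta_term_le summable_real_powr_iff intro!: summable_mult)

lemma holomorphic_log_zeta: "log_zeta holomorphic_on {s. Re s > 1}"
  unfolding log_zeta_def
proof (rule holomorphic_suminf)
  show "open {s. Re s > 1}" by (simp add: open_halfspace_Re_gt)
  show "log_zeta_term n holomorphic_on {s. Re s > 1}" for n
  proof (cases "prime n")
    case True
    have "(\<lambda>s. - Ln (1 - of_nat n powr (-s))) holomorphic_on {s. Re s > 1}"
      using True by (intro holomorphic_intros one_minus_notin_nonpos norm_prime_powr_less) auto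
    thus ?thesis using True by (simp add: log_zeta_term_def[abs_def])
  qed (simp add: log_zeta_term_def[abs_def])
  fix x assume x: "x \<in> {s. Re s > 1}"
  define d where "d = (Re x - 1) / 2"
  have d: "d > 0" using x by (simp add: d_def)
  have yb: "Re y \<ge> 1 + d" if "y \<in> cball x d" for y
  proof -
    have *: "norm (x - y) \<le> d" using that by (simp add: dist_norm)
    have "Re (x - y) \<le> d" using * complex_Re_le_cmod[of "x - y"] by linarith
    thus "Re y \<ge> 1 + d" by (simp add: d_def field_simps)
  qed
  have "norm (log_zeta_term n y) \<le> 2 * real n powr (- 1 - d)" if y: "y \<in> cball x d" for n y
  proof (cases "n = 0")
    case False
    have "Re y > 1" using yb[OF y] d by linarith
    hence "norm (log_zeta_term n y) \<le> 2 * real n powr (- Re y)" by (rule norm_log_zeta_term_le)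
    also have "\<dots> \<le> 2 * real n powr (- 1 - d)" using yb[OF y] False by (intro mult_left_mono powr_mono) auto
    finally show ?thesis .
  qed (simp add: log_zeta_term_def)
  moreover have "summable (\<lambda>n. 2 * real n powr (- 1 - d))"
    using d by (intro summable_mult) (simp add: summable_real_powr_iff)
  moreover have "cball x d \<subseteq> {s. Re s > 1}" using yb d by force
  ultimately show "\<exists>d>0. \<exists>M. cball x d \<subseteq> {s. Re s > 1} \<and> summable M \<and> (\<forall>n. \<forall>y\<in>cball x d. norm (log_zeta_term n y) \<le> M n)"
    using d by blast
qed

lemma log_zeta_LIMSEQ: "Re s > 1 \<Longrightarrow> (\<lambda>k. \<Sum>p<k. log_zeta_term p s) \<longlonglongrightarrow> log_zeta s"
  unfolding log_zeta_def by (rule summable_LIMSEQ[OF summable_norm_cancel[OF summable_log_zeta]])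

text \<open>The exponentials of the negated partial sums are the products
  \<open>partial_euler\<close> at z = 0, whose product with zeta tends to 1.\<close>

lemma exp_log_zeta:
  assumes s: "Re s > 1"
  shows "exp (log_zeta s) = zeta s"
proof -
  have eq: "exp (- (\<Sum>p<k. log_zeta_term p s)) = partial_euler k 0 s" for k
  proof -
    have "exp (- log_zeta_term p s) = (if prime p then 1 + (0 - 1) * of_nat p powr (-s) else 1)" for p
    proof (cases "prime p")
      case True
      have "1 - of_nat p powr (-s) \<noteq> (0::complex)" using norm_prime_powr_less[OF True, of s] s by auto
      thus ?thesis using True by (simp add: log_zeta_term_def)
    qed (simp add: log_zeta_term_def)
    thus ?thesis unfolding partial_euler_def sum_negf[symmetric] by (simp add: exp_sum)
  qed
  have "(\<lambda>k. zeta s * exp (- (\<Sum>p<k. log_zeta_term p s))) \<longlonglongrightarrow> zeta s * exp (- log_zeta s)"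
    by (intro tendsto_intros log_zeta_LIMSEQ s)
  moreover have "(\<lambda>k. zeta s * exp (- (\<Sum>p<k. log_zeta_term p s))) \<longlonglongrightarrow> 1"
    unfolding eq using euler_product_LIMSEQ[OF s, of 0] by (simp add: omega_dirichlet_0)
  ultimately have "zeta s * exp (- log_zeta s) = 1" by (rule LIMSEQ_unique)
  thus ?thesis by (simp add: exp_minus field_simps)
qed

text \<open>The term at n = 0 is a quotient by 0, hence 0, so the series effectively starts at n =
  1.\<close>

lemma log_series_sums:
  fixes w :: complex assumes "norm w < 1"
  shows "(\<lambda>n. w ^ n / of_nat n) sums (- Ln (1 - w))"
  using sums_minus[OF Ln_series'[of "-w"]] assms by simp

lemma log_series_sums_real:
  fixes r :: real assumes "0 \<le> r" "r < 1"
  shows "(\<lambda>n. r ^ n / real n) sums (- ln (1 - r))"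
proof -
  have "(\<lambda>n. complex_of_real (r ^ n / real n)) sums (- Ln (1 - of_real r))"
    using log_series_sums[of "of_real r"] assms by simp
  also have "- Ln (1 - of_real r) = complex_of_real (- ln (1 - r))"
    using assms Ln_of_real[of "1 - r"] by simp
  finally show ?thesis unfolding sums_of_real_iff .
qed

lemma log_zeta_term_of_real:
  assumes "\<sigma> > 0"
  shows "log_zeta_term p (of_real \<sigma>) = of_real (if prime p then - ln (1 - real p powr (-\<sigma>)) else 0)"
proof (cases "prime p")
  case True
  have "of_nat p powr (- complex_of_real \<sigma>) = of_real (real p powr (-\<sigma>))"
    using of_nat_powr_of_real[of p "-\<sigma>"] by simp
  thus ?thesis using True prime_powr_bounds[OF True assms] Ln_of_real[of "1 - real p powr (-\<sigma>)"]
    by (simp add: log_zeta_term_def)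
qed (simp add: log_zeta_term_def)

text \<open>The power series of -log(1 - w) has nonnegative coefficients, so its value at |w|
  dominates.\<close>

lemma norm_log_zeta_term_le_real:
  assumes "Re s > 0"
  shows "norm (log_zeta_term p s) \<le> Re (log_zeta_term p (of_real (Re s)))"
proof (cases "prime p")
  case True
  define w where "w = (of_nat p powr (-s) :: complex)"
  have w: "norm w < 1" "norm w = real p powr (- Re s)"
    unfolding w_def using norm_prime_powr_less[OF True assms] by (auto simp: norm_of_nat_powr)
  have "norm (- Ln (1 - w)) \<le> (\<Sum>n. norm w ^ n / real n)"
    unfolding sums_unique[OF log_series_sums[OF w(1)]]
    using log_series_sums_real[of "norm w"] w(1)
    by (intro norm_suminf_le) (auto simp: norm_divide norm_power sums_iff)
  also have "\<dots> = - ln (1 - norm w)" using log_series_sums_real[of "norm w"] w(1) by (simp add: sums_iff)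
  finally show ?thesis using True log_zeta_term_of_real[OF assms, of p] w(2)
    by (simp add: log_zeta_term_def w_def)
qed (simp add: log_zeta_term_def)

lemma log_zeta_of_real_Im: "\<sigma> > 1 \<Longrightarrow> Im (log_zeta (of_real \<sigma>)) = 0"
proof -
  assume s: "\<sigma> > 1"
  have "Im (log_zeta (of_real \<sigma>)) = (\<Sum>p. Im (log_zeta_term p (of_real \<sigma>)))"
    unfolding log_zeta_def using s
    by (intro Im_suminf summable_norm_cancel[OF summable_log_zeta]) auto
  also have "\<dots> = 0" using s by (subst log_zeta_term_of_real) auto
  finally show ?thesis .
qed

lemma norm_log_zeta_le:
  assumes "Re s > 1"
  shows "norm (log_zeta s) \<le> Re (log_zeta (of_real (Re s)))"
proof -
  have sm: "summable (\<lambda>p. log_zeta_term p (of_real (Re s)))"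
    using assms by (intro summable_norm_cancel[OF summable_log_zeta]) auto
  have "norm (log_zeta s) \<le> (\<Sum>p. Re (log_zeta_term p (of_real (Re s))))"
    unfolding log_zeta_def using assms sm
    by (intro norm_suminf_le norm_log_zeta_term_le_real summable_Re) auto
  also have "\<dots> = Re (log_zeta (of_real (Re s)))" unfolding log_zeta_def by (rule Re_suminf[symmetric, OF sm])
  finally show ?thesis .
qed

lemma log_zeta_real_bound:
  assumes "\<sigma> > 1"
  shows "Re (log_zeta (of_real \<sigma>)) \<le> ln (\<sigma> / (\<sigma> - 1))"
proof -
  have "norm (zeta (of_real \<sigma>)) = exp (Re (log_zeta (of_real \<sigma>)))"
    using exp_log_zeta[of "of_real \<sigma>"] assms by (metis Re_complex_of_real norm_exp_eq_Re)
  hence "exp (Re (log_zeta (of_real \<sigma>))) \<le> \<sigma> / (\<sigma> - 1)" using zeta_real_bound[OF assms] by simp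
  thus ?thesis using assms by (subst ln_ge_iff) auto
qed

lemma sums_nonneg:
  fixes f :: "nat \<Rightarrow> real"
  shows "f sums c \<Longrightarrow> (\<And>n. f n \<ge> 0) \<Longrightarrow> c \<ge> 0"
  using sums_le[of "\<lambda>_. 0" f 0 c] by simp

text \<open>In the double series over primes and exponents n, each term is a nonnegative multiple of
  3 + 4 cos a + cos 2a = 2 (1 + cos a)^2.\<close>

lemma mertens_inequality:
  assumes "\<sigma> > 1"
  shows "3 * Re (log_zeta (of_real \<sigma>)) + 4 * Re (log_zeta (Complex \<sigma> t)) + Re (log_zeta (Complex \<sigma> (2*t))) \<ge> 0"
proof -
  define T where "T = (\<lambda>p. 3 * Re (log_zeta_term p (of_real \<sigma>)) + 4 * Re (log_zeta_term p (Complex \<sigma> t)) + Re (log_zeta_term p (Complex \<sigma> (2*t))))"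
  have S: "(\<lambda>p. log_zeta_term p s) sums log_zeta s" if "Re s > 1" for s
    unfolding log_zeta_def using summable_norm_cancel[OF summable_log_zeta[OF that]] by (rule summable_sums)
  have "T sums (3 * Re (log_zeta (of_real \<sigma>)) + 4 * Re (log_zeta (Complex \<sigma> t)) + Re (log_zeta (Complex \<sigma> (2*t))))"
    unfolding T_def using assms by (intro sums_add sums_mult sums_Re S) auto
  moreover have "T p \<ge> 0" for p
  proof (cases "prime p")
    case True
    define r where "r = real p powr (-\<sigma>)"
    define x where "x = - (t * ln (real p))"
    have p: "p > 0" using True prime_gt_0_nat by blast
    have r: "0 < r" "r < 1" unfolding r_def using prime_powr_bounds[OF True, of \<sigma>] assms by auto
    have w: "of_nat p powr (- Complex \<sigma> (c*t)) = of_real r * cis (c * x)" for c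
      using p by (simp add: powr_def exp_eq_polar r_def x_def mult_ac Ln_of_nat)
    have ser: "(\<lambda>n. r ^ n * cos (real n * (c * x)) / real n) sums Re (log_zeta_term p (Complex \<sigma> (c*t)))" for c
    proof -
      have "norm (of_nat p powr (- Complex \<sigma> (c*t)) :: complex) < 1" unfolding w using r by (simp add: norm_mult)
      from sums_Re[OF log_series_sums[OF this]]
      have "(\<lambda>n. Re ((of_real r * cis (c*x)) ^ n / of_nat n)) sums Re (log_zeta_term p (Complex \<sigma> (c*t)))"
        using True unfolding w by (simp add: log_zeta_term_def w)
      also have "(\<lambda>n. Re ((of_real r * cis (c*x)) ^ n / of_nat n)) = (\<lambda>n. r ^ n * cos (real n * (c * x)) / real n)"
      proof
        fix n
        have "(of_real r * cis (c*x)) ^ n / of_nat n = complex_of_real (r ^ n / real n) * cis (real n * (c * x))"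
          by (simp add: power_mult_distrib Complex.DeMoivre)
        thus "Re ((of_real r * cis (c*x)) ^ n / of_nat n) = r ^ n * cos (real n * (c * x)) / real n"
          by (simp add: Re_complex_of_real[symmetric] del: of_real_divide of_real_power)
      qed
      finally show ?thesis .
    qed
    have "(\<lambda>n. 3 * (r ^ n * cos (real n * (0 * x)) / real n) + 4 * (r ^ n * cos (real n * (1 * x)) / real n) + r ^ n * cos (real n * (2 * x)) / real n) sums T p"
      unfolding T_def using ser[of 0] ser[of 1] ser[of 2]
      by (intro sums_add sums_mult) (simp_all add: complex_of_real_def)
    moreover have "3 * (r ^ n * cos (real n * (0 * x)) / real n) + 4 * (r ^ n * cos (real n * (1 * x)) / real n) + r ^ n * cos (real n * (2 * x)) / real n \<ge> 0" for n
    proof -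
      define c where "c = cos (real n * x)"
      have e: "cos (real n * (0 * x)) = 1" "cos (real n * (1 * x)) = c" by (simp_all add: c_def)
      have e2: "cos (real n * (2 * x)) = 2 * c^2 - 1" unfolding c_def using cos_double_cos[of "real n * x"] by (simp add: mult_ac)
      have "3 * (r ^ n * cos (real n * (0 * x)) / real n) + 4 * (r ^ n * cos (real n * (1 * x)) / real n) + r ^ n * cos (real n * (2 * x)) / real n
         = r ^ n / real n * (2 * (1 + c)^2)"
      proof -
        have "r ^ n * y / real n = r ^ n / real n * y" for y by simp
        moreover have "3 * (a * 1) + 4 * (a * c) + a * (2 * c^2 - 1) = a * (2 * (1 + c)^2)" for a
          by (simp add: power2_eq_square algebra_simps)
        ultimately show ?thesis unfolding e e2 by (simp only:)
      qed
      also have "\<dots> \<ge> 0" using r by (intro mult_nonneg_nonneg divide_nonneg_nonneg) auto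
      finally show ?thesis .
    qed
    ultimately show ?thesis by (rule sums_nonneg)
  qed (simp add: T_def log_zeta_term_def)
  ultimately show ?thesis by (rule sums_nonneg)
qed

section \<open>The Euler product left after division by zeta(s)^z\<close>

text \<open>
  Local factor of the Dirichlet series of $z^{\omega(n)}$ after division by $\zeta(s)^z$, with $w = p^{-s}$:
  $1 + zw/(1-w) = (1 + (z-1)w)(1-w)^{-1}$, and $\phi_z(w) = 1 + O(w^2)$.
\<close>

definition phi :: "complex \<Rightarrow> complex \<Rightarrow> complex" where
  "phi z w = (1 + (z - 1) * w) * (1 - w) powr (z - 1)"

lemma phi_holomorphic: "phi z holomorphic_on ball 0 1"
  unfolding phi_def by (intro holomorphic_intros one_minus_notin_nonpos) auto

text \<open>At w = 0 the value is 1 and the derivative is (z-1) - (z-1) = 0, so the first-order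
  Taylor remainder, with the second derivative bounded on the compact disc, gives the
  square.\<close>

lemma phi_bound:
  assumes "0 < \<rho>" "\<rho> < 1"
  shows "\<exists>C>0. \<forall>w. norm w \<le> \<rho> \<longrightarrow> norm (phi z w - 1) \<le> C * norm w ^ 2"
proof -
  define f where "f = (\<lambda>i. (deriv ^^ i) (phi z))"
  have hol: "f i holomorphic_on ball 0 1" for i
    unfolding f_def by (intro holomorphic_higher_deriv phi_holomorphic) auto
  have "continuous_on (cball 0 \<rho>) (f 2)"
    using assms by (intro holomorphic_on_imp_continuous_on holomorphic_on_subset[OF hol]) auto
  hence "bounded (f 2 ` cball 0 \<rho>)" by (intro compact_imp_bounded compact_continuous_image) auto
  then obtain B where B: "B > 0" "\<And>w. w \<in> cball 0 \<rho> \<Longrightarrow> norm (f 2 w) \<le> B"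
    by (auto simp: bounded_pos)
  have "(phi z has_field_derivative 0) (at 0)"
    unfolding phi_def by (auto intro!: derivative_eq_intros)
  hence d0: "f 1 0 = 0" by (simp add: f_def DERIV_imp_deriv)
  have p0: "f 0 0 = 1" by (simp add: f_def phi_def)
  have "norm (phi z w - 1) \<le> B * norm w ^ 2" if w: "norm w \<le> \<rho>" for w
  proof -
    have "cmod (f 0 w - (\<Sum>i\<le>1. f i 0 * (w-0) ^ i / (fact i))) \<le> B * cmod(w - 0)^(Suc 1) / fact 1"
    proof (rule complex_Taylor[where S = "cball 0 \<rho>"])
      fix i :: nat and x :: complex assume x: "x \<in> cball 0 \<rho>"
      have "(f i has_field_derivative deriv (f i) x) (at x)"
        using x assms by (intro holomorphic_derivI[OF hol]) auto
      thus "(f i has_field_derivative f (Suc i) x) (at x within cball 0 \<rho>)"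
        by (simp add: f_def has_field_derivative_at_within)
    qed (use w B assms in \<open>auto simp: numeral_2_eq_2\<close>)
    thus ?thesis using p0 d0 by (simp add: f_def numeral_2_eq_2)
  qed
  thus ?thesis using B by blast
qed

definition euler_factor :: "complex \<Rightarrow> nat \<Rightarrow> complex \<Rightarrow> complex" where
  "euler_factor z p s = (if prime p then phi z (of_nat p powr (-s)) else 1)"

definition G :: "complex \<Rightarrow> complex \<Rightarrow> complex" where
  "G z s = (\<Prod>p. euler_factor z p s)"

text \<open>For real part at least 3/4 the square of |p^(-s)| is at most the summable p^(-3/2), and
  all |p^(-s)| lie in the disc of radius 2^(-3/4) < 1, where \<open>phi_bound\<close> is
  uniform.\<close>

lemma euler_factor_bound:
  "\<exists>C>0. \<forall>p s. Re s \<ge> 3/4 \<longrightarrow> norm (euler_factor z p s - 1) \<le> C * real p powr (-3/2)"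
proof -
  define \<rho> where "\<rho> = (2::real) powr (-3/4)"
  have "\<rho> < 2 powr 0" unfolding \<rho>_def by (intro powr_less_mono) auto
  hence "0 < \<rho>" "\<rho> < 1" by (auto simp: \<rho>_def)
  then obtain C where C: "C > 0" "\<And>w. norm w \<le> \<rho> \<Longrightarrow> norm (phi z w - 1) \<le> C * norm w ^ 2"
    using phi_bound by metis
  have "norm (euler_factor z p s - 1) \<le> C * real p powr (-3/2)" if s: "Re s \<ge> 3/4" for p s
  proof (cases "prime p")
    case True
    define w where "w = (of_nat p powr (-s) :: complex)"
    have p2: "p \<ge> 2" using True prime_ge_2_nat by blast
    have nw: "norm w \<le> real p powr (-3/4)" unfolding w_def norm_of_nat_powr using s p2 by (intro powr_mono) auto
    also have "\<dots> \<le> \<rho>" unfolding \<rho>_def using p2 by (intro powr_mono2') auto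
    finally have "norm (phi z w - 1) \<le> C * norm w ^ 2" by (rule C(2))
    also have "\<dots> \<le> C * (real p powr (-3/4)) ^ 2" using nw C by (intro mult_left_mono power_mono) auto
    also have "(real p powr (-3/4)) ^ 2 = real p powr (-3/2)"
      by (simp add: power2_eq_square powr_add[symmetric])
    finally show ?thesis using True by (simp add: euler_factor_def w_def)
  qed (use C in \<open>auto simp: euler_factor_def\<close>)
  with C show ?thesis by blast
qed

lemma holomorphic_euler_factor: "euler_factor z p holomorphic_on {s. Re s > 0}"
proof (cases "prime p")
  case True
  have "(phi z \<circ> (\<lambda>s. of_nat p powr (-s))) holomorphic_on {s. Re s > 0}"
    using norm_prime_powr_less[OF True]
    by (intro holomorphic_on_compose_gen[OF _ phi_holomorphic] holomorphic_intros) (auto simp: True)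
  thus ?thesis using True by (simp add: euler_factor_def[abs_def] o_def)
qed (simp add: euler_factor_def[abs_def])

lemma G_LIMSEQ:
  assumes "Re s \<ge> 3/4"
  shows "(\<lambda>k. \<Prod>p<k. euler_factor z p s) \<longlonglongrightarrow> G z s"
proof -
  obtain C where C: "\<And>p s. Re s \<ge> 3/4 \<Longrightarrow> norm (euler_factor z p s - 1) \<le> C * real p powr (-3/2)"
    using euler_factor_bound by metis
  have "summable (\<lambda>p. norm (euler_factor z p s - 1))"
    by (rule summable_comparison_test'[where N = 0 and g = "\<lambda>p. C * real p powr (-3/2)"])
       (use C assms in \<open>auto simp: summable_real_powr_iff intro!: summable_mult\<close>)
  hence "convergent_prod (\<lambda>p. euler_factor z p s)"
    by (intro abs_convergent_prod_imp_convergent_prod summable_imp_abs_convergent_prod)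
  from convergent_prod_LIMSEQ[OF this] show ?thesis
    unfolding G_def LIMSEQ_lessThan_iff_atMost .
qed

lemma G_bounded: "\<exists>C>0. \<forall>s. Re s \<ge> 3/4 \<longrightarrow> norm (G z s) \<le> C"
proof -
  obtain C where C: "C > 0" "\<And>p s. Re s \<ge> 3/4 \<Longrightarrow> norm (euler_factor z p s - 1) \<le> C * real p powr (-3/2)"
    using euler_factor_bound by metis
  define K where "K = (\<Sum>p. C * real p powr (-3/2))"
  have sm: "summable (\<lambda>p. C * real p powr (-3/2))" by (intro summable_mult) (simp add: summable_real_powr_iff)
  have "norm (G z s) \<le> exp K" if s: "Re s \<ge> 3/4" for s
  proof (rule LIMSEQ_le_const2[OF tendsto_norm[OF G_LIMSEQ[OF s]]], intro exI allI impI)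
    fix k
    have "norm (\<Prod>p<k. euler_factor z p s) \<le> (\<Prod>p<k. norm (euler_factor z p s))"
      by (rule norm_prod_le)
    also have "\<dots> \<le> (\<Prod>p<k. 1 + C * real p powr (-3/2))"
    proof (intro prod_mono conjI)
      fix p
      have "norm (euler_factor z p s) \<le> 1 + norm (euler_factor z p s - 1)"
        using norm_triangle_sub[of "euler_factor z p s" 1] by simp
      thus "norm (euler_factor z p s) \<le> 1 + C * real p powr (-3/2)" using C(2)[OF s, of p] by linarith
    qed auto
    also have "\<dots> \<le> exp (\<Sum>p<k. C * real p powr (-3/2))" using C by (intro prod_le_exp_sum) auto
    also have "\<dots> \<le> exp K" unfolding K_def exp_le_cancel_iff using C by (intro sum_le_suminf sm) auto
    finally show "norm (\<Prod>p<k. euler_factor z p s) \<le> exp K" .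
  qed
  thus ?thesis by (meson exp_gt_zero)
qed

text \<open>Uniform convergence on closed discs is obtained towards some limit function, which is
  then identified with \<open>G z\<close> pointwise.\<close>

lemma holomorphic_G: "G z holomorphic_on {s. Re s > 3/4}"
proof (rule holomorphic_uniform_sequence)
  show "open {s. Re s > 3/4}" by (rule open_halfspace_Re_gt)
  show "(\<lambda>s. \<Prod>p<k. euler_factor z p s) holomorphic_on {s. Re s > 3/4}" for k
    by (intro holomorphic_intros holomorphic_on_subset[OF holomorphic_euler_factor]) auto
  fix x assume x: "x \<in> {s. Re s > 3/4}"
  define d where "d = (Re x - 3/4) / 2"
  have d: "d > 0" using x by (simp add: d_def)
  have yb: "Re y > 3/4" if "y \<in> cball x d" for y
  proof -
    have *: "norm (x - y) \<le> d" using that by (simp add: dist_norm)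
    have "Re (x - y) \<le> d" using * complex_Re_le_cmod[of "x - y"] by linarith
    thus "Re y > 3/4" using x by (simp add: d_def field_simps)
  qed
  obtain C where C: "\<And>p s. Re s \<ge> 3/4 \<Longrightarrow> norm (euler_factor z p s - 1) \<le> C * real p powr (-3/2)"
    using euler_factor_bound by metis
  have u: "uniformly_convergent_on (cball x d) (\<lambda>k s. \<Prod>p<k. 1 + (\<lambda>p s. euler_factor z p s - 1) p s)"
  proof (rule uniformly_convergent_on_prod)
    fix n
    have "continuous_on (cball x d) (euler_factor z n)"
      using yb by (intro holomorphic_on_imp_continuous_on holomorphic_on_subset[OF holomorphic_euler_factor]) force
    thus "continuous_on (cball x d) (\<lambda>s. euler_factor z n s - 1)" by (intro continuous_intros)
  next
    have "uniform_limit (cball x d) (\<lambda>n s. \<Sum>p<n. norm (euler_factor z p s - 1)) (\<lambda>s. \<Sum>p. norm (euler_factor z p s - 1)) sequentially"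
      by (rule Weierstrass_m_test[where M = "\<lambda>p. C * real p powr (-3/2)"])
         (use C less_imp_le[OF yb] in \<open>auto simp: summable_real_powr_iff intro!: summable_mult\<close>)
    thus "uniformly_convergent_on (cball x d) (\<lambda>N s. \<Sum>n<N. norm (euler_factor z n s - 1))"
      by (auto simp: uniformly_convergent_on_def)
  qed auto
  then obtain g where g: "uniform_limit (cball x d) (\<lambda>k s. \<Prod>p<k. euler_factor z p s) g sequentially"
    by (auto simp: uniformly_convergent_on_def)
  have "g s = G z s" if "s \<in> cball x d" for s
    using tendsto_uniform_limitI[OF g that] G_LIMSEQ[OF less_imp_le[OF yb[OF that]], of z] by (rule LIMSEQ_unique)
  hence "uniform_limit (cball x d) (\<lambda>k s. \<Prod>p<k. euler_factor z p s) g sequentially \<longleftrightarrow>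
      uniform_limit (cball x d) (\<lambda>k s. \<Prod>p<k. euler_factor z p s) (G z) sequentially"
    by (intro uniform_limit_cong') auto
  hence "uniform_limit (cball x d) (\<lambda>k s. \<Prod>p<k. euler_factor z p s) (G z) sequentially"
    using g by blast
  moreover have "cball x d \<subseteq> {s. Re s > 3/4}" using yb by auto
  ultimately show "\<exists>d>0. cball x d \<subseteq> {s. Re s > 3/4} \<and> uniform_limit (cball x d) (\<lambda>k s. \<Prod>p<k. euler_factor z p s) (G z) sequentially"
    using d by blast
qed

text \<open>At s = 1 the power p^(-s) is 1/p, and (1 + (z-1)/p) / (1 - 1/p) = 1 + z/(p-1).\<close>

lemma G_1: "G z 1 = g_one z"
proof -
  have "euler_factor z p 1 = (if prime p then (1 + z / (of_nat p - 1)) * complex_of_real (1 - 1 / real p) powr z else 1)" for p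
  proof (cases "prime p")
    case True
    have p: "p \<ge> 2" using True prime_ge_2_nat by blast
    have w: "of_nat p powr (-1) = (1 / of_nat p :: complex)" using p by (simp add: powr_minus_divide)
    define q where "q = (1 - 1 / of_nat p :: complex)"
    have q: "q = complex_of_real (1 - 1 / real p)" by (simp add: q_def)
    have p1: "of_nat p \<noteq> (1::complex)" "of_nat p \<noteq> (0::complex)" using p by auto
    have q0: "q \<noteq> 0" using p1 by (simp add: q_def field_simps)
    have "euler_factor z p 1 = (1 + (z - 1) / of_nat p) * q powr (z - 1)"
      using True by (simp add: euler_factor_def phi_def w q_def)
    also have "q powr (z - 1) = q powr z / q" using q0 by (simp add: powr_diff)
    also have "(1 + (z - 1) / of_nat p) * (q powr z / q) = (1 + z / (of_nat p - 1)) * q powr z"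
    proof -
      have "(1 + (z - 1) / of_nat p) / q = 1 + z / (of_nat p - 1)"
        unfolding q_def using p1 by (simp add: field_simps)
      thus ?thesis by (metis times_divide_eq_left times_divide_eq_right)
    qed
    finally show ?thesis using True by (simp add: q)
  qed (simp add: euler_factor_def)
  thus ?thesis unfolding G_def g_one_def by simp
qed

text \<open>The partial products supply G together with zeta^(z-1); the missing factor zeta is the
  one standing in \<open>euler_product_LIMSEQ\<close>.\<close>

lemma omega_dirichlet_eq:
  assumes s: "Re s > 1"
  shows "omega_dirichlet z s = exp (z * log_zeta s) * G z s"
proof -
  have eq: "partial_euler k z s = (\<Prod>p<k. euler_factor z p s) * exp ((z - 1) * (\<Sum>p<k. log_zeta_term p s))" for k
  proof -
    have "(if prime p then 1 + (z - 1) * of_nat p powr (-s) else 1) = euler_factor z p s * exp ((z - 1) * log_zeta_term p s)" for p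
    proof (cases "prime p")
      case True
      define w where "w = (of_nat p powr (-s) :: complex)"
      have "1 - w \<noteq> 0" using norm_prime_powr_less[OF True, of s] s by (auto simp: w_def)
      hence "(1 - w) powr (z - 1) * exp ((z - 1) * (- Ln (1 - w))) = 1"
        by (simp add: powr_def exp_add[symmetric])
      hence "phi z w * exp ((z - 1) * (- Ln (1 - w))) = 1 + (z - 1) * w"
        by (simp add: phi_def mult.assoc)
      thus ?thesis using True by (simp add: euler_factor_def log_zeta_term_def w_def)
    qed (simp add: euler_factor_def log_zeta_term_def)
    thus ?thesis unfolding partial_euler_def by (simp add: prod.distrib exp_sum sum_distrib_left)
  qed
  have "(\<lambda>k. zeta s * ((\<Prod>p<k. euler_factor z p s) * exp ((z - 1) * (\<Sum>p<k. log_zeta_term p s)))) \<longlonglongrightarrow>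
     zeta s * (G z s * exp ((z - 1) * log_zeta s))"
    using s by (intro tendsto_intros G_LIMSEQ log_zeta_LIMSEQ) auto
  with euler_product_LIMSEQ[OF s, of z] have "omega_dirichlet z s = zeta s * (G z s * exp ((z - 1) * log_zeta s))"
    unfolding eq by (rule LIMSEQ_unique)
  also have "\<dots> = (exp (log_zeta s) * exp ((z - 1) * log_zeta s)) * G z s"
    by (simp add: exp_log_zeta[OF s])
  also have "exp (log_zeta s) * exp ((z - 1) * log_zeta s) = exp (z * log_zeta s)"
    by (simp add: exp_add[symmetric] algebra_simps)
  finally show ?thesis .
qed

section \<open>Bounds near the line of real part 1\<close>

lemma cball_Re_Im:
  assumes "w \<in> cball s r"
  shows "\<bar>Re s - Re w\<bar> \<le> r" "\<bar>Im s - Im w\<bar> \<le> r"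
proof -
  have *: "norm (s - w) \<le> r" using assms by (simp add: dist_norm)
  show "\<bar>Re s - Re w\<bar> \<le> r" "\<bar>Im s - Im w\<bar> \<le> r"
    using * abs_Re_le_cmod[of "s-w"] abs_Im_le_cmod[of "s-w"] by auto
qed

lemma zeta_has_field_derivative:
  assumes "Re s > 0" "s \<noteq> 1"
  shows "(zeta has_field_derivative deriv zeta s) (at s)"
proof -
  have "open ({s. Re s > 0} - {1})" by (intro open_Diff open_halfspace_Re_gt) auto
  thus ?thesis by (rule holomorphic_derivI[OF holomorphic_zeta]) (use assms in auto)
qed

lemma log_zeta_has_field_derivative:
  assumes s: "Re s > 1"
  shows "(log_zeta has_field_derivative deriv zeta s / zeta s) (at s)"
proof -
  have op: "open {s. Re s > 1}" by (rule open_halfspace_Re_gt)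
  have d: "(log_zeta has_field_derivative deriv log_zeta s) (at s)"
    by (rule holomorphic_derivI[OF holomorphic_log_zeta op]) (use s in auto)
  have "((\<lambda>s. exp (log_zeta s)) has_field_derivative exp (log_zeta s) * deriv log_zeta s) (at s)"
    by (rule DERIV_chain2[OF DERIV_exp d])
  hence "(zeta has_field_derivative exp (log_zeta s) * deriv log_zeta s) (at s)"
    by (rule has_field_derivative_transform_within_open[OF _ op]) (use s exp_log_zeta in auto)
  moreover have "(zeta has_field_derivative deriv zeta s) (at s)"
    using s by (intro zeta_has_field_derivative) auto
  ultimately have "deriv zeta s = exp (log_zeta s) * deriv log_zeta s"
    using DERIV_unique by blast
  hence "deriv log_zeta s = deriv zeta s / zeta s"
    using exp_log_zeta[OF s] by (metis exp_not_eq_zero nonzero_mult_div_cancel_left)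
  with d show ?thesis by simp
qed

lemma zeta_nonzero: "Re s > 1 \<Longrightarrow> zeta s \<noteq> 0"
  using exp_log_zeta by (metis exp_not_eq_zero)

lemma norm_zeta_exp: "Re s > 1 \<Longrightarrow> norm (zeta s) = exp (Re (log_zeta s))"
  using exp_log_zeta norm_exp_eq_Re by metis

lemma convex_Im_eq: "convex {w. Im w = c}"
  by (auto simp: convex_def distrib_right[symmetric])

text \<open>Let M bound zeta and its first two derivatives at height t, and zeta at height 2t. For
  real part at least 1 + \<eta> the 3-4-1 inequality gives |zeta| >= 2 \<eta> M; covering the
  remaining distance \<eta> towards the line changes zeta by at most \<eta> M, so |zeta| >= \<eta> M
  throughout. As \<eta> is a power of 1/M and M a small power of t, every quantity is a small power
  of t. The parameter A will dominate |z|, so that zeta^z is controlled.\<close>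

lemma zeta_bounds:
  assumes e: "e > 0" and tau: "\<tau> > 0" and A: "A \<ge> 1"
  shows "\<exists>C>0. \<forall>s. 1 < Re s \<and> Re s \<le> 2 \<and> \<bar>Im s\<bar> \<ge> \<tau> \<longrightarrow>
     (\<forall>j\<le>2. norm ((deriv ^^ j) zeta s) \<le> C * \<bar>Im s\<bar> powr e) \<and>
     norm (inverse (zeta s)) \<le> C * \<bar>Im s\<bar> powr e \<and>
     exp (A * norm (log_zeta s)) \<le> C * \<bar>Im s\<bar> powr e"
proof -
  \<comment> \<open>The final bounds are a constant times M^(5A), where M is of order t^e0.\<close>
  define e0 where "e0 = e / (5 * A)"
  have e0: "e0 > 0" using e A by (simp add: e0_def)
  obtain C1 where C1: "C1 > 0" "\<And>s j. 1 \<le> Re s \<Longrightarrow> Re s \<le> 2 \<Longrightarrow> \<bar>Im s\<bar> \<ge> \<tau> \<Longrightarrow> j \<le> 2 \<Longrightarrow> norm ((deriv ^^ j) zeta s) \<le> C1 * \<bar>Im s\<bar> powr e0"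
    using zeta_deriv_bound[OF e0 tau] by blast
  \<comment> \<open>The factor 2^e0 covers height 2t; the second alternative forces M >= 1 for all t
    >= \<tau>.\<close>
  define C0 where "C0 = max (2 powr e0 * C1) (\<tau> powr (-e0))"
  have C0: "C0 \<ge> 2 powr e0 * C1" "C0 \<ge> \<tau> powr (-e0)" by (auto simp: C0_def)
  have "2 powr e0 * C1 \<ge> 1 * C1" using e0 C1 by (intro mult_right_mono ge_one_powr_ge_zero) auto
  hence "C0 \<ge> C1" using C0(1) by linarith
  hence C0': "C0 \<ge> C1" "C0 > 0" using C1(1) by linarith+
  define C where "C = (256 * exp 1) powr A * C0 powr (5 * A)"
  have Cpos: "C > 0" using C0' by (simp add: C_def)
  have main: "(\<forall>j\<le>2. norm ((deriv ^^ j) zeta s) \<le> C * \<bar>Im s\<bar> powr e) \<and>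
     norm (inverse (zeta s)) \<le> C * \<bar>Im s\<bar> powr e \<and>
     exp (A * norm (log_zeta s)) \<le> C * \<bar>Im s\<bar> powr e"
    if s: "1 < Re s" "Re s \<le> 2" "\<bar>Im s\<bar> \<ge> \<tau>" for s
  proof -
    define t where "t = \<bar>Im s\<bar>"
    define M where "M = C0 * t powr e0"
    have t: "t > 0" "t \<ge> \<tau>" using s tau by (auto simp: t_def)
    have M1: "M \<ge> 1"
    proof -
      have "1 = \<tau> powr (-e0) * \<tau> powr e0" using tau by (simp add: powr_minus)
      also have "\<dots> \<le> C0 * t powr e0" using C0 C0' t tau e0 by (intro mult_mono powr_mono2) auto
      finally show ?thesis by (simp add: M_def)
    qed
    have zb: "norm ((deriv ^^ j) zeta w) \<le> M" if "1 < Re w" "Re w \<le> 2" "\<bar>Im w\<bar> = t" "j \<le> 2" for w j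
    proof -
      have "norm ((deriv ^^ j) zeta w) \<le> C1 * t powr e0" using C1(2)[of w j] that t by auto
      also have "\<dots> \<le> M" unfolding M_def using C0' by (intro mult_right_mono) auto
      finally show ?thesis .
    qed
    have zb2: "norm (zeta w) \<le> M" if "1 < Re w" "Re w \<le> 2" "\<bar>Im w\<bar> = 2 * t" for w
    proof -
      have "norm (zeta w) \<le> C1 * (2 * t) powr e0" using C1(2)[of w 0] that t by auto
      also have "\<dots> = 2 powr e0 * C1 * t powr e0" using t by (simp add: powr_mult)
      also have "\<dots> \<le> M" unfolding M_def using C0 by (intro mult_right_mono) auto
      finally show ?thesis .
    qed
    \<comment> \<open>Balances the 3-4-1 inequality: with this choice (2 \<eta> M)^4 * 8 M equals
      \<eta>^3 exactly.\<close>
    define \<eta> where "\<eta> = 1 / (128 * M ^ 5)"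
    have M5: "M ^ 5 \<ge> 1" using M1 by simp
    have eta: "\<eta> > 0" "\<eta> < 1" "\<eta> * M ^ 5 = 1/128" 
    proof -
      have M0: "M ^ 5 > 0" using M5 by linarith
      show "\<eta> > 0" "\<eta> * M ^ 5 = 1/128" using M0 by (simp_all add: \<eta>_def del: zero_less_power_eq)
      have "1 < 128 * M ^ 5" using M5 by linarith
      thus "\<eta> < 1" unfolding \<eta>_def using M0 by (subst divide_less_eq_1_pos) auto
    qed
    have low1: "norm (zeta w) \<ge> 2 * \<eta> * M" if w: "1 + \<eta> \<le> Re w" "Re w \<le> 2" "\<bar>Im w\<bar> = t" for w
    proof -
      define \<sigma> where "\<sigma> = Re w"
      have sg: "\<sigma> > 1" using w eta by (simp add: \<sigma>_def)
      define a b c where "a = norm (zeta (of_real \<sigma>))" and "b = norm (zeta w)" and "c = norm (zeta (Complex \<sigma> (2 * Im w)))"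
      have "0 \<le> 3 * Re (log_zeta (of_real \<sigma>)) + 4 * Re (log_zeta w) + Re (log_zeta (Complex \<sigma> (2 * Im w)))"
        using mertens_inequality[OF sg, of "Im w"] by (simp add: \<sigma>_def)
      hence "1 \<le> exp (3 * Re (log_zeta (of_real \<sigma>)) + 4 * Re (log_zeta w) + Re (log_zeta (Complex \<sigma> (2 * Im w))))" by simp
      also have "\<dots> = a ^ 3 * b ^ 4 * c"
        unfolding a_def b_def c_def using sg
        by (simp add: norm_zeta_exp exp_add \<sigma>_def exp_of_nat_mult[symmetric])
      finally have 1: "1 \<le> a ^ 3 * b ^ 4 * c" .
      have "a \<le> \<sigma> / (\<sigma> - 1)" unfolding a_def by (rule zeta_real_bound[OF sg])
      also have "\<dots> \<le> 2 / \<eta>" using w sg eta by (intro frac_le) (auto simp: \<sigma>_def)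
      finally have a: "a ^ 3 \<le> (2 / \<eta>) ^ 3" by (intro power_mono) (auto simp: a_def)
      have c: "c \<le> M" unfolding c_def using w sg by (intro zb2) (auto simp: \<sigma>_def abs_mult)
      have "a ^ 3 * b ^ 4 * c \<le> (2 / \<eta>) ^ 3 * b ^ 4 * M"
        using a c eta by (intro mult_mono) (auto simp: b_def c_def)
      with 1 have "1 \<le> (2 / \<eta>) ^ 3 * b ^ 4 * M" by linarith
      hence "\<eta> ^ 3 \<le> 8 * M * b ^ 4" using eta by (simp add: field_simps power_divide)
      moreover have "(2 * \<eta> * M) ^ 4 * (8 * M) = \<eta> ^ 3 * (128 * (\<eta> * M ^ 5))"
        by (simp add: power_mult_distrib eval_nat_numeral mult_ac)
      ultimately have "(2 * \<eta> * M) ^ 4 * (8 * M) \<le> b ^ 4 * (8 * M)" using eta by (simp add: mult_ac)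
      hence "(2 * \<eta> * M) ^ 4 \<le> b ^ 4" using M1 by simp
      thus ?thesis unfolding b_def using eta M1 by (subst (asm) power_mono_iff) auto
    qed
    have seg: "1 < Re w \<and> Re w \<le> 2 \<and> \<bar>Im w\<bar> = t"
      if "w \<in> closed_segment s (Complex (1+\<eta>) (Im s))" for w
    proof -
      have "w \<in> {w. Re w > 1} \<inter> {w. Re w \<le> 2} \<inter> {w. Im w = Im s}"
        by (rule subsetD[OF closed_segment_subset that])
           (use s eta in \<open>auto intro!: convex_Int convex_halfspace_Re_gt convex_halfspace_Re_le convex_Im_eq\<close>)
      thus ?thesis by (auto simp: t_def)
    qed
    have low: "norm (zeta w) \<ge> \<eta> * M" if w: "1 < Re w" "Re w \<le> 2" "\<bar>Im w\<bar> = t" for w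
    proof (cases "1 + \<eta> \<le> Re w")
      case True
      have "\<eta> * M \<ge> 0" using eta M1 by simp
      thus ?thesis using low1[OF True w(2,3)] by linarith
    next
      case False
      define w1 where "w1 = Complex (1+\<eta>) (Im w)"
      have sub: "closed_segment w w1 \<subseteq> {v. Re v > 1} \<inter> {v. Re v \<le> 2} \<inter> {v. Im v = Im w}"
        by (rule closed_segment_subset)
           (use w eta in \<open>auto simp: w1_def intro!: convex_Int convex_halfspace_Re_gt convex_halfspace_Re_le convex_Im_eq\<close>)
      have "norm (zeta w - zeta w1) \<le> M * norm (w - w1)"
      proof (rule field_differentiable_bound)
        fix v assume v: "v \<in> closed_segment w w1"
        hence v': "1 < Re v" "Re v \<le> 2" "\<bar>Im v\<bar> = t" using sub w by auto
        show "(zeta has_field_derivative deriv zeta v) (at v within closed_segment w w1)"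
          using v' by (intro has_field_derivative_at_within[OF zeta_has_field_derivative]) auto
        show "norm (deriv zeta v) \<le> M" using zb[OF v', of 1] by simp
      qed auto
      also have "norm (w - w1) \<le> \<eta>"
      proof -
        have "w - w1 = of_real (Re w - (1 + \<eta>))" by (simp add: w1_def complex_eq_iff)
        thus ?thesis using False w by (simp del: of_real_diff of_real_add)
      qed
      finally have "norm (zeta w - zeta w1) \<le> M * \<eta>" using M1 by (simp add: mult_left_mono)
      moreover have "norm (zeta w1) \<ge> 2 * \<eta> * M" using w eta by (intro low1) (auto simp: w1_def)
      moreover have "norm (zeta w1) \<le> norm (zeta w) + norm (zeta w - zeta w1)"
        by (metis norm_minus_commute norm_triangle_sub)
      ultimately show ?thesis by (simp add: algebra_simps)
    qed
    have Lb1: "norm (log_zeta w) \<le> ln (2 / \<eta>)" if w: "1 + \<eta> \<le> Re w" "Re w \<le> 2" for w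
    proof -
      have "norm (log_zeta w) \<le> Re (log_zeta (of_real (Re w)))" using w eta by (intro norm_log_zeta_le) auto
      also have "\<dots> \<le> ln (Re w / (Re w - 1))" using w eta by (intro log_zeta_real_bound) auto
      also have "\<dots> \<le> ln (2 / \<eta>)"
      proof -
        have "Re w / (Re w - 1) \<le> 2 / \<eta>" using w eta by (intro frac_le) auto
        thus ?thesis using w eta by simp
      qed
      finally show ?thesis .
    qed
    \<comment> \<open>To the right of 1 + \<eta> the real axis gives log(2/\<eta>). The remaining
      segment has length at most \<eta> and |zeta'/zeta| <= M / (\<eta> M) = 1/\<eta> on it, so it
      adds at most 1.\<close>
    have Lb: "norm (log_zeta s) \<le> ln (2 / \<eta>) + 1"
    proof (cases "1 + \<eta> \<le> Re s")
      case True
      thus ?thesis using Lb1[OF True s(2)] by linarith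
    next
      case False
      define w1 where "w1 = Complex (1+\<eta>) (Im s)"
      have "norm (log_zeta s - log_zeta w1) \<le> (1 / \<eta>) * norm (s - w1)"
      proof (rule field_differentiable_bound)
        fix v assume v: "v \<in> closed_segment s w1"
        hence v': "1 < Re v" "Re v \<le> 2" "\<bar>Im v\<bar> = t" using seg w1_def by auto
        show "(log_zeta has_field_derivative deriv zeta v / zeta v) (at v within closed_segment s w1)"
          using v' by (intro has_field_derivative_at_within[OF log_zeta_has_field_derivative]) auto
        have "norm (deriv zeta v / zeta v) \<le> M / (\<eta> * M)"
          unfolding norm_divide using zb[OF v', of 1] low[OF v'] eta M1 by (intro frac_le) auto
        thus "norm (deriv zeta v / zeta v) \<le> 1 / \<eta>" using M1 by simp
      qed auto
      also have "(1 / \<eta>) * norm (s - w1) \<le> (1 / \<eta>) * \<eta>"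
      proof -
        have "s - w1 = of_real (Re s - (1 + \<eta>))" by (simp add: w1_def complex_eq_iff)
        hence "norm (s - w1) \<le> \<eta>" using False s by (simp del: of_real_diff of_real_add)
        thus ?thesis using eta by (intro mult_left_mono) auto
      qed
      finally have "norm (log_zeta s - log_zeta w1) \<le> 1" using eta by simp
      moreover have "norm (log_zeta w1) \<le> ln (2 / \<eta>)" using eta by (intro Lb1) (auto simp: w1_def)
      moreover have "norm (log_zeta s) \<le> norm (log_zeta w1) + norm (log_zeta s - log_zeta w1)"
        by (rule norm_triangle_sub)
      ultimately show ?thesis by linarith
    qed
    have CM: "(256 * exp 1 * M ^ 5) powr A = C * t powr e"
    proof -
      have "M ^ 5 = M powr 5" using M1 by (simp add: powr_numeral)
      hence "(256 * exp 1 * M ^ 5) powr A = (256 * exp 1) powr A * (M powr 5) powr A"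
        using M1 by (simp add: powr_mult)
      also have "(M powr 5) powr A = M powr (5 * A)" by (simp add: powr_powr)
      also have "\<dots> = C0 powr (5 * A) * (t powr e0) powr (5 * A)"
        unfolding M_def using C0' t by (simp add: powr_mult)
      also have "(t powr e0) powr (5 * A) = t powr e" using A by (simp add: powr_powr e0_def)
      finally show ?thesis by (simp add: C_def)
    qed
    have big: "256 * M ^ 5 \<le> C * t powr e"
    proof -
      have "256 * M ^ 5 * 1 \<le> 256 * M ^ 5 * exp 1" using M1 by (intro mult_left_mono) auto
      also have "\<dots> = (256 * exp 1 * M ^ 5) powr 1" using M1 by simp
      also have "\<dots> \<le> (256 * exp 1 * M ^ 5) powr A"
      proof (rule powr_mono[OF A])
        have "1 * 1 * 1 \<le> 256 * exp 1 * M ^ 5" using M5 by (intro mult_mono) auto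
        thus "1 \<le> 256 * exp 1 * M ^ 5" by simp
      qed
      finally show ?thesis using CM by simp
    qed
    have Mpow: "M \<le> M ^ 5" "M ^ 4 \<le> M ^ 5"
      using M1 power_increasing[of 1 5 M] power_increasing[of 4 5 M] by auto
    show ?thesis
    proof (intro conjI allI impI)
      fix j :: nat assume "j \<le> 2"
      have "norm ((deriv ^^ j) zeta s) \<le> M" using \<open>j \<le> 2\<close> s by (intro zb) (auto simp: t_def)
      also have "M \<le> 256 * M ^ 5" using Mpow M1 by linarith
      finally show "norm ((deriv ^^ j) zeta s) \<le> C * \<bar>Im s\<bar> powr e" using big by (simp add: t_def)
    next
      have "norm (zeta s) \<ge> \<eta> * M" using s by (intro low) (auto simp: t_def)
      hence "norm (inverse (zeta s)) \<le> inverse (\<eta> * M)"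
        unfolding norm_inverse using eta M1 by (intro le_imp_inverse_le) auto
      also have "\<dots> = 128 * M ^ 4" unfolding \<eta>_def using M1 by (simp add: field_simps eval_nat_numeral)
      also have "\<dots> \<le> 256 * M ^ 5" using Mpow M1 by linarith
      finally show "norm (inverse (zeta s)) \<le> C * \<bar>Im s\<bar> powr e" using big by (simp add: t_def)
    next
      have "exp (A * norm (log_zeta s)) \<le> exp (A * (ln (2/\<eta>) + 1))" using Lb A by simp
      also have "\<dots> = (exp 1 * (2 / \<eta>)) powr A" using eta by (simp add: powr_def ln_mult ln_div)
      also have "exp 1 * (2 / \<eta>) = 256 * exp 1 * M ^ 5" by (simp add: \<eta>_def)
      finally show "exp (A * norm (log_zeta s)) \<le> C * \<bar>Im s\<bar> powr e" using CM by (simp add: t_def)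
    qed
  qed
  with Cpos show ?thesis by blast
qed

text \<open>Division by s turns the Dirichlet series into the Mellin transform of its summatory
  function.\<close>

definition Phi :: "complex \<Rightarrow> complex \<Rightarrow> complex" where
  "Phi z s = omega_dirichlet z s / s"

lemma Phi_eq: "Re s > 1 \<Longrightarrow> Phi z s = exp (z * log_zeta s) * (G z s / s)"
  by (simp add: Phi_def omega_dirichlet_eq)

lemma holomorphic_G_over: "(\<lambda>s. G z s / s) holomorphic_on {s. Re s > 3/4}"
  by (intro holomorphic_intros holomorphic_G) auto

lemma Cauchy_bound_2:
  assumes "f holomorphic_on cball s r" "0 < r" "r \<le> 1" "j \<le> 2" "B \<ge> 0"
    and "\<And>w. w \<in> cball s r \<Longrightarrow> norm (f w) \<le> B"
  shows "norm ((deriv ^^ j) f s) \<le> 2 * B / r ^ 2"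
proof -
  have "norm ((deriv ^^ j) f s) \<le> fact j * B / r ^ j"
  proof (rule Cauchy_inequality)
    show "f holomorphic_on ball s r" using assms(1) by (rule holomorphic_on_subset) auto
    show "continuous_on (cball s r) f" using assms(1) by (rule holomorphic_on_imp_continuous_on)
    show "norm (f x) \<le> B" if "norm (s - x) = r" for x
      using that by (intro assms(6)) (auto simp: dist_norm)
  qed (use assms in auto)
  also have "\<dots> \<le> 2 * B / r ^ 2"
  proof (rule frac_le)
    have "fact j \<le> (fact 2 :: real)" using assms by (intro fact_mono)
    thus "fact j * B \<le> 2 * B" using assms by (intro mult_right_mono) auto
    show "r ^ 2 \<le> r ^ j" using assms by (intro power_decreasing) auto
  qed (use assms in auto)
  finally show ?thesis .
qed

text \<open>G is bounded, so 1/|Im s| comes from the division by s; derivatives cost only a constant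
  by Cauchy estimates on discs of fixed radius.\<close>

lemma G_over_deriv_bound:
  assumes tau: "\<tau> > 0"
  shows "\<exists>C>0. \<forall>s j. Re s \<ge> 1 \<and> \<bar>Im s\<bar> \<ge> \<tau> \<and> j \<le> 2 \<longrightarrow> norm ((deriv ^^ j) (\<lambda>s. G z s / s) s) \<le> C / \<bar>Im s\<bar>"
proof -
  obtain C where C: "C > 0" "\<And>s. Re s \<ge> 3/4 \<Longrightarrow> norm (G z s) \<le> C" using G_bounded by metis
  define r where "r = min (1/8) (\<tau>/2)"
  have r: "r > 0" "r \<le> 1/8" "r \<le> \<tau>/2" using tau by (auto simp: r_def)
  have "norm ((deriv ^^ j) (\<lambda>s. G z s / s) s) \<le> (4 * C / r ^ 2) / \<bar>Im s\<bar>"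
    if s: "Re s \<ge> 1" "\<bar>Im s\<bar> \<ge> \<tau>" "j \<le> 2" for s j
  proof -
    have t0: "\<bar>Im s\<bar> > 0" using s tau by linarith
    have w: "Re w > 3/4" "\<bar>Im w\<bar> \<ge> \<bar>Im s\<bar> / 2" if "w \<in> cball s r" for w
      using cball_Re_Im[OF that] r s by linarith+
    have "norm ((deriv ^^ j) (\<lambda>s. G z s / s) s) \<le> 2 * (2 * C / \<bar>Im s\<bar>) / r ^ 2"
    proof (rule Cauchy_bound_2)
      show "(\<lambda>s. G z s / s) holomorphic_on cball s r"
        by (rule holomorphic_on_subset[OF holomorphic_G_over]) (use w in auto)
      fix v assume v: "v \<in> cball s r"
      have "norm v \<ge> \<bar>Im s\<bar> / 2" using w(2)[OF v] abs_Im_le_cmod[of v] by linarith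
      hence "norm (G z v) / norm v \<le> C / (\<bar>Im s\<bar> / 2)"
        using C(2)[of v] w(1)[OF v] t0 C(1) by (intro frac_le) auto
      thus "norm (G z v / v) \<le> 2 * C / \<bar>Im s\<bar>" by (simp add: norm_divide mult.commute)
    qed (use r C t0 s in auto)
    thus ?thesis by (simp add: mult_ac)
  qed
  moreover have "4 * C / r ^ 2 > 0" using C r by simp
  ultimately show ?thesis by blast
qed

lemma deriv2_eq: "(deriv ^^ 2) f = deriv (deriv f)"
  by (simp add: numeral_2_eq_2)

text \<open>Writing \<open>Phi\<close> as zeta^z times G(s)/s, the first factor and its first two
  derivatives involve at most five factors out of zeta^z, 1/zeta, zeta' and zeta'' in each term.
  Each factor is O(|Im s|^(e/5)), and G(s)/s with its derivatives supplies 1/|Im s|.\<close>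

lemma Phi_deriv2_large:
  assumes e: "e > 0" and tau: "\<tau> > 0"
  shows "\<exists>C>0. \<forall>s. 1 < Re s \<and> Re s \<le> 2 \<and> \<bar>Im s\<bar> \<ge> \<tau> \<longrightarrow> norm ((deriv ^^ 2) (Phi z) s) \<le> C * \<bar>Im s\<bar> powr (e - 1)"
proof -
  define A where "A = max 1 (norm z)"
  have A: "A \<ge> 1" "norm z \<le> A" by (auto simp: A_def)
  define e1 where "e1 = e / 5"
  have e1: "e1 > 0" using e by (simp add: e1_def)
  obtain C1 where C1: "C1 > 0" and b: "\<And>s. 1 < Re s \<Longrightarrow> Re s \<le> 2 \<Longrightarrow> \<bar>Im s\<bar> \<ge> \<tau> \<Longrightarrow>
     (\<forall>j\<le>2. norm ((deriv ^^ j) zeta s) \<le> C1 * \<bar>Im s\<bar> powr e1) \<and>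
     norm (inverse (zeta s)) \<le> C1 * \<bar>Im s\<bar> powr e1 \<and>
     exp (A * norm (log_zeta s)) \<le> C1 * \<bar>Im s\<bar> powr e1"
    using zeta_bounds[OF e1 tau A(1)] by blast
  obtain C2 where C2: "C2 > 0" "\<And>s j. Re s \<ge> 1 \<Longrightarrow> \<bar>Im s\<bar> \<ge> \<tau> \<Longrightarrow> j \<le> 2 \<Longrightarrow> norm ((deriv ^^ j) (\<lambda>s. G z s / s) s) \<le> C2 / \<bar>Im s\<bar>"
    using G_over_deriv_bound[OF tau] by metis
  define K where "K = norm z ^ 2 + 2 * norm z + 1"
  define C where "C = 4 * K * C1 ^ 5 * C2"
  have K: "K \<ge> 1" "norm z \<le> K" by (auto simp: K_def)
  define U where "U = {s. Re s > 1}"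
  have opU: "open U" unfolding U_def by (rule open_halfspace_Re_gt)
  define E where "E = (\<lambda>s. exp (z * log_zeta s))"
  define E1 where "E1 = (\<lambda>s. E s * (z * (deriv zeta s * inverse (zeta s))))"
  define E2 where "E2 = (\<lambda>s. E1 s * (z * (deriv zeta s * inverse (zeta s))) +
     E s * (z * ((deriv ^^ 2) zeta s * inverse (zeta s) - (deriv zeta s * inverse (zeta s))\<^sup>2)))"
  have dE: "(E has_field_derivative E1 s) (at s)" if "s \<in> U" for s
    unfolding E_def E1_def using that log_zeta_has_field_derivative[of s]
    by (auto simp: U_def divide_inverse intro!: derivative_eq_intros)
  have dz2: "(deriv zeta has_field_derivative (deriv ^^ 2) zeta s) (at s)" if "s \<in> U" for s
  proof -
    have "open ({s. Re s > 0} - {1})" by (intro open_Diff open_halfspace_Re_gt) auto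
    hence "deriv zeta holomorphic_on ({s. Re s > 0} - {1})" by (rule holomorphic_deriv[OF holomorphic_zeta])
    hence "deriv zeta holomorphic_on U" by (rule holomorphic_on_subset) (auto simp: U_def)
    thus ?thesis unfolding deriv2_eq by (rule holomorphic_derivI[OF _ opU that])
  qed
  have dE1: "(E1 has_field_derivative E2 s) (at s)" if "s \<in> U" for s
  proof -
    have nz: "zeta s \<noteq> 0" using that by (simp add: U_def zeta_nonzero)
    have dz: "(zeta has_field_derivative deriv zeta s) (at s)"
      using that by (intro zeta_has_field_derivative) (auto simp: U_def)
    have "((\<lambda>s. E s * (z * (deriv zeta s * inverse (zeta s)))) has_field_derivative
       (E1 s * (z * (deriv zeta s * inverse (zeta s))) +
        (z * ((deriv ^^ 2) zeta s * inverse (zeta s) + (- (inverse (zeta s) * deriv zeta s * inverse (zeta s))) * deriv zeta s)) * E s)) (at s)"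
      by (intro DERIV_mult DERIV_cmult DERIV_inverse' dE dz2 dz that nz)
    thus ?thesis unfolding E1_def[symmetric] E2_def
      by (rule DERIV_cong) (simp add: power2_eq_square algebra_simps)
  qed
  have derE: "deriv E s = E1 s" if "s \<in> U" for s using dE[OF that] by (rule DERIV_imp_deriv)
  have derE2: "deriv (deriv E) s = E2 s" if "s \<in> U" for s
  proof -
    have "(deriv E has_field_derivative E2 s) (at s)"
      by (rule has_field_derivative_transform_within_open[OF dE1[OF that] opU that]) (simp add: derE)
    thus ?thesis by (rule DERIV_imp_deriv)
  qed
  have holE: "E holomorphic_on U" using dE opU by (auto simp: holomorphic_on_open)
  have "norm ((deriv ^^ 2) (Phi z) s) \<le> C * \<bar>Im s\<bar> powr (e - 1)"
    if s: "1 < Re s" "Re s \<le> 2" "\<bar>Im s\<bar> \<ge> \<tau>" for s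
  proof -
    have sU: "s \<in> U" using s by (simp add: U_def)
    define t where "t = \<bar>Im s\<bar>"
    define N where "N = C1 * t powr e1"
    have t: "t > 0" using s tau by (simp add: t_def)
    have bz: "norm (deriv zeta s) \<le> N" "norm ((deriv ^^ 2) zeta s) \<le> N" "norm (inverse (zeta s)) \<le> N" "exp (A * norm (log_zeta s)) \<le> N"
      using b[OF s] unfolding N_def t_def by (auto dest: spec[of _ 1])
    have "1 \<le> exp (A * norm (log_zeta s))" using A by simp
    hence N1: "N \<ge> 1" using bz by linarith
    have bE: "norm (E s) \<le> N"
    proof -
      have "norm (E s) \<le> exp (norm (z * log_zeta s))" unfolding E_def by (rule norm_exp)
      also have "\<dots> \<le> exp (A * norm (log_zeta s))" using A by (simp add: norm_mult mult_right_mono)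
      finally show ?thesis using bz by linarith
    qed
    have bq: "norm (deriv zeta s * inverse (zeta s)) \<le> N ^ 2"
      unfolding norm_mult power2_eq_square using bz N1 by (intro mult_mono) auto
    have bq2: "norm ((deriv ^^ 2) zeta s * inverse (zeta s)) \<le> N ^ 2"
      unfolding norm_mult power2_eq_square using bz N1 by (intro mult_mono) auto
    have bE1: "norm (E1 s) \<le> norm z * N ^ 3"
    proof -
      have "norm (E1 s) \<le> N * (norm z * N ^ 2)"
        unfolding E1_def norm_mult[of "E s"] norm_mult[of z] using bE bq N1
        by (intro mult_mono) auto
      thus ?thesis by (simp add: eval_nat_numeral mult_ac)
    qed
    have Npow: "N \<le> N ^ 5" "N ^ 3 \<le> N ^ 5"
      using N1 power_increasing[of 1 5 N] power_increasing[of 3 5 N] by auto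
    have bE2: "norm (E2 s) \<le> K * N ^ 5"
    proof -
      have "norm (E1 s * (z * (deriv zeta s * inverse (zeta s)))) \<le> norm z * N ^ 3 * (norm z * N ^ 2)"
        unfolding norm_mult[of "E1 s"] norm_mult[of z] using bE1 bq N1 by (intro mult_mono) auto
      moreover have "norm (E s * (z * ((deriv ^^ 2) zeta s * inverse (zeta s) - (deriv zeta s * inverse (zeta s))\<^sup>2)))
          \<le> N * (norm z * (N ^ 2 + (N ^ 2) ^ 2))"
      proof -
        have "norm ((deriv ^^ 2) zeta s * inverse (zeta s) - (deriv zeta s * inverse (zeta s))\<^sup>2) \<le> N ^ 2 + (N ^ 2) ^ 2"
          by (rule norm_triangle_le_diff, rule add_mono[OF bq2]) (use bq in \<open>simp only: norm_power power_mono norm_ge_zero\<close>)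
        thus ?thesis unfolding norm_mult[of "E s"] norm_mult[of z] using bE N1 by (intro mult_mono) auto
      qed
      ultimately have "norm (E2 s) \<le> norm z * N ^ 3 * (norm z * N ^ 2) + N * (norm z * (N ^ 2 + (N ^ 2) ^ 2))"
        unfolding E2_def by (intro norm_triangle_le add_mono)
      also have "\<dots> = norm z ^ 2 * N ^ 5 + norm z * (N ^ 3 + N ^ 5)"
        by (simp add: eval_nat_numeral algebra_simps)
      also have "\<dots> \<le> norm z ^ 2 * N ^ 5 + norm z * (N ^ 5 + N ^ 5)"
        using Npow by (intro add_mono mult_left_mono) auto
      also have "\<dots> \<le> K * N ^ 5" using N1 by (simp add: K_def algebra_simps)
      finally show ?thesis .
    qed
    have bE1': "norm (E1 s) \<le> K * N ^ 5"
    proof -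
      have "norm z * N ^ 3 \<le> K * N ^ 5" using K Npow N1 by (intro mult_mono) auto
      thus ?thesis using bE1 by linarith
    qed
    have bE': "norm (E s) \<le> K * N ^ 5"
    proof -
      have "1 * N \<le> K * N ^ 5" using K Npow N1 by (intro mult_mono) auto
      thus ?thesis using bE by linarith
    qed
    have holEG: "(\<lambda>s. E s * (G z s / s)) holomorphic_on U"
      by (intro holomorphic_on_mult holE holomorphic_on_subset[OF holomorphic_G_over]) (auto simp: U_def)
    have PhiE: "Phi z w = E w * (G z w / w)" if "w \<in> U" for w
      unfolding E_def by (rule Phi_eq) (use that in \<open>simp add: U_def\<close>)
    have holPhi: "Phi z holomorphic_on U"
      by (rule holomorphic_transform[OF holEG]) (rule PhiE[symmetric])
    have "(deriv ^^ 2) (Phi z) s = (deriv ^^ 2) (\<lambda>s. E s * (G z s / s)) s"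
      by (rule higher_deriv_transform_within_open[OF holPhi holEG opU sU PhiE])
    also have "\<dots> = (\<Sum>i = 0..2. of_nat (2 choose i) * (deriv ^^ i) E s * (deriv ^^ (2-i)) (\<lambda>s. G z s / s) s)"
      by (rule higher_deriv_mult[OF holE _ opU sU], rule holomorphic_on_subset[OF holomorphic_G_over]) (auto simp: U_def)
    also have "\<dots> = E s * (deriv ^^ 2) (\<lambda>s. G z s / s) s + 2 * E1 s * (deriv ^^ 1) (\<lambda>s. G z s / s) s + E2 s * (deriv ^^ 0) (\<lambda>s. G z s / s) s"
      using derE[OF sU] derE2[OF sU] by (simp add: numeral_2_eq_2)
    finally have eq: "(deriv ^^ 2) (Phi z) s = \<dots>" .
    have bG: "norm ((deriv ^^ j) (\<lambda>s. G z s / s) s) \<le> C2 / t" if "j \<le> 2" for j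
      using C2(2)[of s j] s that by (simp add: t_def)
    define X where "X = K * N ^ 5"
    have X0: "X \<ge> 0" using K N1 by (simp add: X_def)
    have "norm (E s * (deriv ^^ 2) (\<lambda>s. G z s / s) s) \<le> X * (C2 / t)"
      unfolding norm_mult X_def[symmetric] using bE' X0 unfolding X_def[symmetric] by (intro mult_mono bG) auto
    moreover have "norm (2 * E1 s * (deriv ^^ 1) (\<lambda>s. G z s / s) s) \<le> 2 * X * (C2 / t)"
      unfolding norm_mult norm_numeral using bE1' X0 unfolding X_def[symmetric] by (intro mult_mono bG) auto
    moreover have "norm (E2 s * (deriv ^^ 0) (\<lambda>s. G z s / s) s) \<le> X * (C2 / t)"
      unfolding norm_mult using bE2 X0 unfolding X_def[symmetric] by (intro mult_mono bG) auto
    ultimately have "norm ((deriv ^^ 2) (Phi z) s) \<le> X * (C2 / t) + 2 * X * (C2 / t) + X * (C2 / t)"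
      unfolding eq by (intro norm_triangle_le add_mono)
    hence "norm ((deriv ^^ 2) (Phi z) s) \<le> K * N ^ 5 * (C2 / t) + 2 * (K * N ^ 5) * (C2 / t) + K * N ^ 5 * (C2 / t)"
      by (simp only: X_def)
    also have "\<dots> = 4 * K * N ^ 5 * C2 / t" by (simp add: field_simps)
    also have "N ^ 5 = C1 ^ 5 * t powr e"
      unfolding N_def power_mult_distrib using t by (simp add: e1_def powr_power)
    also have "4 * K * (C1 ^ 5 * t powr e) * C2 / t = C * t powr (e - 1)"
      using t by (simp add: C_def powr_diff)
    finally show ?thesis by (simp add: t_def)
  qed
  moreover have "C > 0" unfolding C_def using K C1 C2 by simp
  ultimately show ?thesis by blast
qed

lemma norm_powr_le:
  assumes "w \<noteq> 0"
  shows "norm (w powr a) \<le> norm w powr (Re a) * exp (pi * \<bar>Im a\<bar>)"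
proof -
  have "norm (w powr a) = exp (Re (a * Ln w))" using assms by (simp add: powr_def norm_exp_eq_Re)
  also have "Re (a * Ln w) = Re a * ln (norm w) - Im a * Im (Ln w)" using assms by simp
  also have "\<dots> \<le> Re a * ln (norm w) + pi * \<bar>Im a\<bar>"
  proof -
    have "\<bar>Im (Ln w)\<bar> \<le> pi" using assms mpi_less_Im_Ln[of w] Im_Ln_le_pi[of w] by linarith
    hence "\<bar>Im a * Im (Ln w)\<bar> \<le> \<bar>Im a\<bar> * pi" unfolding abs_mult by (intro mult_left_mono) auto
    thus ?thesis by (simp add: mult.commute)
  qed
  finally show ?thesis using assms by (simp add: powr_def exp_add)
qed

text \<open>Both sides have the exponential zeta(s), so their difference has derivative 0 on a
  convex set and is constant. It vanishes at a real point: all three logarithms are real there, and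
  the exponential of the difference is 1.\<close>

lemma log_zeta_near_1:
  assumes r: "\<And>s. s \<in> ball 1 r \<Longrightarrow> Re (zeta_num s) > 0" and r1: "r > 0" "r \<le> 1"
    and s: "s \<in> ball 1 r" "Re s > 1"
  shows "log_zeta s = Ln (zeta_num s) - Ln (s - 1)"
proof -
  define U where "U = ball (1::complex) r \<inter> {s. Re s > 1}"
  have opU: "open U" unfolding U_def by (intro open_Int open_ball open_halfspace_Re_gt)
  have conU: "connected U" unfolding U_def by (intro convex_connected convex_Int convex_ball convex_halfspace_Re_gt)
  define d where "d = (\<lambda>s. log_zeta s + Ln (s - 1) - Ln (zeta_num s))"
  have nz: "s - 1 \<notin> \<real>\<^sub>\<le>\<^sub>0 \<and> zeta_num s \<notin> \<real>\<^sub>\<le>\<^sub>0" if "s \<in> U" for s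
    using that r[of s] by (auto simp: U_def complex_nonpos_Reals_iff)
  have Upos: "Re w > 0" if "w \<in> U" for w using that by (simp add: U_def)
  have hol: "d holomorphic_on U"
    unfolding d_def
    by (intro holomorphic_intros holomorphic_on_subset[OF holomorphic_log_zeta] holomorphic_on_subset[OF holomorphic_zeta_num])
       (use nz Upos in \<open>auto simp: U_def\<close>)
  have ex: "exp (d s) = 1" if "s \<in> U" for s
  proof -
    have s1: "Re s > 1" "s \<noteq> 1" "zeta_num s \<noteq> 0" using that r[of s] by (auto simp: U_def)
    hence "exp (d s) = zeta s * (s - 1) / zeta_num s" unfolding d_def
      by (simp add: exp_add exp_diff exp_log_zeta)
    also have "\<dots> = 1" using s1 by (simp add: zeta_def)
    finally show ?thesis .
  qed
  have "(d has_field_derivative 0) (at s)" if "s \<in> U" for s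
  proof -
    have 1: "(d has_field_derivative deriv d s) (at s)" by (rule holomorphic_derivI[OF hol opU that])
    have "((\<lambda>s. exp (d s)) has_field_derivative exp (d s) * deriv d s) (at s)"
      by (rule DERIV_chain2[OF DERIV_exp 1])
    hence "((\<lambda>_. 1) has_field_derivative exp (d s) * deriv d s) (at s)"
      by (rule has_field_derivative_transform_within_open[OF _ opU that]) (simp add: ex)
    hence "exp (d s) * deriv d s = 0" using DERIV_unique DERIV_const by blast
    thus ?thesis using 1 by simp
  qed
  hence d0: "\<forall>s\<in>U. (d has_field_derivative 0) (at s)" by blast
  obtain c where c: "\<And>s. s \<in> U \<Longrightarrow> d s = c"
    using DERIV_zero_connected_constant[OF conU opU finite.emptyI holomorphic_on_imp_continuous_on[OF hol]] d0
    by auto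
  define x where "x = 1 + r / 2"
  have xU: "of_real x \<in> U" using r1 by (auto simp: U_def x_def dist_norm)
  have "d (of_real x) = 0"
  proof -
    have x1: "x > 1" using r1 by (simp add: x_def)
    have z: "zeta (of_real x) = of_real (exp (Re (log_zeta (of_real x))))"
      using exp_log_zeta[of "of_real x"] log_zeta_of_real_Im[OF x1] x1
      by (metis Re_complex_of_real complex_is_Real_iff exp_of_real of_real_Re)
    have "zeta_num (of_real x) = (of_real x - 1) * zeta (of_real x)" using x1 by (simp add: zeta_def)
    also have "\<dots> = of_real ((x - 1) * exp (Re (log_zeta (of_real x))))" by (simp add: z)
    finally have "Im (Ln (zeta_num (of_real x))) = 0"
      using x1 Ln_of_real[of "(x - 1) * exp (Re (log_zeta (of_real x)))"] by simp
    moreover have "Im (Ln (of_real x - 1)) = 0"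
      using x1 Ln_of_real[of "x - 1"] by simp
    ultimately have im: "Im (d (of_real x)) = 0" using log_zeta_of_real_Im[OF x1] by (simp add: d_def)
    have "exp (d (of_real x)) = 1" by (rule ex[OF xU])
    hence "norm (exp (d (of_real x))) = 1" by simp
    hence "Re (d (of_real x)) = 0" by (simp add: norm_exp_eq_Re)
    with im show ?thesis by (simp add: complex_eq_iff)
  qed
  hence "c = 0" using c[OF xU] by simp
  hence "d s = 0" using c[of s] s by (simp add: U_def)
  thus ?thesis by (simp add: d_def algebra_simps)
qed

lemma powr_ratio_le:
  fixes a b e :: real
  assumes "b > 0" "b / 2 \<le> a" "a \<le> 2 * b"
  shows "a powr e \<le> 2 powr \<bar>e\<bar> * b powr e"
proof -
  have a: "a > 0" using assms by linarith
  have "\<bar>ln (a / b)\<bar> \<le> ln 2"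
  proof -
    have "ln (a / b) \<le> ln 2" using assms a by (subst ln_le_cancel_iff) (auto simp: field_simps)
    moreover have "ln (1/2) \<le> ln (a / b)" using assms a by (subst ln_le_cancel_iff) (auto simp: field_simps)
    ultimately show ?thesis by (simp add: ln_div)
  qed
  hence "\<bar>e * ln (a / b)\<bar> \<le> \<bar>e\<bar> * ln 2" unfolding abs_mult by (intro mult_left_mono) auto
  hence "exp (e * ln (a / b)) \<le> exp (\<bar>e\<bar> * ln 2)" by simp
  hence "(a / b) powr e \<le> 2 powr \<bar>e\<bar>" using a assms by (simp add: powr_def)
  thus ?thesis using a assms by (simp add: powr_divide field_simps)
qed

lemma shifted_powr_deriv2:
  fixes s a :: complex
  assumes "Re s > 1"
  shows "(deriv ^^ 2) (\<lambda>s. (s - 1) powr (-a)) s = a * (a + 1) * (s - 1) powr (-a - 2)"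
proof -
  define U where "U = {s::complex. Re s > 1}"
  have opU: "open U" unfolding U_def by (rule open_halfspace_Re_gt)
  have nz: "w - 1 \<notin> \<real>\<^sub>\<le>\<^sub>0" if "w \<in> U" for w using that by (auto simp: U_def complex_nonpos_Reals_iff)
  have d: "((\<lambda>s. (s - 1) powr b) has_field_derivative b * (w - 1) powr (b - 1)) (at w)" if "w \<in> U" for w b
  proof -
    have "((\<lambda>s. s - 1) has_field_derivative 1) (at w)" by (auto intro!: derivative_eq_intros)
    from DERIV_chain2[where f = "\<lambda>u. u powr b" and g = "\<lambda>s. s - 1" and x = w and s = UNIV, OF has_field_derivative_powr[OF nz[OF that]] this]
    show ?thesis by simp
  qed
  have d1: "deriv (\<lambda>s. (s - 1) powr (-a)) w = (-a) * (w - 1) powr (-a - 1)" if "w \<in> U" for w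
    by (rule DERIV_imp_deriv[OF d[OF that]])
  have sU: "s \<in> U" using assms by (simp add: U_def)
  have "((\<lambda>w. (-a) * (w - 1) powr (-a - 1)) has_field_derivative (-a) * ((-a - 1) * (s - 1) powr (-a - 1 - 1))) (at s)"
    by (rule DERIV_cmult[OF d[OF sU]])
  hence "(deriv (\<lambda>s. (s - 1) powr (-a)) has_field_derivative (-a) * ((-a - 1) * (s - 1) powr (-a - 1 - 1))) (at s)"
    by (rule has_field_derivative_transform_within_open[OF _ opU sU]) (simp add: d1)
  thus ?thesis unfolding deriv2_eq by (simp add: DERIV_imp_deriv algebra_simps)
qed

text \<open>Near 1, \<open>Phi z\<close> is (s-1)^(-z) H(s) with H holomorphic across the line and
  H(1) = \<open>g_one z\<close>. Replacing H by H(1) leaves R = O(|s-1|^(1-Re z)), and Cauchy's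
  estimate on a disc of radius |s-1|/2 costs |s-1|^(-2).\<close>

lemma Phi_deriv2_near:
  "\<exists>r>0. \<exists>C>0. \<forall>s. 1 < Re s \<and> norm (s - 1) < r \<longrightarrow>
     norm ((deriv ^^ 2) (Phi z) s - z * (z + 1) * g_one z * (s - 1) powr (-z - 2)) \<le> C * norm (s - 1) powr (- Re z - 1)"
proof -
  have "open {s::complex. Re s > 0}" by (rule open_halfspace_Re_gt)
  hence "isCont zeta_num 1"
    by (intro continuous_on_interior[OF holomorphic_on_imp_continuous_on[OF holomorphic_zeta_num]])
       (simp add: interior_open)
  hence "((\<lambda>s. Re (zeta_num s)) \<longlongrightarrow> 1) (at 1)"
    using tendsto_Re[of zeta_num "zeta_num 1" "at 1"] by (simp add: isCont_def zeta_num_1)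
  hence "\<forall>\<^sub>F s in at 1. Re (zeta_num s) > 0" by (rule order_tendstoD(1)) simp
  then obtain r1 where r1: "r1 > 0" "\<And>s. s \<noteq> 1 \<Longrightarrow> dist s 1 < r1 \<Longrightarrow> Re (zeta_num s) > 0"
    unfolding eventually_at by blast
  define r0 where "r0 = min r1 (1/4)"
  have r0: "r0 > 0" "r0 \<le> 1/4" using r1 by (auto simp: r0_def)
  have pos: "Re (zeta_num s) > 0" if "s \<in> ball 1 r0" for s
    using that r1(2)[of s] by (cases "s = 1") (auto simp: r0_def dist_commute zeta_num_1)
  have Re34: "Re s > 3/4" if "s \<in> ball 1 r0" for s
  proof -
    have "\<bar>Re (1 - s)\<bar> < 1/4" using that r0 abs_Re_le_cmod[of "1 - s"] by (auto simp: dist_norm)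
    hence "\<bar>1 - Re s\<bar> < 1/4" by simp
    thus ?thesis unfolding abs_less_iff by linarith
  qed
  define H where "H = (\<lambda>s. exp (z * Ln (zeta_num s)) * (G z s / s))"
  have holH: "H holomorphic_on ball 1 r0"
    unfolding H_def
    by (intro holomorphic_intros holomorphic_on_subset[OF holomorphic_zeta_num] holomorphic_on_subset[OF holomorphic_G])
       (use pos Re34 in \<open>force simp: complex_nonpos_Reals_iff\<close>)+
  have H1: "H 1 = g_one z" by (simp add: H_def zeta_num_1 G_1)
  have "deriv H holomorphic_on ball 1 r0" by (rule holomorphic_deriv[OF holH]) auto
  hence "continuous_on (cball 1 (r0/2)) (deriv H)"
    using r0 by (intro holomorphic_on_imp_continuous_on, elim holomorphic_on_subset) (auto simp: subset_iff)
  hence "bounded (deriv H ` cball 1 (r0/2))" by (intro compact_imp_bounded compact_continuous_image) auto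
  then obtain B where B: "B > 0" "\<And>w. w \<in> cball 1 (r0/2) \<Longrightarrow> norm (deriv H w) \<le> B"
    by (auto simp: bounded_pos)
  have Hlip: "norm (H w - H 1) \<le> B * norm (w - 1)" if "w \<in> cball 1 (r0/2)" for w
  proof (rule field_differentiable_bound[where S = "cball 1 (r0/2)"])
    fix v :: complex assume v: "v \<in> cball 1 (r0/2)"
    have "v \<in> ball 1 r0" using v r0 by auto
    thus "(H has_field_derivative deriv H v) (at v within cball 1 (r0/2))"
      by (intro has_field_derivative_at_within[OF holomorphic_derivI[OF holH]]) auto
  qed (use that B r0 in auto)
  define R where "R = (\<lambda>s. (s - 1) powr (-z) * (H s - H 1))"
  define V where "V = ball (1::complex) r0 \<inter> {s. s - 1 \<notin> \<real>\<^sub>\<le>\<^sub>0}"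
  have holR: "R holomorphic_on V"
    unfolding R_def by (intro holomorphic_intros holomorphic_on_subset[OF holH]) (auto simp: V_def)
  define U where "U = ball (1::complex) r0 \<inter> {s. Re s > 1}"
  have opU: "open U" unfolding U_def by (intro open_Int open_ball open_halfspace_Re_gt)
  have UV: "U \<subseteq> V" by (auto simp: U_def V_def complex_nonpos_Reals_iff)
  have PhiR: "Phi z s = R s + g_one z * (s - 1) powr (-z)" if s: "s \<in> U" for s
  proof -
    have s': "s \<in> ball 1 r0" "Re s > 1" "s \<noteq> 1" using s by (auto simp: U_def)
    have "log_zeta s = Ln (zeta_num s) - Ln (s - 1)"
      using log_zeta_near_1[OF pos] r0 s' by auto
    hence "z * log_zeta s = z * Ln (zeta_num s) + (-z) * Ln (s - 1)" by (simp add: right_diff_distrib)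
    hence "exp (z * log_zeta s) = exp (z * Ln (zeta_num s)) * (s - 1) powr (-z)"
      using s' by (simp add: powr_def exp_add[symmetric])
    hence "Phi z s = (s - 1) powr (-z) * H s" using s' by (simp add: Phi_eq H_def)
    thus ?thesis by (simp add: R_def H1 algebra_simps)
  qed
  define C3 where "C3 = exp (pi * \<bar>Im z\<bar>)"
  define C where "C = 8 * (C3 * B * 2 powr \<bar>1 - Re z\<bar>)"
  have bound: "norm ((deriv ^^ 2) (Phi z) s - z * (z + 1) * g_one z * (s - 1) powr (-z - 2)) \<le> C * norm (s - 1) powr (- Re z - 1)"
    if s: "1 < Re s" "norm (s - 1) < r0 / 4" for s
  proof -
    \<comment> \<open>The disc may cross the line of real part 1 but avoids the branch cut: as Re s
      > 1, every point of the cut has distance at least |s-1| from s.\<close>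
    define \<rho> where "\<rho> = norm (s - 1) / 2"
    have rho: "\<rho> > 0" using s by (auto simp: \<rho>_def)
    have sU: "s \<in> U" using s r0 by (auto simp: U_def dist_norm norm_minus_commute)
    have w: "norm (w - 1) \<ge> norm (s - 1) / 2" "norm (w - 1) \<le> 2 * norm (s - 1)" "norm (w - 1) \<le> r0 / 2" "w - 1 \<notin> \<real>\<^sub>\<le>\<^sub>0"
      if "w \<in> cball s \<rho>" for w
    proof -
      have d: "norm (s - w) \<le> norm (s - 1) / 2" using that by (simp add: \<rho>_def dist_norm)
      have "norm (s - 1) \<le> norm (w - 1) + norm (s - w)" using norm_triangle_ineq[of "w - 1" "s - w"] by (simp add: algebra_simps)
      thus "norm (w - 1) \<ge> norm (s - 1) / 2" using d by linarith
      have t: "norm (w - 1) \<le> norm (s - 1) + norm (s - w)" using norm_triangle_ineq4[of "s - 1" "s - w"] by (simp add: algebra_simps)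
      show "norm (w - 1) \<le> 2 * norm (s - 1)" "norm (w - 1) \<le> r0 / 2" using t d s r0 norm_ge_zero[of "s-1"] by linarith+
      show "w - 1 \<notin> \<real>\<^sub>\<le>\<^sub>0"
      proof
        assume n: "w - 1 \<in> \<real>\<^sub>\<le>\<^sub>0"
        hence n': "Re w \<le> 1" "Im w = 0" by (auto simp: complex_nonpos_Reals_iff)
        have "(Re s - 1)\<^sup>2 \<le> (Re s - Re w)\<^sup>2" using n' s by (intro power_mono) auto
        hence "norm (s - 1) \<le> norm (s - w)" by (simp add: norm_complex_def n'(2))
        moreover have "norm (s - 1) > 0" using s by auto
        ultimately show False using d by linarith
      qed
    qed
    have sub: "cball s \<rho> \<subseteq> V" using w(3,4) r0 by (fastforce simp: V_def dist_norm norm_minus_commute)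
    have "norm ((deriv ^^ 2) R s) \<le> 2 * (C3 * B * (2 powr \<bar>1 - Re z\<bar> * norm (s - 1) powr (1 - Re z))) / \<rho> ^ 2"
    proof (rule Cauchy_bound_2)
      show "R holomorphic_on cball s \<rho>" by (rule holomorphic_on_subset[OF holR sub])
      show "\<rho> \<le> 1" using s r0 by (simp add: \<rho>_def)
      fix v assume v: "v \<in> cball s \<rho>"
      have v0: "v \<noteq> 1" using w(1)[OF v] rho by (auto simp: \<rho>_def)
      have "norm (R v) \<le> (norm (v - 1) powr (Re (-z)) * exp (pi * \<bar>Im (-z)\<bar>)) * (B * norm (v - 1))"
        unfolding R_def norm_mult using v0 B w(3)[OF v]
        by (intro mult_mono norm_powr_le Hlip) (auto simp: dist_norm norm_minus_commute)
      also have "\<dots> = C3 * B * norm (v - 1) powr (1 - Re z)"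
        using v0 by (simp add: C3_def powr_diff powr_minus field_simps)
      also have "\<dots> \<le> C3 * B * (2 powr \<bar>1 - Re z\<bar> * norm (s - 1) powr (1 - Re z))"
        using w[OF v] B rho by (intro mult_left_mono powr_ratio_le) (auto simp: \<rho>_def C3_def)
      finally show "norm (R v) \<le> C3 * B * (2 powr \<bar>1 - Re z\<bar> * norm (s - 1) powr (1 - Re z))" .
    qed (use rho B in \<open>auto simp: C3_def\<close>)
    also have "\<dots> = C * (norm (s - 1) powr (1 - Re z) / norm (s - 1) ^ 2)"
      unfolding C_def \<rho>_def by (simp add: field_simps power2_eq_square)
    also have "norm (s - 1) powr (1 - Re z) / norm (s - 1) ^ 2 = norm (s - 1) powr (- Re z - 1)"
    proof -
      have "norm (s - 1) ^ 2 = norm (s - 1) powr 2" using s by (simp add: powr_numeral)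
      moreover have "1 - Re z - 2 = - Re z - 1" by simp
      ultimately show ?thesis by (metis powr_diff)
    qed
    finally have R2: "norm ((deriv ^^ 2) R s) \<le> C * norm (s - 1) powr (- Re z - 1)" .
    have holP: "(\<lambda>s. (s - 1) powr (-z)) holomorphic_on U"
      by (intro holomorphic_intros) (auto simp: U_def complex_nonpos_Reals_iff)
    have hR: "R holomorphic_on U" by (rule holomorphic_on_subset[OF holR UV])
    have hP: "(\<lambda>s. g_one z * (s - 1) powr (-z)) holomorphic_on U" by (intro holomorphic_on_mult holP holomorphic_on_const)
    have hS: "(\<lambda>s. R s + g_one z * (s - 1) powr (-z)) holomorphic_on U" by (intro holomorphic_on_add hR hP)
    have hPhi: "Phi z holomorphic_on U"
      by (rule holomorphic_transform[OF hS]) (rule PhiR[symmetric])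
    have "(deriv ^^ 2) (Phi z) s = (deriv ^^ 2) (\<lambda>s. R s + g_one z * (s - 1) powr (-z)) s"
      by (rule higher_deriv_transform_within_open[OF hPhi hS opU sU PhiR])
    also have "\<dots> = (deriv ^^ 2) R s + (deriv ^^ 2) (\<lambda>s. g_one z * (s - 1) powr (-z)) s"
      by (rule higher_deriv_add[OF hR hP opU sU])
    also have "(deriv ^^ 2) (\<lambda>s. g_one z * (s - 1) powr (-z)) s = g_one z * (deriv ^^ 2) (\<lambda>s. (s - 1) powr (-z)) s"
      by (rule higher_deriv_cmult[OF holP sU opU])
    also have "(deriv ^^ 2) (\<lambda>s. (s - 1) powr (-z)) s = z * (z + 1) * (s - 1) powr (-z - 2)"
      by (rule shifted_powr_deriv2) (rule s(1))
    finally have "(deriv ^^ 2) (Phi z) s - z * (z + 1) * g_one z * (s - 1) powr (-z - 2) = (deriv ^^ 2) R s"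
      by simp
    thus ?thesis using R2 by simp
  qed
  have "r0 / 4 > 0" "C > 0" using r0 B by (auto simp: C_def C3_def)
  thus ?thesis using bound by blast
qed

text \<open>The order of quantifiers matters: \<tau> comes from the neighbourhood of 1 alone,
  whereas the constant depends on e, which is fixed only in \<open>err_bound\<close>. Away from 1
  the subtracted power is O(|t|^(-Re z - 2)) and is absorbed in |t|^(e-1).\<close>

lemma transform_bound:
  assumes z: "Re z > 0"
  shows "\<exists>\<tau>>0. \<tau> \<le> 1 \<and> (\<forall>e>0. \<exists>C>0. \<forall>\<delta> t. 0 < \<delta> \<and> \<delta> \<le> \<tau> \<longrightarrow>
     norm ((deriv ^^ 2) (Phi z) (1 + Complex \<delta> t) - z * (z + 1) * g_one z * Complex \<delta> t powr (-z - 2))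
       \<le> C * (if \<bar>t\<bar> < \<tau> then norm (Complex \<delta> t) powr (- Re z - 1) else \<bar>t\<bar> powr (e - 1)))"
proof -
  obtain r C1 where r: "r > 0" "C1 > 0" and near: "\<And>s. 1 < Re s \<Longrightarrow> norm (s - 1) < r \<Longrightarrow>
     norm ((deriv ^^ 2) (Phi z) s - z * (z + 1) * g_one z * (s - 1) powr (-z - 2)) \<le> C1 * norm (s - 1) powr (- Re z - 1)"
    using Phi_deriv2_near by blast
  define \<tau> where "\<tau> = min 1 (r / 2)"
  have tau: "\<tau> > 0" "\<tau> \<le> 1" "\<tau> \<le> r / 2" using r by (auto simp: \<tau>_def)
  have "\<exists>C>0. \<forall>\<delta> t. 0 < \<delta> \<and> \<delta> \<le> \<tau> \<longrightarrow>
     norm ((deriv ^^ 2) (Phi z) (1 + Complex \<delta> t) - z * (z + 1) * g_one z * Complex \<delta> t powr (-z - 2))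
       \<le> C * (if \<bar>t\<bar> < \<tau> then norm (Complex \<delta> t) powr (- Re z - 1) else \<bar>t\<bar> powr (e - 1))" if e: "e > 0" for e
  proof -
    obtain C2 where C2: "C2 > 0" "\<And>s. 1 < Re s \<Longrightarrow> Re s \<le> 2 \<Longrightarrow> \<bar>Im s\<bar> \<ge> \<tau> \<Longrightarrow> norm ((deriv ^^ 2) (Phi z) s) \<le> C2 * \<bar>Im s\<bar> powr (e - 1)"
      using Phi_deriv2_large[OF e tau(1)] by blast
    define c where "c = norm (z * (z + 1) * g_one z) * exp (pi * \<bar>Im z\<bar>) * \<tau> powr (- Re z - 1 - e)"
    define C where "C = max C1 (C2 + c)"
    have "norm ((deriv ^^ 2) (Phi z) (1 + Complex \<delta> t) - z * (z + 1) * g_one z * Complex \<delta> t powr (-z - 2))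
       \<le> C * (if \<bar>t\<bar> < \<tau> then norm (Complex \<delta> t) powr (- Re z - 1) else \<bar>t\<bar> powr (e - 1))"
      if d: "0 < \<delta>" "\<delta> \<le> \<tau>" for \<delta> t
    proof (cases "\<bar>t\<bar> < \<tau>")
      case True
      have "norm (Complex \<delta> t) \<le> \<bar>\<delta>\<bar> + \<bar>t\<bar>" using cmod_le[of "Complex \<delta> t"] by simp
      also have "\<dots> < r" using True d tau by linarith
      finally have "norm ((deriv ^^ 2) (Phi z) (1 + Complex \<delta> t) - z * (z + 1) * g_one z * Complex \<delta> t powr (-z - 2)) \<le> C1 * norm (Complex \<delta> t) powr (- Re z - 1)"
        using near[of "1 + Complex \<delta> t"] d by simp
      also have "\<dots> \<le> C * norm (Complex \<delta> t) powr (- Re z - 1)" unfolding C_def by (intro mult_right_mono) auto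
      finally show ?thesis using True by simp
    next
      case False
      have t: "\<bar>t\<bar> \<ge> \<tau>" "\<bar>t\<bar> > 0" using False tau by auto
      have 1: "norm ((deriv ^^ 2) (Phi z) (1 + Complex \<delta> t)) \<le> C2 * \<bar>t\<bar> powr (e - 1)"
        using C2(2)[of "1 + Complex \<delta> t"] d tau t by simp
      have "norm (Complex \<delta> t powr (-z - 2)) \<le> norm (Complex \<delta> t) powr (- Re z - 2) * exp (pi * \<bar>Im z\<bar>)"
        using norm_powr_le[of "Complex \<delta> t" "-z - 2"] d by (auto simp: complex_eq_iff)
      also have "norm (Complex \<delta> t) powr (- Re z - 2) \<le> \<bar>t\<bar> powr (- Re z - 2)"
        using abs_Im_le_cmod[of "Complex \<delta> t"] t z by (intro powr_mono2') auto
      also have "\<bar>t\<bar> powr (- Re z - 2) = \<bar>t\<bar> powr (- Re z - 1 - e) * \<bar>t\<bar> powr (e - 1)"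
        by (simp add: powr_add[symmetric])
      also have "\<dots> \<le> \<tau> powr (- Re z - 1 - e) * \<bar>t\<bar> powr (e - 1)"
        using t tau z e by (intro mult_right_mono powr_mono2') auto
      finally have 2: "norm (Complex \<delta> t powr (-z - 2)) \<le> \<tau> powr (- Re z - 1 - e) * \<bar>t\<bar> powr (e - 1) * exp (pi * \<bar>Im z\<bar>)"
        by (simp add: mult_right_mono)
      have "norm (z * (z + 1) * g_one z * Complex \<delta> t powr (-z - 2)) \<le> c * \<bar>t\<bar> powr (e - 1)"
        unfolding c_def norm_mult[of "z * (z + 1) * g_one z"] using mult_left_mono[OF 2, of "norm (z * (z + 1) * g_one z)"]
        by (simp add: mult_ac)
      with 1 have "norm ((deriv ^^ 2) (Phi z) (1 + Complex \<delta> t) - z * (z + 1) * g_one z * Complex \<delta> t powr (-z - 2)) \<le> C2 * \<bar>t\<bar> powr (e - 1) + c * \<bar>t\<bar> powr (e - 1)"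
        by (intro norm_triangle_le_diff add_mono)
      also have "\<dots> \<le> C * \<bar>t\<bar> powr (e - 1)" unfolding C_def distrib_right[symmetric] by (intro mult_right_mono) auto
      finally show ?thesis using False by simp
    qed
    moreover have "C > 0" using r by (simp add: C_def)
    ultimately show ?thesis by blast
  qed
  with tau show ?thesis by blast
qed

section \<open>Laplace transforms and Gaussian smoothing\<close>

definition laplace :: "(real \<Rightarrow> complex) \<Rightarrow> complex \<Rightarrow> complex" where
  "laplace f s = (LINT u|lborel. exp (- (s * of_real u)) * f u)"

text \<open>Absolute convergence at every positive abscissa. Vanishing for u < 0 makes the integral
  over the whole line one-sided, while Gaussian averages may still run over all of it.\<close>

definition laplace_admissible :: "(real \<Rightarrow> complex) \<Rightarrow> bool" where
  "laplace_admissible f \<longleftrightarrow> f \<in> borel_measurable borel \<and> (\<forall>u<0. f u = 0) \<and>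
     (\<forall>a>0. integrable lborel (\<lambda>u. exp (- a * u) * norm (f u)))"

lemma laplace_admissibleD:
  assumes "laplace_admissible f"
  shows "f \<in> borel_measurable borel" "u < 0 \<Longrightarrow> f u = 0"
    "a > 0 \<Longrightarrow> integrable lborel (\<lambda>u. exp (- a * u) * norm (f u))"
  using assms by (auto simp: laplace_admissible_def)

lemma times_exp_le:
  fixes a u :: real
  assumes "a > 0"
  shows "u * exp (- a * u) \<le> (2 / a) * exp (- (a/2) * u)"
proof -
  have "a / 2 * u \<le> exp (a / 2 * u)" using exp_ge_add_one_self[of "a/2*u"] by linarith
  hence "a / 2 * u * exp (- a * u) \<le> exp (a / 2 * u) * exp (- a * u)" by (intro mult_right_mono) auto
  also have "\<dots> = exp (- (a/2) * u)" by (simp add: exp_add[symmetric])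
  finally show ?thesis using assms by (simp add: field_simps)
qed

text \<open>The factor u is paid for with half of the exponential weight.\<close>

lemma laplace_admissible_times:
  assumes f: "laplace_admissible f"
  shows "laplace_admissible (\<lambda>u. - of_real u * f u)"
  unfolding laplace_admissible_def
proof (intro conjI allI impI)
  note m [measurable] = laplace_admissibleD(1)[OF f]
  show "(\<lambda>u. - of_real u * f u) \<in> borel_measurable borel" by measurable
  show "- of_real u * f u = 0" if "u < 0" for u using laplace_admissibleD(2)[OF f that] by simp
  fix a :: real assume a: "a > 0"
  have i: "integrable lborel (\<lambda>u. (2 / a) * (exp (- (a/2) * u) * norm (f u)))"
    using laplace_admissibleD(3)[OF f, of "a/2"] a by (intro integrable_mult_right) auto
  show "integrable lborel (\<lambda>u. exp (- a * u) * norm (- of_real u * f u))"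
  proof (rule Bochner_Integration.integrable_bound[OF i])
    show "AE u in lborel. norm (exp (- a * u) * norm (- of_real u * f u)) \<le> norm ((2 / a) * (exp (- (a/2) * u) * norm (f u)))"
    proof (rule AE_I2)
      fix u
      show "norm (exp (- a * u) * norm (- of_real u * f u)) \<le> norm ((2 / a) * (exp (- (a/2) * u) * norm (f u)))"
      proof (cases "u < 0")
        case False
        have "u * exp (- a * u) * norm (f u) \<le> (2 / a) * exp (- (a/2) * u) * norm (f u)"
          by (intro mult_right_mono times_exp_le a) auto
        thus ?thesis using False a by (simp add: norm_mult mult_ac)
      qed (simp add: laplace_admissibleD(2)[OF f])
    qed
  qed measurable
qed

lemma norm_laplace_kernel: "norm (exp (- (s * of_real u)) :: complex) = exp (- Re s * u)"
  by (simp add: norm_exp_eq_Re)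

lemma laplace_integrable:
  assumes f: "laplace_admissible f" and s: "Re s > 0"
  shows "integrable lborel (\<lambda>u. exp (- (s * of_real u)) * f u)"
proof -
  note m [measurable] = laplace_admissibleD(1)[OF f]
  show ?thesis
    by (rule Bochner_Integration.integrable_bound[OF laplace_admissibleD(3)[OF f s]])
       (auto simp: norm_mult norm_laplace_kernel)
qed

text \<open>Differentiation under the integral by dominated convergence along sequences. Once the
  sequence lies in the half plane of real part above (Re s)/2, the mean value inequality there
  bounds the difference quotients of the kernel.\<close>

lemma laplace_has_field_derivative:
  assumes f: "laplace_admissible f" and s: "Re s > 0"
  shows "(laplace f has_field_derivative laplace (\<lambda>u. - of_real u * f u) s) (at s)"
  unfolding has_field_derivative_iff tendsto_at_iff_sequentially
proof (intro allI impI)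
  fix X :: "nat \<Rightarrow> complex" assume X: "\<forall>i. X i \<in> UNIV - {s}" "X \<longlonglongrightarrow> s"
  note m [measurable] = laplace_admissibleD(1)[OF f]
  define \<sigma> where "\<sigma> = Re s"
  have sg: "\<sigma> > 0" using s by (simp add: \<sigma>_def)
  have "\<forall>\<^sub>F i in sequentially. dist (X i) s < \<sigma>/2" using X(2) sg by (intro tendstoD) auto
  then obtain N where N: "\<And>i. i \<ge> N \<Longrightarrow> dist (X i) s < \<sigma>/2" by (auto simp: eventually_sequentially)
  have near: "Re (X i) > \<sigma>/2" if "i \<ge> N" for i
    using N[OF that] abs_Re_le_cmod[of "X i - s"] by (auto simp: dist_norm \<sigma>_def)
  define Q where "Q = (\<lambda>i u. (exp (- (X i * of_real u)) - exp (- (s * of_real u))) / (X i - s) * f u)"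
  have "(\<lambda>i. integral\<^sup>L lborel (Q (i + N))) \<longlonglongrightarrow> integral\<^sup>L lborel (\<lambda>u. exp (- (s * of_real u)) * (- of_real u * f u))"
  proof (rule integral_dominated_convergence)
    show "integrable lborel (\<lambda>u. exp (- (\<sigma>/2) * u) * norm (- of_real u * f u))"
      using laplace_admissibleD(3)[OF laplace_admissible_times[OF f], of "\<sigma>/2"] sg by auto
    show "AE u in lborel. (\<lambda>i. Q (i + N) u) \<longlonglongrightarrow> exp (- (s * of_real u)) * (- of_real u * f u)"
    proof (rule AE_I2)
      fix u
      have "((\<lambda>w. exp (- (w * of_real u))) has_field_derivative - of_real u * exp (- (s * of_real u))) (at s)"
        by (auto intro!: derivative_eq_intros)
      hence "((\<lambda>i. (exp (- (X i * of_real u)) - exp (- (s * of_real u))) / (X i - s)) \<longlonglongrightarrow> - of_real u * exp (- (s * of_real u)))"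
        using X unfolding has_field_derivative_iff tendsto_at_iff_sequentially o_def by blast
      hence "(\<lambda>i. (exp (- (X (i + N) * of_real u)) - exp (- (s * of_real u))) / (X (i + N) - s)) \<longlonglongrightarrow> - of_real u * exp (- (s * of_real u))"
        by (rule LIMSEQ_ignore_initial_segment)
      hence "(\<lambda>i. Q (i + N) u) \<longlonglongrightarrow> - of_real u * exp (- (s * of_real u)) * f u"
        unfolding Q_def by (intro tendsto_mult tendsto_const)
      thus "(\<lambda>i. Q (i + N) u) \<longlonglongrightarrow> exp (- (s * of_real u)) * (- of_real u * f u)" by (simp add: mult_ac)
    qed
    show "AE u in lborel. norm (Q (i + N) u) \<le> exp (- (\<sigma>/2) * u) * norm (- of_real u * f u)" for i
    proof (rule AE_I2)
      fix u
      show "norm (Q (i + N) u) \<le> exp (- (\<sigma>/2) * u) * norm (- of_real u * f u)"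
      proof (cases "u < 0")
        case False
        have "norm (exp (- (X (i+N) * of_real u)) - exp (- (s * of_real u))) \<le> (u * exp (- (\<sigma>/2) * u)) * norm (X (i+N) - s)"
        proof (rule field_differentiable_bound[where S = "{w. Re w > \<sigma>/2}" and f' = "\<lambda>w. - of_real u * exp (- (w * of_real u))"])
          show "convex {w. Re w > \<sigma>/2}" by (rule convex_halfspace_Re_gt)
          show "((\<lambda>w. exp (- (w * of_real u))) has_field_derivative - of_real u * exp (- (w * of_real u))) (at w within {w. Re w > \<sigma>/2})" for w
            by (auto intro!: derivative_eq_intros)
          fix w assume "w \<in> {w. Re w > \<sigma>/2}"
          hence "- Re w * u \<le> - (\<sigma>/2) * u" using False by (intro mult_right_mono) auto
          hence "exp (- Re w * u) \<le> exp (- (\<sigma>/2) * u)" by (simp only: exp_le_cancel_iff)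
          thus "norm (- of_real u * exp (- (w * of_real u))) \<le> u * exp (- (\<sigma>/2) * u)"
            using False by (simp only: norm_mult norm_minus_cancel norm_of_real norm_laplace_kernel) (simp add: mult_left_mono)
        qed (use near[of "i+N"] sg in \<open>auto simp: \<sigma>_def\<close>)
        moreover have "norm (X (i+N) - s) > 0" using X(1) by auto
        ultimately have "norm (exp (- (X (i+N) * of_real u)) - exp (- (s * of_real u))) / norm (X (i+N) - s) \<le> u * exp (- (\<sigma>/2) * u)"
          by (subst pos_divide_le_eq) auto
        hence "norm (exp (- (X (i+N) * of_real u)) - exp (- (s * of_real u))) / norm (X (i+N) - s) * norm (f u) \<le> u * exp (- (\<sigma>/2) * u) * norm (f u)"
          by (rule mult_right_mono) auto
        thus ?thesis using False by (simp add: Q_def norm_mult norm_divide mult_ac)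
      qed (simp add: Q_def laplace_admissibleD(2)[OF f])
    qed
  qed (auto simp: Q_def)
  hence lim: "(\<lambda>i. integral\<^sup>L lborel (Q (i + N))) \<longlonglongrightarrow> laplace (\<lambda>u. - of_real u * f u) s" by (simp add: laplace_def)
  have "integral\<^sup>L lborel (Q (i + N)) = (laplace f (X (i + N)) - laplace f s) / (X (i + N) - s)" for i
  proof -
    have 1: "integrable lborel (\<lambda>u. exp (- (X (i + N) * of_real u)) * f u)"
      using near[of "i+N"] sg by (intro laplace_integrable f) auto
    have 2: "integrable lborel (\<lambda>u. exp (- (s * of_real u)) * f u)" by (intro laplace_integrable f s)
    have "integral\<^sup>L lborel (Q (i + N)) = (LINT u|lborel. (exp (- (X (i + N) * of_real u)) * f u - exp (- (s * of_real u)) * f u) / (X (i + N) - s))"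
      unfolding Q_def by (intro Bochner_Integration.integral_cong refl) (simp add: diff_divide_distrib left_diff_distrib)
    thus ?thesis using 1 2 by (simp add: laplace_def)
  qed
  hence "(\<lambda>i. (laplace f (X (i + N)) - laplace f s) / (X (i + N) - s)) \<longlonglongrightarrow> laplace (\<lambda>u. - of_real u * f u) s"
    using lim by simp
  hence "(\<lambda>i. (laplace f (X i) - laplace f s) / (X i - s)) \<longlonglongrightarrow> laplace (\<lambda>u. - of_real u * f u) s"
    by (rule LIMSEQ_offset)
  thus "((\<lambda>y. (laplace f y - laplace f s) / (y - s)) \<circ> X) \<longlonglongrightarrow> laplace (\<lambda>u. - of_real u * f u) s"
    by (simp add: o_def)
qed

lemma holomorphic_laplace: "laplace_admissible f \<Longrightarrow> laplace f holomorphic_on {s. Re s > 0}"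
  using laplace_has_field_derivative by (auto simp: holomorphic_on_open open_halfspace_Re_gt)

lemma laplace_deriv2:
  assumes f: "laplace_admissible f" and s: "Re s > 0"
  shows "(deriv ^^ 2) (laplace f) s = laplace (\<lambda>u. of_real (u\<^sup>2) * f u) s"
proof -
  have op: "open {s. Re s > 0}" by (rule open_halfspace_Re_gt)
  have d: "deriv (laplace f) w = laplace (\<lambda>u. - of_real u * f u) w" if "w \<in> {s. Re s > 0}" for w
    using that by (intro DERIV_imp_deriv laplace_has_field_derivative f) auto
  have "(laplace (\<lambda>u. - of_real u * f u) has_field_derivative laplace (\<lambda>u. - of_real u * (- of_real u * f u)) s) (at s)"
    by (intro laplace_has_field_derivative laplace_admissible_times f s)
  hence "(deriv (laplace f) has_field_derivative laplace (\<lambda>u. - of_real u * (- of_real u * f u)) s) (at s)"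
    by (rule has_field_derivative_transform_within_open[OF _ op]) (use s d in auto)
  hence "deriv (deriv (laplace f)) s = laplace (\<lambda>u. - of_real u * (- of_real u * f u)) s" by (rule DERIV_imp_deriv)
  thus ?thesis by (simp add: deriv2_eq power2_eq_square mult_ac)
qed

text \<open>By the identity theorem, formulas for transforms have to be computed only at positive
  real s.\<close>

lemma holomorphic_eq_from_reals:
  assumes "f holomorphic_on {s. Re s > 0}" "g holomorphic_on {s. Re s > 0}"
    and eq: "\<And>x. x > 0 \<Longrightarrow> f (of_real x) = g (of_real x)" and s: "Re s > 0"
  shows "f s = g s"
proof -
  have "(1::complex) islimpt (of_real ` {0<..})"
    unfolding islimpt_approachable
  proof (intro allI impI)
    fix e :: real assume "e > 0"
    thus "\<exists>x'\<in>complex_of_real ` {0<..}. x' \<noteq> 1 \<and> dist x' 1 < e"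
      by (intro bexI[of _ "complex_of_real (1 + e/2)"] imageI) (auto simp: dist_norm)
  qed
  have "(\<lambda>s. f s - g s) s = 0"
    by (rule analytic_continuation[of _ "{s. Re s > 0}" "of_real ` {0<..}" 1])
       (use assms \<open>1 islimpt _\<close> in \<open>auto intro!: holomorphic_intros open_halfspace_Re_gt convex_connected convex_halfspace_Re_gt\<close>)
  thus ?thesis by simp
qed

text \<open>Transfers improper integrals known for the gauge integral to the Lebesgue integral;
  nonnegativity makes this possible.\<close>

lemma has_bochner_integral_of_has_integral:
  fixes f :: "real \<Rightarrow> real"
  assumes "f \<in> borel_measurable borel" "\<And>x. f x \<ge> 0" "(f has_integral I) UNIV"
  shows "has_bochner_integral lborel f I"
proof (rule has_bochner_integral_nn_integral)
  show "I \<ge> 0" using assms(2,3) by (intro has_integral_nonneg[OF assms(3)]) auto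
qed (use assms nn_integral_has_integral_lborel[OF assms] in auto)

lemma exp_tail_integral:
  fixes a c :: real assumes "a > 0"
  shows "has_bochner_integral lborel (\<lambda>u. exp (- a * u) * indicator {c..} u) (exp (- a * c) / a)"
proof (rule has_bochner_integral_of_has_integral)
  have "((\<lambda>u. if u \<in> {c..} then exp (- a * u) else 0) has_integral exp (- a * c) / a) UNIV"
    unfolding has_integral_restrict_UNIV by (rule has_integral_exp_minus_to_infinity[OF assms])
  also have "(\<lambda>u. if u \<in> {c..} then exp (- a * u) else 0) = (\<lambda>u. exp (- a * u) * indicator {c..} u)"
    by (auto simp: indicator_def)
  finally show "((\<lambda>u. exp (- a * u) * indicator {c..} u) has_integral exp (- a * c) / a) UNIV" .
qed (auto simp: indicator_def)

section \<open>The summatory function on a logarithmic scale and its transform\<close>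

definition omega_sum :: "complex \<Rightarrow> real \<Rightarrow> complex" where
  "omega_sum z x = (\<Sum>n\<in>{n. 1 \<le> n \<and> real n \<le> x}. z ^ omega n)"

text \<open>
  The factor $e^{-u}$ moves the singularity of the Laplace transform from $1$ to $0$.
\<close>

definition omega_sum_exp :: "complex \<Rightarrow> real \<Rightarrow> complex" where
  "omega_sum_exp z u = (if u < 0 then 0 else of_real (exp (-u)) * omega_sum z (exp u))"

lemma finite_nat_le: "finite {n. 1 \<le> n \<and> real n \<le> x}"
  by (rule finite_subset[of _ "{..nat \<lfloor>x\<rfloor>}"]) (auto simp: le_nat_floor)

text \<open>Each integer enters at u equal to its logarithm, so for fixed u the sum is finite, and
  empty if u < 0. This form yields measurability and integration term by term.\<close>

lemma omega_sum_exp_suminf: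
  "(\<lambda>n. z ^ omega (Suc n) * of_real (exp (-u) * indicator {ln (real (Suc n))..} u)) sums omega_sum_exp z u"
proof -
  define A where "A = {n. real (Suc n) \<le> exp u}"
  have "real (Suc n) \<le> exp u \<longleftrightarrow> ln (real (Suc n)) \<le> u" for n
    using exp_le_cancel_iff[of "ln (real (Suc n))" u] by (simp del: of_nat_Suc)
  hence A: "A = {n. ln (real (Suc n)) \<le> u}" unfolding A_def by simp
  have finA: "finite A" unfolding A_def
    by (rule finite_subset[of _ "{..nat \<lfloor>exp u\<rfloor>}"]) (auto simp: le_nat_floor)
  have "(\<lambda>n. z ^ omega (Suc n) * of_real (exp (-u) * indicator {ln (real (Suc n))..} u)) sums
     (\<Sum>n\<in>A. z ^ omega (Suc n) * of_real (exp (-u) * indicator {ln (real (Suc n))..} u))"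
    using finA by (intro sums_finite) (auto simp: A)
  also have "(\<Sum>n\<in>A. z ^ omega (Suc n) * of_real (exp (-u) * indicator {ln (real (Suc n))..} u)) = (\<Sum>n\<in>A. z ^ omega (Suc n) * of_real (exp (-u)))"
    by (intro sum.cong refl) (auto simp: A)
  also have "\<dots> = of_real (exp (-u)) * omega_sum z (exp u)"
  proof -
    have "(\<Sum>n\<in>A. z ^ omega (Suc n)) = omega_sum z (exp u)"
      unfolding omega_sum_def A_def by (rule sum.reindex_bij_witness[of _ "\<lambda>n. n - 1" Suc]) auto
    thus ?thesis unfolding sum_distrib_right[symmetric] by (simp add: mult.commute)
  qed
  also have "\<dots> = omega_sum_exp z u"
  proof (cases "u < 0")
    case True
    hence e1: "exp u < 1" by simp
    have "\<not> real n \<le> exp u" if "1 \<le> n" for n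
    proof -
      have "real n \<ge> 1" using that by simp
      thus ?thesis using e1 by linarith
    qed
    hence E: "{n. 1 \<le> n \<and> real n \<le> exp u} = {}" by blast
    show ?thesis using True unfolding omega_sum_exp_def omega_sum_def E by simp
  qed (simp add: omega_sum_exp_def)
  finally show ?thesis .
qed

lemma omega_sum_exp_measurable [measurable]: "omega_sum_exp z \<in> borel_measurable borel"
proof -
  have "(\<lambda>u. \<Sum>n. z ^ omega (Suc n) * of_real (exp (-u) * indicator {ln (real (Suc n))..} u)) \<in> borel_measurable borel"
    by (intro borel_measurable_suminf) measurable
  also have "(\<lambda>u. \<Sum>n. z ^ omega (Suc n) * of_real (exp (-u) * indicator {ln (real (Suc n))..} u)) = omega_sum_exp z"
    using omega_sum_exp_suminf by (auto simp: sums_iff fun_eq_iff)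
  finally show ?thesis .
qed

text \<open>Term by term, the integral of exp(-(1+a) u) from log n to infinity is n^(-(1+a)) /
  (1+a); the exchange is justified by absolute convergence of the Dirichlet series at 1 + a.\<close>

lemma omega_sum_exp_laplace_real:
  assumes a: "a > 0"
  shows "integrable lborel (\<lambda>u. exp (- (of_real a * of_real u)) * omega_sum_exp z u)"
    "laplace (omega_sum_exp z) (of_real a) = Phi z (1 + of_real a)"
proof -
  define F where "F = (\<lambda>n u. z ^ omega (Suc n) * complex_of_real (exp (- (1 + a) * u) * indicator {ln (real (Suc n))..} u))"
  define I where "I = (\<lambda>n. real (Suc n) powr (- (1 + a)) / (1 + a))"
  have hb: "has_bochner_integral lborel (\<lambda>u. exp (- (1 + a) * u) * indicator {ln (real (Suc n))..} u) (I n)" for n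
    using exp_tail_integral[of "1 + a" "ln (real (Suc n))"] a by (simp add: I_def powr_def del: of_nat_Suc)
  have F: "has_bochner_integral lborel (F n) (z ^ omega (Suc n) * of_real (I n))" for n
    unfolding F_def by (intro has_bochner_integral_mult_right has_bochner_integral_of_real hb)
  have nF: "norm (F n u) = norm (z ^ omega (Suc n)) * (exp (- (1 + a) * u) * indicator {ln (real (Suc n))..} u)" for n u
    by (simp add: F_def norm_mult abs_mult)
  have InF: "(LINT u|lborel. norm (F n u)) = norm (z ^ omega (Suc n)) * I n" for n
    unfolding nF using hb[of n] by (simp add: has_bochner_integral_iff)
  have sm: "summable (\<lambda>n. norm (z ^ omega (Suc n) * of_nat (Suc n) powr (- complex_of_real (1 + a))))"
    by (rule summable_omega_dirichlet) (use a in auto)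
  have eqI: "z ^ omega (Suc n) * of_real (I n) = (z ^ omega (Suc n) * of_nat (Suc n) powr (- complex_of_real (1 + a))) / (1 + of_real a)" for n
    using of_nat_powr_of_real[of "Suc n" "-(1+a)"] by (simp add: I_def del: of_nat_Suc)
  have "summable (\<lambda>n. norm (z ^ omega (Suc n) * of_nat (Suc n) powr (- complex_of_real (1 + a))) / (1 + a))"
    by (intro summable_divide sm)
  moreover have "norm (z ^ omega (Suc n) * of_nat (Suc n) powr (- complex_of_real (1 + a))) / (1 + a) = norm (z ^ omega (Suc n)) * I n" for n
    by (simp add: norm_mult norm_of_nat_powr I_def del: of_nat_Suc)
  ultimately have smI: "summable (\<lambda>n. LINT u|lborel. norm (F n u))" unfolding InF by (simp only:)
  have Fs: "(\<lambda>n. F n u) sums (exp (- (of_real a * of_real u)) * omega_sum_exp z u)" for u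
  proof -
    have "(\<lambda>n. exp (- (of_real a * of_real u)) * (z ^ omega (Suc n) * of_real (exp (-u) * indicator {ln (real (Suc n))..} u))) sums (exp (- (of_real a * of_real u)) * omega_sum_exp z u)"
      by (intro sums_mult omega_sum_exp_suminf)
    moreover have "exp (- (of_real a * of_real u)) * (z ^ omega (Suc n) * of_real (exp (-u) * indicator {ln (real (Suc n))..} u)) = F n u" for n
    proof -
      have "exp (- (complex_of_real a * of_real u)) = of_real (exp (- (a * u)))" by (simp add: exp_of_real[symmetric])
      moreover have "exp (- (1 + a) * u) = exp (- (a * u)) * exp (-u)" by (simp add: exp_add[symmetric] algebra_simps)
      ultimately show ?thesis by (simp add: F_def mult_ac)
    qed
    ultimately show ?thesis by simp
  qed
  have AE: "AE u in lborel. summable (\<lambda>n. norm (F n u))"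
  proof (rule AE_I2)
    fix u
    show "summable (\<lambda>n. norm (F n u))"
    proof (rule summable_finite[of "{n. real (Suc n) \<le> exp u}"])
      show "finite {n. real (Suc n) \<le> exp u}"
        by (rule finite_subset[of _ "{..nat \<lfloor>exp u\<rfloor>}"]) (auto simp: le_nat_floor)
      fix n assume "n \<notin> {n. real (Suc n) \<le> exp u}"
      hence "u < ln (real (Suc n))" by (metis exp_ln linorder_not_less mem_Collect_eq exp_less_cancel_iff of_nat_0_less_iff zero_less_Suc)
      thus "norm (F n u) = 0" by (simp add: F_def)
    qed
  qed
  have iF: "\<And>n. integrable lborel (F n)" using F by (simp add: has_bochner_integral_iff)
  have suF: "(\<lambda>u. \<Sum>n. F n u) = (\<lambda>u. exp (- (of_real a * of_real u)) * omega_sum_exp z u)"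
    using Fs by (auto simp: sums_iff)
  show "integrable lborel (\<lambda>u. exp (- (of_real a * of_real u)) * omega_sum_exp z u)"
    using integrable_suminf[OF iF AE smI] unfolding suF .
  have "laplace (omega_sum_exp z) (of_real a) = (\<Sum>n. integral\<^sup>L lborel (F n))"
    unfolding laplace_def suF[symmetric] by (rule integral_suminf[OF iF AE smI])
  also have "\<dots> = (\<Sum>n. (z ^ omega (Suc n) * of_nat (Suc n) powr (- complex_of_real (1 + a))) / (1 + of_real a))"
    using F by (simp add: has_bochner_integral_iff eqI)
  also have "\<dots> = Phi z (1 + of_real a)"
    unfolding Phi_def omega_dirichlet_def using suminf_divide[OF summable_norm_cancel[OF sm], of "1 + of_real a"] by simp
  finally show "laplace (omega_sum_exp z) (of_real a) = Phi z (1 + of_real a)" .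
qed

lemma omega_sum_exp_admissible: "laplace_admissible (omega_sum_exp z)"
  unfolding laplace_admissible_def
proof (intro conjI allI impI)
  fix a :: real assume "a > 0"
  from integrable_norm[OF omega_sum_exp_laplace_real(1)[OF this, of z]]
  show "integrable lborel (\<lambda>u. exp (- a * u) * norm (omega_sum_exp z u))" by (simp add: norm_mult norm_exp_eq_Re)
qed (auto simp: omega_sum_exp_def)

lemma holomorphic_Phi: "Phi z holomorphic_on {s. Re s > 1}"
proof -
  have "(\<lambda>s. exp (z * log_zeta s) * (G z s / s)) holomorphic_on {s. Re s > 1}"
    by (intro holomorphic_intros holomorphic_log_zeta holomorphic_on_subset[OF holomorphic_G]) auto
  thus ?thesis by (rule holomorphic_transform) (simp add: Phi_eq)
qed

lemma laplace_omega_sum_exp: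
  assumes "Re s > 0"
  shows "laplace (omega_sum_exp z) s = Phi z (1 + s)"
proof (rule holomorphic_eq_from_reals[OF holomorphic_laplace[OF omega_sum_exp_admissible] _ _ assms])
  have "(Phi z \<circ> (\<lambda>s. 1 + s)) holomorphic_on {s. Re s > 0}"
    by (intro holomorphic_on_compose_gen[OF _ holomorphic_Phi] holomorphic_intros) auto
  thus "(\<lambda>s. Phi z (1 + s)) holomorphic_on {s. Re s > 0}" by (simp add: o_def)
qed (rule omega_sum_exp_laplace_real(2))

lemma laplace_omega_sum_exp_square:
  assumes "Re s > 0"
  shows "laplace (\<lambda>u. of_real (u\<^sup>2) * omega_sum_exp z u) s = (deriv ^^ 2) (Phi z) (1 + s)"
proof -
  have op: "open {s. Re s > 0}" "open {s. Re s > 1}" by (rule open_halfspace_Re_gt)+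
  have "laplace (\<lambda>u. of_real (u\<^sup>2) * omega_sum_exp z u) s = (deriv ^^ 2) (laplace (omega_sum_exp z)) s"
    by (rule laplace_deriv2[OF omega_sum_exp_admissible assms, symmetric])
  also have "\<dots> = (deriv ^^ 2) (\<lambda>s. Phi z (1 * s + 1)) s"
  proof (rule higher_deriv_transform_within_open[OF holomorphic_laplace[OF omega_sum_exp_admissible] _ op(1)])
    have "(Phi z \<circ> (\<lambda>s. 1 * s + 1)) holomorphic_on {s. Re s > 0}"
      by (intro holomorphic_on_compose_gen[OF _ holomorphic_Phi] holomorphic_intros) auto
    thus "(\<lambda>s. Phi z (1 * s + 1)) holomorphic_on {s. Re s > 0}" by (simp add: o_def)
  qed (use assms laplace_omega_sum_exp in \<open>auto simp: add.commute\<close>)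
  also have "\<dots> = 1 ^ 2 * (deriv ^^ 2) (Phi z) (1 * s + 1)"
    by (rule higher_deriv_compose_linear'[OF holomorphic_Phi op]) (use assms in auto)
  finally show ?thesis by (simp add: add.commute)
qed

text \<open>The inverse Laplace transform of Gamma(w) s^(-w).\<close>

definition gamma_kernel :: "complex \<Rightarrow> real \<Rightarrow> complex" where
  "gamma_kernel w u = (if u > 0 then of_real u powr (w - 1) else 0)"

lemma gamma_kernel_measurable [measurable]: "gamma_kernel w \<in> borel_measurable borel"
proof -
  have "gamma_kernel w = (\<lambda>u. if u > 0 then exp ((w - 1) * of_real (ln u)) else 0)"
    by (auto simp: gamma_kernel_def powr_def Ln_of_real fun_eq_iff)
  thus ?thesis by simp
qed

lemma norm_gamma_kernel: "norm (gamma_kernel w u) = (if u > 0 then u powr (Re w - 1) else 0)"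
  using norm_powr_real_powr[of "of_real u" "w - 1"] by (simp add: gamma_kernel_def)

lemma gamma_kernel_admissible:
  assumes "Re w > 0"
  shows "laplace_admissible (gamma_kernel w)"
  unfolding laplace_admissible_def
proof (intro conjI allI impI)
  fix a :: real assume a: "a > 0"
  have "integrable lebesgue (\<lambda>t. indicator {0<..} t *\<^sub>R (complex_of_real t powr (w - 1) / of_real (exp (a * t))))"
    using absolutely_integrable_Gamma_integral[OF assms a] by (simp add: set_integrable_def)
  also have "(\<lambda>t. indicator {0<..} t *\<^sub>R (complex_of_real t powr (w - 1) / of_real (exp (a * t)))) = (\<lambda>t. gamma_kernel w t * of_real (exp (- a * t)))"
    by (auto simp: gamma_kernel_def fun_eq_iff exp_minus field_simps indicator_def)
  finally have "integrable lborel (\<lambda>t. gamma_kernel w t * of_real (exp (- a * t)))"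
    by (subst (asm) integrable_completion) measurable
  from integrable_norm[OF this] show "integrable lborel (\<lambda>u. exp (- a * u) * norm (gamma_kernel w u))"
    by (simp add: norm_mult mult.commute)
qed (auto simp: gamma_kernel_def)

lemma laplace_gamma_kernel_1:
  assumes "Re w > 0"
  shows "laplace (gamma_kernel w) 1 = Gamma w"
proof -
  have "((\<lambda>t. if t \<in> {0..} then of_real t powr (w - 1) / of_real (exp t) else 0) has_integral Gamma w) UNIV"
    unfolding has_integral_restrict_UNIV by (rule Gamma_integral_complex[OF assms])
  also have "(\<lambda>t. if t \<in> {0..} then of_real t powr (w - 1) / of_real (exp t) else 0) = (\<lambda>t. exp (- (1 * of_real t)) * gamma_kernel w t)"
    by (auto simp: gamma_kernel_def fun_eq_iff exp_minus field_simps exp_of_real)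
  finally have "((\<lambda>t. exp (- (1 * of_real t)) * gamma_kernel w t) has_integral Gamma w) UNIV" .
  moreover have "((\<lambda>t. exp (- (1 * of_real t)) * gamma_kernel w t) has_integral laplace (gamma_kernel w) 1) UNIV"
    unfolding laplace_def by (intro has_integral_integral_lborel laplace_integrable gamma_kernel_admissible assms) simp
  ultimately show ?thesis by (metis has_integral_unique)
qed

text \<open>The substitution t -> a t in the Gamma integral, which is the case a = 1.\<close>

lemma laplace_gamma_kernel_real:
  assumes w: "Re w > 0" and a: "a > 0"
  shows "laplace (gamma_kernel w) (of_real a) = Gamma w * of_real a powr (-w)"
proof -
  have "Gamma w = (LINT t|lborel. exp (- (1 * of_real t)) * gamma_kernel w t)"
    using laplace_gamma_kernel_1[OF w] by (simp add: laplace_def)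
  also have "\<dots> = \<bar>a\<bar> *\<^sub>R (LINT t|lborel. exp (- (1 * of_real (0 + a * t))) * gamma_kernel w (0 + a * t))"
    using a by (intro lborel_integral_real_affine) auto
  also have "(\<lambda>t. exp (- (1 * of_real (0 + a * t))) * gamma_kernel w (0 + a * t)) = (\<lambda>t. of_real a powr (w - 1) * (exp (- (of_real a * of_real t)) * gamma_kernel w t))"
  proof
    fix t
    show "exp (- (1 * of_real (0 + a * t))) * gamma_kernel w (0 + a * t) = of_real a powr (w - 1) * (exp (- (of_real a * of_real t)) * gamma_kernel w t)"
      using a by (auto simp: gamma_kernel_def zero_less_mult_iff powr_times_real)
  qed
  also have "\<bar>a\<bar> *\<^sub>R (LINT t|lborel. of_real a powr (w - 1) * (exp (- (of_real a * of_real t)) * gamma_kernel w t)) =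
     of_real a * of_real a powr (w - 1) * laplace (gamma_kernel w) (of_real a)"
    using a by (simp add: laplace_def scaleR_conv_of_real)
  also have "of_real a * of_real a powr (w - 1) = (of_real a powr w :: complex)" using a by (simp add: powr_diff)
  finally show ?thesis using a by (simp add: powr_minus field_simps)
qed

lemma laplace_gamma_kernel:
  assumes w: "Re w > 0" and s: "Re s > 0"
  shows "laplace (gamma_kernel w) s = Gamma w * s powr (-w)"
  by (rule holomorphic_eq_from_reals[OF holomorphic_laplace[OF gamma_kernel_admissible[OF w]] _ _ s])
     (auto intro!: holomorphic_intros laplace_gamma_kernel_real w simp: complex_nonpos_Reals_iff)

text \<open>
  Multiplication by $u^2$ corresponds to two derivatives of the transform; they produce the decay in
  the imaginary direction that makes the smoothed integral absolutely convergent.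
\<close>

definition err :: "complex \<Rightarrow> real \<Rightarrow> complex" where
  "err z u = of_real (u\<^sup>2) * omega_sum_exp z u - g_one z / Gamma z * gamma_kernel (z + 2) u"

lemma laplace_admissible_square: "laplace_admissible f \<Longrightarrow> laplace_admissible (\<lambda>u. of_real (u\<^sup>2) * f u)"
  using laplace_admissible_times[OF laplace_admissible_times, of f] by (simp add: power2_eq_square mult.assoc)

lemma laplace_admissible_diff:
  assumes f: "laplace_admissible f" and g: "laplace_admissible g"
  shows "laplace_admissible (\<lambda>u. f u - c * g u)"
  unfolding laplace_admissible_def
proof (intro conjI allI impI)
  note m [measurable] = laplace_admissibleD(1)[OF f] laplace_admissibleD(1)[OF g]
  show "(\<lambda>u. f u - c * g u) \<in> borel_measurable borel" by measurable
  show "f u - c * g u = 0" if "u < 0" for u using that laplace_admissibleD(2)[OF f] laplace_admissibleD(2)[OF g] by simp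
  fix a :: real assume a: "a > 0"
  have i: "integrable lborel (\<lambda>u. exp (- a * u) * norm (f u) + norm c * (exp (- a * u) * norm (g u)))"
    using laplace_admissibleD(3)[OF f a] laplace_admissibleD(3)[OF g a] by (intro Bochner_Integration.integrable_add integrable_mult_right)
  show "integrable lborel (\<lambda>u. exp (- a * u) * norm (f u - c * g u))"
  proof (rule Bochner_Integration.integrable_bound[OF i])
    show "AE u in lborel. norm (exp (- a * u) * norm (f u - c * g u)) \<le> norm (exp (- a * u) * norm (f u) + norm c * (exp (- a * u) * norm (g u)))"
    proof (rule AE_I2)
      fix u
      have "exp (- a * u) * norm (f u - c * g u) \<le> exp (- a * u) * (norm (f u) + norm (c * g u))"
        by (intro mult_left_mono norm_triangle_ineq4) auto
      thus "norm (exp (- a * u) * norm (f u - c * g u)) \<le> norm (exp (- a * u) * norm (f u) + norm c * (exp (- a * u) * norm (g u)))"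
        by (simp add: norm_mult algebra_simps)
    qed
  qed measurable
qed

lemma err_admissible: "Re z > 0 \<Longrightarrow> laplace_admissible (err z)"
  unfolding err_def by (intro laplace_admissible_diff laplace_admissible_square omega_sum_exp_admissible gamma_kernel_admissible) auto

lemma Re_pos_notin_nonpos_Ints: "Re w > 0 \<Longrightarrow> w \<notin> \<int>\<^sub>\<le>\<^sub>0"
  by (auto elim!: nonpos_Ints_cases)

text \<open>Since Gamma(z+2) = z (z+1) Gamma(z), the power of u subtracted in \<open>err\<close> has
  as its transform exactly the second derivative of the leading singularity of
  \<open>Phi\<close>.\<close>

lemma laplace_err:
  assumes z: "Re z > 0" and s: "Re s > 0"
  shows "laplace (err z) s = (deriv ^^ 2) (Phi z) (1 + s) - z * (z + 1) * g_one z * s powr (-z - 2)"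
proof -
  have 1: "integrable lborel (\<lambda>u. exp (- (s * of_real u)) * (of_real (u\<^sup>2) * omega_sum_exp z u))"
    by (intro laplace_integrable laplace_admissible_square omega_sum_exp_admissible s)
  have 2: "integrable lborel (\<lambda>u. exp (- (s * of_real u)) * gamma_kernel (z + 2) u)"
    using z by (intro laplace_integrable gamma_kernel_admissible s) auto
  have "laplace (err z) s = (LINT u|lborel. exp (- (s * of_real u)) * (of_real (u\<^sup>2) * omega_sum_exp z u) - (g_one z / Gamma z) * (exp (- (s * of_real u)) * gamma_kernel (z + 2) u))"
    unfolding laplace_def err_def by (intro Bochner_Integration.integral_cong refl) (simp add: algebra_simps)
  also have "\<dots> = (LINT u|lborel. exp (- (s * of_real u)) * (of_real (u\<^sup>2) * omega_sum_exp z u)) - (LINT u|lborel. (g_one z / Gamma z) * (exp (- (s * of_real u)) * gamma_kernel (z + 2) u))"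
    by (intro Bochner_Integration.integral_diff 1 integrable_mult_right 2)
  also have "\<dots> = laplace (\<lambda>u. of_real (u\<^sup>2) * omega_sum_exp z u) s - g_one z / Gamma z * laplace (gamma_kernel (z + 2)) s"
    unfolding laplace_def by simp
  also have "laplace (\<lambda>u. of_real (u\<^sup>2) * omega_sum_exp z u) s = (deriv ^^ 2) (Phi z) (1 + s)" by (rule laplace_omega_sum_exp_square[OF s])
  also have "laplace (gamma_kernel (z + 2)) s = Gamma (z + 2) * s powr (- (z + 2))" using z by (intro laplace_gamma_kernel s) auto
  also have "Gamma (z + 2) = z * (z + 1) * Gamma z"
  proof -
    have "z \<notin> \<int>\<^sub>\<le>\<^sub>0" "z + 1 \<notin> \<int>\<^sub>\<le>\<^sub>0" using z by (auto intro!: Re_pos_notin_nonpos_Ints)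
    hence "Gamma (z + 1) = z * Gamma z" "Gamma (z + 1 + 1) = (z + 1) * Gamma (z + 1)"
      using Gamma_plus1[of z] Gamma_plus1[of "z + 1"] by blast+
    moreover have "z + 1 + 1 = z + 2" by simp
    ultimately show ?thesis by (simp add: mult_ac)
  qed
  also have "g_one z / Gamma z * (z * (z + 1) * Gamma z * s powr (- (z + 2))) = z * (z + 1) * g_one z * s powr (-z - 2)"
  proof -
    have "Gamma z \<noteq> 0" using Re_pos_notin_nonpos_Ints[OF z] by (simp add: Gamma_eq_zero_iff)
    moreover have "- (z + 2) = - z - 2" by simp
    ultimately show ?thesis by simp
  qed
  finally show ?thesis .
qed

text \<open>The Gaussian is, up to a constant, its own characteristic function. Inserting this and
  exchanging the integrals by Fubini turns the average of a at scale 1/T around u into an average of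
  its Fourier transform over frequencies of size T. The phase carrying u has modulus 1, so the bound
  does not depend on u.\<close>

lemma gaussian_smoothing:
  fixes a :: "real \<Rightarrow> complex"
  assumes a: "integrable lborel a" and T: "T > 0"
  shows "norm (LINT y|lborel. of_real (std_normal_density y) * a (u + y / T)) \<le>
     T * enn2real (\<integral>\<^sup>+ w. ennreal (std_normal_density w * norm (LINT v|lborel. a v * exp (\<i> * of_real (T * w * v)))) \<partial>lborel)"
    (is "_ \<le> T * enn2real ?N")
proof -
  have am [measurable]: "a \<in> borel_measurable borel" using a by auto
  define n where "n = std_normal_density"
  have nm [measurable]: "n \<in> borel_measurable borel" unfolding n_def by auto
  have n0: "n x \<ge> 0" for x by (simp add: n_def normal_density_nonneg)
  have ni: "integrable lborel n" unfolding n_def using integrable_normal_density[of 1 0] by simp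
  define A where "A = (\<lambda>w. LINT v|lborel. a v * exp (\<i> * of_real (T * w * v)))"
  have Am [measurable]: "A \<in> borel_measurable borel" unfolding A_def by measurable
  have Abd: "norm (A w) \<le> (LINT v|lborel. norm (a v))" for w
    unfolding A_def
    by (rule order_trans[OF integral_norm_bound]) (simp add: norm_mult)
  have iA: "integrable lborel (\<lambda>w. n w * norm (A w))"
    by (rule Bochner_Integration.integrable_bound[OF integrable_mult_left[OF ni, of "LINT v|lborel. norm (a v)"]])
       (use Abd n0 in \<open>auto simp: abs_mult intro!: mult_left_mono order_trans[OF Abd]\<close>)
  have four: "complex_of_real (n x) = of_real (1 / sqrt (2 * pi)) * (LINT w|lborel. of_real (n w) * exp (\<i> * of_real (x * w)))" for x
  proof -
    have "char std_normal_distribution x = complex_of_real (exp (- (x^2) / 2))" by (simp add: char_std_normal_distribution)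
    also have "char std_normal_distribution x = (LINT w|lborel. n w *\<^sub>R iexp (x * w))"
      unfolding char_def n_def by (subst integral_density) (auto simp: normal_density_nonneg)
    also have "\<dots> = (LINT w|lborel. of_real (n w) * exp (\<i> * of_real (x * w)))" by (simp add: scaleR_conv_of_real)
    finally show ?thesis by (simp add: n_def normal_density_def)
  qed
  define f where "f = (\<lambda>(v, w). a v * (of_real (n w) * exp (\<i> * of_real (T * (v - u) * w))))"
  have fm [measurable]: "f \<in> borel_measurable (lborel \<Otimes>\<^sub>M lborel)" unfolding f_def by measurable
  have nf: "norm (f (v, w)) = norm (a v) * n w" for v w using n0[of w] by (simp add: f_def norm_mult)
  have fi: "integrable (lborel \<Otimes>\<^sub>M lborel) f"
  proof (rule lborel_pair.Fubini_integrable[OF fm])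
    show "integrable lborel (\<lambda>v. LINT w|lborel. norm (f (v, w)))"
      unfolding nf using a ni by simp
    show "AE v in lborel. integrable lborel (\<lambda>w. f (v, w))"
    proof (rule AE_I2)
      fix v
      have [measurable]: "(\<lambda>w. f (v, w)) \<in> borel_measurable lborel" unfolding f_def prod.case by measurable
      show "integrable lborel (\<lambda>w. f (v, w))"
        by (rule Bochner_Integration.integrable_bound[OF integrable_mult_right[OF ni, of "norm (a v)"]])
           (use n0 in \<open>auto simp: nf\<close>)
    qed
  qed
  have "(LINT y|lborel. of_real (n y) * a (u + y / T)) = \<bar>T\<bar> *\<^sub>R (LINT v|lborel. of_real (n (- T * u + T * v)) * a (u + (- T * u + T * v) / T))"
    using T by (intro lborel_integral_real_affine) auto
  also have "(\<lambda>v. of_real (n (- T * u + T * v)) * a (u + (- T * u + T * v) / T)) = (\<lambda>v. of_real (1 / sqrt (2 * pi)) * (LINT w|lborel. f (v, w)))"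
  proof
    fix v
    have e: "u + (- T * u + T * v) / T = v" using T by (simp add: field_simps)
    have e2: "- T * u + T * v = T * (v - u)" by (simp add: algebra_simps)
    show "of_real (n (- T * u + T * v)) * a (u + (- T * u + T * v) / T) = of_real (1 / sqrt (2 * pi)) * (LINT w|lborel. f (v, w))"
      unfolding e e2 four[of "T * (v - u)"] f_def using T by (simp add: mult_ac)
  qed
  also have "(LINT v|lborel. of_real (1 / sqrt (2 * pi)) * (LINT w|lborel. f (v, w))) = of_real (1 / sqrt (2 * pi)) * (LINT v|lborel. (LINT w|lborel. f (v, w)))"
    by simp
  also have "(LINT v|lborel. (LINT w|lborel. f (v, w))) = (LINT w|lborel. (LINT v|lborel. f (v, w)))"
    using lborel_pair.Fubini_integral[of "\<lambda>v w. f (v, w)"] fi by simp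
  also have "(\<lambda>w. LINT v|lborel. f (v, w)) = (\<lambda>w. of_real (n w) * exp (- (\<i> * of_real (T * u * w))) * A w)"
  proof
    fix w
    have "(LINT v|lborel. f (v, w)) = (LINT v|lborel. of_real (n w) * exp (- (\<i> * of_real (T * u * w))) * (a v * exp (\<i> * of_real (T * w * v))))"
    proof (intro Bochner_Integration.integral_cong refl)
      fix v
      have "exp (\<i> * of_real (T * (v - u) * w)) = exp (- (\<i> * of_real (T * u * w))) * exp (\<i> * of_real (T * w * v))"
        by (simp add: exp_add[symmetric] algebra_simps)
      thus "f (v, w) = of_real (n w) * exp (- (\<i> * of_real (T * u * w))) * (a v * exp (\<i> * of_real (T * w * v)))"
        by (simp add: f_def mult_ac)
    qed
    also have "\<dots> = of_real (n w) * exp (- (\<i> * of_real (T * u * w))) * A w" by (simp add: A_def)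
    finally show "(LINT v|lborel. f (v, w)) = of_real (n w) * exp (- (\<i> * of_real (T * u * w))) * A w" .
  qed
  finally have eq: "(LINT y|lborel. of_real (n y) * a (u + y / T)) = \<bar>T\<bar> *\<^sub>R (of_real (1 / sqrt (2 * pi)) * (LINT w|lborel. of_real (n w) * exp (- (\<i> * of_real (T * u * w))) * A w))" .
  have "norm (LINT w|lborel. of_real (n w) * exp (- (\<i> * of_real (T * u * w))) * A w) \<le> (LINT w|lborel. n w * norm (A w))"
    by (rule order_trans[OF integral_norm_bound]) (simp add: norm_mult n0 norm_exp_eq_Re)
  also have "\<dots> = enn2real ?N"
    using nn_integral_eq_integral[OF iA] n0 by (simp add: A_def n_def integral_nonneg_AE)
  finally have 1: "norm (LINT w|lborel. of_real (n w) * exp (- (\<i> * of_real (T * u * w))) * A w) \<le> enn2real ?N" .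
  have "1 / sqrt (2 * pi) \<le> 1"
  proof -
    have "1 \<le> 2 * pi" using pi_gt3 by linarith
    hence "sqrt 1 \<le> sqrt (2 * pi)" by (intro real_sqrt_le_mono)
    thus ?thesis by simp
  qed
  hence 2: "norm (complex_of_real (1 / sqrt (2 * pi))) \<le> 1" unfolding norm_of_real by simp
  have "norm (LINT y|lborel. of_real (n y) * a (u + y / T)) \<le> \<bar>T\<bar> * (1 * enn2real ?N)"
    unfolding eq norm_scaleR norm_mult[of "complex_of_real (1 / sqrt (2 * pi))"]
    by (intro mult_left_mono mult_mono 1 2) auto
  thus ?thesis using T by (simp add: n_def)
qed

section \<open>Bounding the smoothed error term\<close>

lemma powr_tail_integrable:
  fixes k :: real assumes "k > 0"
  shows "integrable lborel (\<lambda>s::real. s powr (- k - 1) * indicator {1..} s)"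
proof -
  have "has_bochner_integral lborel (\<lambda>s::real. s powr (- k - 1) * indicator {1..} s) (- (1 powr (- k - 1 + 1)) / (- k - 1 + 1))"
  proof (rule has_bochner_integral_of_has_integral)
    have "((\<lambda>s::real. if s \<in> {1..} then s powr (- k - 1) else 0) has_integral - (1 powr (- k - 1 + 1)) / (- k - 1 + 1)) UNIV"
      unfolding has_integral_restrict_UNIV using assms by (intro has_integral_powr_to_inf) auto
    also have "(\<lambda>s::real. if s \<in> {1..} then s powr (- k - 1) else 0) = (\<lambda>s. s powr (- k - 1) * indicator {1..} s)"
      by (auto simp: indicator_def)
    finally show "((\<lambda>s::real. s powr (- k - 1) * indicator {1..} s) has_integral - (1 powr (- k - 1 + 1)) / (- k - 1 + 1)) UNIV" .
  qed (auto simp: indicator_def)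
  thus ?thesis by (simp add: has_bochner_integral_iff)
qed

lemma integrable_reflect:
  fixes f :: "real \<Rightarrow> real"
  shows "integrable lborel f \<Longrightarrow> integrable lborel (\<lambda>x. f (- x))"
  using lborel_integrable_real_affine[of f "-1" 0] by simp

text \<open>The kernel |\<delta> + i t|^(-k-1) in the scaling t = \<delta> s; k > 0 makes it
  integrable at infinity.\<close>

lemma pole_kernel_integrable:
  assumes k: "k > 0"
  shows "integrable lborel (\<lambda>s. norm (Complex 1 s) powr (- k - 1))"
proof -
  define p where "p = (\<lambda>s::real. s powr (- k - 1) * indicator {1..} s)"
  have p: "integrable lborel p" unfolding p_def by (rule powr_tail_integrable[OF k])
  have i: "integrable lborel (\<lambda>s. indicator {-1..1} s + p s + p (- s))"
    by (intro Bochner_Integration.integrable_add p integrable_reflect[OF p]) auto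
  have eq: "norm (Complex 1 s) = sqrt (1 + s\<^sup>2)" for s by (simp add: complex_norm)
  show ?thesis
  proof (rule Bochner_Integration.integrable_bound[OF i])
    show "(\<lambda>s. norm (Complex 1 s) powr (- k - 1)) \<in> borel_measurable lborel"
      unfolding eq by measurable
    show "AE s in lborel. norm (norm (Complex 1 s) powr (- k - 1)) \<le> norm (indicator {-1..1} s + p s + p (- s))"
    proof (rule AE_I2)
      fix s :: real
      have scaled_m_deriv: "p s \<ge> 0" "p (- s) \<ge> 0" by (auto simp: p_def)
      have n1: "norm (Complex 1 s) \<ge> 1" "norm (Complex 1 s) \<ge> \<bar>s\<bar>"
        using abs_Re_le_cmod[of "Complex 1 s"] abs_Im_le_cmod[of "Complex 1 s"] by auto
      have "norm (Complex 1 s) powr (- k - 1) \<le> indicator {-1..1} s + p s + p (- s)"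
      proof (cases "\<bar>s\<bar> \<le> 1")
        case True
        have "norm (Complex 1 s) powr (- k - 1) \<le> 1 powr (- k - 1)" using n1 k by (intro powr_mono2') auto
        thus ?thesis using True scaled_m_deriv by (auto simp: indicator_def)
      next
        case False
        have "norm (Complex 1 s) powr (- k - 1) \<le> \<bar>s\<bar> powr (- k - 1)" using n1 k False by (intro powr_mono2') auto
        also have "\<dots> \<le> p s + p (- s)" using False by (auto simp: p_def indicator_def)
        finally show ?thesis using False by (auto simp: indicator_def)
      qed
      thus "norm (norm (Complex 1 s) powr (- k - 1)) \<le> norm (indicator {-1..1} s + p s + p (- s))" using scaled_m_deriv by simp
    qed
  qed
qed

lemma std_normal_density_bounds:
  "std_normal_density y \<le> 1" "std_normal_density y \<le> exp (1/2) * exp (- \<bar>y\<bar>)" "std_normal_density y \<ge> 0"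
proof -
  have "1 \<le> sqrt (2 * pi)" using pi_gt3 by (intro real_le_rsqrt) auto
  hence c: "1 / sqrt (2 * pi) \<le> 1" by simp
  have e: "std_normal_density y \<le> exp (- y\<^sup>2 / 2)"
    unfolding std_normal_density_def using c mult_right_mono[OF c, of "exp (- y\<^sup>2 / 2)"] by simp
  have "exp (- y\<^sup>2 / 2) \<le> 1" by simp
  with e show "std_normal_density y \<le> 1" by linarith
  have "0 \<le> (\<bar>y\<bar> - 1)\<^sup>2" by simp
  hence "- y\<^sup>2 / 2 \<le> 1 / 2 + - \<bar>y\<bar>" by (simp add: power2_eq_square algebra_simps)
  hence "exp (- y\<^sup>2 / 2) \<le> exp (1/2 + - \<bar>y\<bar>)" by (simp only: exp_le_cancel_iff)
  with e show "std_normal_density y \<le> exp (1/2) * exp (- \<bar>y\<bar>)" unfolding exp_add by linarith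
  show "std_normal_density y \<ge> 0" by (simp add: normal_density_nonneg)
qed

lemma normal_abs_powr_integrable:
  assumes e: "e > 0"
  shows "integrable lborel (\<lambda>w. std_normal_density w * \<bar>w\<bar> powr (e - 1))"
proof -
  define p where "p = (\<lambda>u. exp (- 1 * u) * norm (gamma_kernel (of_real e) u))"
  have p: "integrable lborel p" unfolding p_def
    using laplace_admissibleD(3)[OF gamma_kernel_admissible[of "of_real e"], of 1] e by simp
  have i: "integrable lborel (\<lambda>w. exp (1/2) * (p w + p (- w)))"
    by (intro integrable_mult_right Bochner_Integration.integrable_add p integrable_reflect[OF p])
  show ?thesis
  proof (rule Bochner_Integration.integrable_bound[OF i])
    show "AE w in lborel. norm (std_normal_density w * \<bar>w\<bar> powr (e - 1)) \<le> norm (exp (1/2) * (p w + p (- w)))"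
    proof (rule AE_I2)
      fix w :: real
      have scaled_m_deriv: "p w \<ge> 0" "p (- w) \<ge> 0" by (auto simp: p_def)
      have "std_normal_density w * \<bar>w\<bar> powr (e - 1) \<le> (exp (1/2) * exp (- \<bar>w\<bar>)) * \<bar>w\<bar> powr (e - 1)"
        by (intro mult_right_mono std_normal_density_bounds) auto
      also have "exp (- \<bar>w\<bar>) * \<bar>w\<bar> powr (e - 1) = p w + p (- w)"
        by (auto simp: p_def norm_gamma_kernel)
      hence "(exp (1/2) * exp (- \<bar>w\<bar>)) * \<bar>w\<bar> powr (e - 1) = exp (1/2) * (p w + p (- w))" by (simp add: mult.assoc)
      finally show "norm (std_normal_density w * \<bar>w\<bar> powr (e - 1)) \<le> norm (exp (1/2) * (p w + p (- w)))"
        using scaled_m_deriv std_normal_density_bounds(3)[of w] by simp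
    qed
  qed measurable
qed

text \<open>Frequency w corresponds to height t = -T w. For |t| < \<tau> the density is at most 1,
  and scaling by \<delta> yields \<delta>^(-Re z) / T; elsewhere |T w|^(e-1) integrated against the
  Gaussian yields T^(e-1). The factor T of \<open>gaussian_smoothing\<close> gives the
  result.\<close>

lemma smoothing_bound:
  assumes z: "Re z > 0"
  shows "\<exists>\<tau>>0. \<tau> \<le> 1 \<and> (\<forall>e>0. \<exists>C>0. \<forall>\<delta> T u. 0 < \<delta> \<and> \<delta> \<le> \<tau> \<and> T > 0 \<longrightarrow>
     norm (LINT y|lborel. of_real (std_normal_density y) * (of_real (exp (- \<delta> * (u + y / T))) * err z (u + y / T)))
       \<le> C * (\<delta> powr (- Re z) + T powr e))"
proof -
  obtain \<tau> where tau: "\<tau> > 0" "\<tau> \<le> 1" and tb: "\<And>e. e > 0 \<Longrightarrow> \<exists>C>0. \<forall>\<delta> t. 0 < \<delta> \<and> \<delta> \<le> \<tau> \<longrightarrow>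
     norm ((deriv ^^ 2) (Phi z) (1 + Complex \<delta> t) - z * (z + 1) * g_one z * Complex \<delta> t powr (-z - 2))
       \<le> C * (if \<bar>t\<bar> < \<tau> then norm (Complex \<delta> t) powr (- Re z - 1) else \<bar>t\<bar> powr (e - 1))"
    using transform_bound[OF z] by blast
  define k where "k = Re z"
  have k: "k > 0" using z by (simp add: k_def)
  define K1 where "K1 = (LINT s|lborel. norm (Complex 1 s) powr (- k - 1))"
  have K1: "K1 \<ge> 0" unfolding K1_def by (intro Bochner_Integration.integral_nonneg) auto
  have "\<exists>C>0. \<forall>\<delta> T u. 0 < \<delta> \<and> \<delta> \<le> \<tau> \<and> T > 0 \<longrightarrow>
     norm (LINT y|lborel. of_real (std_normal_density y) * (of_real (exp (- \<delta> * (u + y / T))) * err z (u + y / T)))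
       \<le> C * (\<delta> powr (- Re z) + T powr e)" if e: "e > 0" for e
  proof -
    obtain C1 where C1: "C1 > 0" "\<And>\<delta> t. 0 < \<delta> \<Longrightarrow> \<delta> \<le> \<tau> \<Longrightarrow>
      norm ((deriv ^^ 2) (Phi z) (1 + Complex \<delta> t) - z * (z + 1) * g_one z * Complex \<delta> t powr (-z - 2))
       \<le> C1 * (if \<bar>t\<bar> < \<tau> then norm (Complex \<delta> t) powr (- Re z - 1) else \<bar>t\<bar> powr (e - 1))"
      using tb[OF e] by blast
    define K2 where "K2 = (LINT w|lborel. std_normal_density w * \<bar>w\<bar> powr (e - 1))"
    have K2: "K2 \<ge> 0" unfolding K2_def using std_normal_density_bounds(3) by (intro Bochner_Integration.integral_nonneg) auto
    define C where "C = C1 * (K1 + K2) + 1"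
    have "norm (LINT y|lborel. of_real (std_normal_density y) * (of_real (exp (- \<delta> * (u + y / T))) * err z (u + y / T)))
       \<le> C * (\<delta> powr (- Re z) + T powr e)" if d: "0 < \<delta>" "\<delta> \<le> \<tau>" and T: "T > 0" for \<delta> T u
    proof -
      define a where "a = (\<lambda>v. complex_of_real (exp (- \<delta> * v)) * err z v)"
      have a_eq: "a v = exp (- (of_real \<delta> * of_real v)) * err z v" for v by (simp add: a_def exp_of_real[symmetric])
      have ai: "integrable lborel a"
        unfolding a_eq[abs_def] using d by (intro laplace_integrable err_admissible z) auto
      have A: "(LINT v|lborel. a v * exp (\<i> * of_real (T * w * v))) = laplace (err z) (Complex \<delta> (- (T * w)))" for w
        unfolding laplace_def
      proof (intro Bochner_Integration.integral_cong refl)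
        fix v
        have "- (Complex \<delta> (- (T * w)) * of_real v) = - (of_real \<delta> * of_real v) + \<i> * of_real (T * w * v)"
          by (simp add: complex_eq_iff)
        hence "exp (- (Complex \<delta> (- (T * w)) * of_real v)) = exp (- (of_real \<delta> * of_real v)) * exp (\<i> * of_real (T * w * v))"
          by (simp only: exp_add)
        thus "a v * exp (\<i> * of_real (T * w * v)) = exp (- (Complex \<delta> (- (T * w)) * of_real v)) * err z v"
          by (simp add: a_eq mult_ac)
      qed
      have scale: "norm (Complex \<delta> (- (T * w))) = \<delta> * norm (Complex 1 (0 + (- T / \<delta>) * w))" for w
      proof -
        have "Complex \<delta> (- (T * w)) = of_real \<delta> * Complex 1 (0 + (- T / \<delta>) * w)" using d by (simp add: complex_eq_iff)
        thus ?thesis using d by (simp add: norm_mult)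
      qed
      define f1 where "f1 = (\<lambda>w. \<delta> powr (- k - 1) * norm (Complex 1 (0 + (- T / \<delta>) * w)) powr (- k - 1))"
      define f2 where "f2 = (\<lambda>w. T powr (e - 1) * (std_normal_density w * \<bar>w\<bar> powr (e - 1)))"
      have Td: "- T / \<delta> \<noteq> 0" using T d by simp
      have f1i: "integrable lborel f1" unfolding f1_def
        by (intro integrable_mult_right lborel_integrable_real_affine[OF pole_kernel_integrable[OF k] Td])
      have f2i: "integrable lborel f2" unfolding f2_def by (intro integrable_mult_right normal_abs_powr_integrable e)
      define J where "J = (LINT w|lborel. norm (Complex 1 (0 + (- T / \<delta>) * w)) powr (- k - 1))"
      have "K1 = \<bar>- T / \<delta>\<bar> *\<^sub>R J"
        unfolding K1_def J_def by (rule lborel_integral_real_affine[OF Td])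
      hence J: "J = K1 * \<delta> / T" using T d by (simp add: field_simps)
      have "integral\<^sup>L lborel f1 = \<delta> powr (- k - 1) * J" unfolding f1_def J_def by (rule integral_mult_right_zero)
      hence f1I: "integral\<^sup>L lborel f1 = \<delta> powr (- k) * K1 / T" unfolding J using T d
        by (simp add: field_simps powr_diff)
      have f2I: "integral\<^sup>L lborel f2 = T powr (e - 1) * K2" by (simp add: f2_def K2_def)
      have bd: "std_normal_density w * norm (laplace (err z) (Complex \<delta> (- (T * w)))) \<le> C1 * (f1 w + f2 w)" for w
      proof -
        have scaled_m_deriv: "f1 w \<ge> 0" "f2 w \<ge> 0" using std_normal_density_bounds(3)[of w] by (auto simp: f1_def f2_def)
        have L: "norm (laplace (err z) (Complex \<delta> (- (T * w)))) \<le> C1 * (if \<bar>- (T * w)\<bar> < \<tau> then norm (Complex \<delta> (- (T * w))) powr (- Re z - 1) else \<bar>- (T * w)\<bar> powr (e - 1))"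
          using C1(2)[OF d, of "- (T * w)"] laplace_err[OF z, of "Complex \<delta> (- (T * w))"] d by simp
        show ?thesis
        proof (cases "\<bar>- (T * w)\<bar> < \<tau>")
          case True
          have "std_normal_density w * norm (laplace (err z) (Complex \<delta> (- (T * w)))) \<le> 1 * (C1 * norm (Complex \<delta> (- (T * w))) powr (- Re z - 1))"
            using L True by (intro mult_mono std_normal_density_bounds) auto
          also have "norm (Complex \<delta> (- (T * w))) powr (- Re z - 1) = f1 w"
            unfolding scale f1_def k_def using d by (subst powr_mult) auto
          finally show ?thesis using scaled_m_deriv C1(1) by (simp add: algebra_simps add_increasing2)
        next
          case False
          have "std_normal_density w * norm (laplace (err z) (Complex \<delta> (- (T * w)))) \<le> std_normal_density w * (C1 * \<bar>- (T * w)\<bar> powr (e - 1))"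
            using L False by (intro mult_left_mono std_normal_density_bounds) auto
          also have "\<bar>- (T * w)\<bar> powr (e - 1) = T powr (e - 1) * \<bar>w\<bar> powr (e - 1)"
            using T by (simp add: abs_mult powr_mult)
          also have "std_normal_density w * (C1 * (T powr (e - 1) * \<bar>w\<bar> powr (e - 1))) = C1 * f2 w" by (simp add: f2_def mult_ac)
          finally show ?thesis using scaled_m_deriv C1(1) by (simp add: algebra_simps add_increasing)
        qed
      qed
      have "(\<integral>\<^sup>+ w. ennreal (std_normal_density w * norm (LINT v|lborel. a v * exp (\<i> * of_real (T * w * v)))) \<partial>lborel)
         \<le> (\<integral>\<^sup>+ w. ennreal (C1 * (f1 w + f2 w)) \<partial>lborel)"
        unfolding A by (intro nn_integral_mono ennreal_leI bd)
      also have "\<dots> = ennreal (LINT w|lborel. C1 * (f1 w + f2 w))"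
        using C1(1) std_normal_density_bounds(3)
        by (intro nn_integral_eq_integral integrable_mult_right Bochner_Integration.integrable_add f1i f2i) (auto simp: f1_def f2_def)
      also have "(LINT w|lborel. C1 * (f1 w + f2 w)) = C1 * (\<delta> powr (- k) * K1 / T + T powr (e - 1) * K2)"
        using f1i f2i f1I f2I by simp
      finally have "enn2real (\<integral>\<^sup>+ w. ennreal (std_normal_density w * norm (LINT v|lborel. a v * exp (\<i> * of_real (T * w * v)))) \<partial>lborel)
         \<le> C1 * (\<delta> powr (- k) * K1 / T + T powr (e - 1) * K2)"
        using C1(1) K1 K2 T by (intro enn2real_leI) auto
      hence "norm (LINT y|lborel. of_real (std_normal_density y) * a (u + y / T)) \<le> T * (C1 * (\<delta> powr (- k) * K1 / T + T powr (e - 1) * K2))"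
        using gaussian_smoothing[OF ai T, of u] T by (meson mult_left_mono less_imp_le order_trans)
      also have "\<dots> = C1 * (K1 * \<delta> powr (- k) + K2 * T powr e)"
        using T by (simp add: field_simps powr_diff)
      also have "\<dots> \<le> C1 * ((K1 + K2) * \<delta> powr (- k) + (K1 + K2) * T powr e)"
        using C1(1) K1 K2 by (intro mult_left_mono add_mono mult_right_mono) auto
      also have "\<dots> \<le> C * (\<delta> powr (- k) + T powr e)" by (simp add: C_def algebra_simps)
      finally show ?thesis by (simp add: a_def k_def)
    qed
    moreover have "C > 0" unfolding C_def using C1 K1 K2 by (intro add_nonneg_pos mult_nonneg_nonneg) auto
    ultimately show ?thesis by blast
  qed
  with tau show ?thesis by blast
qed

section \<open>The asymptotics of the full sum\<close>

text \<open>Rankin's trick: with \<sigma> = 1 + 1 / (1 + log x) one has n^\<sigma> <= e x for all n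
  <= x, and \<sigma> / (\<sigma> - 1), the bound for zeta at \<sigma>, is exactly 2 + log x.\<close>

lemma omega_moment_bound:
  assumes R: "R \<ge> 1" and x: "x \<ge> 1"
  shows "(\<Sum>n\<in>{n. 1 \<le> n \<and> real n \<le> x}. R ^ omega n) \<le> exp 1 * x * (2 + ln x) powr R"
proof -
  define L where "L = 1 + ln x"
  have L: "L \<ge> 1" using x by (simp add: L_def)
  define \<sigma> where "\<sigma> = 1 + 1 / L"
  have sg: "\<sigma> > 1" using L by (simp add: \<sigma>_def)
  define N where "N = nat \<lfloor>x\<rfloor>"
  have "{n. 1 \<le> n \<and> real n \<le> x} = {1..N}"
    unfolding N_def by (auto simp: le_nat_iff le_floor_iff) linarith+
  hence "(\<Sum>n\<in>{n. 1 \<le> n \<and> real n \<le> x}. R ^ omega n) = (\<Sum>m<N. R ^ omega (Suc m))"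
    by (simp, intro sum.reindex_bij_witness[of _ Suc "\<lambda>n. n - 1"]) auto
  also have "\<dots> \<le> (\<Sum>m<N. (exp 1 * x) * (R ^ omega (Suc m) * real (Suc m) powr (- \<sigma>)))"
  proof (rule sum_mono)
    fix m assume m: "m \<in> {..<N}"
    have mx: "real (Suc m) \<le> x" using m x unfolding N_def by (simp add: zless_nat_conj nat_less_iff less_floor_iff) linarith
    have "real (Suc m) powr \<sigma> \<le> x powr \<sigma>" using mx sg by (intro powr_mono2) auto
    also have "x powr \<sigma> = x powr 1 * x powr (1 / L)" unfolding \<sigma>_def by (rule powr_add)
    also have "\<dots> = x * exp (ln x / L)" using x by (simp add: powr_def[of x "1/L"])
    also have "ln x / L \<le> 1" using L by (simp add: L_def divide_le_eq_1)
    hence "x * exp (ln x / L) \<le> x * exp 1" using x by (intro mult_left_mono) auto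
    finally have "1 \<le> (exp 1 * x) * real (Suc m) powr (- \<sigma>)"
      by (simp add: powr_minus field_simps del: of_nat_Suc)
    hence "R ^ omega (Suc m) * 1 \<le> R ^ omega (Suc m) * ((exp 1 * x) * real (Suc m) powr (- \<sigma>))"
      using R by (intro mult_left_mono) auto
    thus "R ^ omega (Suc m) \<le> (exp 1 * x) * (R ^ omega (Suc m) * real (Suc m) powr (- \<sigma>))" by (simp add: mult_ac)
  qed
  also have "\<dots> = exp 1 * x * (\<Sum>m<N. R ^ omega (Suc m) * real (Suc m) powr (- \<sigma>))"
    by (simp add: sum_distrib_left)
  also have "\<dots> \<le> exp 1 * x * (norm (zeta (of_real \<sigma>)) powr R)"
    using x by (intro mult_left_mono sum_omega_le R sg) auto
  also have "norm (zeta (of_real \<sigma>)) powr R \<le> (2 + ln x) powr R"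
  proof -
    have "norm (zeta (of_real \<sigma>)) \<le> \<sigma> / (\<sigma> - 1)" by (rule zeta_real_bound[OF sg])
    also have "\<dots> = 2 + ln x" using L by (simp add: \<sigma>_def L_def field_simps)
    finally show ?thesis using R by (intro powr_mono2) auto
  qed
  finally show ?thesis using x by (simp add: mult_left_mono)
qed

text \<open>One base for both moments: |z| in trivial bounds and |z|^2 after
  Cauchy--Schwarz.\<close>

definition moment_exp :: "complex \<Rightarrow> real" where
  "moment_exp z = max 1 ((norm z)\<^sup>2)"

lemma moment_exp: "moment_exp z \<ge> 1" "norm z \<le> moment_exp z" "(norm z)\<^sup>2 \<le> moment_exp z"
proof -
  show "moment_exp z \<ge> 1" "(norm z)\<^sup>2 \<le> moment_exp z" by (auto simp: moment_exp_def)
  show "norm z \<le> moment_exp z"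
  proof (cases "norm z \<le> 1")
    case False
    hence "norm z * 1 \<le> norm z * norm z" by (intro mult_left_mono) auto
    thus ?thesis by (simp add: moment_exp_def power2_eq_square)
  qed (simp add: moment_exp_def)
qed

lemma omega_sum_exp_bound:
  assumes u: "u \<ge> 0"
  shows "norm (omega_sum_exp z u) \<le> exp 1 * (2 + u) powr moment_exp z"
proof -
  have "norm (omega_sum z (exp u)) \<le> (\<Sum>n\<in>{n. 1 \<le> n \<and> real n \<le> exp u}. norm z ^ omega n)"
    unfolding omega_sum_def by (rule order_trans[OF norm_sum]) (simp add: norm_power)
  also have "\<dots> \<le> (\<Sum>n\<in>{n. 1 \<le> n \<and> real n \<le> exp u}. moment_exp z ^ omega n)"
    using moment_exp[of z] by (intro sum_mono power_mono) auto
  also have "\<dots> \<le> exp 1 * exp u * (2 + ln (exp u)) powr moment_exp z"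
    using u by (intro omega_moment_bound moment_exp) auto
  finally have "exp (- u) * norm (omega_sum z (exp u)) \<le> exp (- u) * (exp 1 * exp u * (2 + u) powr moment_exp z)"
    by (intro mult_left_mono) auto
  also have "\<dots> = exp 1 * (2 + u) powr moment_exp z" by (simp add: exp_minus field_simps)
  finally show ?thesis using u by (simp add: omega_sum_exp_def norm_mult)
qed

text \<open>
  By Cauchy--Schwarz a short interval still gains the square root of its length, while powers of $|z|$
  cost only powers of the logarithm; hence smoothing on the scale of a negative power of $u$ is harmless.
\<close>

lemma omega_sum_diff_bound:
  assumes uv: "0 \<le> u" "u \<le> v"
  shows "exp (- v) * norm (omega_sum z (exp v) - omega_sum z (exp u)) \<le> exp 1 * (2 + v) powr moment_exp z * (sqrt (v - u) + exp (- v / 2))"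
proof -
  define R where "R = moment_exp z"
  have R: "R \<ge> 1" "(norm z)\<^sup>2 \<le> R" using moment_exp[of z] by (auto simp: R_def)
  define B where "B = {n. exp u < real n \<and> real n \<le> exp v}"
  define V where "V = {n. 1 \<le> n \<and> real n \<le> exp v}"
  have finV: "finite V" unfolding V_def by (rule finite_nat_le)
  have BV: "B \<subseteq> V"
  proof
    fix n assume "n \<in> B"
    hence "n \<noteq> 0" "real n \<le> exp v" using not_exp_less_zero[of u] by (auto simp: B_def intro!: gr0I)
    thus "n \<in> V" by (simp add: V_def)
  qed
  have eV: "exp u \<le> exp v" using uv by simp
  have "V = {n. 1 \<le> n \<and> real n \<le> exp u} \<union> B" using BV by (auto simp: V_def B_def intro: order_trans[OF _ eV])
  moreover have "{n. 1 \<le> n \<and> real n \<le> exp u} \<inter> B = {}" by (auto simp: B_def)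
  ultimately have "omega_sum z (exp v) = omega_sum z (exp u) + (\<Sum>n\<in>B. z ^ omega n)"
    unfolding omega_sum_def V_def[symmetric] using finite_subset[OF BV finV] finite_nat_le
    by (simp add: sum.union_disjoint)
  hence "norm (omega_sum z (exp v) - omega_sum z (exp u)) \<le> (\<Sum>n\<in>B. norm z ^ omega n)"
    using norm_sum[of "\<lambda>n. z ^ omega n" B] by (simp add: norm_power)
  also have "\<dots> = (\<Sum>n\<in>B. \<bar>1\<bar> * \<bar>norm z ^ omega n\<bar>)" by simp
  also have "\<dots> \<le> L2_set (\<lambda>n. 1) B * L2_set (\<lambda>n. norm z ^ omega n) B"
    by (rule L2_set_mult_ineq)
  also have "L2_set (\<lambda>n. 1) B \<le> sqrt (exp v * (v - u) + 1)"
  proof -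
    have "B \<subseteq> {nat \<lfloor>exp u\<rfloor><..nat \<lfloor>exp v\<rfloor>}"
      unfolding B_def by (auto simp: nat_less_iff floor_less_iff le_nat_iff le_floor_iff)
    hence "card B \<le> card {nat \<lfloor>exp u\<rfloor><..nat \<lfloor>exp v\<rfloor>}" by (intro card_mono) auto
    hence "real (card B) \<le> real (nat \<lfloor>exp v\<rfloor> - nat \<lfloor>exp u\<rfloor>)" by simp
    also have "\<dots> \<le> exp v - exp u + 1"
    proof -
      have "nat \<lfloor>exp u\<rfloor> \<le> nat \<lfloor>exp v\<rfloor>" using eV by (intro nat_mono floor_mono)
      hence "real (nat \<lfloor>exp v\<rfloor> - nat \<lfloor>exp u\<rfloor>) = of_int \<lfloor>exp v\<rfloor> - of_int \<lfloor>exp u\<rfloor>"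
        by (simp add: of_nat_diff)
      thus ?thesis by linarith
    qed
    also have "exp v - exp u \<le> exp v * (v - u)"
    proof -
      have "1 + - (v - u) \<le> exp (- (v - u))" by (rule exp_ge_add_one_self)
      hence "exp v * (1 + - (v - u)) \<le> exp v * exp (- (v - u))" by (rule mult_left_mono) simp
      also have "exp v * exp (- (v - u)) = exp u" by (simp add: exp_add[symmetric])
      finally show ?thesis by (simp add: algebra_simps)
    qed
    finally have "real (card B) \<le> exp v * (v - u) + 1" by simp
    thus ?thesis by (simp add: L2_set_def)
  qed
  also have "L2_set (\<lambda>n. norm z ^ omega n) B \<le> sqrt (exp 1 * exp v * (2 + v) powr R)"
  proof -
    have "(\<Sum>n\<in>B. (norm z ^ omega n)\<^sup>2) \<le> (\<Sum>n\<in>V. (norm z ^ omega n)\<^sup>2)"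
      by (intro sum_mono2 finV BV) auto
    also have "\<dots> = (\<Sum>n\<in>V. ((norm z)\<^sup>2) ^ omega n)" by (simp add: power_mult[symmetric] mult.commute)
    also have "\<dots> \<le> (\<Sum>n\<in>V. R ^ omega n)" using R by (intro sum_mono power_mono) auto
    also have "\<dots> \<le> exp 1 * exp v * (2 + ln (exp v)) powr R"
      unfolding V_def using uv by (intro omega_moment_bound R) auto
    finally show ?thesis by (simp add: L2_set_def)
  qed
  finally have "norm (omega_sum z (exp v) - omega_sum z (exp u)) \<le> sqrt (exp v * (v - u) + 1) * sqrt (exp 1 * exp v * (2 + v) powr R)"
    using uv by (simp add: mult_left_mono mult_right_mono L2_set_nonneg)
  hence "exp (- v) * norm (omega_sum z (exp v) - omega_sum z (exp u)) \<le> exp (- v) * (sqrt (exp v * (v - u) + 1) * sqrt (exp 1 * exp v * (2 + v) powr R))"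
    by (intro mult_left_mono) auto
  also have "\<dots> = sqrt ((v - u) + exp (- v)) * sqrt (exp 1 * (2 + v) powr R)"
  proof -
    have "exp (- v) = sqrt (exp (- v) * exp (- v))" by simp
    hence "exp (- v) * (sqrt (exp v * (v - u) + 1) * sqrt (exp 1 * exp v * (2 + v) powr R)) =
       sqrt ((exp (- v) * (exp v * (v - u) + 1)) * (exp (- v) * (exp 1 * exp v * (2 + v) powr R)))"
      by (simp only: real_sqrt_mult) (simp add: mult_ac)
    also have "exp (- v) * (exp v * (v - u) + 1) = (v - u) + exp (- v)" by (simp add: exp_minus field_simps)
    also have "exp (- v) * (exp 1 * exp v * (2 + v) powr R) = exp 1 * (2 + v) powr R" by (simp add: exp_minus field_simps)
    finally show ?thesis by (simp only: real_sqrt_mult)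
  qed
  also have "\<dots> \<le> (sqrt (v - u) + exp (- v / 2)) * (exp 1 * (2 + v) powr R)"
  proof (rule mult_mono)
    have "sqrt ((v - u) + exp (- v)) \<le> sqrt (v - u) + sqrt (exp (- v))"
      using uv by (intro sqrt_add_le_add_sqrt) auto
    also have "sqrt (exp (- v)) = exp (- v / 2)"
      by (intro real_sqrt_unique) (auto simp: power2_eq_square exp_add[symmetric])
    finally show "sqrt ((v - u) + exp (- v)) \<le> sqrt (v - u) + exp (- v / 2)" .
    define Y where "Y = exp 1 * (2 + v) powr R"
    have "(1::real) * 1 \<le> exp 1 * (2 + v) powr R" using uv R by (intro mult_mono ge_one_powr_ge_zero) auto
    hence "Y \<ge> 1" by (simp add: Y_def)
    hence "Y * 1 \<le> Y * Y" by (intro mult_left_mono) auto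
    hence "Y \<le> Y\<^sup>2" by (simp add: power2_eq_square)
    hence "sqrt Y \<le> Y" using \<open>Y \<ge> 1\<close> by (intro real_le_lsqrt) auto
    thus "sqrt (exp 1 * (2 + v) powr R) \<le> exp 1 * (2 + v) powr R" by (simp add: Y_def)
  qed (use uv in auto)
  finally show ?thesis by (simp add: R_def mult_ac)
qed

lemma exp_diff_le:
  fixes u v c :: real
  assumes "0 \<le> u" "u \<le> v" "0 \<le> c" "c \<le> 1"
  shows "\<bar>exp (- c * v) - exp (- c * u)\<bar> \<le> v - u"
proof -
  have "1 + (- (c * (v - u))) \<le> exp (- (c * (v - u)))" by (rule exp_ge_add_one_self)
  hence "1 - exp (- (c * (v - u))) \<le> c * (v - u)" by simp
  also have "c * (v - u) \<le> 1 * (v - u)" using assms by (intro mult_right_mono) auto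
  finally have 1: "1 - exp (- (c * (v - u))) \<le> v - u" by simp
  have "exp (- c * u) - exp (- c * v) = exp (- c * u) * (1 - exp (- (c * (v - u))))"
    by (simp add: right_diff_distrib exp_add[symmetric] algebra_simps)
  also have "\<dots> \<le> 1 * (v - u)" using assms 1 by (intro mult_mono) auto
  finally have "exp (- c * u) - exp (- c * v) \<le> v - u" by simp
  moreover have "c * u \<le> c * v" using assms by (intro mult_left_mono) auto
  hence "exp (- c * v) \<le> exp (- c * u)" by simp
  ultimately show ?thesis by linarith
qed

lemma omega_sum_exp_diff_bound:
  assumes uv: "0 \<le> u" "u \<le> v"
  shows "norm (omega_sum_exp z v - omega_sum_exp z u) \<le> exp 1 * (2 + v) powr moment_exp z * (sqrt (v - u) + exp (- v / 2) + (v - u))"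
proof -
  define R where "R = moment_exp z"
  have R: "R \<ge> 1" using moment_exp[of z] by (auto simp: R_def)
  have "omega_sum_exp z v - omega_sum_exp z u = of_real (exp (- v)) * (omega_sum z (exp v) - omega_sum z (exp u)) + of_real (exp (- (v - u)) - 1) * omega_sum_exp z u"
  proof -
    have "exp (- (v - u)) * exp (- u) = exp (- v)" by (simp add: exp_add[symmetric])
    hence "complex_of_real (exp (- (v - u))) * of_real (exp (- u)) = of_real (exp (- v))" by (metis of_real_mult)
    thus ?thesis using uv by (simp add: omega_sum_exp_def algebra_simps)
  qed
  hence "norm (omega_sum_exp z v - omega_sum_exp z u) \<le> exp (- v) * norm (omega_sum z (exp v) - omega_sum z (exp u)) + \<bar>exp (- (v - u)) - 1\<bar> * norm (omega_sum_exp z u)"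
    using norm_triangle_ineq[of "of_real (exp (- v)) * (omega_sum z (exp v) - omega_sum z (exp u))" "of_real (exp (- (v - u)) - 1) * omega_sum_exp z u"]
    by (simp add: norm_mult del: of_real_diff)
  also have "\<dots> \<le> exp 1 * (2 + v) powr R * (sqrt (v - u) + exp (- v / 2)) + (v - u) * (exp 1 * (2 + v) powr R)"
  proof (rule add_mono)
    show "exp (- v) * norm (omega_sum z (exp v) - omega_sum z (exp u)) \<le> exp 1 * (2 + v) powr R * (sqrt (v - u) + exp (- v / 2))"
      unfolding R_def by (rule omega_sum_diff_bound[OF uv])
    have 1: "\<bar>exp (- (v - u)) - 1\<bar> \<le> v - u" using exp_diff_le[of 0 "v - u" 1] uv by simp
    have "norm (omega_sum_exp z u) \<le> exp 1 * (2 + u) powr R" unfolding R_def by (rule omega_sum_exp_bound[OF uv(1)])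
    also have "\<dots> \<le> exp 1 * (2 + v) powr R" using uv R by (intro mult_left_mono powr_mono2) auto
    finally have 2: "norm (omega_sum_exp z u) \<le> exp 1 * (2 + v) powr R" .
    show "\<bar>exp (- (v - u)) - 1\<bar> * norm (omega_sum_exp z u) \<le> (v - u) * (exp 1 * (2 + v) powr R)"
      using uv by (intro mult_mono 1 2) auto
  qed
  also have "\<dots> = exp 1 * (2 + v) powr R * (sqrt (v - u) + exp (- v / 2) + (v - u))" by (simp add: algebra_simps)
  finally show ?thesis by (simp add: R_def)
qed

lemma gamma_kernel_diff_bound:
  assumes z: "Re z > 0" and uv: "0 \<le> u" "u \<le> v"
  shows "norm (gamma_kernel (z + 2) v - gamma_kernel (z + 2) u) \<le> norm (z + 1) * v powr Re z * (v - u)"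
proof (cases "u = 0")
  case True
  have "1 \<le> Re (z + 1)" using z by simp
  also have "\<dots> \<le> norm (z + 1)" by (rule complex_Re_le_cmod)
  finally have 1: "1 \<le> norm (z + 1)" .
  have "norm (gamma_kernel (z + 2) v - gamma_kernel (z + 2) u) \<le> v powr Re z * v"
    using uv True by (cases "v = 0") (auto simp: norm_gamma_kernel gamma_kernel_def[of _ 0] powr_add)
  also have "\<dots> \<le> norm (z + 1) * (v powr Re z * v)" using 1 uv mult_right_mono[OF 1, of "v powr Re z * v"] by simp
  finally show ?thesis using True by (simp add: mult_ac)
next
  case False
  hence u: "u > 0" using uv by simp
  have seg: "\<exists>x. w = of_real x \<and> u \<le> x \<and> x \<le> v" if "w \<in> closed_segment (complex_of_real u) (of_real v)" for w
    using that uv by (auto simp: closed_segment_of_real closed_segment_eq_real_ivl)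
  have "norm ((complex_of_real v) powr (z + 1) - (of_real u) powr (z + 1)) \<le> norm (z + 1) * v powr Re z * norm (complex_of_real v - of_real u)"
  proof (rule field_differentiable_bound[where S = "closed_segment (complex_of_real u) (of_real v)" and f' = "\<lambda>w. (z + 1) * w powr z"])
    fix w assume "w \<in> closed_segment (complex_of_real u) (of_real v)"
    then obtain x where x: "w = of_real x" "u \<le> x" "x \<le> v" using seg by blast
    have "w \<notin> \<real>\<^sub>\<le>\<^sub>0" using x u by (auto simp: complex_nonpos_Reals_iff)
    from has_field_derivative_powr[OF this, of "z + 1"]
    show "((\<lambda>w. w powr (z + 1)) has_field_derivative (z + 1) * w powr z) (at w within closed_segment (complex_of_real u) (of_real v))"
      by (simp add: has_field_derivative_at_within)
    have "norm (w powr z) = x powr Re z" using x u norm_powr_real_powr[of w z] by simp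
    also have "\<dots> \<le> v powr Re z" using x u z by (intro powr_mono2) auto
    finally show "norm ((z + 1) * w powr z) \<le> norm (z + 1) * v powr Re z" by (simp add: norm_mult mult_left_mono)
  qed auto
  moreover have "norm (complex_of_real v - of_real u) = v - u"
    using uv by (metis abs_of_nonneg diff_ge_0_iff_ge norm_of_real of_real_diff)
  ultimately show ?thesis using u uv by (simp add: gamma_kernel_def add.commute)
qed

lemma powr_le_power:
  fixes v a :: real
  assumes "v \<ge> 0" "a \<le> real M"
  shows "(3 + v) powr a \<le> (3 + v) ^ M"
proof -
  have "(3 + v) powr a \<le> (3 + v) powr real M" using assms by (intro powr_mono) auto
  thus ?thesis using assms by (simp add: powr_realpow)
qed

text \<open>Coarse bounds suffice here, as a power of v is affordable. The square root comes from
  Cauchy--Schwarz, and exp(-v/2) from the single integer that an arbitrarily short interval may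
  contain.\<close>

lemma err_growth:
  assumes z: "Re z > 0"
  shows "\<exists>M C. M \<ge> 1 \<and> C > 0 \<and> (\<forall>v\<ge>0. norm (err z v) \<le> C * (3 + v) ^ M) \<and>
     (\<forall>u v. 0 \<le> u \<and> u \<le> v \<and> v - u \<le> 1 \<longrightarrow> norm (err z v - err z u) \<le> C * (3 + v) ^ M * (sqrt (v - u) + exp (- v / 2)))"
proof -
  define R where "R = moment_exp z"
  have R: "R \<ge> 1" using moment_exp[of z] by (auto simp: R_def)
  define k where "k = Re z"
  have k: "k > 0" using z by (simp add: k_def)
  \<comment> \<open>R and k are the growth exponents of the sum and of the kernel; 3 more leave room
    for the factor v^2 and the exponent k + 1. M is a natural number because |y|^M is later
    integrated as a Gaussian moment.\<close>
  define M where "M = nat \<lceil>R + k\<rceil> + 3"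
  have M: "real M \<ge> R + k + 3" unfolding M_def using R k by linarith
  define c where "c = norm (g_one z / Gamma z)"
  have c0: "c \<ge> 0" by (simp add: c_def)
  define C where "C = 6 * exp 1 + c * (1 + norm (z + 1))"
  have C0: "C > 0" unfolding C_def using c0 by (intro add_pos_nonneg) auto
  have D: "norm (omega_sum_exp z v) \<le> exp 1 * (3 + v) powr R" if "v \<ge> 0" for v
  proof -
    have "norm (omega_sum_exp z v) \<le> exp 1 * (2 + v) powr R" unfolding R_def by (rule omega_sum_exp_bound[OF that])
    also have "\<dots> \<le> exp 1 * (3 + v) powr R" using that R by (intro mult_left_mono powr_mono2) auto
    finally show ?thesis .
  qed
  have v2: "v\<^sup>2 * (3 + v) powr R \<le> (3 + v) ^ M" if "v \<ge> 0" for v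
  proof -
    have "v\<^sup>2 * (3 + v) powr R \<le> (3 + v)\<^sup>2 * (3 + v) powr R" using that by (intro mult_right_mono power_mono) auto
    also have "\<dots> = (3 + v) powr (2 + R)" using that by (simp add: powr_add powr_numeral)
    also have "\<dots> \<le> (3 + v) ^ M" using that M k by (intro powr_le_power) auto
    finally show ?thesis .
  qed
  have b1: "norm (err z v) \<le> C * (3 + v) ^ M" if v: "v \<ge> 0" for v
  proof -
    have "norm (of_real (v\<^sup>2) * omega_sum_exp z v) \<le> v\<^sup>2 * (exp 1 * (3 + v) powr R)"
      unfolding norm_mult norm_of_real using D[OF v] by (simp add: mult_left_mono)
    also have "\<dots> \<le> exp 1 * (3 + v) ^ M" using v2[OF v] by (simp add: mult_left_mono mult.left_commute)
    finally have 1: "norm (of_real (v\<^sup>2) * omega_sum_exp z v) \<le> exp 1 * (3 + v) ^ M" .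
    have "norm (gamma_kernel (z + 2) v) \<le> v powr (k + 1)" using v by (simp add: norm_gamma_kernel k_def add.commute)
    also have "\<dots> \<le> (3 + v) powr (k + 1)" using v k by (intro powr_mono2) auto
    also have "\<dots> \<le> (3 + v) ^ M" using v M R by (intro powr_le_power) auto
    finally have "norm (g_one z / Gamma z * gamma_kernel (z + 2) v) \<le> c * (3 + v) ^ M"
      unfolding norm_mult c_def by (intro mult_left_mono) auto
    with 1 have "norm (err z v) \<le> exp 1 * (3 + v) ^ M + c * (3 + v) ^ M"
      unfolding err_def by (intro norm_triangle_le_diff add_mono)
    also have "\<dots> = (exp 1 + c) * (3 + v) ^ M" by (simp add: algebra_simps)
    also have "\<dots> \<le> C * (3 + v) ^ M" unfolding C_def using v c0
      by (intro mult_right_mono) (auto simp: algebra_simps)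
    finally show ?thesis .
  qed
  have b2: "norm (err z v - err z u) \<le> C * (3 + v) ^ M * (sqrt (v - u) + exp (- v / 2))"
    if uv: "0 \<le> u" "u \<le> v" "v - u \<le> 1" for u v
  proof -
    define h where "h = sqrt (v - u) + exp (- v / 2)"
    have h: "v - u \<le> sqrt (v - u)"
      using uv by (intro real_le_rsqrt) (auto simp: power2_eq_square intro: mult_left_le)
    have h': "v - u \<le> h" "h \<ge> 0" unfolding h_def using h uv by (auto simp: add_increasing2)
    have v: "v \<ge> 0" using uv by simp
    have P: "(3 + v) ^ M \<ge> 0" using v by simp
    have eq: "err z v - err z u = of_real (v\<^sup>2) * (omega_sum_exp z v - omega_sum_exp z u) + of_real (v\<^sup>2 - u\<^sup>2) * omega_sum_exp z u
       - g_one z / Gamma z * (gamma_kernel (z + 2) v - gamma_kernel (z + 2) u)"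
      by (simp add: err_def algebra_simps)
    have t1: "norm (of_real (v\<^sup>2) * (omega_sum_exp z v - omega_sum_exp z u)) \<le> 2 * exp 1 * (3 + v) ^ M * h"
    proof -
      have "norm (omega_sum_exp z v - omega_sum_exp z u) \<le> exp 1 * (2 + v) powr R * (sqrt (v - u) + exp (- v / 2) + (v - u))"
        unfolding R_def by (rule omega_sum_exp_diff_bound[OF uv(1,2)])
      also have "\<dots> \<le> exp 1 * (3 + v) powr R * (2 * h)"
        using v R uv h' by (intro mult_mono powr_mono2) (auto simp: h_def)
      finally have "v\<^sup>2 * norm (omega_sum_exp z v - omega_sum_exp z u) \<le> v\<^sup>2 * (exp 1 * (3 + v) powr R * (2 * h))"
        by (intro mult_left_mono) auto
      also have "\<dots> = 2 * exp 1 * h * (v\<^sup>2 * (3 + v) powr R)" by (simp add: mult_ac)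
      also have "\<dots> \<le> 2 * exp 1 * h * (3 + v) ^ M" using v2[OF v] h' by (intro mult_left_mono) auto
      finally show ?thesis unfolding norm_mult norm_of_real by (simp add: mult_ac)
    qed
    have t2: "norm (of_real (v\<^sup>2 - u\<^sup>2) * omega_sum_exp z u) \<le> 2 * exp 1 * (3 + v) ^ M * h"
    proof -
      have d: "v\<^sup>2 - u\<^sup>2 = (v - u) * (v + u)" by (simp add: power2_eq_square algebra_simps)
      have "norm (omega_sum_exp z u) \<le> exp 1 * (3 + u) powr R" by (rule D[OF uv(1)])
      also have "\<dots> \<le> exp 1 * (3 + v) powr R" using uv R by (intro mult_left_mono powr_mono2) auto
      finally have D': "norm (omega_sum_exp z u) \<le> exp 1 * (3 + v) powr R" .
      have "norm (of_real (v\<^sup>2 - u\<^sup>2) * omega_sum_exp z u) = (v - u) * (v + u) * norm (omega_sum_exp z u)"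
        unfolding norm_mult norm_of_real d using uv by simp
      also have "\<dots> \<le> h * (2 * (3 + v)) * (exp 1 * (3 + v) powr R)"
        using uv h' D' by (intro mult_mono) auto
      also have "\<dots> = 2 * exp 1 * h * (3 + v) powr (1 + R)" using v by (simp add: powr_add mult_ac)
      also have "\<dots> \<le> 2 * exp 1 * h * (3 + v) ^ M" using v M k h' by (intro mult_left_mono powr_le_power) auto
      finally show ?thesis by (simp add: mult_ac)
    qed
    have t3: "norm (g_one z / Gamma z * (gamma_kernel (z + 2) v - gamma_kernel (z + 2) u)) \<le> c * norm (z + 1) * (3 + v) ^ M * h"
    proof -
      have "norm (gamma_kernel (z + 2) v - gamma_kernel (z + 2) u) \<le> norm (z + 1) * v powr k * (v - u)"
        unfolding k_def by (rule gamma_kernel_diff_bound[OF z uv(1,2)])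
      also have "v powr k \<le> (3 + v) powr k" using v k by (intro powr_mono2) auto
      also have "(3 + v) powr k \<le> (3 + v) ^ M" using v M R by (intro powr_le_power) auto
      also have "v - u \<le> h" by (rule h')
      finally have "norm (gamma_kernel (z + 2) v - gamma_kernel (z + 2) u) \<le> norm (z + 1) * (3 + v) ^ M * h"
        using uv v by (simp add: mult_left_mono mult_right_mono)
      thus ?thesis unfolding norm_mult[of "g_one z / Gamma z"] c_def using mult_left_mono[of _ _ "norm (g_one z / Gamma z)"]
        by (simp add: mult.assoc)
    qed
    have "norm (err z v - err z u) \<le> 2 * exp 1 * (3 + v) ^ M * h + 2 * exp 1 * (3 + v) ^ M * h + c * norm (z + 1) * (3 + v) ^ M * h"
      unfolding eq by (intro norm_triangle_le_diff norm_triangle_le add_mono t1 t2 t3)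
    also have "\<dots> = (4 * exp 1 + c * norm (z + 1)) * ((3 + v) ^ M * h)" by (simp add: algebra_simps)
    also have "\<dots> \<le> C * ((3 + v) ^ M * h)" unfolding C_def using P h' c0
      by (intro mult_right_mono) (auto simp: algebra_simps)
    finally show ?thesis by (simp add: h_def mult.assoc)
  qed
  have "M \<ge> 1" by (simp add: M_def)
  with C0 b1 b2 show ?thesis by blast
qed

text \<open>Within distance 1 of u >= 1 the other point is nonnegative and \<open>err_growth\<close>
  applies. Beyond that only growth is used, with 3 + u + |u-v| bounded by 2 (3+u) |u-v|; at negative
  points \<open>err\<close> vanishes.\<close>

lemma damped_err_diff:
  assumes z: "Re z > 0"
  shows "\<exists>M C. M \<ge> 1 \<and> C > 0 \<and> (\<forall>\<delta> u v. 0 < \<delta> \<and> \<delta> \<le> 1 \<and> u \<ge> 1 \<longrightarrow>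
     norm (of_real (exp (- \<delta> * u)) * err z u - of_real (exp (- \<delta> * v)) * err z v)
       \<le> C * (3 + u) ^ M * (sqrt \<bar>u - v\<bar> + \<bar>u - v\<bar> ^ M + exp (- u / 2)))"
proof -
  obtain M C where M: "M \<ge> 1" "C > 0" and g: "\<And>v. v \<ge> 0 \<Longrightarrow> norm (err z v) \<le> C * (3 + v) ^ M"
    and l: "\<And>u v. 0 \<le> u \<Longrightarrow> u \<le> v \<Longrightarrow> v - u \<le> 1 \<Longrightarrow> norm (err z v - err z u) \<le> C * (3 + v) ^ M * (sqrt (v - u) + exp (- v / 2))"
    using err_growth[OF z] by blast
  have loc: "norm (of_real (exp (- \<delta> * v)) * err z v - of_real (exp (- \<delta> * u)) * err z u)
       \<le> 2 * C * (3 + v) ^ M * (sqrt (v - u) + exp (- v / 2))"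
    if uv: "0 \<le> u" "u \<le> v" "v - u \<le> 1" and d: "0 < \<delta>" "\<delta> \<le> 1" for u v \<delta>
  proof -
    have h: "v - u \<le> sqrt (v - u)"
      using uv by (intro real_le_rsqrt) (auto simp: power2_eq_square intro: mult_left_le)
    have eq: "of_real (exp (- \<delta> * v)) * err z v - of_real (exp (- \<delta> * u)) * err z u =
       of_real (exp (- \<delta> * v)) * (err z v - err z u) + of_real (exp (- \<delta> * v) - exp (- \<delta> * u)) * err z u"
      by (simp add: algebra_simps)
    have "norm (of_real (exp (- \<delta> * v)) * (err z v - err z u)) \<le> 1 * (C * (3 + v) ^ M * (sqrt (v - u) + exp (- v / 2)))"
      unfolding norm_mult using uv d M by (intro mult_mono l) auto
    moreover have "norm (of_real (exp (- \<delta> * v) - exp (- \<delta> * u)) * err z u) \<le> (sqrt (v - u) + exp (- v / 2)) * (C * (3 + v) ^ M)"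
      unfolding norm_mult norm_of_real
    proof (rule mult_mono)
      show "\<bar>exp (- \<delta> * v) - exp (- \<delta> * u)\<bar> \<le> sqrt (v - u) + exp (- v / 2)"
        using exp_diff_le[of u v \<delta>] uv d h exp_ge_zero[of "-v/2"] by linarith
      have "norm (err z u) \<le> C * (3 + u) ^ M" by (rule g[OF uv(1)])
      also have "\<dots> \<le> C * (3 + v) ^ M" using uv M by (intro mult_left_mono power_mono) auto
      finally show "norm (err z u) \<le> C * (3 + v) ^ M" .
    qed (use uv in auto)
    ultimately have "norm (of_real (exp (- \<delta> * v)) * err z v - of_real (exp (- \<delta> * u)) * err z u) \<le>
       1 * (C * (3 + v) ^ M * (sqrt (v - u) + exp (- v / 2))) + (sqrt (v - u) + exp (- v / 2)) * (C * (3 + v) ^ M)"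
      unfolding eq by (intro norm_triangle_le add_mono)
    thus ?thesis by (simp add: algebra_simps)
  qed
  define C' where "C' = 2 * C * 2 ^ M"
  have C': "C' > 0" using M by (simp add: C'_def)
  have "norm (of_real (exp (- \<delta> * u)) * err z u - of_real (exp (- \<delta> * v)) * err z v)
       \<le> C' * (3 + u) ^ M * (sqrt \<bar>u - v\<bar> + \<bar>u - v\<bar> ^ M + exp (- u / 2))"
    if d: "0 < \<delta>" "\<delta> \<le> 1" and u: "u \<ge> 1" for \<delta> u v
  proof (cases "\<bar>u - v\<bar> \<le> 1")
    case True
    define w where "w = max u v"
    have w: "w \<ge> u" "w \<le> u + 1" using True by (auto simp: w_def)
    have "norm (of_real (exp (- \<delta> * u)) * err z u - of_real (exp (- \<delta> * v)) * err z v)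
      \<le> 2 * C * (3 + w) ^ M * (sqrt \<bar>u - v\<bar> + exp (- w / 2))"
    proof (cases "u \<le> v")
      case True
      thus ?thesis using loc[of u v \<delta>] \<open>\<bar>u - v\<bar> \<le> 1\<close> u d by (simp add: w_def norm_minus_commute)
    next
      case False
      thus ?thesis using loc[of v u \<delta>] \<open>\<bar>u - v\<bar> \<le> 1\<close> u d by (simp add: w_def)
    qed
    also have "\<dots> \<le> 2 * C * (2 ^ M * (3 + u) ^ M) * (sqrt \<bar>u - v\<bar> + \<bar>u - v\<bar> ^ M + exp (- u / 2))"
    proof (intro mult_mono mult_left_mono)
      have "(3 + w) ^ M \<le> (2 * (3 + u)) ^ M" using w u by (intro power_mono) auto
      thus "(3 + w) ^ M \<le> 2 ^ M * (3 + u) ^ M" unfolding power_mult_distrib .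
      show "sqrt \<bar>u - v\<bar> + exp (- w / 2) \<le> sqrt \<bar>u - v\<bar> + \<bar>u - v\<bar> ^ M + exp (- u / 2)"
        using w by (intro add_mono) auto
    qed (use M u w in auto)
    finally show ?thesis by (simp add: C'_def mult_ac)
  next
    case False
    define h where "h = \<bar>u - v\<bar>"
    have h: "h > 1" using False by (simp add: h_def)
    have pw: "(3 + u + h) ^ M \<le> 2 ^ M * (3 + u) ^ M * h ^ M"
    proof -
      have "(3 + u) * 1 \<le> (3 + u) * h" "1 * h \<le> (3 + u) * h"
        using u h by (intro mult_left_mono mult_right_mono; simp)+
      hence "3 + u + h \<le> 2 * (3 + u) * h" unfolding mult.assoc mult_1 mult_1_right by linarith
      hence "(3 + u + h) ^ M \<le> (2 * (3 + u) * h) ^ M" using u h by (intro power_mono) auto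
      thus ?thesis unfolding power_mult_distrib .
    qed
    have b: "norm (of_real (exp (- \<delta> * w)) * err z w) \<le> C * (3 + u + h) ^ M" if "w \<le> u + h" for w
    proof (cases "w < 0")
      case True
      thus ?thesis using laplace_admissibleD(2)[OF err_admissible[OF z] True] M u h by simp
    next
      case False
      have "norm (of_real (exp (- \<delta> * w)) * err z w) \<le> 1 * (C * (3 + w) ^ M)"
        unfolding norm_mult using False d by (intro mult_mono g) auto
      also have "\<dots> \<le> C * (3 + u + h) ^ M" unfolding mult_1 using False that M by (intro mult_left_mono power_mono) auto
      finally show ?thesis .
    qed
    have "norm (of_real (exp (- \<delta> * u)) * err z u - of_real (exp (- \<delta> * v)) * err z v) \<le> C * (3 + u + h) ^ M + C * (3 + u + h) ^ M"
      using h by (intro norm_triangle_le_diff add_mono b) (auto simp: h_def)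
    also have "\<dots> = 2 * C * (3 + u + h) ^ M" by simp
    also have "\<dots> \<le> 2 * C * (2 ^ M * (3 + u) ^ M * h ^ M)" using pw M by (intro mult_left_mono) auto
    also have "\<dots> = C' * (3 + u) ^ M * h ^ M" by (simp add: C'_def mult_ac)
    also have "\<dots> \<le> C' * (3 + u) ^ M * (sqrt h + h ^ M + exp (- u / 2))"
      using C' u h by (intro mult_left_mono) auto
    finally show ?thesis by (simp add: h_def)
  qed
  with C' M show ?thesis by blast
qed

text \<open>The value at u is its Gaussian average plus the average of the differences over
  displacements y/T. By \<open>damped_err_diff\<close> the latter is O((3+u)^M (T^(-1/2) +
  exp(-u/2))).\<close>

lemma damped_err_bound:
  assumes z: "Re z > 0"
  shows "\<exists>M \<tau>. M \<ge> (1::nat) \<and> \<tau> > 0 \<and> \<tau> \<le> 1 \<and> (\<forall>e>0. \<exists>C>0. \<forall>\<delta> T u. 0 < \<delta> \<and> \<delta> \<le> \<tau> \<and> T \<ge> 1 \<and> u \<ge> 1 \<longrightarrow>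
     norm (of_real (exp (- \<delta> * u)) * err z u) \<le> C * (\<delta> powr (- Re z) + T powr e + (3 + u) ^ M * (1 / sqrt T + exp (- u / 2))))"
proof -
  obtain M C1 where M: "M \<ge> 1" "C1 > 0" and dd: "\<And>\<delta> u v. 0 < \<delta> \<Longrightarrow> \<delta> \<le> 1 \<Longrightarrow> u \<ge> 1 \<Longrightarrow>
     norm (of_real (exp (- \<delta> * u)) * err z u - of_real (exp (- \<delta> * v)) * err z v)
       \<le> C1 * (3 + u) ^ M * (sqrt \<bar>u - v\<bar> + \<bar>u - v\<bar> ^ M + exp (- u / 2))"
    using damped_err_diff[OF z] by blast
  obtain \<tau> where tau: "\<tau> > 0" "\<tau> \<le> 1" and sb: "\<And>e. e > 0 \<Longrightarrow> \<exists>C>0. \<forall>\<delta> T u. 0 < \<delta> \<and> \<delta> \<le> \<tau> \<and> T > 0 \<longrightarrow>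
     norm (LINT y|lborel. of_real (std_normal_density y) * (of_real (exp (- \<delta> * (u + y / T))) * err z (u + y / T)))
       \<le> C * (\<delta> powr (- Re z) + T powr e)"
    using smoothing_bound[OF z] by blast
  define n where "n = std_normal_density"
  have n: "n y \<ge> 0" "n y \<le> 1" for y using std_normal_density_bounds[of y] by (auto simp: n_def)
  have nm [measurable]: "n \<in> borel_measurable borel" unfolding n_def by auto
  have ni: "integrable lborel n" unfolding n_def using integrable_normal_density[of 1 0] by simp
  have n1: "integral\<^sup>L lborel n = 1" unfolding n_def using integral_normal_density[of 1 0] by simp
  \<comment> \<open>Dominates the moments of the square root of |y| and of |y|^M that the modulus of
    continuity produces.\<close>
  define q where "q = (\<lambda>y. n y * (1 + \<bar>y\<bar> ^ 1 + \<bar>y\<bar> ^ M))"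
  have qi: "integrable lborel q"
    unfolding q_def distrib_left
    using ni integrable_std_normal_moment_abs[of 1] integrable_std_normal_moment_abs[of M]
    by (intro Bochner_Integration.integrable_add) (simp_all add: n_def)
  define K where "K = integral\<^sup>L lborel q"
  have K0: "K \<ge> 0" unfolding K_def q_def using n by (intro Bochner_Integration.integral_nonneg) auto
  have "\<exists>C>0. \<forall>\<delta> T u. 0 < \<delta> \<and> \<delta> \<le> \<tau> \<and> T \<ge> 1 \<and> u \<ge> 1 \<longrightarrow>
     norm (of_real (exp (- \<delta> * u)) * err z u) \<le> C * (\<delta> powr (- Re z) + T powr e + (3 + u) ^ M * (1 / sqrt T + exp (- u / 2)))" if e: "e > 0" for e
  proof -
    obtain C2 where C2: "C2 > 0" "\<And>\<delta> T u. 0 < \<delta> \<Longrightarrow> \<delta> \<le> \<tau> \<Longrightarrow> T > 0 \<Longrightarrow>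
     norm (LINT y|lborel. of_real (n y) * (of_real (exp (- \<delta> * (u + y / T))) * err z (u + y / T)))
       \<le> C2 * (\<delta> powr (- Re z) + T powr e)"
      using sb[OF e] unfolding n_def by blast
    define C where "C = C2 + C1 * (K + 1)"
    have C: "C \<ge> C2" "C \<ge> C1 * (K + 1)" "C > 0" using C2(1) M K0 by (auto simp: C_def add_pos_nonneg)
    have "norm (of_real (exp (- \<delta> * u)) * err z u) \<le> C * (\<delta> powr (- Re z) + T powr e + (3 + u) ^ M * (1 / sqrt T + exp (- u / 2)))"
      if d: "0 < \<delta>" "\<delta> \<le> \<tau>" and T: "T \<ge> 1" and u: "u \<ge> 1" for \<delta> T u
    proof -
      define a where "a = (\<lambda>v. complex_of_real (exp (- \<delta> * v)) * err z v)"
      have a_eq: "a v = exp (- (of_real \<delta> * of_real v)) * err z v" for v by (simp add: a_def exp_of_real[symmetric])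
      have ai: "integrable lborel a"
        unfolding a_eq[abs_def] using d by (intro laplace_integrable err_admissible z) auto
      hence am [measurable]: "a \<in> borel_measurable borel" by auto
      have T0: "1 / T \<noteq> 0" using T by simp
      have "integrable lborel (\<lambda>y. a (u + (1 / T) * y))" by (rule lborel_integrable_real_affine[OF ai T0])
      hence ai': "integrable lborel (\<lambda>y. a (u + y / T))" by simp
      have i1: "integrable lborel (\<lambda>y. complex_of_real (n y) * a (u + y / T))"
        by (rule Bochner_Integration.integrable_bound[OF ai']) (use n in \<open>auto simp: norm_mult mult_left_le_one_le\<close>)
      have i2: "integrable lborel (\<lambda>y. complex_of_real (n y) * a u)"
        using ni by (intro integrable_mult_left integrable_of_real) auto
      have "(LINT y|lborel. complex_of_real (n y) * a u) = a u"
        using n1 ni by simp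
      hence "a u - (LINT y|lborel. complex_of_real (n y) * a (u + y / T)) = (LINT y|lborel. complex_of_real (n y) * a u - complex_of_real (n y) * a (u + y / T))"
        using i1 i2 by simp
      also have "norm \<dots> \<le> (LINT y|lborel. norm (complex_of_real (n y) * a u - complex_of_real (n y) * a (u + y / T)))"
        by (rule integral_norm_bound)
      also have "\<dots> \<le> (LINT y|lborel. C1 * (3 + u) ^ M * ((1 / sqrt T) * q y + exp (- u / 2) * n y))"
      proof (rule integral_mono)
        show "integrable lborel (\<lambda>y. norm (complex_of_real (n y) * a u - complex_of_real (n y) * a (u + y / T)))"
          by (intro integrable_norm Bochner_Integration.integrable_diff i1 i2)
        show "integrable lborel (\<lambda>y. C1 * (3 + u) ^ M * ((1 / sqrt T) * q y + exp (- u / 2) * n y))"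
          by (intro integrable_mult_right Bochner_Integration.integrable_add qi ni)
        fix y :: real
        have h: "\<bar>u - (u + y / T)\<bar> = \<bar>y\<bar> / T" using T by simp
        have sT: "sqrt T \<ge> 1" "sqrt T \<le> T" using T
          by (auto intro!: real_le_lsqrt simp: power2_eq_square)
        have s1: "sqrt (\<bar>y\<bar> / T) \<le> (1 / sqrt T) * (1 + \<bar>y\<bar> ^ 1)"
        proof -
          have "sqrt \<bar>y\<bar> \<le> 1 + \<bar>y\<bar>" by (intro real_le_lsqrt) (auto simp: power2_eq_square algebra_simps)
          thus ?thesis using sT by (simp add: real_sqrt_divide divide_right_mono)
        qed
        have s2: "(\<bar>y\<bar> / T) ^ M \<le> (1 / sqrt T) * \<bar>y\<bar> ^ M"
        proof -
          have "T ^ 1 \<le> T ^ M" using T M by (intro power_increasing) auto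
          hence "1 / T ^ M \<le> 1 / sqrt T" using sT T by (intro frac_le) auto
          hence "1 / T ^ M * \<bar>y\<bar> ^ M \<le> 1 / sqrt T * \<bar>y\<bar> ^ M" by (intro mult_right_mono) auto
          thus ?thesis by (simp add: power_divide)
        qed
        have "norm (complex_of_real (n y) * a u - complex_of_real (n y) * a (u + y / T)) = n y * norm (a u - a (u + y / T))"
          using n[of y] by (simp add: right_diff_distrib[symmetric] norm_mult)
        also have "\<dots> \<le> n y * (C1 * (3 + u) ^ M * (sqrt (\<bar>y\<bar> / T) + (\<bar>y\<bar> / T) ^ M + exp (- u / 2)))"
          using dd[of \<delta> u "u + y / T"] d tau u n[of y] unfolding h a_def by (intro mult_left_mono) auto
        also have "\<dots> \<le> n y * (C1 * (3 + u) ^ M * ((1 / sqrt T) * (1 + \<bar>y\<bar> ^ 1) + (1 / sqrt T) * \<bar>y\<bar> ^ M + exp (- u / 2)))"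
          using n[of y] M u by (intro mult_left_mono add_mono s1 s2) auto
        also have "\<dots> = C1 * (3 + u) ^ M * ((1 / sqrt T) * q y + exp (- u / 2) * n y)"
          by (simp add: q_def algebra_simps add_divide_distrib)
        finally show "norm (complex_of_real (n y) * a u - complex_of_real (n y) * a (u + y / T)) \<le> C1 * (3 + u) ^ M * ((1 / sqrt T) * q y + exp (- u / 2) * n y)" .
      qed
      also have "\<dots> = C1 * (3 + u) ^ M * ((1 / sqrt T) * K + exp (- u / 2))"
        using qi ni n1 by (simp add: K_def)
      also have "\<dots> \<le> C1 * (3 + u) ^ M * ((1 / sqrt T) * (K + 1) + exp (- u / 2) * (K + 1))"
        using M u T K0 by (intro mult_left_mono add_mono) (auto simp: divide_right_mono)
      also have "\<dots> = (C1 * (K + 1)) * ((3 + u) ^ M * (1 / sqrt T + exp (- u / 2)))" by (simp add: algebra_simps)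
      also have "\<dots> \<le> C * ((3 + u) ^ M * (1 / sqrt T + exp (- u / 2)))"
        using C u T by (intro mult_right_mono) auto
      finally have A: "norm (a u - (LINT y|lborel. complex_of_real (n y) * a (u + y / T))) \<le> C * ((3 + u) ^ M * (1 / sqrt T + exp (- u / 2)))" .
      have "norm (LINT y|lborel. complex_of_real (n y) * a (u + y / T)) \<le> C2 * (\<delta> powr (- Re z) + T powr e)"
        unfolding a_def using d T by (intro C2) auto
      also have "\<dots> \<le> C * (\<delta> powr (- Re z) + T powr e)" using C by (intro mult_right_mono) auto
      finally have B: "norm (LINT y|lborel. complex_of_real (n y) * a (u + y / T)) \<le> C * (\<delta> powr (- Re z) + T powr e)" .
      have "norm (a u) \<le> norm (LINT y|lborel. complex_of_real (n y) * a (u + y / T)) + norm (a u - (LINT y|lborel. complex_of_real (n y) * a (u + y / T)))"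
        by (rule norm_triangle_sub)
      also have "\<dots> \<le> C * (\<delta> powr (- Re z) + T powr e) + C * ((3 + u) ^ M * (1 / sqrt T + exp (- u / 2)))" using A B by (rule add_mono[rotated])
      finally show ?thesis by (simp add: a_def algebra_simps)
    qed
    with C(3) show ?thesis by blast
  qed
  with M(1) tau show ?thesis by blast
qed

text \<open>All parameters are tied to u: \<delta> = \<tau>/u makes the damping the constant
  exp(-\<tau>) and \<delta>^(-Re z) a multiple of u^(Re z); sqrt T = (3+u)^M cancels the loss from
  undoing the smoothing; e = 1/(2M) makes T^e = 3 + u.\<close>

lemma err_bound:
  assumes z: "Re z > 0"
  shows "\<exists>C>0. \<forall>u\<ge>1. norm (err z u) \<le> C * (u powr Re z + u)"
proof -
  obtain M \<tau> where M: "M \<ge> (1::nat)" and tau: "\<tau> > 0" "\<tau> \<le> 1" and b: "\<And>e. e > 0 \<Longrightarrow> \<exists>C>0. \<forall>\<delta> T u. 0 < \<delta> \<and> \<delta> \<le> \<tau> \<and> T \<ge> 1 \<and> u \<ge> 1 \<longrightarrow>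
     norm (of_real (exp (- \<delta> * u)) * err z u) \<le> C * (\<delta> powr (- Re z) + T powr e + (3 + u) ^ M * (1 / sqrt T + exp (- u / 2)))"
    using damped_err_bound[OF z] by blast
  define e where "e = 1 / (2 * real M)"
  have e: "e > 0" using M by (simp add: e_def)
  obtain C where C: "C > 0" "\<And>\<delta> T u. 0 < \<delta> \<Longrightarrow> \<delta> \<le> \<tau> \<Longrightarrow> T \<ge> 1 \<Longrightarrow> u \<ge> 1 \<Longrightarrow>
     norm (of_real (exp (- \<delta> * u)) * err z u) \<le> C * (\<delta> powr (- Re z) + T powr e + (3 + u) ^ M * (1 / sqrt T + exp (- u / 2)))"
    using b[OF e] by blast
  define A where "A = \<tau> powr (- Re z) + 5 + (8 * real M) ^ M"
  have A0: "A > 0" unfolding A_def using tau M by (simp add: add_pos_nonneg)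
  have "norm (err z u) \<le> (exp 1 * C * A) * (u powr Re z + u)" if u: "u \<ge> 1" for u
  proof -
    define T where "T = ((3 + u) ^ M)\<^sup>2"
    have T1: "T \<ge> 1" unfolding T_def using u by simp
    have sT: "sqrt T = (3 + u) ^ M" unfolding T_def using u by simp
    have Te: "T powr e = 3 + u"
    proof -
      have "T = (3 + u) powr (real M * 2)" unfolding T_def using u by (simp add: powr_realpow[symmetric] powr_powr powr_numeral[symmetric])
      thus ?thesis using u M by (simp add: powr_powr e_def)
    qed
    \<comment> \<open>Distributes exp(u/2) over the M factors, using 3 + u <= 4u and u <= 2M
      exp(u/(2M)).\<close>
    have ex: "(3 + u) ^ M * exp (- u / 2) \<le> (8 * real M) ^ M"
    proof -
      have "u / (2 * real M) \<le> exp (u / (2 * real M))" using exp_ge_add_one_self[of "u / (2 * real M)"] by linarith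
      hence "u \<le> 2 * real M * exp (u / (2 * real M))" using M by (simp add: field_simps)
      hence "3 + u \<le> 8 * real M * exp (u / (2 * real M))" using u by linarith
      hence "(3 + u) ^ M \<le> (8 * real M * exp (u / (2 * real M))) ^ M" using u by (intro power_mono) auto
      also have "\<dots> = (8 * real M) ^ M * exp (u / 2)"
        using M by (simp add: power_mult_distrib exp_of_nat_mult[symmetric])
      finally have "(3 + u) ^ M * exp (- u / 2) \<le> (8 * real M) ^ M * exp (u / 2) * exp (- u / 2)" by (intro mult_right_mono) auto
      also have "\<dots> = (8 * real M) ^ M" by (simp add: mult.assoc exp_add[symmetric])
      finally show ?thesis .
    qed
    define \<delta> where "\<delta> = \<tau> / u"
    have d: "0 < \<delta>" "\<delta> \<le> \<tau>" using tau u by (auto simp: \<delta>_def field_simps)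
    have du: "- \<delta> * u = - \<tau>" using u by (simp add: \<delta>_def)
    have dk: "\<delta> powr (- Re z) = \<tau> powr (- Re z) * u powr Re z"
      using tau u by (simp add: \<delta>_def powr_divide powr_minus field_simps)
    have "norm (of_real (exp (- \<delta> * u)) * err z u) \<le> C * (\<delta> powr (- Re z) + T powr e + (3 + u) ^ M * (1 / sqrt T + exp (- u / 2)))"
      by (rule C(2)[OF d T1 u])
    also have "(3 + u) ^ M * (1 / sqrt T + exp (- u / 2)) = 1 + (3 + u) ^ M * exp (- u / 2)"
      unfolding sT using u by (simp add: distrib_left)
    also have "C * (\<delta> powr (- Re z) + T powr e + (1 + (3 + u) ^ M * exp (- u / 2))) \<le> C * (\<tau> powr (- Re z) * u powr Re z + (3 + u) + (1 + (8 * real M) ^ M))"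
      unfolding dk Te using ex C(1) by (intro mult_left_mono add_mono) auto
    also have "\<dots> \<le> C * (A * (u powr Re z + u))"
    proof (rule mult_left_mono)
      have "(8 * real M) ^ M * 1 \<le> (8 * real M) ^ M * u" using u by (intro mult_left_mono) auto
      moreover have "3 + u + 1 \<le> 5 * u" using u by simp
      moreover have "0 \<le> 5 * u powr Re z" "0 \<le> (8 * real M) ^ M * u powr Re z" "0 \<le> \<tau> powr (- Re z) * u" using u by auto
      ultimately show "\<tau> powr (- Re z) * u powr Re z + (3 + u) + (1 + (8 * real M) ^ M) \<le> A * (u powr Re z + u)"
        unfolding A_def distrib_right distrib_left by linarith
    qed (use C in auto)
    finally have f: "exp (- \<tau>) * norm (err z u) \<le> C * (A * (u powr Re z + u))"
      unfolding du by (simp add: norm_mult)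
    have "exp \<tau> * (exp (- \<tau>) * norm (err z u)) \<le> exp 1 * (C * (A * (u powr Re z + u)))"
      by (rule mult_mono[OF _ f]) (use tau in auto)
    also have "exp \<tau> * (exp (- \<tau>) * norm (err z u)) = norm (err z u)" by (simp add: exp_minus)
    finally show ?thesis by (simp add: mult_ac)
  qed
  moreover have "exp 1 * C * A > 0" using C A0 by simp
  ultimately show ?thesis by blast
qed

text \<open>\<open>err_bound\<close> divided by u^2 for u = log x >= 1; the remaining range, where
  1/u >= 1, is covered by enlarging the constant.\<close>

theorem omega_sum_asymptotic:
  assumes z: "Re z > 0"
  shows "\<exists>C>0. \<forall>x\<ge>2. norm (omega_sum z x - of_real x * (g_one z / Gamma z * of_real (ln x) powr (z - 1)))
     \<le> C * (x * (ln x powr (Re z - 2) + 1 / ln x))"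
proof -
  obtain C1 where C1: "C1 > 0" "\<And>u. u \<ge> 1 \<Longrightarrow> norm (err z u) \<le> C1 * (u powr Re z + u)"
    using err_bound[OF z] by blast
  define c where "c = g_one z / Gamma z"
  define R where "R = moment_exp z"
  have R: "R \<ge> 1" using moment_exp[of z] by (auto simp: R_def)
  define C2 where "C2 = exp 1 * 3 powr R + norm c * 2 powr \<bar>Re z - 1\<bar>"
  have C2: "C2 > 0" unfolding C2_def by (intro add_pos_nonneg) auto
  define C where "C = max C1 C2"
  have C: "C \<ge> C1" "C \<ge> C2" "C > 0" using C2 by (auto simp: C_def)
  have main: "norm (omega_sum_exp z u - c * of_real u powr (z - 1)) \<le> C * (u powr (Re z - 2) + 1 / u)" if u: "u \<ge> 1/2" for u
  proof (cases "u \<ge> 1")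
    case True
    have "err z u = of_real (u\<^sup>2) * omega_sum_exp z u - c * of_real u powr (z + 1)"
      using True by (simp add: err_def c_def gamma_kernel_def add.commute)
    also have "of_real u powr (z + 1) = of_real (u\<^sup>2) * (of_real u powr (z - 1) :: complex)"
    proof -
      have "of_real u powr (z + 1) = of_real u powr ((z - 1) + of_nat 2)" by (simp add: add.commute)
      also have "\<dots> = of_real u powr (z - 1) * (of_real u :: complex) powr of_nat 2" by (rule powr_add)
      also have "(of_real u :: complex) powr of_nat 2 = of_real (u\<^sup>2)" using True by (subst powr_nat') auto
      finally show ?thesis by (simp add: mult.commute)
    qed
    finally have "err z u = of_real (u\<^sup>2) * (omega_sum_exp z u - c * of_real u powr (z - 1))" by (simp add: algebra_simps)
    hence "u\<^sup>2 * norm (omega_sum_exp z u - c * of_real u powr (z - 1)) \<le> C1 * (u powr Re z + u)"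
      using C1(2)[OF True] unfolding norm_mult norm_of_real by (metis norm_mult norm_of_real abs_of_nonneg zero_le_power2)
    hence "norm (omega_sum_exp z u - c * of_real u powr (z - 1)) \<le> C1 * (u powr Re z + u) / u\<^sup>2"
      using True by (simp add: field_simps)
    also have "\<dots> = C1 * (u powr (Re z - 2) + 1 / u)"
      using True by (simp add: powr_diff powr_numeral field_simps power2_eq_square)
    also have "\<dots> \<le> C * (u powr (Re z - 2) + 1 / u)" using C True by (intro mult_right_mono) auto
    finally show ?thesis .
  next
    case False
    have "norm (omega_sum_exp z u) \<le> exp 1 * (2 + u) powr R" unfolding R_def using u by (intro omega_sum_exp_bound) auto
    also have "\<dots> \<le> exp 1 * 3 powr R" using u False R by (intro mult_left_mono powr_mono2) auto
    finally have 1: "norm (omega_sum_exp z u) \<le> exp 1 * 3 powr R" .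
    have "norm (complex_of_real u powr (z - 1)) = u powr (Re z - 1)" using u norm_powr_real_powr[of "of_real u" "z - 1"] by simp
    also have "\<dots> \<le> 2 powr \<bar>Re z - 1\<bar> * 1 powr (Re z - 1)" using u False by (intro powr_ratio_le) auto
    finally have "norm (c * of_real u powr (z - 1)) \<le> norm c * 2 powr \<bar>Re z - 1\<bar>" unfolding norm_mult by (intro mult_left_mono) auto
    with 1 have "norm (omega_sum_exp z u - c * of_real u powr (z - 1)) \<le> C2" unfolding C2_def by (intro norm_triangle_le_diff add_mono)
    also have "\<dots> \<le> C * 1" using C by simp
    also have "\<dots> \<le> C * (u powr (Re z - 2) + 1 / u)"
    proof (rule mult_left_mono)
      have "1 \<le> 1 / u" using u False by simp
      thus "1 \<le> u powr (Re z - 2) + 1 / u" by (simp add: add_increasing)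
    qed (use C in auto)
    finally show ?thesis .
  qed
  have "norm (omega_sum z x - of_real x * (g_one z / Gamma z * of_real (ln x) powr (z - 1)))
     \<le> C * (x * (ln x powr (Re z - 2) + 1 / ln x))" if x: "x \<ge> 2" for x
  proof -
    have "ln 2 \<le> ln x" using x by simp
    hence u: "ln x \<ge> 1/2" using ln2_ge_two_thirds by linarith
    have "omega_sum z x = of_real x * omega_sum_exp z (ln x)"
      using x u by (simp add: omega_sum_exp_def exp_minus)
    hence "omega_sum z x - of_real x * (g_one z / Gamma z * of_real (ln x) powr (z - 1)) = of_real x * (omega_sum_exp z (ln x) - c * of_real (ln x) powr (z - 1))"
      by (simp add: c_def algebra_simps)
    hence "norm (omega_sum z x - of_real x * (g_one z / Gamma z * of_real (ln x) powr (z - 1))) = x * norm (omega_sum_exp z (ln x) - c * of_real (ln x) powr (z - 1))"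
      using x by (simp add: norm_mult)
    also have "\<dots> \<le> x * (C * (ln x powr (Re z - 2) + 1 / ln x))" using x by (intro mult_left_mono main u) auto
    finally show ?thesis by (simp add: mult_ac)
  qed
  with C(3) show ?thesis by blast
qed

section \<open>Chebyshev and Mertens estimates\<close>

lemma prod_primes_dvd:
  fixes N :: nat
  assumes "finite A" "\<And>p. p \<in> A \<Longrightarrow> prime p \<and> p dvd N"
  shows "\<Prod>A dvd N"
  using assms
proof (induction A rule: finite_induct)
  case (insert p A)
  have "coprime p (\<Prod>A)"
    using insert by (intro prod_coprime_right) (metis insertCI primes_coprime)
  thus ?case using insert by (simp add: divides_mult)
qed simp

text \<open>The two equal middle coefficients together are at most the row sum 2^(2m+1).\<close>

lemma central_binomial_odd_le: "(2 * m + 1) choose m \<le> 4 ^ m"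
proof -
  have "2 * ((2 * m + 1) choose m) = ((2 * m + 1) choose m) + ((2 * m + 1) choose (m + 1))"
    using binomial_symmetric[of m "2 * m + 1"] by simp
  also have "\<dots> = (\<Sum>k\<in>{m, m + 1}. (2 * m + 1) choose k)" by simp
  also have "\<dots> \<le> (\<Sum>k\<le>2 * m + 1. (2 * m + 1) choose k)" by (intro sum_mono2) auto
  also have "\<dots> = 2 ^ (2 * m + 1)" by (rule choose_row_sum)
  also have "\<dots> = 2 * 4 ^ m" by (simp add: power_mult)
  finally show ?thesis by simp
qed

text \<open>Erdos's induction: for n = 2m + 1 the primes in (m+1, 2m+1] all divide the binomial
  coefficient of n over m, and an even n > 2 adds no prime.\<close>

lemma primorial_le: "\<Prod>{p. prime p \<and> p \<le> n} \<le> (4::nat) ^ n"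
proof (induction n rule: less_induct)
  case (less n)
  have fin: "finite {p. prime p \<and> p \<le> k}" for k :: nat by (rule finite_subset[of _ "{..k}"]) auto
  consider "n \<le> 1" | "n = 2" | "n > 2" "even n" | "n > 2" "odd n" by linarith
  thus ?case
  proof cases
    case 1
    hence E: "{p. prime p \<and> p \<le> n} = {}" by (auto dest: prime_ge_2_nat)
    show ?thesis unfolding E by simp
  next
    case 2
    hence E: "{p. prime p \<and> p \<le> n} = {2}" by (auto dest: prime_ge_2_nat)
    show ?thesis unfolding E using 2 by simp
  next
    case 3
    hence np: "\<not> prime n" using prime_odd_nat by blast
    have "{p. prime p \<and> p \<le> n} = {p. prime p \<and> p \<le> n - 1}"
    proof (intro Collect_cong conj_cong refl)
      fix p :: nat assume "prime p"
      hence "p \<noteq> n" using np by auto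
      thus "(p \<le> n) = (p \<le> n - 1)" using 3 by linarith
    qed
    hence "\<Prod>{p. prime p \<and> p \<le> n} \<le> 4 ^ (n - 1)" using less.IH[of "n - 1"] 3 by simp
    also have "\<dots> \<le> 4 ^ n" by (intro power_increasing) auto
    finally show ?thesis .
  next
    case 4
    then obtain m where m: "n = 2 * m + 1" by (elim oddE)
    with 4 have m1: "m \<ge> 1" by simp
    define B where "B = {p. prime p \<and> m + 1 < p \<and> p \<le> n}"
    have finB: "finite B" unfolding B_def by (rule finite_subset[of _ "{..n}"]) auto
    have "{p. prime p \<and> p \<le> n} = {p. prime p \<and> p \<le> m + 1} \<union> B" using m m1 by (auto simp: B_def)
    hence "\<Prod>{p. prime p \<and> p \<le> n} = \<Prod>{p. prime p \<and> p \<le> m + 1} * \<Prod>B"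
      using fin[of "m+1"] finB by (simp only:) (intro prod.union_disjoint; auto simp: B_def)
    also have "\<dots> \<le> 4 ^ (m + 1) * 4 ^ m"
    proof (rule mult_mono)
      show "\<Prod>{p. prime p \<and> p \<le> m + 1} \<le> 4 ^ (m + 1)" using m m1 by (intro less.IH) simp
      have "\<Prod>B dvd ((2 * m + 1) choose m)"
      proof (rule prod_primes_dvd[OF finB], intro conjI)
        fix p assume p: "p \<in> B"
        thus pp: "prime p" by (simp add: B_def)
        have "p dvd fact n" using p by (auto simp: B_def prime_dvd_fact_iff)
        also have "(fact n :: nat) = fact m * fact (n - m) * (n choose m)" using m by (intro binomial_fact_lemma[symmetric]) simp
        finally have "p dvd fact m * fact (n - m) * (n choose m)" .
        moreover have "\<not> p dvd fact m" "\<not> p dvd fact (n - m)" using p m unfolding prime_dvd_fact_iff[OF pp] by (auto simp: B_def)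
        ultimately show "p dvd ((2 * m + 1) choose m)" using pp m by (simp add: prime_dvd_mult_iff)
      qed
      hence "\<Prod>B \<le> ((2 * m + 1) choose m)" by (rule dvd_imp_le) simp
      thus "\<Prod>B \<le> 4 ^ m" using central_binomial_odd_le[of m] by linarith
    qed auto
    also have "\<dots> = 4 ^ n" using m by (simp add: power_add[symmetric] mult_2)
    finally show ?thesis .
  qed
qed

lemma theta_le: "(\<Sum>p\<in>{p. prime p \<and> p \<le> n}. ln (real p)) \<le> real n * ln 4"
proof -
  have "(\<Sum>p\<in>{p. prime p \<and> p \<le> n}. ln (real p)) = ln (\<Prod>p\<in>{p. prime p \<and> p \<le> n}. real p)"
    by (rule ln_prod[symmetric]) (auto dest: prime_gt_0_nat intro: finite_subset[of _ "{..n}"])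
  also have "(\<Prod>p\<in>{p. prime p \<and> p \<le> n}. real p) = real (\<Prod>{p. prime p \<and> p \<le> n})" by simp
  also have "ln \<dots> \<le> ln (4 ^ n)"
  proof -
    define A where "A = \<Prod>{p. prime p \<and> p \<le> n}"
    have "A \<le> 4 ^ n" unfolding A_def by (rule primorial_le)
    hence "real A \<le> real (4 ^ n)" by (simp only: of_nat_le_iff)
    moreover have "A > 0" unfolding A_def by (intro prod_pos) (auto dest: prime_gt_0_nat)
    ultimately show ?thesis unfolding A_def[symmetric] by (subst ln_le_cancel_iff) auto
  qed
  also have "\<dots> = real n * ln 4" by (simp add: ln_realpow)
  finally show ?thesis .
qed

section \<open>Legendre's formula and Mertens' first theorem\<close>

lemma card_multiples_le:
  assumes "d > (0::nat)"
  shows "card {m\<in>{1..n}. d dvd m} = n div d"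
proof -
  have "{m\<in>{1..n}. d dvd m} = (\<lambda>j. d * j) ` {1..n div d}"
  proof (intro set_eqI iffI)
    fix m assume m: "m \<in> {m\<in>{1..n}. d dvd m}"
    then obtain j where j: "m = d * j" by auto
    have "j \<ge> 1" using m j by (cases j) auto
    moreover have "j \<le> n div d" using m j assms by (simp add: less_eq_div_iff_mult_less_eq mult.commute)
    ultimately show "m \<in> (\<lambda>j. d * j) ` {1..n div d}" using j by auto
  next
    fix m assume "m \<in> (\<lambda>j. d * j) ` {1..n div d}"
    then obtain j where j: "m = d * j" "1 \<le> j" "j \<le> n div d" unfolding image_iff Bex_def atLeastAtMost_iff by blast
    have "d * j \<le> n" using j assms by (simp add: less_eq_div_iff_mult_less_eq mult.commute)
    thus "m \<in> {m\<in>{1..n}. d dvd m}" using j assms by simp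
  qed
  moreover have "inj_on (\<lambda>j. d * j) {1..n div d}" using assms by (auto simp: inj_on_def)
  ultimately show ?thesis by (simp add: card_image)
qed

text \<open>Legendre's formula: m contributes the number of k with p^k | m. The range k <= n loses
  nothing, because p^k exceeds n beyond it.\<close>

lemma multiplicity_fact:
  assumes p: "prime (p::nat)"
  shows "multiplicity p (fact n) = (\<Sum>k=1..n. n div p ^ k)"
proof -
  have "multiplicity p (fact n) = (\<Sum>m=1..n. multiplicity p m)"
  proof (induction n)
    case (Suc n)
    have f: "(fact (Suc n) :: nat) = Suc n * fact n" by (simp only: fact_Suc of_nat_id)
    have "multiplicity p (Suc n * fact n) = multiplicity p (Suc n) + multiplicity p (fact n)"
      using p by (intro prime_elem_multiplicity_mult_distrib) auto
    thus ?case unfolding f using Suc by (simp del: mult_Suc)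
  qed simp
  also have "\<dots> = (\<Sum>m=1..n. \<Sum>k=1..n. if p ^ k dvd m then 1 else 0)"
  proof (intro sum.cong refl)
    fix m assume m: "m \<in> {1..n}"
    have v: "p ^ k dvd m \<longleftrightarrow> k \<le> multiplicity p m" for k
      using m p by (intro power_dvd_iff_le_multiplicity) (auto dest: not_prime_unit)
    have le: "multiplicity p m \<le> n"
    proof -
      have "p ^ multiplicity p m dvd m" by (rule multiplicity_dvd)
      hence "p ^ multiplicity p m \<le> m" using m by (intro dvd_imp_le) auto
      moreover have "multiplicity p m < p ^ multiplicity p m"
        using prime_gt_1_nat[OF p] by (intro power_gt_expt) auto
      ultimately show ?thesis using m by simp
    qed
    have "{k\<in>{1..n}. p ^ k dvd m} = {1..multiplicity p m}"
    proof (intro set_eqI iffI)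
      fix k assume "k \<in> {k\<in>{1..n}. p ^ k dvd m}"
      hence "1 \<le> k" "p ^ k dvd m" by (simp_all only: mem_Collect_eq atLeastAtMost_iff)
      thus "k \<in> {1..multiplicity p m}" unfolding v by (simp only: atLeastAtMost_iff)
    next
      fix k assume "k \<in> {1..multiplicity p m}"
      hence k: "1 \<le> k" "k \<le> multiplicity p m" by (simp_all only: atLeastAtMost_iff)
      hence "k \<le> n" using le by linarith
      thus "k \<in> {k\<in>{1..n}. p ^ k dvd m}" using k unfolding v by (simp only: mem_Collect_eq atLeastAtMost_iff)
    qed
    hence "multiplicity p m = card {k\<in>{1..n}. p ^ k dvd m}" by (simp only: card_atLeastAtMost)
    also have "\<dots> = (\<Sum>k=1..n. if p ^ k dvd m then 1 else 0)" by (simp add: sum.If_cases Int_def)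
    finally show "multiplicity p m = (\<Sum>k=1..n. if p ^ k dvd m then 1 else 0)" .
  qed
  also have "\<dots> = (\<Sum>k=1..n. \<Sum>m=1..n. if p ^ k dvd m then 1 else 0)" by (rule sum.swap)
  also have "\<dots> = (\<Sum>k=1..n. n div p ^ k)"
  proof (intro sum.cong refl)
    fix k
    have "(\<Sum>m=1..n. if p ^ k dvd m then 1 else 0) = card {m\<in>{1..n}. p ^ k dvd m}" by (simp add: sum.If_cases Int_def)
    also have "\<dots> = n div p ^ k" using prime_gt_0_nat[OF p] by (intro card_multiples_le) simp
    finally show "(\<Sum>m=1..n. if p ^ k dvd m then 1 else 0) = n div p ^ k" .
  qed
  finally show ?thesis .
qed

lemma real_div_bounds: "real (m div d) \<le> real m / real d" "real m / real d - 1 \<le> real (m div d)"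
proof -
  have "real_of_int \<lfloor>real m / real d\<rfloor> = real (m div d)" by (simp add: floor_divide_of_nat_eq)
  thus "real (m div d) \<le> real m / real d" "real m / real d - 1 \<le> real (m div d)" by linarith+
qed

lemma multiplicity_fact_bounds:
  assumes p: "prime (p::nat)" "p \<le> n"
  shows "real n / real p - 1 \<le> real (multiplicity p (fact n))"
    "real (multiplicity p (fact n)) \<le> real n / (real p - 1)"
proof -
  have p2: "p \<ge> 2" using p prime_ge_2_nat by blast
  have "n div p ^ 1 \<le> (\<Sum>k=1..n. n div p ^ k)" using p p2 by (intro member_le_sum) auto
  hence "n div p \<le> multiplicity p (fact n)" unfolding multiplicity_fact[OF p(1)] by simp
  moreover have "real n / real p - 1 \<le> real (n div p)" by (rule real_div_bounds)
  ultimately show "real n / real p - 1 \<le> real (multiplicity p (fact n))" by linarith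
  have "real (multiplicity p (fact n)) = (\<Sum>k=1..n. real (n div p ^ k))" unfolding multiplicity_fact[OF p(1)] by simp
  also have "\<dots> \<le> (\<Sum>k=1..n. real n * (1 / real p) ^ k)"
  proof (rule sum_mono)
    fix k
    show "real (n div p ^ k) \<le> real n * (1 / real p) ^ k" using real_div_bounds(1)[of n "p ^ k"] by (simp add: power_divide)
  qed
  also have "\<dots> = real n * (\<Sum>k=1..n. (1 / real p) ^ k)" by (simp add: sum_distrib_left)
  also have "(\<Sum>k=1..n. (1 / real p) ^ k) \<le> 1 / (real p - 1)"
  proof -
    have "(\<Sum>k=1..n. (1 / real p) ^ k) = ((1 / real p) ^ 1 - (1 / real p) ^ Suc n) / (1 - 1 / real p)"
      using p2 p by (subst sum_gp) auto
    also have "\<dots> \<le> (1 / real p) / (1 - 1 / real p)" using p2 by (intro divide_right_mono) auto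
    also have "\<dots> = 1 / (real p - 1)" using p2 by (simp add: field_simps)
    finally show ?thesis .
  qed
  finally show "real (multiplicity p (fact n)) \<le> real n / (real p - 1)" by (simp add: mult_left_mono)
qed

lemma ln_fact_primes: "ln (fact n) = (\<Sum>p\<in>{p. prime p \<and> p \<le> n}. real (multiplicity p (fact n)) * ln (real p))"
proof -
  have pf: "prime_factors (fact n :: nat) = {p. prime p \<and> p \<le> n}"
    by (auto simp: prime_factors_dvd prime_dvd_fact_iff)
  have "(fact n :: nat) = (\<Prod>p\<in>prime_factors (fact n). p ^ multiplicity p (fact n))"
    by (rule prime_factorization_nat) simp
  from arg_cong[OF this, of real]
  have "real (fact n) = (\<Prod>p\<in>{p. prime p \<and> p \<le> n}. real p ^ multiplicity p (fact n))"
    unfolding pf of_nat_prod of_nat_power .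
  hence "ln (real (fact n)) = ln (\<Prod>p\<in>{p. prime p \<and> p \<le> n}. real p ^ multiplicity p (fact n))" by (rule arg_cong)
  hence "ln (fact n) = ln (\<Prod>p\<in>{p. prime p \<and> p \<le> n}. real p ^ multiplicity p (fact n))" unfolding of_nat_fact .
  also have "\<dots> = (\<Sum>p\<in>{p. prime p \<and> p \<le> n}. ln (real p ^ multiplicity p (fact n)))"
    by (rule ln_prod) (auto dest: prime_gt_0_nat intro: finite_subset[of _ "{..n}"])
  also have "\<dots> = (\<Sum>p\<in>{p. prime p \<and> p \<le> n}. real (multiplicity p (fact n)) * ln (real p))"
    by (intro sum.cong refl) (auto simp: ln_realpow dest: prime_gt_0_nat)
  finally show ?thesis .
qed

lemma ln_fact_bounds: "n \<ge> 1 \<Longrightarrow> real n * ln (real n) - real n \<le> ln (fact n)" "ln (fact n) \<le> real n * ln (real n)"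
proof -
  show "n \<ge> 1 \<Longrightarrow> real n * ln (real n) - real n \<le> ln (fact n)"
  proof (induction n rule: nat_induct_at_least)
    case (Suc n)
    have "ln (1 + 1 / real n) \<le> 1 / real n" using Suc by (intro ln_add_one_self_le_self) auto
    moreover have "1 + 1 / real n = real (Suc n) / real n" using Suc by (simp add: field_simps)
    hence "ln (1 + 1 / real n) = ln (real (Suc n)) - ln (real n)" using Suc by (simp only:) (subst ln_div; simp)
    ultimately have "real n * (ln (real (Suc n)) - ln (real n)) \<le> real n * (1 / real n)" by (intro mult_left_mono) auto
    hence "real n * ln (real (Suc n)) \<le> real n * ln (real n) + 1" using Suc by (simp add: right_diff_distrib)
    moreover have "ln (fact (Suc n)) = ln (fact n) + ln (real (Suc n))" by (simp add: ln_mult add.commute del: of_nat_Suc)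
    ultimately show ?case using Suc.IH by (simp add: algebra_simps)
  qed simp
  show "ln (fact n) \<le> real n * ln (real n)"
  proof (cases "n = 0")
    case False
    have "fact n \<le> (real n) ^ n" using fact_le_power[of n, where ?'a = real] by simp
    hence "ln (fact n) \<le> ln (real n ^ n)" using False by (subst ln_le_cancel_iff) auto
    thus ?thesis using False by (simp add: ln_realpow)
  qed simp
qed

text \<open>Compares log n! = n log n + O(n) with its prime factorisation. In one direction the
  rounding loses at most the sum of log p, which is O(n) by \<open>theta_le\<close>; in the other
  the higher prime powers lose n times a convergent series.\<close>

lemma mertens_nat:
  "\<exists>K>0. \<forall>n\<ge>1. \<bar>(\<Sum>p\<in>{p. prime p \<and> p \<le> n}. ln (real p) / real p) - ln (real n)\<bar> \<le> K"
proof -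
  define K0 where "K0 = (\<Sum>p::nat. 4 * real p powr (-3/2))"
  have sm: "summable (\<lambda>p::nat. 4 * real p powr (-3/2))" by (intro summable_mult) (simp add: summable_real_powr_iff)
  have K0: "K0 \<ge> 0" unfolding K0_def by (intro suminf_nonneg sm) auto
  define K where "K = K0 + 1 + ln 4"
  have "\<bar>(\<Sum>p\<in>{p. prime p \<and> p \<le> n}. ln (real p) / real p) - ln (real n)\<bar> \<le> K" if n: "n \<ge> 1" for n
  proof -
    define P where "P = {p. prime p \<and> p \<le> n}"
    have finP: "finite P" unfolding P_def by (rule finite_subset[of _ "{..n}"]) auto
    define s where "s = (\<Sum>p\<in>P. ln (real p) / real p)"
    have p2: "p \<ge> 2" "real p \<ge> 2" "ln (real p) \<ge> 0" if "p \<in> P" for p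
    proof -
      show "p \<ge> 2" using that prime_ge_2_nat by (auto simp: P_def)
      thus "real p \<ge> 2" "ln (real p) \<ge> 0" by simp_all
    qed
    have "real n * s - (\<Sum>p\<in>P. ln (real p)) = (\<Sum>p\<in>P. (real n / real p - 1) * ln (real p))"
      unfolding s_def by (simp add: sum_distrib_left sum_subtractf[symmetric] algebra_simps)
    also have "\<dots> \<le> (\<Sum>p\<in>P. real (multiplicity p (fact n)) * ln (real p))"
      using p2 by (intro sum_mono mult_right_mono multiplicity_fact_bounds) (auto simp: P_def)
    also have "\<dots> = ln (fact n)" unfolding P_def by (rule ln_fact_primes[symmetric])
    also have "\<dots> \<le> real n * ln (real n)" by (rule ln_fact_bounds)
    finally have "real n * s \<le> real n * ln (real n) + real n * ln 4" using theta_le[of n] unfolding P_def by linarith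
    hence "real n * s \<le> real n * (ln (real n) + ln 4)" by (simp add: distrib_left)
    hence up: "s \<le> ln (real n) + ln 4" using n by simp
    have "real n * ln (real n) - real n \<le> ln (fact n)" using n by (rule ln_fact_bounds)
    also have "\<dots> = (\<Sum>p\<in>P. real (multiplicity p (fact n)) * ln (real p))" unfolding P_def by (rule ln_fact_primes)
    also have "\<dots> \<le> (\<Sum>p\<in>P. real n * (ln (real p) / real p) + real n * (4 * real p powr (-3/2)))"
    proof (rule sum_mono)
      fix p assume p: "p \<in> P"
      have "real (multiplicity p (fact n)) * ln (real p) \<le> real n / (real p - 1) * ln (real p)"
        using p p2[OF p] by (intro mult_right_mono multiplicity_fact_bounds) (auto simp: P_def)
      also have "real n / (real p - 1) * ln (real p) = real n * (ln (real p) / real p) + real n * (ln (real p) / (real p * (real p - 1)))"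
        using p2[OF p] by (simp add: field_simps)
      \<comment> \<open>From log p <= 2 sqrt p and p - 1 >= p/2.\<close>
      also have "ln (real p) / (real p * (real p - 1)) \<le> 4 * real p powr (-3/2)"
      proof -
        have "ln (real p powr (1/2)) \<le> real p powr (1/2) - 1" using p2[OF p] by (intro ln_le_minus_one) auto
        hence l: "ln (real p) \<le> 2 * real p powr (1/2)" using p2[OF p] by (simp add: ln_powr)
        have "real p * real p / 2 \<le> real p * (real p - 1)" using p2[OF p] by simp
        hence "ln (real p) / (real p * (real p - 1)) \<le> (2 * real p powr (1/2)) / (real p * real p / 2)"
          using p2[OF p] l by (intro frac_le) auto
        also have "\<dots> = 4 * (real p powr (1/2) / real p powr 2)" using p2[OF p] by (simp add: powr_numeral power2_eq_square)
        also have "real p powr (1/2) / real p powr 2 = real p powr (-3/2)" by (simp only: powr_diff[symmetric]) simp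
        finally show ?thesis .
      qed
      finally show "real (multiplicity p (fact n)) * ln (real p) \<le> real n * (ln (real p) / real p) + real n * (4 * real p powr (-3/2))"
        by (simp add: mult_left_mono)
    qed
    also have "\<dots> = real n * (s + (\<Sum>p\<in>P. 4 * real p powr (-3/2)))"
      by (simp add: s_def sum.distrib sum_distrib_left distrib_left)
    also have "\<dots> \<le> real n * (s + K0)"
      unfolding K0_def by (intro mult_left_mono add_left_mono sum_le_suminf sm finP) auto
    finally have "real n * (ln (real n) - 1) \<le> real n * (s + K0)" by (simp add: right_diff_distrib)
    hence lo: "ln (real n) - 1 \<le> s + K0" using n by simp
    have "ln (4::real) \<ge> 0" by simp
    thus ?thesis using up lo K0 unfolding K_def s_def P_def abs_le_iff by linarith
  qed
  moreover have "K > 0" unfolding K_def using K0 by (simp add: add_pos_nonneg)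
  ultimately show ?thesis by blast
qed

text \<open>Half-open to match the range y <= p < y' of Buchstab's identity and to let adjacent
  ranges partition; logarithmic because the weights are functions of log p.\<close>

definition log_primes :: "real \<Rightarrow> real \<Rightarrow> nat set" where
  "log_primes a b = {p. prime p \<and> a \<le> ln (real p) \<and> ln (real p) < b}"

lemma finite_log_primes [simp]: "finite (log_primes a b)"
proof (rule finite_subset[of _ "{..nat \<lfloor>exp b\<rfloor>}"])
  show "log_primes a b \<subseteq> {..nat \<lfloor>exp b\<rfloor>}"
  proof
    fix p assume "p \<in> log_primes a b"
    hence p: "prime p" "ln (real p) < b" by (auto simp: log_primes_def)
    hence "real p \<le> exp b" by (metis exp_less_cancel_iff exp_ln less_imp_le of_nat_0_less_iff prime_gt_0_nat)
    thus "p \<in> {..nat \<lfloor>exp b\<rfloor>}" by (simp add: le_nat_floor)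
  qed
qed simp

text \<open>\<open>mertens_nat\<close> at both ends. Rounding exp v to an integer moves its
  logarithm by at most 1, and the closed lower end admits at most one prime with log p = a, whose
  term is at most 1.\<close>

lemma mertens_ln:
  "\<exists>K>0. \<forall>a v. 0 < a \<and> a \<le> v \<longrightarrow>
     \<bar>(\<Sum>p\<in>{p. prime p \<and> a \<le> ln (real p) \<and> ln (real p) \<le> v}. ln (real p) / real p) - (v - a)\<bar> \<le> K"
proof -
  obtain K where K: "K > 0" "\<And>n. n \<ge> 1 \<Longrightarrow> \<bar>(\<Sum>p\<in>{p. prime p \<and> p \<le> n}. ln (real p) / real p) - ln (real n)\<bar> \<le> K"
    using mertens_nat by blast
  define Q where "Q = (\<lambda>v. {p::nat. prime p \<and> ln (real p) \<le> v})"
  have QP: "Q v = {p. prime p \<and> p \<le> nat \<lfloor>exp v\<rfloor>}" for v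
  proof -
    have "ln (real p) \<le> v \<longleftrightarrow> p \<le> nat \<lfloor>exp v\<rfloor>" if "prime p" for p
    proof -
      have "p > 0" using that prime_gt_0_nat by blast
      hence "ln (real p) \<le> v \<longleftrightarrow> real p \<le> exp v" using exp_le_cancel_iff[of "ln (real p)" v] by simp
      thus ?thesis by (simp add: le_nat_iff le_floor_iff)
    qed
    thus ?thesis by (auto simp: Q_def)
  qed
  have finQ: "finite (Q v)" for v unfolding QP by (rule finite_subset[of _ "{..nat \<lfloor>exp v\<rfloor>}"]) auto
  have q: "\<bar>(\<Sum>p\<in>Q v. ln (real p) / real p) - v\<bar> \<le> K + 1" if v: "v \<ge> 0" for v
  proof -
    define n where "n = nat \<lfloor>exp v\<rfloor>"
    have e1: "exp v \<ge> 1" using v by simp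
    have n: "n \<ge> 1" "real n \<le> exp v" "exp v \<le> 2 * real n"
    proof -
      have f: "\<lfloor>exp v\<rfloor> \<ge> 1" using e1 by simp
      hence r: "real n = of_int \<lfloor>exp v\<rfloor>" unfolding n_def by simp
      show "n \<ge> 1" using f unfolding n_def by linarith
      show "real n \<le> exp v" unfolding r by linarith
      have "1 \<le> real_of_int \<lfloor>exp v\<rfloor>" using f by linarith
      thus "exp v \<le> 2 * real n" unfolding r by linarith
    qed
    have "ln (real n) \<le> ln (exp v)" using n by (subst ln_le_cancel_iff) auto
    moreover have "ln (exp v) \<le> ln (2 * real n)" using n by (subst ln_le_cancel_iff) auto
    moreover have "ln (2 * real n) = ln 2 + ln (real n)" using n by (simp add: ln_mult)
    ultimately have "\<bar>v - ln (real n)\<bar> \<le> 1" using ln_2_less_1 by simp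
    thus ?thesis using K(2)[OF n(1)] unfolding QP n_def[symmetric] by linarith
  qed
  have "\<bar>(\<Sum>p\<in>{p. prime p \<and> a \<le> ln (real p) \<and> ln (real p) \<le> v}. ln (real p) / real p) - (v - a)\<bar> \<le> 2 * K + 3" if av: "0 < a" "a \<le> v" for a v
  proof -
    define W where "W = {p::nat. prime p \<and> a \<le> ln (real p) \<and> ln (real p) \<le> v}"
    define E where "E = {p::nat. prime p \<and> ln (real p) = a}"
    have WQ: "W \<subseteq> Q v" by (auto simp: W_def Q_def)
    have "Q v = (Q a - E) \<union> W" "(Q a - E) \<inter> W = {}" using av by (auto simp: W_def Q_def E_def)
    hence "(\<Sum>p\<in>Q v. ln (real p) / real p) = (\<Sum>p\<in>Q a - E. ln (real p) / real p) + (\<Sum>p\<in>W. ln (real p) / real p)"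
      using sum.union_disjoint[OF finite_Diff[OF finQ] finite_subset[OF WQ finQ], of a E "\<lambda>p. ln (real p) / real p"] by (simp only:)
    moreover have "E \<subseteq> Q a" by (auto simp: E_def Q_def)
    hence "(\<Sum>p\<in>Q a - E. ln (real p) / real p) = (\<Sum>p\<in>Q a. ln (real p) / real p) - (\<Sum>p\<in>E. ln (real p) / real p)"
      by (rule sum_diff[OF finQ])
    moreover have "0 \<le> (\<Sum>p\<in>E. ln (real p) / real p) \<and> (\<Sum>p\<in>E. ln (real p) / real p) \<le> 1"
    proof -
      have "\<exists>p0. E \<subseteq> {p0}"
      proof (cases "E = {}")
        case False
        then obtain p0 where p0: "p0 \<in> E" by blast
        have "p = p0" if "p \<in> E" for p
        proof -
          have "ln (real p) = ln (real p0)" "p > 0" "p0 > 0" using that p0 by (auto simp: E_def dest: prime_gt_0_nat)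
          thus ?thesis by simp
        qed
        thus ?thesis by blast
      qed simp
      then obtain p0 where p0: "E \<subseteq> {p0}" by blast
      have b: "0 \<le> ln (real p) / real p \<and> ln (real p) / real p \<le> 1" if "prime p" for p
      proof -
        have p: "real p \<ge> 2" using prime_ge_2_nat[OF that] by simp
        hence "ln (real p) \<le> real p" "0 \<le> ln (real p)" using ln_le_minus_one[of "real p"] by (linarith, simp)
        thus ?thesis using p by (simp add: divide_le_eq_1)
      qed
      show ?thesis
      proof (cases "E = {}")
        case False
        hence E: "E = {p0}" using p0 by auto
        hence "prime p0" by (auto simp: E_def)
        thus ?thesis unfolding E using b by simp
      qed simp
    qed
    ultimately show ?thesis using q[of v] q[of a] av unfolding W_def[symmetric] by linarith
  qed
  moreover have "2 * K + 3 > 0" using K by simp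
  ultimately show ?thesis by blast
qed

section \<open>Sums over primes as integrals\<close>

text \<open>
  The weights occurring below have derivatives with integrable singularities at end points, so they are
  differentiable only off a finite set, and their variation is measured by the increment of $H$.
\<close>

definition dominated_on :: "real \<Rightarrow> real \<Rightarrow> (real \<Rightarrow> complex) \<Rightarrow> (real \<Rightarrow> complex) \<Rightarrow> (real \<Rightarrow> real) \<Rightarrow> (real \<Rightarrow> real) \<Rightarrow> real set \<Rightarrow> bool" where
  "dominated_on a b g g' H h S \<longleftrightarrow> finite S \<and> continuous_on {a..b} g \<and> continuous_on {a..b} H \<and>
     (\<forall>v\<in>{a<..<b} - S. (g has_vector_derivative g' v) (at v) \<and> (H has_vector_derivative h v) (at v) \<and> norm (g' v) \<le> h v)"

text \<open>The fundamental theorem with finitely many exceptional points supplies the integrability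
  of both derivatives, so they may be unbounded near end points. They are set to 0 at the
  exceptional points.\<close>

lemma dominated_integrals:
  assumes d: "dominated_on a b g g' H h S" and cd: "a \<le> c" "c \<le> d" "d \<le> b"
  defines "g0 \<equiv> (\<lambda>v. if v \<in> {a<..<b} - S then g' v else 0)" and "h0 \<equiv> (\<lambda>v. if v \<in> {a<..<b} - S then h v else 0)"
  shows "(g0 has_integral (g d - g c)) {c..d}" "(h0 has_integral (H d - H c)) {c..d}"
    "norm (g d - g c) \<le> H d - H c" "H c \<le> H d"
proof -
  have fin: "finite S" and cont: "continuous_on {c..d} g" "continuous_on {c..d} H"
    using d cd by (auto simp: dominated_on_def intro: continuous_on_subset)
  show g0: "(g0 has_integral (g d - g c)) {c..d}"
    by (rule fundamental_theorem_of_calculus_interior_strong[OF fin cd(2) _ cont(1)])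
       (use d cd in \<open>auto simp: dominated_on_def g0_def\<close>)
  show h0: "(h0 has_integral (H d - H c)) {c..d}"
    by (rule fundamental_theorem_of_calculus_interior_strong[OF fin cd(2) _ cont(2)])
       (use d cd in \<open>auto simp: dominated_on_def h0_def\<close>)
  have n: "norm (g0 v) \<le> h0 v" for v using d by (auto simp: dominated_on_def g0_def h0_def)
  have "norm (integral {c..d} g0) \<le> integral {c..d} h0"
    using g0 h0 n by (intro integral_norm_bound_integral) auto
  thus *: "norm (g d - g c) \<le> H d - H c" using g0 h0 by (simp add: integral_unique)
  show "H c \<le> H d" using order_trans[OF norm_ge_zero *] by simp
qed

text \<open>A named choice of the constant, so that later bounds can state their dependence on the
  end points explicitly.\<close>

definition mertens_const :: real where
  "mertens_const = (SOME K. K > 0 \<and> (\<forall>a v. 0 < a \<and> a \<le> v \<longrightarrow>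
     \<bar>(\<Sum>p\<in>{p. prime p \<and> a \<le> ln (real p) \<and> ln (real p) \<le> v}. ln (real p) / real p) - (v - a)\<bar> \<le> K))"

lemma mertens_const:
  "mertens_const > 0"
  "0 < a \<Longrightarrow> a \<le> v \<Longrightarrow> \<bar>(\<Sum>p\<in>{p. prime p \<and> a \<le> ln (real p) \<and> ln (real p) \<le> v}. ln (real p) / real p) - (v - a)\<bar> \<le> mertens_const"
proof -
  have "\<exists>K. K > 0 \<and> (\<forall>a v. 0 < a \<and> a \<le> v \<longrightarrow>
     \<bar>(\<Sum>p\<in>{p. prime p \<and> a \<le> ln (real p) \<and> ln (real p) \<le> v}. ln (real p) / real p) - (v - a)\<bar> \<le> K)"
    using mertens_ln by blast
  from someI_ex[OF this] show "mertens_const > 0"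
  "0 < a \<Longrightarrow> a \<le> v \<Longrightarrow> \<bar>(\<Sum>p\<in>{p. prime p \<and> a \<le> ln (real p) \<and> ln (real p) \<le> v}. ln (real p) / real p) - (v - a)\<bar> \<le> mertens_const"
    unfolding mertens_const_def[symmetric] by blast+
qed

lemma sum_log_primes_bound:
  assumes ab: "0 < a" "a \<le> b"
  shows "\<bar>(\<Sum>p\<in>log_primes a b. ln (real p) / real p) - (b - a)\<bar> \<le> mertens_const + 1"
proof (cases "a = b")
  case True
  hence "log_primes a b = {}" by (auto simp: log_primes_def)
  thus ?thesis using True mertens_const(1) by simp
next
  case False
  \<comment> \<open>The half-open sum up to b is the closed sum up to this m, and b - 1 <= m <
    b.\<close>
  define m where "m = Max (insert (max a (b - 1)) ((\<lambda>p. ln (real p)) ` log_primes a b))"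
  have fin: "finite (insert (max a (b - 1)) ((\<lambda>p. ln (real p)) ` log_primes a b))" by simp
  have mge: "x \<le> m" if "x \<in> insert (max a (b - 1)) ((\<lambda>p. ln (real p)) ` log_primes a b)" for x
    unfolding m_def using that fin by (rule Max_ge[rotated])
  have "m \<in> insert (max a (b - 1)) ((\<lambda>p. ln (real p)) ` log_primes a b)" unfolding m_def using fin by (rule Max_in) simp
  hence mb: "m < b" using False ab by (auto simp: log_primes_def)
  have ma: "a \<le> m" "b - 1 \<le> m" using mge[of "max a (b - 1)"] by auto
  have "log_primes a b = {p. prime p \<and> a \<le> ln (real p) \<and> ln (real p) \<le> m}"
    using mge mb by (fastforce simp: log_primes_def)
  hence "\<bar>(\<Sum>p\<in>log_primes a b. ln (real p) / real p) - (m - a)\<bar> \<le> mertens_const"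
    using mertens_const(2)[OF ab(1) ma(1)] by simp
  thus ?thesis using ma mb by linarith
qed

text \<open>Partial summation without Stieltjes integrals: g(b) - g(log p) is the integral of g'
  over [log p, b], so summing over p produces the integral of A(v) g'(v) with A(v) = v - a + O(1).
  The O(1) costs the increment of the dominating function H.\<close>

lemma abel_primes:
  assumes ab: "0 < a" "a \<le> b" and d: "dominated_on a b g g' H h S"
  shows "norm ((\<Sum>p\<in>log_primes a b. of_real (ln (real p) / real p) * g (ln (real p))) - integral {a..b} g)
     \<le> (mertens_const + 1) * (norm (g b) + (H b - H a))"
proof -
  define K where "K = mertens_const"
  have K: "K > 0" using mertens_const(1) by (simp add: K_def)
  define g0 where "g0 = (\<lambda>v. if v \<in> {a<..<b} - S then g' v else 0)"
  define h0 where "h0 = (\<lambda>v. if v \<in> {a<..<b} - S then h v else 0)"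
  have I: "(g0 has_integral (g d - g c)) {c..d}" "(h0 has_integral (H d - H c)) {c..d}"
    if "a \<le> c" "c \<le> d" "d \<le> b" for c d
    using dominated_integrals[OF d that] unfolding g0_def h0_def by auto
  have n: "norm (g0 v) \<le> h0 v" for v using d by (auto simp: dominated_on_def g0_def h0_def)
  define c where "c = (\<lambda>p::nat. ln (real p) / real p)"
  define A where "A = (\<lambda>v. \<Sum>p\<in>log_primes a b. if ln (real p) \<le> v then c p else 0)"
  define s where "s = (\<Sum>p\<in>log_primes a b. of_real (c p) * g (ln (real p)))"
  define sc where "sc = (\<Sum>p\<in>log_primes a b. c p)"
  have rest: "((\<lambda>v. if ln (real p) \<le> v then g0 v else 0) has_integral (g b - g (ln (real p)))) {a..b}"
    if p: "p \<in> log_primes a b" for p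
  proof -
    have r: "a \<le> ln (real p)" "ln (real p) \<le> b" using p by (auto simp: log_primes_def)
    have "((\<lambda>v. if v \<in> {ln (real p)..b} then g0 v else 0) has_integral (g b - g (ln (real p)))) {a..b}"
      using I(1)[OF r(1) r(2) order_refl] r by (subst has_integral_restrict) auto
    thus ?thesis by (rule has_integral_eq[rotated]) auto
  qed
  have 1: "((\<lambda>v. \<Sum>p\<in>log_primes a b. of_real (c p) * (if ln (real p) \<le> v then g0 v else 0)) has_integral
      (\<Sum>p\<in>log_primes a b. of_real (c p) * (g b - g (ln (real p))))) {a..b}"
    by (intro has_integral_sum has_integral_mult_right rest) auto
  have "(\<lambda>v. \<Sum>p\<in>log_primes a b. of_real (c p) * (if ln (real p) \<le> v then g0 v else 0)) = (\<lambda>v. of_real (A v) * g0 v)"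
    unfolding A_def of_real_sum sum_distrib_right by (intro ext sum.cong) auto
  moreover have "(\<Sum>p\<in>log_primes a b. of_real (c p) * (g b - g (ln (real p)))) = of_real sc * g b - s"
    by (simp add: s_def sc_def algebra_simps sum_subtractf sum_distrib_left)
  ultimately have i1: "((\<lambda>v. of_real (A v) * g0 v) has_integral (of_real sc * g b - s)) {a..b}" using 1 by simp
  have contg: "continuous_on {a..b} g" and fin: "finite S" using d by (auto simp: dominated_on_def)
  have ig: "(g has_integral (integral {a..b} g)) {a..b}"
    using contg by (intro integrable_integral integrable_continuous_real)
  \<comment> \<open>Integration by parts for the main part v - a of A(v); it returns the integral of
    g up to an end-point term.\<close>
  have "((\<lambda>v. g v + of_real (v - a) * g0 v) has_integral (of_real (b - a) * g b - of_real (a - a) * g a)) {a..b}"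
  proof (rule fundamental_theorem_of_calculus_interior_strong[OF fin ab(2), where f = "\<lambda>v. of_real (v - a) * g v"])
    show "continuous_on {a..b} (\<lambda>v. of_real (v - a) * g v)" by (intro continuous_intros contg)
    fix v assume v: "v \<in> {a<..<b} - S"
    have "(g has_vector_derivative g' v) (at v)" using d v by (auto simp: dominated_on_def)
    hence "((\<lambda>v. of_real (v - a) * g v) has_vector_derivative (of_real (v - a) * g' v + of_real (1 - 0) * g v)) (at v)"
      by (intro has_vector_derivative_mult has_vector_derivative_of_real) (auto intro!: derivative_eq_intros)
    thus "((\<lambda>v. of_real (v - a) * g v) has_vector_derivative g v + of_real (v - a) * g0 v) (at v)"
      using v by (simp add: g0_def add.commute)
  qed
  from has_integral_diff[OF this ig]
  have i2: "((\<lambda>v. of_real (v - a) * g0 v) has_integral (of_real (b - a) * g b - integral {a..b} g)) {a..b}" by simp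
  from has_integral_diff[OF i1 i2]
  have i3: "((\<lambda>v. of_real (A v - (v - a)) * g0 v) has_integral (of_real sc * g b - s - (of_real (b - a) * g b - integral {a..b} g))) {a..b}"
    by (simp add: left_diff_distrib)
  have i4: "((\<lambda>v. K * h0 v) has_integral K * (H b - H a)) {a..b}"
    by (intro has_integral_mult_right I(2)) (use ab in auto)
  have "norm (integral {a..b} (\<lambda>v. of_real (A v - (v - a)) * g0 v)) \<le> integral {a..b} (\<lambda>v. K * h0 v)"
  proof (rule integral_norm_bound_integral)
    fix v assume v: "v \<in> {a..b}"
    show "norm (of_real (A v - (v - a)) * g0 v) \<le> K * h0 v"
    \<comment> \<open>At v = b the closed range of primes might contain one with log p = b, which
      \<open>log_primes\<close> excludes; there \<open>g0\<close> is 0.\<close>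
    proof (cases "v < b")
      case True
      have "A v = (\<Sum>p\<in>{p\<in>log_primes a b. ln (real p) \<le> v}. c p)"
        unfolding A_def by (rule sum.inter_filter[symmetric]) simp
      also have "{p\<in>log_primes a b. ln (real p) \<le> v} = {p. prime p \<and> a \<le> ln (real p) \<and> ln (real p) \<le> v}"
        using True by (auto simp: log_primes_def)
      finally have "\<bar>A v - (v - a)\<bar> \<le> K" using mertens_const(2)[of a v] ab v by (simp add: K_def c_def)
      thus ?thesis unfolding norm_mult norm_of_real using n[of v] by (intro mult_mono) auto
    next
      case False
      hence "g0 v = 0" "h0 v = 0" by (auto simp: g0_def h0_def)
      thus ?thesis by simp
    qed
  qed (use i3 i4 in auto)
  hence b1: "norm (of_real sc * g b - s - (of_real (b - a) * g b - integral {a..b} g)) \<le> K * (H b - H a)"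
    unfolding integral_unique[OF i3] integral_unique[OF i4] .
  have b2: "norm (of_real (sc - (b - a)) * g b) \<le> (K + 1) * norm (g b)"
    unfolding norm_mult norm_of_real using sum_log_primes_bound[OF ab] by (intro mult_right_mono) (auto simp: sc_def c_def K_def)
  have "s - integral {a..b} g = of_real (sc - (b - a)) * g b - (of_real sc * g b - s - (of_real (b - a) * g b - integral {a..b} g))"
    by (simp add: algebra_simps)
  also have "norm \<dots> \<le> (K + 1) * norm (g b) + K * (H b - H a)"
    by (intro norm_triangle_le_diff add_mono b1 b2)
  also have "\<dots> \<le> (K + 1) * (norm (g b) + (H b - H a))"
    using dominated_integrals(4)[OF d order_refl ab(2) order_refl] by (simp add: algebra_simps)
  finally show ?thesis by (simp add: s_def c_def K_def)
qed

text \<open>\<open>abel_primes\<close> for w(v)/v. With W bounding |w| on the interval,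
  differentiating 1/v is accounted for by the increment of -W/v. The end-point value and the two
  parts of the variation are each at most W/a, whence the factor 3.\<close>

lemma prime_sum_integral:
  assumes ab: "0 < a" "a \<le> b" and d: "dominated_on a b w w' H h S"
  shows "norm ((\<Sum>p\<in>log_primes a b. w (ln (real p)) / of_nat p) - integral {a..b} (\<lambda>v. w v / of_real v))
     \<le> 3 * (mertens_const + 1) / a * (norm (w b) + (H b - H a))"
proof -
  define W where "W = norm (w b) + (H b - H a)"
  have Hab: "H a \<le> H b" by (rule dominated_integrals(4)[OF d order_refl ab(2) order_refl])
  have wW: "norm (w v) \<le> W" if v: "v \<in> {a..b}" for v
  proof -
    have "norm (w b - w v) \<le> H b - H v" "H a \<le> H v" using dominated_integrals(3,4)[OF d] v by auto
    moreover have "norm (w v) \<le> norm (w b) + norm (w b - w v)" using norm_triangle_sub[of "w v" "w b"] by (simp add: norm_minus_commute)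
    ultimately show ?thesis by (simp add: W_def)
  qed
  have W0: "W \<ge> 0" using Hab by (simp add: W_def)
  define g where "g = (\<lambda>v. w v / of_real v)"
  define g' where "g' = (\<lambda>v. w' v / of_real v - w v / of_real (v\<^sup>2))"
  define G where "G = (\<lambda>v. H v / a - W / v)"
  define G' where "G' = (\<lambda>v. h v / a + W / v\<^sup>2)"
  have "dominated_on a b g g' G G' S"
    unfolding dominated_on_def
  proof (intro conjI ballI)
    show "finite S" using d by (auto simp: dominated_on_def)
    show "continuous_on {a..b} g" "continuous_on {a..b} G" unfolding g_def G_def
      using d ab by (auto simp: dominated_on_def intro!: continuous_intros)
    fix v assume v: "v \<in> {a<..<b} - S"
    hence v0: "v > 0" using ab by auto
    have dw: "(w has_vector_derivative w' v) (at v)" "(H has_vector_derivative h v) (at v)" "norm (w' v) \<le> h v"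
      using d v by (auto simp: dominated_on_def)
    have inv: "((\<lambda>v. 1 / v) has_real_derivative (- 1 / v\<^sup>2)) (at v)"
      using v0 by (auto intro!: derivative_eq_intros simp: power2_eq_square)
    have "((\<lambda>v. w v * of_real (1 / v)) has_vector_derivative (w v * of_real (- 1 / v\<^sup>2) + w' v * of_real (1 / v))) (at v)"
      by (intro has_vector_derivative_mult dw has_vector_derivative_of_real) (use inv in \<open>simp add: has_real_derivative_iff_has_vector_derivative\<close>)
    thus "(g has_vector_derivative g' v) (at v)"
      by (simp add: g_def g'_def divide_inverse algebra_simps)
    have "(H has_real_derivative h v) (at v)" using dw(2) by (simp add: has_real_derivative_iff_has_vector_derivative)
    hence "((\<lambda>v. H v / a - W * (1 / v)) has_real_derivative (h v / a - W * (- 1 / v\<^sup>2))) (at v)"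
      by (intro DERIV_diff DERIV_cdivide DERIV_cmult inv)
    thus "(G has_vector_derivative G' v) (at v)"
      by (simp add: G_def G'_def has_real_derivative_iff_has_vector_derivative)
    have "norm (g' v) \<le> norm (w' v / of_real v) + norm (w v / of_real (v\<^sup>2))" unfolding g'_def by (rule norm_triangle_ineq4)
    also have "\<dots> = norm (w' v) / v + norm (w v) / v\<^sup>2" using v0 by (simp add: norm_divide norm_power)
    also have "\<dots> \<le> h v / a + W / v\<^sup>2"
      using dw(3) v ab wW[of v] order_trans[OF norm_ge_zero dw(3)] by (intro add_mono frac_le divide_right_mono) auto
    finally show "norm (g' v) \<le> G' v" by (simp add: G'_def)
  qed
  from abel_primes[OF ab this]
  have "norm ((\<Sum>p\<in>log_primes a b. of_real (ln (real p) / real p) * g (ln (real p))) - integral {a..b} g)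
     \<le> (mertens_const + 1) * (norm (g b) + (G b - G a))" .
  also have "(\<Sum>p\<in>log_primes a b. of_real (ln (real p) / real p) * g (ln (real p))) = (\<Sum>p\<in>log_primes a b. w (ln (real p)) / of_nat p)"
  proof (intro sum.cong refl)
    fix p assume "p \<in> log_primes a b"
    hence "ln (real p) \<noteq> 0" using ab by (auto simp: log_primes_def)
    thus "of_real (ln (real p) / real p) * g (ln (real p)) = w (ln (real p)) / of_nat p" by (simp add: g_def)
  qed
  also have "(mertens_const + 1) * (norm (g b) + (G b - G a)) \<le> (mertens_const + 1) * (3 * W / a)"
  proof (rule mult_left_mono)
    have "norm (g b) \<le> W / a"
    proof -
      have "norm (g b) = norm (w b) / b" using ab by (simp add: g_def norm_divide)
      also have "\<dots> \<le> W / a" using wW[of b] ab W0 by (intro frac_le) auto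
      finally show ?thesis .
    qed
    moreover have "G b - G a \<le> (H b - H a) / a + W / a"
      using ab W0 by (simp add: G_def diff_divide_distrib)
    moreover have "(H b - H a) / a \<le> W / a" using ab by (intro divide_right_mono) (auto simp: W_def)
    moreover have "3 * W / a = W / a + W / a + W / a" by simp
    ultimately show "norm (g b) + (G b - G a) \<le> 3 * W / a" by linarith
  qed (use mertens_const(1) in auto)
  also have "(mertens_const + 1) * (3 * W / a) = 3 * (mertens_const + 1) / a * W" by simp
  finally show ?thesis unfolding g_def W_def .
qed

lemma sum_inverse_log_primes:
  assumes ab: "0 < a" "a \<le> b"
  shows "(\<Sum>p\<in>log_primes a b. 1 / real p) \<le> ln (b / a) + 3 * (mertens_const + 1) / a"
proof -
  have d: "dominated_on a b (\<lambda>_. 1) (\<lambda>_. 0) (\<lambda>_. 0) (\<lambda>_. 0) {}"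
    by (auto simp: dominated_on_def)
  have "((\<lambda>v. 1 / v) has_integral (ln b - ln a)) {a..b}"
    using ab by (intro fundamental_theorem_of_calculus)
      (auto intro!: derivative_eq_intros simp: has_real_derivative_iff_has_vector_derivative[symmetric])
  hence "((\<lambda>v. complex_of_real (1 / v)) has_integral of_real (ln b - ln a)) {a..b}" by (rule has_integral_of_real)
  hence I: "integral {a..b} (\<lambda>v. 1 / complex_of_real v) = of_real (ln b - ln a)" by (simp add: integral_unique)
  have "norm (complex_of_real ((\<Sum>p\<in>log_primes a b. 1 / real p) - (ln b - ln a))) \<le> 3 * (mertens_const + 1) / a"
    using prime_sum_integral[OF ab d] unfolding I by simp
  hence "\<bar>(\<Sum>p\<in>log_primes a b. 1 / real p) - (ln b - ln a)\<bar> \<le> 3 * (mertens_const + 1) / a" by (simp only: norm_of_real)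
  moreover have "ln b - ln a = ln (b / a)" using ab by (simp add: ln_div)
  ultimately show ?thesis by linarith
qed

text \<open>The source of log log x, with X = log x. The range stops at p = x/2 because 1/(X - v) is
  not integrable up to X; bounding 1/v by 1/a leaves a logarithmic integral.\<close>

lemma sum_inverse_log_distance:
  assumes ab: "0 < a" "a \<le> X - ln 2"
  shows "(\<Sum>p\<in>log_primes a (X - ln 2). 1 / (real p * (X - ln (real p)))) \<le> (ln X - ln (ln 2)) / a + 3 * (mertens_const + 1) / a * (2 / ln 2)"
proof -
  define b where "b = X - ln 2"
  have Xb: "X - v \<ge> ln 2" if "v \<le> b" for v using that by (simp add: b_def)
  have l2: "ln (2::real) > 0" by simp
  have pos: "X - v > 0" if "v \<le> b" for v using Xb[OF that] l2 by linarith
  have nz: "complex_of_real X - of_real v \<noteq> 0" if "v \<le> b" for v using pos[OF that] by (metis less_irrefl of_real_diff of_real_eq_0_iff)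
  have dr: "((\<lambda>v. 1 / (X - v)) has_real_derivative (1 / (X - v)\<^sup>2)) (at v)" if "v \<le> b" for v
    using pos[OF that] by (auto intro!: derivative_eq_intros simp: power2_eq_square)
  have d: "dominated_on a b (\<lambda>v. of_real (1 / (X - v))) (\<lambda>v. of_real (1 / (X - v)\<^sup>2)) (\<lambda>v. 1 / (X - v)) (\<lambda>v. 1 / (X - v)\<^sup>2) {}"
    unfolding dominated_on_def
  proof (intro conjI ballI)
    show "continuous_on {a..b} (\<lambda>v. complex_of_real (1 / (X - v)))" "continuous_on {a..b} (\<lambda>v. 1 / (X - v))"
      using pos nz by (force intro!: continuous_intros)+
    fix v assume v: "v \<in> {a<..<b} - {}"
    show "((\<lambda>v. complex_of_real (1 / (X - v))) has_vector_derivative of_real (1 / (X - v)\<^sup>2)) (at v)"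
      using v dr[of v] by (intro has_vector_derivative_of_real) (auto simp: has_real_derivative_iff_has_vector_derivative)
    show "((\<lambda>v. 1 / (X - v)) has_vector_derivative 1 / (X - v)\<^sup>2) (at v)"
      using v dr[of v] by (auto simp: has_real_derivative_iff_has_vector_derivative)
    show "norm (complex_of_real (1 / (X - v)\<^sup>2)) \<le> 1 / (X - v)\<^sup>2" unfolding norm_of_real by simp
  qed auto
  have ab': "a \<le> b" using ab by (simp add: b_def)
  define s where "s = (\<Sum>p\<in>log_primes a b. 1 / (real p * (X - ln (real p))))"
  define J where "J = integral {a..b} (\<lambda>v. 1 / (X - v) / v)"
  have contJ: "continuous_on {a..b} (\<lambda>v. 1 / (X - v) / v)" using pos ab by (force intro!: continuous_intros)
  have "((\<lambda>v. 1 / (X - v) / v) has_integral J) {a..b}" unfolding J_def by (intro integrable_integral integrable_continuous_real contJ)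
  hence "((\<lambda>v. complex_of_real (1 / (X - v) / v)) has_integral of_real J) {a..b}" by (rule has_integral_of_real)
  hence Ic: "integral {a..b} (\<lambda>v. complex_of_real (1 / (X - v)) / of_real v) = of_real J" by (simp add: integral_unique)
  have "(\<Sum>p\<in>log_primes a b. complex_of_real (1 / (X - ln (real p))) / of_nat p) = of_real s"
    unfolding s_def by (simp add: mult.commute)
  hence "norm (complex_of_real (s - J)) \<le> 3 * (mertens_const + 1) / a * (norm (complex_of_real (1 / (X - b))) + (1 / (X - b) - 1 / (X - a)))"
    using prime_sum_integral[OF ab(1) ab' d] unfolding Ic by simp
  also have "norm (complex_of_real (1 / (X - b))) + (1 / (X - b) - 1 / (X - a)) \<le> 2 / ln 2"
    unfolding norm_of_real using pos[OF ab'] by (simp add: b_def)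
  hence "3 * (mertens_const + 1) / a * (norm (complex_of_real (1 / (X - b))) + (1 / (X - b) - 1 / (X - a))) \<le> 3 * (mertens_const + 1) / a * (2 / ln 2)"
    using ab mertens_const(1) by (intro mult_left_mono) auto
  finally have 1: "s - J \<le> 3 * (mertens_const + 1) / a * (2 / ln 2)" unfolding norm_of_real by linarith
  have Lint: "((\<lambda>v. 1 / a * (1 / (X - v))) has_integral (1 / a * (- ln (X - b) - - ln (X - a)))) {a..b}"
    using ab' pos by (intro has_integral_mult_right fundamental_theorem_of_calculus)
      (force intro!: derivative_eq_intros simp: has_real_derivative_iff_has_vector_derivative[symmetric])+
  have "J \<le> integral {a..b} (\<lambda>v. 1 / a * (1 / (X - v)))"
    unfolding J_def
  proof (rule integral_le)
    fix v assume v: "v \<in> {a..b}"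
    have "1 / (X - v) / v \<le> 1 / (X - v) / a" using v ab pos[of v] by (intro divide_left_mono) auto
    thus "1 / (X - v) / v \<le> 1 / a * (1 / (X - v))" by (simp add: mult.commute)
  qed (use Lint contJ in \<open>auto intro: integrable_continuous_real\<close>)
  also have "\<dots> = (ln (X - a) - ln (ln 2)) / a" using Lint by (simp add: integral_unique b_def)
  also have "\<dots> \<le> (ln X - ln (ln 2)) / a"
  proof -
    have "X - a > 0" "X - a \<le> X" using pos[OF ab'] ab by auto
    hence "ln (X - a) \<le> ln X" by simp
    thus ?thesis using ab by (intro divide_right_mono) auto
  qed
  finally have "J \<le> (ln X - ln (ln 2)) / a" .
  with 1 show ?thesis by (simp add: s_def b_def)
qed

section \<open>Buchstab's identity\<close>

definition omega_below_sum :: "complex \<Rightarrow> real \<Rightarrow> nat \<Rightarrow> complex" where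
  "omega_below_sum z x k = (\<Sum>n\<in>{n. 1 \<le> n \<and> real n \<le> x}. z ^ omega_below k n)"

lemma less_nat_ceiling_iff: "p < nat \<lceil>y\<rceil> \<longleftrightarrow> real p < y"
  by (rule iffI; linarith)

lemma S_sum_eq_omega_below_sum: "S_sum z x y = omega_below_sum z x (nat \<lceil>y\<rceil>)"
proof -
  have "omega_lt y n = omega_below (nat \<lceil>y\<rceil>) n" for n by (simp add: omega_lt_def omega_below_def less_nat_ceiling_iff)
  thus ?thesis by (simp add: S_sum_def omega_below_sum_def)
qed

text \<open>Raising the cut-off past a prime k changes only the multiples n = k m, by a factor z.
  The sum over m keeps the cut-off k, so m may again be divisible by k.\<close>

lemma omega_below_sum_Suc: "omega_below_sum z x k = omega_below_sum z x (Suc k) + (if prime k then (1 - z) * omega_below_sum z (x / real k) k else 0)"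
proof (cases "prime k")
  case False
  thus ?thesis by (simp add: omega_below_sum_def omega_below_Suc)
next
  case True
  have k0: "k > 0" using True prime_gt_0_nat by blast
  define V where "V = {n. 1 \<le> n \<and> real n \<le> x}"
  have finV: "finite V" unfolding V_def by (rule finite_nat_le)
  have "omega_below_sum z x k = (\<Sum>n\<in>V. z ^ omega_below (Suc k) n + (if k dvd n then (1 - z) * z ^ omega_below k n else 0))"
    unfolding omega_below_sum_def V_def[symmetric] using True by (intro sum.cong refl) (auto simp: omega_below_Suc algebra_simps)
  also have "\<dots> = omega_below_sum z x (Suc k) + (\<Sum>n\<in>V. if k dvd n then (1 - z) * z ^ omega_below k n else 0)"
    by (simp add: sum.distrib omega_below_sum_def V_def)
  also have "(\<Sum>n\<in>V. if k dvd n then (1 - z) * z ^ omega_below k n else 0) = (\<Sum>n\<in>{n\<in>V. k dvd n}. (1 - z) * z ^ omega_below k n)"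
    by (rule sum.inter_filter[symmetric, OF finV])
  also have "\<dots> = (\<Sum>m\<in>{m. 1 \<le> m \<and> real m \<le> x / real k}. (1 - z) * z ^ omega_below k m)"
  proof (rule sum.reindex_bij_witness[of _ "\<lambda>m. k * m" "\<lambda>n. n div k"])
    fix n assume n: "n \<in> {n\<in>V. k dvd n}"
    then obtain m where m: "n = k * m" by auto
    show "k * (n div k) = n" using n by auto
    have "m \<ge> 1" using n m by (cases m) (auto simp: V_def)
    moreover have "real m \<le> x / real k" using n m k0 by (simp add: V_def field_simps)
    ultimately show "n div k \<in> {m. 1 \<le> m \<and> real m \<le> x / real k}" using m k0 by simp
    show "(1 - z) * z ^ omega_below k (n div k) = (1 - z) * z ^ omega_below k n" using m k0 omega_below_times_prime[OF True order_refl, of m] by simp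
  next
    fix m assume m: "m \<in> {m. 1 \<le> m \<and> real m \<le> x / real k}"
    show "k * m div k = m" using k0 by simp
    have "real (k * m) \<le> x" using m k0 by (simp add: field_simps)
    thus "k * m \<in> {n\<in>V. k dvd n}" using m k0 by (simp add: V_def)
  qed
  also have "\<dots> = (1 - z) * omega_below_sum z (x / real k) k" by (simp add: omega_below_sum_def sum_distrib_left)
  finally show ?thesis using True by simp
qed

lemma omega_below_sum_telescope:
  assumes "k1 \<le> k2"
  shows "omega_below_sum z x k1 = omega_below_sum z x k2 + (1 - z) * (\<Sum>p\<in>{p. prime p \<and> k1 \<le> p \<and> p < k2}. omega_below_sum z (x / real p) p)"
  using assms
proof (induction k2 rule: dec_induct)
  case base
  have E: "{p. prime p \<and> k1 \<le> p \<and> p < k1} = {}" by auto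
  show ?case unfolding E by simp
next
  case (step k)
  have fin: "finite {p. prime p \<and> k1 \<le> p \<and> p < k}" by (rule finite_subset[of _ "{..k}"]) auto
  have "{p. prime p \<and> k1 \<le> p \<and> p < Suc k} = (if prime k then insert k {p. prime p \<and> k1 \<le> p \<and> p < k} else {p. prime p \<and> k1 \<le> p \<and> p < k})"
    using step by (auto simp: less_Suc_eq)
  hence "(\<Sum>p\<in>{p. prime p \<and> k1 \<le> p \<and> p < Suc k}. omega_below_sum z (x / real p) p) =
     (\<Sum>p\<in>{p. prime p \<and> k1 \<le> p \<and> p < k}. omega_below_sum z (x / real p) p) + (if prime k then omega_below_sum z (x / real k) k else 0)"
    using fin by simp
  thus ?case using step.IH omega_below_sum_Suc[of z x k] by (cases "prime k") (simp_all add: algebra_simps)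
qed

lemma log_primes_eq:
  assumes "0 < y" "0 < y2"
  shows "log_primes (ln y) (ln y2) = {p. prime p \<and> nat \<lceil>y\<rceil> \<le> p \<and> p < nat \<lceil>y2\<rceil>}"
proof -
  have "ln y \<le> ln (real p) \<longleftrightarrow> nat \<lceil>y\<rceil> \<le> p" "ln (real p) < ln y2 \<longleftrightarrow> p < nat \<lceil>y2\<rceil>" if "prime p" for p
  proof -
    have p: "real p > 0" using prime_gt_0_nat[OF that] by simp
    have "ln y \<le> ln (real p) \<longleftrightarrow> y \<le> real p" using p assms by simp
    also have "\<dots> \<longleftrightarrow> nat \<lceil>y\<rceil> \<le> p" by (simp add: nat_le_iff ceiling_le_iff)
    finally show "ln y \<le> ln (real p) \<longleftrightarrow> nat \<lceil>y\<rceil> \<le> p" .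
    have "ln (real p) < ln y2 \<longleftrightarrow> real p < y2" using p assms by simp
    also have "\<dots> \<longleftrightarrow> p < nat \<lceil>y2\<rceil>" by (rule less_nat_ceiling_iff[symmetric])
    finally show "ln (real p) < ln y2 \<longleftrightarrow> p < nat \<lceil>y2\<rceil>" .
  qed
  thus ?thesis by (auto simp: log_primes_def)
qed

lemma buchstab:
  assumes "0 < y" "y \<le> y2"
  shows "S_sum z x y = S_sum z x y2 + (1 - z) * (\<Sum>p\<in>log_primes (ln y) (ln y2). S_sum z (x / real p) (real p))"
proof -
  have "nat \<lceil>y\<rceil> \<le> nat \<lceil>y2\<rceil>" using assms by (intro nat_mono ceiling_mono)
  from omega_below_sum_telescope[OF this, of z x] show ?thesis
    using assms by (simp add: S_sum_eq_omega_below_sum log_primes_eq)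
qed

lemma S_sum_eq_omega_sum:
  assumes "x < y"
  shows "S_sum z x y = omega_sum z x"
  unfolding S_sum_eq_omega_below_sum omega_below_sum_def omega_sum_def
proof (intro sum.cong refl)
  fix n assume n: "n \<in> {n. 1 \<le> n \<and> real n \<le> x}"
  hence "real n < y" using assms by simp
  hence "n < nat \<lceil>y\<rceil>" by linarith
  thus "z ^ omega_below (nat \<lceil>y\<rceil>) n = z ^ omega n" using n by (simp add: omega_below_eq_omega)
qed

text \<open>S counts the primes strictly below p, so the two sums can differ only at n = p, and this
  n occurs only if x = p.\<close>

lemma S_sum_minus_omega_sum:
  assumes p: "prime p" and x: "x \<le> real p"
  shows "norm (S_sum z x (real p) - omega_sum z x) \<le> (if x = real p then 1 + norm z else 0)"
proof (cases "x = real p")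
  case False
  thus ?thesis using S_sum_eq_omega_sum[of x "real p" z] x by simp
next
  case True
  have "{n. 1 \<le> n \<and> real n \<le> x} = {1..p}" using True by auto
  hence "S_sum z x (real p) - omega_sum z x = (\<Sum>n=1..p. z ^ omega_below p n - z ^ omega n)"
    by (simp add: S_sum_eq_omega_below_sum omega_below_sum_def omega_sum_def sum_subtractf)
  also have "\<dots> = (\<Sum>n\<in>{p}. z ^ omega_below p n - z ^ omega n)"
    using prime_ge_1_nat[OF p] by (intro sum.mono_neutral_right) (auto simp: omega_below_eq_omega)
  also have "\<dots> = 1 - z"
  proof -
    have e: "omega_below p p = 0" using omega_below_times_prime[OF p order_refl, of 1] by simp
    have "omega p = 1" unfolding omega_def omega_below_Suc e using p by simp
    thus ?thesis using e by simp
  qed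
  finally show ?thesis using True norm_triangle_ineq4[of 1 z] by simp
qed

lemma S_sum_small:
  assumes "x \<le> 2"
  shows "norm (S_sum z x y) \<le> 2 + norm z"
proof -
  define k where "k = nat \<lceil>y\<rceil>"
  have "norm (S_sum z x y) \<le> (\<Sum>n\<in>{n. 1 \<le> n \<and> real n \<le> x}. norm z ^ omega_below k n)"
    unfolding S_sum_eq_omega_below_sum omega_below_sum_def k_def by (rule order_trans[OF norm_sum]) (simp add: norm_power)
  also have "\<dots> \<le> (\<Sum>n\<in>{1,2}. norm z ^ omega_below k n)"
  proof (rule sum_mono2)
    show "{n. 1 \<le> n \<and> real n \<le> x} \<subseteq> {1, 2}"
    proof
      fix n assume "n \<in> {n. 1 \<le> n \<and> real n \<le> x}"
      hence "1 \<le> n" "real n \<le> 2" using assms by auto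
      hence "1 \<le> n" "n \<le> 2" by linarith+
      thus "n \<in> {1, 2}" by auto
    qed
  qed auto
  also have "\<dots> = 1 + norm z ^ omega_below k 2" by simp
  also have "norm z ^ omega_below k 2 \<le> 1 + norm z"
  proof -
    have "omega_below k 2 \<le> omega 2" by (rule omega_below_le_omega) simp
    also have "omega 2 \<le> 1"
    proof -
      have "{p. prime p \<and> p < Suc 2 \<and> p dvd (2::nat)} \<subseteq> {2}" by (auto dest: prime_ge_2_nat)
      hence "card {p. prime p \<and> p < Suc 2 \<and> p dvd (2::nat)} \<le> card {2::nat}" by (intro card_mono) auto
      thus ?thesis by (simp add: omega_def omega_below_def)
    qed
    finally have "omega_below k 2 = 0 \<or> omega_below k 2 = 1" by linarith
    thus ?thesis by auto
  qed
  finally show ?thesis by simp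
qed

section \<open>The kernel defining m_z on [1, 2]\<close>

definition m_kernel :: "complex \<Rightarrow> real \<Rightarrow> complex" where
  "m_kernel z u = 1 / (of_real u powr z * of_real (u - 1) powr (1 - z))"

definition m_kernel_integral :: "complex \<Rightarrow> real \<Rightarrow> complex" where
  "m_kernel_integral z \<alpha> = integral {1..\<alpha>} (m_kernel z)"

lemma m_kernel_eq: "u > 1 \<Longrightarrow> m_kernel z u = exp (- z * of_real (ln u) - (1 - z) * of_real (ln (u - 1)))"
proof -
  assume u: "u > 1"
  have a: "complex_of_real u powr z = exp (z * of_real (ln u))"
    using u by (simp add: powr_def Ln_of_real)
  have b: "complex_of_real (u - 1) powr (1 - z) = exp ((1 - z) * of_real (ln (u - 1)))"
    using u Ln_of_real[of "u - 1"] by (simp add: powr_def)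
  have "- z * of_real (ln u) - (1 - z) * of_real (ln (u - 1)) = - (z * of_real (ln u) + (1 - z) * complex_of_real (ln (u - 1)))"
    by simp
  thus ?thesis unfolding m_kernel_def a b exp_add[symmetric] by (simp only: exp_minus inverse_eq_divide)
qed

text \<open>At u = 1 both sides are 0 by the conventions for powers of 0 and for division by
  0.\<close>

lemma norm_m_kernel_le:
  assumes z: "Re z > 0" and u: "u \<ge> 1"
  shows "norm (m_kernel z u) \<le> (u - 1) powr (Re z - 1)"
proof (cases "u = 1")
  case False
  hence u1: "u > 1" using u by simp
  have "norm (m_kernel z u) = exp (- Re z * ln u - (1 - Re z) * ln (u - 1))"
    unfolding m_kernel_eq[OF u1] by (simp add: norm_exp_eq_Re)
  also have "\<dots> \<le> exp (0 - (1 - Re z) * ln (u - 1))" using z u1 by simp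
  also have "\<dots> = (u - 1) powr (Re z - 1)" using u1 by (simp add: powr_def algebra_simps)
  finally show ?thesis .
qed (simp add: m_kernel_def)

lemma shifted_powr_has_integral:
  assumes k: "k > (0::real)" and e: "e \<ge> 0"
  shows "((\<lambda>u. (u - 1) powr (k - 1)) has_integral (e powr k / k)) {1..1+e}"
proof -
  have "((\<lambda>u. (u - 1) powr (k - 1)) has_integral ((1 + e - 1) powr k / k - (1 - 1) powr k / k)) {1..1+e}"
  proof (rule fundamental_theorem_of_calculus_interior)
    show "continuous_on {1..1+e} (\<lambda>u. (u - 1) powr k / k)" using k by (intro continuous_on_divide continuous_on_powr' continuous_intros) auto
    fix u assume "u \<in> {1<..<1+e}"
    hence "u - 1 > 0" by simp
    have "((\<lambda>u. (u - 1) powr k) has_real_derivative (k * (u - 1) powr (k - 1) * 1)) (at u)"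
      by (rule DERIV_chain2[where f = "\<lambda>v. v powr k" and g = "\<lambda>u. u - 1" and x = u and s = UNIV, OF has_real_derivative_powr])
         (use \<open>u - 1 > 0\<close> in \<open>auto intro!: derivative_eq_intros\<close>)
    from DERIV_cdivide[OF this, of k] show "((\<lambda>u. (u - 1) powr k / k) has_vector_derivative (u - 1) powr (k - 1)) (at u)"
      using k by (simp add: has_real_derivative_iff_has_vector_derivative)
  qed (use e in auto)
  thus ?thesis using k by simp
qed

text \<open>The majorant is integrable at 1 because Re z > 0. The function j1 is a visibly Borel
  version of the kernel.\<close>

lemma m_kernel_integrable:
  assumes z: "Re z > 0"
  shows "m_kernel z integrable_on {1..2}"
proof -
  define j1 where "j1 = (\<lambda>u. if u > 1 then exp (- z * of_real (ln u) - (1 - z) * of_real (ln (u - 1))) else 0)"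
  have "j1 \<in> borel_measurable borel" unfolding j1_def by measurable
  hence m: "j1 \<in> borel_measurable (lebesgue_on {1..2})"
    by (intro measurable_restrict_space1 measurable_completion) simp
  have g: "(\<lambda>u. (u - 1) powr (Re z - 1)) integrable_on {1..2}"
    using shifted_powr_has_integral[OF z, of 1] by auto
  have "j1 integrable_on {1..2}"
  proof (rule measurable_bounded_by_integrable_imp_integrable[OF m g])
    fix u :: real assume "u \<in> {1..2}"
    thus "norm (j1 u) \<le> (u - 1) powr (Re z - 1)"
      using norm_m_kernel_le[OF z, of u] m_kernel_eq[of u z] by (auto simp: j1_def)
  qed simp
  moreover have "j1 u = m_kernel z u" if "u \<in> {1..2}" for u
  proof (cases "u = 1")
    case True
    thus ?thesis by (simp add: j1_def m_kernel_def)
  next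
    case False
    thus ?thesis using that m_kernel_eq[of u z] by (simp add: j1_def)
  qed
  ultimately show ?thesis using integrable_cong[of "{1..2}" j1 "m_kernel z"] by blast
qed

lemma m_kernel_integral_continuous: "Re z > 0 \<Longrightarrow> continuous_on {1..2} (m_kernel_integral z)"
  unfolding m_kernel_integral_def by (rule indefinite_integral_continuous_1[OF m_kernel_integrable])

lemma m_kernel_integral_deriv:
  assumes z: "Re z > 0" and u: "1 < u" "u < 2"
  shows "(m_kernel_integral z has_vector_derivative m_kernel z u) (at u)"
proof -
  have c: "isCont (m_kernel z) u"
  proof -
    have "isCont (\<lambda>u. exp (- z * of_real (ln u) - (1 - z) * of_real (ln (u - 1)))) u"
      using u by (intro continuous_intros) auto
    moreover have "\<forall>\<^sub>F v in nhds u. m_kernel z v = exp (- z * of_real (ln v) - (1 - z) * of_real (ln (v - 1)))"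
      using u by (intro eventually_nhds_in_open[of "{1<..}", THEN eventually_mono]) (auto simp: m_kernel_eq)
    ultimately show ?thesis by (simp add: isCont_cong)
  qed
  have "((\<lambda>v. integral {1..v} (m_kernel z)) has_vector_derivative m_kernel z u) (at u within {1..2} - {})"
    using u c by (intro integral_has_vector_derivative_continuous_at m_kernel_integrable z) (auto intro: continuous_at_imp_continuous_at_within)
  moreover have "at u within {1..2} = at u" using u by (intro at_within_interior) (auto simp: interior_atLeastAtMost_real)
  ultimately show ?thesis by (simp add: m_kernel_integral_def[abs_def])
qed

lemma m_kernel_integral_bound:
  assumes z: "Re z > 0" and e: "0 \<le> e" "e \<le> 1"
  shows "norm (m_kernel_integral z (1 + e)) \<le> e powr Re z / Re z"
proof -
  have "norm (m_kernel_integral z (1 + e)) \<le> integral {1..1+e} (\<lambda>u. (u - 1) powr (Re z - 1))"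
    unfolding m_kernel_integral_def
  proof (rule integral_norm_bound_integral)
    show "m_kernel z integrable_on {1..1+e}" by (rule integrable_subinterval_real[OF m_kernel_integrable[OF z]]) (use e in auto)
    show "(\<lambda>u. (u - 1) powr (Re z - 1)) integrable_on {1..1+e}" using shifted_powr_has_integral[OF z e(1)] by auto
  qed (use norm_m_kernel_le[OF z] in auto)
  thus ?thesis using shifted_powr_has_integral[OF z e(1)] by (simp add: integral_unique)
qed

section \<open>The function m\<close>

definition leading_factor :: "complex \<Rightarrow> complex" where
  "leading_factor z = g_one z / Gamma z"

text \<open>
  In terms of $N(\alpha) = \alpha^{1-z} m_z(\alpha)$ both branches of the definition of $m_z$ become
  indefinite integrals.
\<close>

definition scaled_m :: "complex \<Rightarrow> real \<Rightarrow> complex" where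
  "scaled_m z \<alpha> = of_real \<alpha> powr (1 - z) * m_fun z \<alpha>"

lemma of_real_powr_cancel:
  "a > 0 \<Longrightarrow> of_real a powr (1 - z) * of_real a powr (z - 1) = (1::complex)"
  "a > 0 \<Longrightarrow> of_real a powr (z - 1) * of_real a powr (1 - z) = (1::complex)"
  by (simp_all add: powr_add[symmetric])

lemma m_fun_scaled_m: "\<alpha> > 0 \<Longrightarrow> m_fun z \<alpha> = of_real \<alpha> powr (z - 1) * scaled_m z \<alpha>"
  unfolding scaled_m_def mult.assoc[symmetric] by (simp add: of_real_powr_cancel)

lemma scaled_m_low:
  assumes "1 \<le> \<alpha>" "\<alpha> \<le> 2"
  shows "scaled_m z \<alpha> = leading_factor z * (1 + (1 - z) * m_kernel_integral z \<alpha>)"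
proof -
  have J: "integral {1..\<alpha>} (\<lambda>u. 1 / (of_real u powr z * of_real (u - 1) powr (1 - z))) = m_kernel_integral z \<alpha>"
    by (simp add: m_kernel_integral_def m_kernel_def[abs_def])
  have "m_fun z \<alpha> = leading_factor z * (of_real \<alpha> powr (z - 1) + (1 - z) * of_real \<alpha> powr (z - 1) * m_kernel_integral z \<alpha>)"
    using assms unfolding J[symmetric] leading_factor_def by (subst m_fun.simps) (simp only: if_True)
  also have "\<dots> = of_real \<alpha> powr (z - 1) * (leading_factor z * (1 + (1 - z) * m_kernel_integral z \<alpha>))" by (simp add: algebra_simps)
  finally show ?thesis unfolding scaled_m_def using assms of_real_powr_cancel(1)[of \<alpha> z]
    by (simp only: mult.assoc[symmetric]) simp
qed

lemma scaled_m_high: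
  assumes "\<alpha> \<ge> 2"
  shows "scaled_m z \<alpha> = scaled_m z 2 + (1 - z) * integral {2..\<alpha>} (\<lambda>u. m_fun z (u - 1) / of_real u powr z)"
proof (cases "\<alpha> = 2")
  case False
  hence a: "\<alpha> > 2" using assms by simp
  define I where "I = integral {2..\<alpha>} (\<lambda>u. m_fun z (u - 1) / of_real u powr z)"
  have "m_fun z \<alpha> = 2 powr (1 - z) * m_fun z 2 / of_real \<alpha> powr (1 - z) + (1 - z) / of_real \<alpha> powr (1 - z) * I"
    using a unfolding I_def by (subst m_fun.simps) (simp only: not_le[symmetric] if_False)
  moreover have "of_real \<alpha> powr (1 - z) \<noteq> (0::complex)" using a by simp
  moreover have "P * (A / P + B / P * C) = A + B * C" if "P \<noteq> 0" for A B C P :: complex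
    using that by (simp add: field_simps)
  ultimately have "scaled_m z \<alpha> = 2 powr (1 - z) * m_fun z 2 + (1 - z) * I" unfolding scaled_m_def by simp
  thus ?thesis by (simp add: scaled_m_def I_def)
qed simp

lemma continuous_of_real_powr:
  assumes "\<And>x. x \<in> S \<Longrightarrow> x > 0"
  shows "continuous_on S (\<lambda>x. complex_of_real x powr a)"
proof -
  show ?thesis by (intro continuous_intros) (auto dest: assms)
qed

text \<open>Unit steps match the recursion, since values up to \<alpha> > 2 depend on those up to
  \<alpha> - 1 and on the value at 2. The pieces overlap on a set containing 2, where both formulas
  agree.\<close>

lemma m_fun_continuous:
  assumes z: "Re z > 0"
  shows "continuous_on {1..real n + 2} (m_fun z) \<and> continuous_on {1..real n + 2} (scaled_m z)"
proof (induction n)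
  case 0
  have "continuous_on {1..2} (\<lambda>\<alpha>. leading_factor z * (1 + (1 - z) * m_kernel_integral z \<alpha>))"
    by (intro continuous_intros m_kernel_integral_continuous z)
  hence N: "continuous_on {1..2} (scaled_m z)" by (rule continuous_on_eq) (auto simp: scaled_m_low)
  have "continuous_on {1..2} (\<lambda>\<alpha>. of_real \<alpha> powr (z - 1) * scaled_m z \<alpha>)"
    by (intro continuous_on_mult N continuous_of_real_powr) auto
  hence "continuous_on {1..2} (m_fun z)" by (rule continuous_on_eq) (auto simp: m_fun_scaled_m)
  with N show ?case by simp
next
  case (Suc n)
  define b where "b = real (Suc n) + 2"
  have mc: "continuous_on {1..b - 1} (m_fun z)" using Suc by (simp add: b_def add.commute)
  have N1: "continuous_on {1..b - 1} (scaled_m z)" using Suc by (simp add: b_def add.commute)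
  have "continuous_on {2..b} (m_fun z \<circ> (\<lambda>u. u - 1))"
    by (intro continuous_on_compose continuous_intros continuous_on_subset[OF mc]) auto
  hence "continuous_on {2..b} (\<lambda>u. m_fun z (u - 1) / of_real u powr z)"
    unfolding o_def by (intro continuous_on_divide continuous_of_real_powr) auto
  hence "continuous_on {2..b} (\<lambda>\<alpha>. integral {2..\<alpha>} (\<lambda>u. m_fun z (u - 1) / of_real u powr z))"
    by (intro indefinite_integral_continuous_1 integrable_continuous_real)
  hence "continuous_on {2..b} (\<lambda>\<alpha>. scaled_m z 2 + (1 - z) * integral {2..\<alpha>} (\<lambda>u. m_fun z (u - 1) / of_real u powr z))"
    by (intro continuous_intros)
  hence N2: "continuous_on {2..b} (scaled_m z)" by (rule continuous_on_eq) (auto simp: scaled_m_high[symmetric])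
  have "continuous_on ({1..b - 1} \<union> {2..b}) (scaled_m z)"
    by (intro continuous_on_closed_Un N1 N2) auto
  also have "{1..b - 1} \<union> {2..b} = {1..b}" by (auto simp: b_def)
  finally have N: "continuous_on {1..b} (scaled_m z)" .
  have "continuous_on {1..b} (\<lambda>\<alpha>. of_real \<alpha> powr (z - 1) * scaled_m z \<alpha>)"
    by (intro continuous_on_mult N continuous_of_real_powr) auto
  hence "continuous_on {1..b} (m_fun z)" by (rule continuous_on_eq) (auto simp: m_fun_scaled_m)
  with N show ?case by (simp add: b_def)
qed

lemma m_fun_continuous_on:
  assumes z: "Re z > 0" and S: "S \<subseteq> {1..b}"
  shows "continuous_on S (m_fun z)" "continuous_on S (scaled_m z)"
proof -
  have "b \<le> real (nat \<lceil>b\<rceil>) + 2" by linarith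
  hence "S \<subseteq> {1..real (nat \<lceil>b\<rceil>) + 2}" using S by force
  thus "continuous_on S (m_fun z)" "continuous_on S (scaled_m z)"
    using m_fun_continuous[OF z, of "nat \<lceil>b\<rceil>"] by (auto intro: continuous_on_subset)
qed

text \<open>Both branches are (1-z) u^(-z) m_z(u-1), if m_z(v) is read as c v^(z-1) for 0 < v < 1
  with c = \<open>leading_factor z\<close>. The first branch is unbounded near u = 1 when Re z < 1
  and its coefficient is nonzero.\<close>

definition scaled_m_deriv :: "complex \<Rightarrow> real \<Rightarrow> complex" where
  "scaled_m_deriv z u = (if u < 2 then leading_factor z * ((1 - z) * m_kernel z u) else (1 - z) * (m_fun z (u - 1) / of_real u powr z))"

lemma scaled_m_has_derivative:
  assumes z: "Re z > 0" and u: "u > 1" "u \<noteq> 2"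
  shows "(scaled_m z has_vector_derivative scaled_m_deriv z u) (at u)"
proof (cases "u < 2")
  case True
  have "((\<lambda>\<alpha>. leading_factor z * (1 + (1 - z) * m_kernel_integral z \<alpha>)) has_vector_derivative leading_factor z * (0 + (1 - z) * m_kernel z u)) (at u)"
    by (intro has_vector_derivative_mult_right has_vector_derivative_add has_vector_derivative_const m_kernel_integral_deriv z u True)
  moreover have "open {1<..<2::real}" by simp
  ultimately have "(scaled_m z has_vector_derivative leading_factor z * (0 + (1 - z) * m_kernel z u)) (at u)"
    by (rule has_vector_derivative_transform_within_open) (use u True in \<open>auto simp: scaled_m_low\<close>)
  thus ?thesis using True by (simp add: scaled_m_deriv_def)
next
  case False
  hence u2: "u > 2" using u by simp
  define f where "f = (\<lambda>u. m_fun z (u - 1) / of_real u powr z)"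
  have "continuous_on {2..u+1} (m_fun z \<circ> (\<lambda>u. u - 1))"
    by (intro continuous_on_compose continuous_intros m_fun_continuous_on[OF z, of _ "u+1"]) auto
  hence cf: "continuous_on {2..u+1} f"
    unfolding o_def f_def by (intro continuous_on_divide continuous_of_real_powr) auto
  have "((\<lambda>\<alpha>. integral {2..\<alpha>} f) has_vector_derivative f u) (at u within {2..u+1})"
    using u2 by (intro integral_has_vector_derivative cf) auto
  moreover have "at u within {2..u+1} = at u" using u2 by (intro at_within_interior) (auto simp: interior_atLeastAtMost_real)
  ultimately have "((\<lambda>\<alpha>. integral {2..\<alpha>} f) has_vector_derivative f u) (at u)" by simp
  hence "((\<lambda>\<alpha>. scaled_m z 2 + (1 - z) * integral {2..\<alpha>} f) has_vector_derivative 0 + (1 - z) * f u) (at u)"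
    by (intro has_vector_derivative_mult_right has_vector_derivative_add has_vector_derivative_const)
  moreover have "open {2::real<..}" by simp
  ultimately have "(scaled_m z has_vector_derivative 0 + (1 - z) * f u) (at u)"
    by (rule has_vector_derivative_transform_within_open) (use u2 in \<open>auto simp: scaled_m_high[symmetric] f_def\<close>)
  thus ?thesis using u2 by (simp add: scaled_m_deriv_def f_def)
qed

lemma scaled_m_deriv_bound:
  assumes z: "Re z > 0"
  shows "\<exists>C>0. \<forall>u. 1 < u \<and> u \<le> b \<longrightarrow> norm (scaled_m_deriv z u) \<le> C * (1 + (u - 1) powr (Re z - 1))"
proof -
  have "continuous_on {2..b} (m_fun z \<circ> (\<lambda>u. u - 1))"
    by (intro continuous_on_compose continuous_intros m_fun_continuous_on[OF z, of _ b]) auto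
  hence "continuous_on {2..b} (\<lambda>u. (1 - z) * (m_fun z (u - 1) / of_real u powr z))"
    unfolding o_def by (intro continuous_on_mult continuous_on_divide continuous_of_real_powr continuous_on_const) auto
  hence "bounded ((\<lambda>u. (1 - z) * (m_fun z (u - 1) / of_real u powr z)) ` {2..b})"
    by (intro compact_imp_bounded compact_continuous_image) auto
  then obtain B where B: "B > 0" "\<And>u. u \<in> {2..b} \<Longrightarrow> norm ((1 - z) * (m_fun z (u - 1) / of_real u powr z)) \<le> B"
    unfolding bounded_pos by blast
  define C where "C = B + norm (leading_factor z * (1 - z))"
  have C: "C > 0" "C \<ge> B" "C \<ge> norm (leading_factor z * (1 - z))" using B(1) by (auto simp: C_def add_pos_nonneg)
  have "norm (scaled_m_deriv z u) \<le> C * (1 + (u - 1) powr (Re z - 1))" if u: "1 < u" "u \<le> b" for u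
  proof (cases "u < 2")
    case True
    have "norm (scaled_m_deriv z u) = norm (leading_factor z * (1 - z)) * norm (m_kernel z u)" using True by (simp add: scaled_m_deriv_def norm_mult)
    also have "\<dots> \<le> C * (u - 1) powr (Re z - 1)" using norm_m_kernel_le[OF z, of u] u C by (intro mult_mono) auto
    also have "\<dots> \<le> C * (1 + (u - 1) powr (Re z - 1))" using C by (intro mult_left_mono) auto
    finally show ?thesis .
  next
    case False
    have "norm (scaled_m_deriv z u) \<le> B" using B(2)[of u] u False by (simp add: scaled_m_deriv_def)
    also have "\<dots> \<le> C * 1" using C by simp
    also have "\<dots> \<le> C * (1 + (u - 1) powr (Re z - 1))" using C by (intro mult_left_mono) auto
    finally show ?thesis .
  qed
  with C(1) show ?thesis by blast
qed

lemma has_vector_derivative_compose_real: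
  fixes g :: "real \<Rightarrow> complex"
  assumes "(g has_vector_derivative g') (at (f x))" "(f has_real_derivative f') (at x)"
  shows "((\<lambda>x. g (f x)) has_vector_derivative of_real f' * g') (at x)"
  using vector_diff_chain_at[of f f' x g g'] assms
  by (simp add: o_def has_real_derivative_iff_has_vector_derivative scaleR_conv_of_real)

lemma of_real_powr_deriv:
  assumes "f x > 0" "(f has_real_derivative f') (at x)"
  shows "((\<lambda>x. complex_of_real (f x) powr a) has_vector_derivative of_real f' * (a * of_real (f x) powr (a - 1))) (at x)"
proof (rule has_vector_derivative_compose_real[OF _ assms(2)])
  have "complex_of_real (f x) \<notin> \<real>\<^sub>\<le>\<^sub>0" using assms by (auto simp: complex_nonpos_Reals_iff)
  from has_field_derivative_powr[OF this, of a]
  show "((\<lambda>u. complex_of_real u powr a) has_vector_derivative a * of_real (f x) powr (a - 1)) (at (f x))"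
    by (rule has_vector_derivative_real_field)
qed

lemma inverse_real_deriv: "v \<noteq> 0 \<Longrightarrow> ((\<lambda>v. X / v) has_real_derivative (- X / v\<^sup>2)) (at v)"
  by (auto intro!: derivative_eq_intros simp: power2_eq_square)

text \<open>The derivative of \<open>scaled_m\<close> at X/v with respect to v. The assumption on
  X/2 keeps X/v different from 2 in the interior, where the two branches meet.\<close>

lemma scaled_m_integral_identity:
  assumes z: "Re z > 0" and ab: "0 < a" "a \<le> b" "b < X" and out: "b \<le> X / 2 \<or> X / 2 \<le> a"
  shows "((\<lambda>v. of_real X powr (z - 1) * (of_real (X / v\<^sup>2) * scaled_m_deriv z (X / v))) has_integral
     (of_real X powr (z - 1) * (scaled_m z (X / a) - scaled_m z (X / b)))) {a..b}"
proof -
  define F where "F = (\<lambda>v. - (of_real X powr (z - 1) * scaled_m z (X / v)))"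
  have X: "X > 0" using ab by simp
  have "((\<lambda>v. of_real X powr (z - 1) * (of_real (X / v\<^sup>2) * scaled_m_deriv z (X / v))) has_integral (F b - F a)) {a..b}"
  proof (rule fundamental_theorem_of_calculus_interior)
    have "continuous_on {a..b} (scaled_m z \<circ> (\<lambda>v. X / v))"
    proof (rule continuous_on_compose)
      show "continuous_on {a..b} (\<lambda>v. X / v)" using ab by (intro continuous_intros) auto
      have "(\<lambda>v. X / v) ` {a..b} \<subseteq> {1..X / a}" using ab X by (auto simp: field_simps intro: mult_left_mono)
      thus "continuous_on ((\<lambda>v. X / v) ` {a..b}) (scaled_m z)" by (rule m_fun_continuous_on[OF z])
    qed
    thus "continuous_on {a..b} F" unfolding F_def o_def by (intro continuous_intros)
    fix v assume v: "v \<in> {a<..<b}"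
    have u: "X / v > 1" "X / v \<noteq> 2" using v ab X out by (auto simp: field_simps)
    have "((\<lambda>v. scaled_m z (X / v)) has_vector_derivative of_real (- X / v\<^sup>2) * scaled_m_deriv z (X / v)) (at v)"
      using v ab by (intro has_vector_derivative_compose_real scaled_m_has_derivative z u inverse_real_deriv) auto
    hence "(F has_vector_derivative - (of_real X powr (z - 1) * (of_real (- X / v\<^sup>2) * scaled_m_deriv z (X / v)))) (at v)"
      unfolding F_def by (intro has_vector_derivative_minus has_vector_derivative_mult_right)
    thus "(F has_vector_derivative of_real X powr (z - 1) * (of_real (X / v\<^sup>2) * scaled_m_deriv z (X / v))) (at v)" by simp
  qed (rule ab(2))
  thus ?thesis by (simp add: F_def algebra_simps)
qed

text \<open>
  Up to the factor $X^{z-1}$, the main term of $S_z(x/p,p)$ divided by $x/p$, where $\log x = X$ and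
  $\log p = sX$.
\<close>

definition step_weight :: "complex \<Rightarrow> real \<Rightarrow> complex" where
  "step_weight z s = of_real s powr (z - 1) * m_fun z (1 / s - 1)"

lemma step_weight_eq:
  assumes "0 < s" "s < 1"
  shows "step_weight z s = of_real (1 - s) powr (z - 1) * scaled_m z (1 / s - 1)"
proof -
  have "of_real s powr (z - 1) * of_real (1 / s - 1) powr (z - 1) = (of_real s * complex_of_real (1 / s - 1)) powr (z - 1)"
    using assms by (subst powr_times_real) (auto simp del: of_real_diff of_real_divide simp: field_simps)
  also have "of_real s * complex_of_real (1 / s - 1) = of_real (s * (1 / s - 1))" by (rule of_real_mult[symmetric])
  also have "s * (1 / s - 1) = 1 - s" using assms by (simp add: field_simps)
  finally have "of_real s powr (z - 1) * of_real (1 / s - 1) powr (z - 1) = of_real (1 - s) powr (z - 1)" .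
  moreover have "1 / s - 1 > 0" using assms by (simp add: field_simps)
  ultimately show ?thesis unfolding step_weight_def by (subst m_fun_scaled_m) (auto simp: mult.assoc[symmetric] simp del: of_real_diff)
qed

text \<open>The derivative may blow up like (1-2s)^(Re z - 1) as s tends to 1/2, where 1/s - 1 tends
  to 1; H is built on the primitive of this power, continuous because Re z > 0. The exceptional
  point 1/3 is where 1/s - 1 = 2.\<close>

lemma step_weight_dominated:
  assumes z: "Re z > 0" and sg: "0 < \<sigma>" "\<sigma> \<le> 1/2"
  shows "\<exists>g' H h S. dominated_on \<sigma> (1/2) (step_weight z) g' H h S"
proof -
  define k where "k = Re z"
  have k: "k > 0" using z by (simp add: k_def)
  define b where "b = 1 / \<sigma>"
  obtain C where C: "C > 0" "\<And>u. 1 < u \<Longrightarrow> u \<le> b \<Longrightarrow> norm (scaled_m_deriv z u) \<le> C * (1 + (u - 1) powr (k - 1))"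
    using scaled_m_deriv_bound[OF z, of b] unfolding k_def by blast
  have "continuous_on {1..b} (scaled_m z)" by (rule m_fun_continuous_on[OF z order_refl])
  hence "bounded (scaled_m z ` {1..b})" by (intro compact_imp_bounded compact_continuous_image) auto
  then obtain B where B: "B > 0" "\<And>u. u \<in> {1..b} \<Longrightarrow> norm (scaled_m z u) \<le> B" unfolding bounded_pos by blast
  define g' where "g' = (\<lambda>s. of_real (1 - s) powr (z - 1) * (of_real (- 1 / s\<^sup>2) * scaled_m_deriv z (1 / s - 1)) +
     of_real (- 1) * ((z - 1) * of_real (1 - s) powr (z - 1 - 1)) * scaled_m z (1 / s - 1))"
  define C3 where "C3 = 2 powr \<bar>k - 1\<bar> * (1 / \<sigma>\<^sup>2 * (C * (1 + b powr \<bar>k - 1\<bar>))) + norm (z - 1) * 2 powr \<bar>k - 2\<bar> * B"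
  define h where "h = (\<lambda>s. C3 * (1 + (1 - 2 * s) powr (k - 1)))"
  define H where "H = (\<lambda>s. C3 * (s - (1 - 2 * s) powr k / (2 * k)))"
  have C3: "C3 \<ge> 0" unfolding C3_def using C(1) B(1) by auto
  have rng: "1 / s - 1 \<ge> 1" "1 / s - 1 \<le> b" if "\<sigma> \<le> s" "s \<le> 1/2" for s
  proof -
    show "1 / s - 1 \<ge> 1" using that sg by (simp add: field_simps)
    have "1 / s \<le> b" unfolding b_def using that sg by (intro divide_left_mono) auto
    thus "1 / s - 1 \<le> b" by linarith
  qed
  have "dominated_on \<sigma> (1/2) (step_weight z) g' H h {1/3}"
    unfolding dominated_on_def
  proof (intro conjI ballI)
    have "continuous_on {\<sigma>..1/2} (scaled_m z \<circ> (\<lambda>s. 1 / s - 1))"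
    proof (rule continuous_on_compose)
      show "continuous_on {\<sigma>..1/2} (\<lambda>s. 1 / s - 1)" using sg by (intro continuous_intros) auto
      show "continuous_on ((\<lambda>s. 1 / s - 1) ` {\<sigma>..1/2}) (scaled_m z)"
        by (rule m_fun_continuous_on[OF z, of _ b]) (use rng in auto)
    qed
    moreover have "continuous_on {\<sigma>..1/2} (\<lambda>s. complex_of_real (1 - s) powr (z - 1))"
      by (intro continuous_intros) (auto simp: complex_nonpos_Reals_iff)
    ultimately have "continuous_on {\<sigma>..1/2} (\<lambda>s. of_real (1 - s) powr (z - 1) * scaled_m z (1 / s - 1))"
      unfolding o_def by (intro continuous_on_mult)
    thus "continuous_on {\<sigma>..1/2} (step_weight z)" by (rule continuous_on_eq) (use sg in \<open>auto simp: step_weight_eq\<close>)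
    show "continuous_on {\<sigma>..1/2} H" unfolding H_def using k
      by (intro continuous_on_mult continuous_on_diff continuous_on_divide continuous_on_powr' continuous_intros) auto
    fix s assume s: "s \<in> {\<sigma><..<1/2} - {1/3}"
    hence s0: "0 < s" "s < 1/2" "\<sigma> \<le> s" using sg by auto
    have u: "1 / s - 1 > 1" "1 / s - 1 \<noteq> 2" using s s0 by (auto simp: field_simps)
    have d1: "((\<lambda>s. scaled_m z (1 / s - 1)) has_vector_derivative of_real (- 1 / s\<^sup>2) * scaled_m_deriv z (1 / s - 1)) (at s)"
    proof (rule has_vector_derivative_compose_real[where f = "\<lambda>s. 1 / s - 1" and x = s, OF scaled_m_has_derivative[OF z u]])
      show "((\<lambda>s. 1 / s - 1) has_real_derivative (- 1 / s\<^sup>2)) (at s)"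
        using DERIV_diff[OF inverse_real_deriv[of s 1] DERIV_const[of 1]] s0 by simp
    qed
    have d2: "((\<lambda>s. complex_of_real (1 - s) powr (z - 1)) has_vector_derivative of_real (- 1) * ((z - 1) * of_real (1 - s) powr (z - 1 - 1))) (at s)"
      using s0 by (intro of_real_powr_deriv) (auto intro!: derivative_eq_intros)
    have "((\<lambda>s. of_real (1 - s) powr (z - 1) * scaled_m z (1 / s - 1)) has_vector_derivative g' s) (at s)"
      unfolding g'_def by (rule has_vector_derivative_mult[OF d2 d1])
    moreover have "open {0<..<1::real}" by simp
    ultimately show "(step_weight z has_vector_derivative g' s) (at s)"
      by (rule has_vector_derivative_transform_within_open) (use s0 in \<open>auto simp: step_weight_eq\<close>)
    have "((\<lambda>s. (1 - 2 * s) powr k) has_real_derivative (k * (1 - 2 * s) powr (k - 1) * (- 2))) (at s)"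
      by (rule DERIV_chain2[where f = "\<lambda>v. v powr k" and g = "\<lambda>u. 1 - 2 * u" and x = s and s = UNIV, OF has_real_derivative_powr])
         (use s0 in \<open>auto intro!: derivative_eq_intros\<close>)
    from DERIV_cmult[OF DERIV_diff[OF DERIV_ident DERIV_cdivide[OF this, of "2 * k"]], of C3]
    show "(H has_vector_derivative h s) (at s)"
      using k by (simp add: H_def h_def has_real_derivative_iff_has_vector_derivative)
    have p1: "norm (complex_of_real (1 - s) powr a) \<le> 2 powr \<bar>Re a\<bar>" for a
    proof -
      have "norm (complex_of_real (1 - s) powr a) = (1 - s) powr Re a"
        using s0 norm_powr_real_powr[of "of_real (1 - s)" a] by simp
      also have "\<dots> \<le> 2 powr \<bar>Re a\<bar> * 1 powr Re a" using s0 by (intro powr_ratio_le) auto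
      finally show ?thesis by simp
    qed
    have p2: "(1 / s - 1 - 1) powr (k - 1) \<le> b powr \<bar>k - 1\<bar> * (1 - 2 * s) powr (k - 1)"
    proof -
      have "1 / s - 1 - 1 = (1 / s) * (1 - 2 * s)" using s0 by (simp add: field_simps)
      hence "(1 / s - 1 - 1) powr (k - 1) = (1 / s) powr (k - 1) * (1 - 2 * s) powr (k - 1)"
        using s0 by (simp only:) (subst powr_mult; simp)
      also have "(1 / s) powr (k - 1) \<le> b powr \<bar>k - 1\<bar>"
      proof -
        have s1: "1 / s \<ge> 1" "1 / s \<le> b" using s0 sg unfolding b_def by (auto simp: field_simps)
        have "(1 / s) powr (k - 1) \<le> (1 / s) powr \<bar>k - 1\<bar>" using s1 by (intro powr_mono) auto
        also have "\<dots> \<le> b powr \<bar>k - 1\<bar>" using s1 s0 by (intro powr_mono2) auto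
        finally show ?thesis .
      qed
      finally show ?thesis by (simp add: mult_right_mono)
    qed
    define P where "P = (1 - 2 * s) powr (k - 1)"
    have P: "P \<ge> 0" by (simp add: P_def)
    have n1: "norm (scaled_m_deriv z (1 / s - 1)) \<le> C * (1 + b powr \<bar>k - 1\<bar>) * (1 + P)"
    proof -
      have "norm (scaled_m_deriv z (1 / s - 1)) \<le> C * (1 + (1 / s - 1 - 1) powr (k - 1))"
        using rng[of s] s0 u by (intro C(2)) auto
      also have "\<dots> \<le> C * (1 + b powr \<bar>k - 1\<bar> * P)" using p2 C(1) by (intro mult_left_mono add_left_mono) (auto simp: P_def)
      also have "\<dots> \<le> C * ((1 + b powr \<bar>k - 1\<bar>) * (1 + P))"
        using C(1) P by (intro mult_left_mono) (auto simp: algebra_simps)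
      finally show ?thesis by (simp add: mult.assoc)
    qed
    have "norm (of_real (1 - s) powr (z - 1) * (of_real (- 1 / s\<^sup>2) * scaled_m_deriv z (1 / s - 1))) \<le> 2 powr \<bar>k - 1\<bar> * (1 / \<sigma>\<^sup>2 * (C * (1 + b powr \<bar>k - 1\<bar>) * (1 + P)))"
      unfolding norm_mult
    proof (intro mult_mono n1)
      show "norm (complex_of_real (1 - s) powr (z - 1)) \<le> 2 powr \<bar>k - 1\<bar>" using p1[of "z - 1"] by (simp add: k_def)
      have "1 / s\<^sup>2 \<le> 1 / \<sigma>\<^sup>2" using s0 sg by (intro divide_left_mono power_mono) auto
      thus "norm (complex_of_real (- 1 / s\<^sup>2)) \<le> 1 / \<sigma>\<^sup>2" unfolding norm_of_real by simp
    qed (use C(1) P in auto)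
    moreover have "norm (of_real (- 1) * ((z - 1) * of_real (1 - s) powr (z - 1 - 1)) * scaled_m z (1 / s - 1)) \<le> norm (z - 1) * 2 powr \<bar>k - 2\<bar> * B"
      unfolding norm_mult using p1[of "z - 1 - 1"] B(2)[of "1 / s - 1"] rng[of s] s0 B(1)
      by (auto simp: k_def intro!: mult_mono)
    ultimately have "norm (g' s) \<le> 2 powr \<bar>k - 1\<bar> * (1 / \<sigma>\<^sup>2 * (C * (1 + b powr \<bar>k - 1\<bar>) * (1 + P))) + norm (z - 1) * 2 powr \<bar>k - 2\<bar> * B"
      unfolding g'_def by (intro norm_triangle_le add_mono)
    also have "\<dots> \<le> 2 powr \<bar>k - 1\<bar> * (1 / \<sigma>\<^sup>2 * (C * (1 + b powr \<bar>k - 1\<bar>) * (1 + P))) + norm (z - 1) * 2 powr \<bar>k - 2\<bar> * B * (1 + P)"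
      using B(1) P mult_left_mono[of 1 "1 + P" "norm (z - 1) * 2 powr \<bar>k - 2\<bar> * B"] by simp
    also have "\<dots> = h s" unfolding h_def C3_def P_def by (simp only: distrib_right mult.assoc)
    finally show "norm (g' s) \<le> h s" .
  qed simp
  thus ?thesis by blast
qed

text \<open>Increments of the dominating function are multiplied by |c| only, without a power of X,
  so one bound on the variation of g serves all x.\<close>

lemma dominated_scale:
  assumes d: "dominated_on a b g g' H h S" and X: "X > 0" and sub: "X * a \<le> a'" "b' \<le> X * b"
  shows "dominated_on a' b' (\<lambda>v. c * g (v / X)) (\<lambda>v. c * (of_real (1 / X) * g' (v / X)))
     (\<lambda>v. norm c * H (v / X)) (\<lambda>v. norm c * (1 / X * h (v / X))) ((\<lambda>s. X * s) ` S)"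
  unfolding dominated_on_def
proof (intro conjI ballI)
  have im: "(\<lambda>v. v / X) ` {a'..b'} \<subseteq> {a..b}"
  proof
    fix s assume "s \<in> (\<lambda>v. v / X) ` {a'..b'}"
    then obtain v where v: "s = v / X" "a' \<le> v" "v \<le> b'" unfolding image_iff Bex_def atLeastAtMost_iff by blast
    have "X * a \<le> v" "v \<le> X * b" using v sub by linarith+
    thus "s \<in> {a..b}" using v X by (auto simp: field_simps)
  qed
  have cX: "continuous_on {a'..b'} (\<lambda>v. v / X)" using X by (intro continuous_intros) auto
  have "continuous_on {a..b} g" "continuous_on {a..b} H" using d by (auto simp: dominated_on_def)
  from continuous_on_compose2[OF this(1) cX im] continuous_on_compose2[OF this(2) cX im]
  show "continuous_on {a'..b'} (\<lambda>v. c * g (v / X))" "continuous_on {a'..b'} (\<lambda>v. norm c * H (v / X))"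
    by (auto intro!: continuous_on_mult continuous_on_const)
  show "finite ((\<lambda>s. X * s) ` S)" using d by (auto simp: dominated_on_def)
  fix v assume v: "v \<in> {a'<..<b'} - (\<lambda>s. X * s) ` S"
  have "X * a < v" "v < X * b" using v sub by auto
  moreover have "v / X \<notin> S"
  proof
    assume "v / X \<in> S"
    hence "X * (v / X) \<in> (\<lambda>s. X * s) ` S" by (rule imageI)
    thus False using v X by simp
  qed
  ultimately have vX: "v / X \<in> {a<..<b} - S" using X by (auto simp: field_simps)
  have dd: "(g has_vector_derivative g' (v / X)) (at (v / X))" "(H has_vector_derivative h (v / X)) (at (v / X))" "norm (g' (v / X)) \<le> h (v / X)"
    using d vX by (auto simp: dominated_on_def)
  have dX: "((\<lambda>v. v / X) has_real_derivative 1 / X) (at v)" using X by (auto intro!: derivative_eq_intros)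
  show "((\<lambda>v. c * g (v / X)) has_vector_derivative c * (of_real (1 / X) * g' (v / X))) (at v)"
    by (intro has_vector_derivative_mult_right has_vector_derivative_compose_real[OF dd(1) dX])
  have "(H has_real_derivative h (v / X)) (at (v / X))" using dd(2) by (simp add: has_real_derivative_iff_has_vector_derivative)
  from DERIV_cmult[OF DERIV_chain2[OF this dX], of "norm c"]
  show "((\<lambda>v. norm c * H (v / X)) has_vector_derivative norm c * (1 / X * h (v / X))) (at v)"
    by (simp add: has_real_derivative_iff_has_vector_derivative mult.commute)
  show "norm (c * (of_real (1 / X) * g' (v / X))) \<le> norm c * (1 / X * h (v / X))"
    unfolding norm_mult norm_of_real using X dd(3) by (intro mult_left_mono mult_mono) auto
qed

section \<open>The inductive step\<close>

text \<open>The relative error without log log x, at Y = log y; its two terms correspond to the two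
  O-terms.\<close>

definition error_shape :: "complex \<Rightarrow> real \<Rightarrow> real" where
  "error_shape z Y = Y powr (Re z - 2) + 1 / Y"

text \<open>Stands for log log x at X = log x, but is at least 1 for all X >= 0, so that it can
  absorb constants.\<close>

definition log_factor :: "real \<Rightarrow> real" where
  "log_factor X = 1 + ln (1 + X)"

lemma log_factor_ge_1: "X \<ge> 0 \<Longrightarrow> log_factor X \<ge> 1"
  by (simp add: log_factor_def)

lemma log_factor_mono: "0 \<le> X \<Longrightarrow> X \<le> X' \<Longrightarrow> log_factor X \<le> log_factor X'"
  by (simp add: log_factor_def)

lemma ln2_bounds: "1/2 \<le> ln (2::real)" "ln (2::real) \<le> 1"
  using ln2_ge_two_thirds ln_2_less_1 by linarith+

lemma powr_ratio_le':
  fixes Y v A e :: real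
  assumes "0 < Y" "Y \<le> v" "v \<le> A * Y"
  shows "v powr e \<le> A powr \<bar>e\<bar> * Y powr e"
proof -
  have q: "1 \<le> v / Y" "v / Y \<le> A" using assms by (auto simp: field_simps)
  have "(v / Y) powr e \<le> (v / Y) powr \<bar>e\<bar>" using q by (intro powr_mono) auto
  also have "\<dots> \<le> A powr \<bar>e\<bar>" using q by (intro powr_mono2) auto
  finally have "(v / Y) powr e \<le> A powr \<bar>e\<bar>" .
  thus ?thesis using assms by (simp add: powr_divide field_simps)
qed

lemma error_shape_le:
  assumes "0 < Y" "Y \<le> v" "v \<le> A * Y"
  shows "error_shape z v \<le> A powr \<bar>Re z - 2\<bar> * error_shape z Y"
proof -
  have A: "A \<ge> 1"
  proof (rule ccontr)
    assume "\<not> A \<ge> 1"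
    hence "A * Y < 1 * Y" using assms by (intro mult_strict_right_mono) auto
    thus False using assms by linarith
  qed
  have "1 / v \<le> 1 / Y" using assms by (intro divide_left_mono) auto
  also have "\<dots> \<le> A powr \<bar>Re z - 2\<bar> * (1 / Y)"
    using assms A mult_right_mono[of 1 "A powr \<bar>Re z - 2\<bar>" "1/Y"] by (simp add: ge_one_powr_ge_zero)
  finally show ?thesis using powr_ratio_le'[OF assms, of "Re z - 2"] by (simp add: error_shape_def distrib_left)
qed

lemma error_shape_nonneg: "Y > 0 \<Longrightarrow> error_shape z Y \<ge> 0"
  by (simp add: error_shape_def)

lemma of_real_mult_powr:
  "a > 0 \<Longrightarrow> b > 0 \<Longrightarrow> complex_of_real (a * b) powr w = of_real a powr w * of_real b powr w"
  by (simp add: powr_times_real)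

text \<open>With \<alpha> = X/Y this is Y^(z-1) m_z(\<alpha>). Written through
  \<open>scaled_m\<close>, its dependence on Y at fixed X is a single increment.\<close>

definition main_term :: "complex \<Rightarrow> real \<Rightarrow> real \<Rightarrow> complex" where
  "main_term z X Y = of_real X powr (z - 1) * scaled_m z (X / Y)"

text \<open>Uniformity over all \<alpha> up to A is essential: the induction uses the estimate at
  all pairs (x/p, p), whose \<alpha> varies with p.\<close>

definition approx_on :: "complex \<Rightarrow> real \<Rightarrow> bool" where
  "approx_on z A \<longleftrightarrow> (\<exists>C>0. \<forall>x y. 2 \<le> y \<and> y \<le> x \<and> ln x \<le> A * ln y \<longrightarrow>
     norm (S_sum z x y - of_real x * main_term z (ln x) (ln y)) \<le> C * (x * (log_factor (ln x) * error_shape z (ln y))))"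

lemma sum_log_primes_real_le:
  assumes "\<And>p. p \<in> log_primes a b \<Longrightarrow> norm (f p) \<le> c * g p" "(\<Sum>p\<in>log_primes a b. g p) \<le> B" "c \<ge> 0"
  shows "norm (\<Sum>p\<in>log_primes a b. f p) \<le> c * B"
proof -
  have "norm (\<Sum>p\<in>log_primes a b. f p) \<le> (\<Sum>p\<in>log_primes a b. c * g p)"
    using assms(1) by (rule sum_norm_le)
  also have "\<dots> = c * (\<Sum>p\<in>log_primes a b. g p)" by (simp add: sum_distrib_left)
  also have "\<dots> \<le> c * B" using assms by (intro mult_left_mono)
  finally show ?thesis .
qed

text \<open>The substitution u = X/v in the integral defining m_z above 2. For v = log p the
  argument u - 1 = (X-v)/v is the \<alpha> of the pair (x/p, p).\<close>

lemma step_integral: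
  assumes z: "Re z > 0" and Y: "0 < Y" "Y \<le> X / 2"
  shows "(1 - z) * integral {Y..X/2} (\<lambda>v. (of_real X powr (z - 1) * step_weight z (v / X)) / of_real v) =
     of_real X powr (z - 1) * (scaled_m z (X / Y) - scaled_m z 2)"
proof -
  have X: "X > 0" using Y by simp
  have "((\<lambda>v. of_real X powr (z - 1) * (of_real (X / v\<^sup>2) * scaled_m_deriv z (X / v))) has_integral
     (of_real X powr (z - 1) * (scaled_m z (X / Y) - scaled_m z (X / (X / 2))))) {Y..X/2}"
    using X Y by (intro scaled_m_integral_identity z) auto
  moreover have "X / (X / 2) = 2" using X by simp
  ultimately have I: "((\<lambda>v. of_real X powr (z - 1) * (of_real (X / v\<^sup>2) * scaled_m_deriv z (X / v))) has_integral
     (of_real X powr (z - 1) * (scaled_m z (X / Y) - scaled_m z 2))) {Y..X/2}" by simp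
  have eq: "of_real X powr (z - 1) * (of_real (X / v\<^sup>2) * scaled_m_deriv z (X / v)) = (1 - z) * ((of_real X powr (z - 1) * step_weight z (v / X)) / of_real v)"
    if v: "v \<in> {Y..X/2}" for v
  proof -
    define q where "q = X / v"
    have v0: "v > 0" using v Y by simp
    have q: "q \<ge> 2" "q > 0" using v v0 by (auto simp: q_def field_simps)
    have qv: "v / X = 1 / q" "X / v\<^sup>2 = q / v" using v0 X by (auto simp: q_def power2_eq_square)
    have p: "of_real q * (1 / of_real q powr z) = (of_real (1 / q) powr (z - 1) :: complex)"
    proof -
      have "of_real (1 / q) powr (z - 1) * of_real q powr (z - 1) = (of_real (1 / q * q) powr (z - 1) :: complex)"
        using q by (intro of_real_mult_powr[symmetric]) auto
      also have "\<dots> = 1" using q by simp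
      finally have a: "of_real (1 / q) powr (z - 1) * of_real q powr (z - 1) = (1::complex)" .
      have b: "of_real q powr (z - 1) = of_real q powr z / (of_real q :: complex)" using q by (simp add: powr_diff)
      have "of_real q powr z \<noteq> (0::complex)" using q by simp
      thus ?thesis using a q unfolding b by (simp add: field_simps)
    qed
    have "of_real X powr (z - 1) * (of_real (X / v\<^sup>2) * scaled_m_deriv z (X / v)) =
      (1 - z) * (of_real X powr (z - 1) * ((of_real q * (1 / of_real q powr z)) * m_fun z (q - 1)) / of_real v)"
      using q unfolding qv q_def[symmetric] by (simp add: scaled_m_deriv_def mult_ac)
    also have "\<dots> = (1 - z) * ((of_real X powr (z - 1) * step_weight z (v / X)) / of_real v)"
      unfolding p qv step_weight_def by simp
    finally show ?thesis .
  qed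
  have "((\<lambda>v. (1 - z) * ((of_real X powr (z - 1) * step_weight z (v / X)) / of_real v)) has_integral
     (of_real X powr (z - 1) * (scaled_m z (X / Y) - scaled_m z 2))) {Y..X/2}"
    using has_integral_eq[OF eq I] .
  hence "integral {Y..X/2} (\<lambda>v. (1 - z) * ((of_real X powr (z - 1) * step_weight z (v / X)) / of_real v)) =
     of_real X powr (z - 1) * (scaled_m z (X / Y) - scaled_m z 2)" by (rule integral_unique)
  thus ?thesis by (simp only: integral_mult_right)
qed

text \<open>For y <= p < sqrt x one has p <= x/p, and log(x/p) <= A log p because log p >= log y >=
  log x / (A+1). So the hypothesis covers every term of Buchstab's sum, and also the pair (x, sqrt
  x), where \<alpha> = 2.\<close>

lemma approx_on_Suc:
  assumes z: "Re z > 0" and A: "A \<ge> 2" and IH: "approx_on z A"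
  shows "approx_on z (A + 1)"
proof -
  define k where "k = Re z"
  obtain C where C: "C > 0" and ih: "\<And>x y. 2 \<le> y \<Longrightarrow> y \<le> x \<Longrightarrow> ln x \<le> A * ln y \<Longrightarrow>
     norm (S_sum z x y - of_real x * main_term z (ln x) (ln y)) \<le> C * (x * (log_factor (ln x) * error_shape z (ln y)))"
    using IH unfolding approx_on_def by blast
  \<comment> \<open>The lower end of log p / log x, since log p >= log y.\<close>
  define \<sigma> where "\<sigma> = 1 / (A + 1)"
  have sg: "0 < \<sigma>" "\<sigma> \<le> 1/2" using A by (auto simp: \<sigma>_def field_simps)
  obtain g' H h S where dom: "dominated_on \<sigma> (1/2) (step_weight z) g' H h S"
    using step_weight_dominated[OF z sg] by blast
  define V where "V = norm (step_weight z (1/2)) + (H (1/2) - H \<sigma>)"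
  have V0: "V \<ge> 0" using dominated_integrals(4)[OF dom, of \<sigma> "1/2"] sg by (simp add: V_def)
  define M where "M = mertens_const + 1"
  have M: "M > 0" using mertens_const(1) by (simp add: M_def)
  define D where "D = (A + 1) powr \<bar>k - 2\<bar>"
  have D: "D \<ge> 0" by (simp add: D_def)
  define C2 where "C2 = norm (1 - z) * (C * D) * (ln (A + 1) + 6 * M)"
  define C3 where "C3 = norm (1 - z) * (3 * M * V * (A + 1) powr \<bar>k - 1\<bar>)"
  have C2: "C2 \<ge> 0" and C3: "C3 \<ge> 0" unfolding C2_def C3_def using C D A M V0 by auto
  define C' where "C' = C + C * D + C2 + C3"
  have C': "C' > 0" "C' \<ge> C" "C' = C + C * D + C2 + C3" unfolding C'_def using C D C2 C3 by (auto simp: add_pos_nonneg)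
  have "norm (S_sum z x y - of_real x * main_term z (ln x) (ln y)) \<le> C' * (x * (log_factor (ln x) * error_shape z (ln y)))"
    if xy: "2 \<le> y" "y \<le> x" "ln x \<le> (A + 1) * ln y" for x y
  proof -
    define X where "X = ln x"
    define Y where "Y = ln y"
    have x0: "x > 0" "y > 0" using xy by auto
    have Y: "Y \<ge> 1/2" using xy ln2_bounds by (simp add: Y_def) (smt (verit) ln_le_cancel_iff)
    have XY: "Y \<le> X" using xy by (simp add: X_def Y_def)
    have eY: "error_shape z Y \<ge> 0" using Y by (intro error_shape_nonneg) auto
    have lX: "log_factor X \<ge> 1" using XY Y by (intro log_factor_ge_1) auto
    show ?thesis
    proof (cases "X \<le> A * Y")
      case True
      have "norm (S_sum z x y - of_real x * main_term z (ln x) (ln y)) \<le> C * (x * (log_factor (ln x) * error_shape z (ln y)))"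
        using xy True by (intro ih) (auto simp: X_def Y_def)
      also have "\<dots> \<le> C' * (x * (log_factor (ln x) * error_shape z (ln y)))"
        using C' x0 eY lX by (intro mult_right_mono) (auto simp: X_def Y_def)
      finally show ?thesis .
    next
      case False
      have "2 * Y \<le> A * Y" using A Y by (intro mult_right_mono) auto
      hence Y2: "Y \<le> X / 2" using False by linarith
      have XA: "X \<le> (A + 1) * Y" using xy by (simp add: X_def Y_def)
      have X0: "X > 0" using Y XY by linarith
      define r where "r = exp (X / 2)"
      have lr: "ln r = X / 2" by (simp add: r_def)
      have yr: "y \<le> r"
      proof -
        have "exp Y \<le> exp (X / 2)" using Y2 by simp
        thus ?thesis using x0 by (simp add: r_def Y_def)
      qed
      have rx: "r \<le> x"
      proof -
        have "exp (X / 2) \<le> exp X" using X0 by simp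
        thus ?thesis using x0 by (simp add: r_def X_def)
      qed
      define w where "w = (\<lambda>v. of_real X powr (z - 1) * step_weight z (v / X))"
      have b: "S_sum z x y = S_sum z x r + (1 - z) * (\<Sum>p\<in>log_primes Y (X/2). S_sum z (x / real p) (real p))"
        using buchstab[OF x0(2) yr, of z x] by (simp add: lr Y_def)
      have e1: "norm (S_sum z x r - of_real x * (of_real X powr (z - 1) * scaled_m z 2)) \<le> C * D * (x * (log_factor X * error_shape z Y))"
      proof -
        have "2 * (X / 2) \<le> A * (X / 2)" using A X0 by (intro mult_right_mono) auto
        hence "norm (S_sum z x r - of_real x * main_term z (ln x) (ln r)) \<le> C * (x * (log_factor (ln x) * error_shape z (ln r)))"
          using xy yr rx by (intro ih) (auto simp: lr X_def[symmetric])
        also have "main_term z (ln x) (ln r) = of_real X powr (z - 1) * scaled_m z 2"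
          using X0 by (simp add: main_term_def lr X_def[symmetric])
        also have "C * (x * (log_factor (ln x) * error_shape z (ln r))) \<le> C * (x * (log_factor X * (D * error_shape z Y)))"
          unfolding lr X_def[symmetric] D_def k_def using C x0 lX Y Y2 XA X0
          by (intro mult_left_mono error_shape_le) auto
        finally show ?thesis by (simp add: mult_ac)
      qed
      \<comment> \<open>The sum of 1/p over this range is bounded in terms of A alone, so adding up
        the errors of the hypothesis creates no further factor log log x.\<close>
      have e2: "norm ((\<Sum>p\<in>log_primes Y (X/2). S_sum z (x / real p) (real p)) - of_real x * (\<Sum>p\<in>log_primes Y (X/2). w (ln (real p)) / of_nat p))
         \<le> (C * D * (x * (log_factor X * error_shape z Y))) * (ln (A + 1) + 6 * M)"
      proof -
        have "norm (\<Sum>p\<in>log_primes Y (X/2). S_sum z (x / real p) (real p) - of_real x * (w (ln (real p)) / of_nat p))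
          \<le> (C * D * (x * (log_factor X * error_shape z Y))) * (ln (A + 1) + 6 * M)"
        proof (rule sum_log_primes_real_le[where g = "\<lambda>p. 1 / real p"])
          fix p assume p: "p \<in> log_primes Y (X/2)"
          define v where "v = ln (real p)"
          have pp: "prime p" "Y \<le> v" "v < X / 2" using p by (auto simp: log_primes_def v_def)
          have p2: "real p \<ge> 2" using prime_ge_2_nat[OF pp(1)] by simp
          have v0: "v > 0" using pp Y by linarith
          have lxp: "ln (x / real p) = X - v" using x0 p2 by (simp add: ln_div X_def v_def)
          have "exp v \<le> exp (X - v)" using pp by simp
          hence pxp: "real p \<le> x / real p" using p2 x0 by (simp add: exp_diff v_def X_def)
          have "(A + 1) * Y \<le> (A + 1) * v" using pp A by (intro mult_left_mono) auto
          hence "X - v \<le> A * v" using XA by (simp add: algebra_simps)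
          hence "norm (S_sum z (x / real p) (real p) - of_real (x / real p) * main_term z (X - v) v) \<le> C * (x / real p * (log_factor (X - v) * error_shape z v))"
            using ih[of "real p" "x / real p"] p2 pxp unfolding lxp v_def[symmetric] by simp
          also have "\<dots> \<le> C * (x / real p * (log_factor X * (D * error_shape z Y)))"
          proof -
            have "log_factor (X - v) \<le> log_factor X" using pp v0 by (intro log_factor_mono) auto
            moreover have "error_shape z v \<le> D * error_shape z Y" unfolding D_def k_def
            proof (rule error_shape_le)
              have "v \<le> X" using pp X0 by linarith
              thus "v \<le> (A + 1) * Y" using XA by linarith
            qed (use Y pp in auto)
            ultimately show ?thesis using C x0 lX v0 error_shape_nonneg[OF v0, of z] by (intro mult_left_mono mult_mono) auto
          qed
          also have "\<dots> = C * D * (x * (log_factor X * error_shape z Y)) * (1 / real p)" by simp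
          also have "of_real (x / real p) * main_term z (X - v) v = of_real x * (w (ln (real p)) / of_nat p)"
          proof -
            have s: "0 < v / X" "v / X < 1" using v0 pp X0 by (auto simp: field_simps)
            have "of_real X powr (z - 1) * of_real (1 - v / X) powr (z - 1) = (of_real (X * (1 - v / X)) powr (z - 1) :: complex)"
              using s X0 by (intro of_real_mult_powr[symmetric]) auto
            also have "X * (1 - v / X) = X - v" using X0 by (simp add: field_simps)
            finally have "w v = of_real (X - v) powr (z - 1) * scaled_m z (1 / (v / X) - 1)"
              unfolding w_def step_weight_eq[OF s] by (simp only: mult.assoc[symmetric])
            also have "1 / (v / X) - 1 = (X - v) / v" using v0 by (simp add: field_simps)
            finally show ?thesis by (simp add: main_term_def v_def)
          qed
          finally show "norm (S_sum z (x / real p) (real p) - of_real x * (w (ln (real p)) / of_nat p)) \<le> C * D * (x * (log_factor X * error_shape z Y)) * (1 / real p)" .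
        next
          have "(\<Sum>p\<in>log_primes Y (X/2). 1 / real p) \<le> ln (X / 2 / Y) + 3 * M / Y"
            unfolding M_def using Y Y2 by (intro sum_inverse_log_primes) auto
          also have "ln (X / 2 / Y) \<le> ln (A + 1)"
          proof -
            have "X / 2 / Y \<le> A + 1" using XA X0 Y by (simp add: field_simps)
            thus ?thesis using X0 Y A by (subst ln_le_cancel_iff) auto
          qed
          also have "3 * M / Y \<le> 6 * M" using Y M by (simp add: field_simps)
          finally show "(\<Sum>p\<in>log_primes Y (X/2). 1 / real p) \<le> ln (A + 1) + 6 * M" by simp
        qed (use C D x0 lX eY in auto)
        thus ?thesis by (simp add: sum_subtractf sum_distrib_left)
      qed
      \<comment> \<open>Value and variation of the weight are bounded by X^(k-1) V, with V
        independent of x; the 1/Y from \<open>prime_sum_integral\<close> then leaves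
        Y^(k-2).\<close>
      have e3: "norm ((\<Sum>p\<in>log_primes Y (X/2). w (ln (real p)) / of_nat p) - integral {Y..X/2} (\<lambda>v. w v / of_real v))
         \<le> 3 * M * V * (A + 1) powr \<bar>k - 1\<bar> * (log_factor X * error_shape z Y)"
      proof -
        have "X * \<sigma> \<le> Y" using XA A by (simp add: \<sigma>_def field_simps)
        hence d: "dominated_on Y (X/2) w (\<lambda>v. of_real X powr (z - 1) * (of_real (1 / X) * g' (v / X)))
          (\<lambda>v. norm (of_real X powr (z - 1)) * H (v / X)) (\<lambda>v. norm (complex_of_real X powr (z - 1)) * (1 / X * h (v / X))) ((\<lambda>s. X * s) ` S)"
          unfolding w_def using X0 by (intro dominated_scale[OF dom]) auto
        have nX: "norm (complex_of_real X powr (z - 1)) = X powr (k - 1)"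
          using X0 norm_powr_real_powr[of "of_real X" "z - 1"] by (simp add: k_def)
        have "norm ((\<Sum>p\<in>log_primes Y (X/2). w (ln (real p)) / of_nat p) - integral {Y..X/2} (\<lambda>v. w v / of_real v))
          \<le> 3 * M / Y * (norm (w (X/2)) + (norm (complex_of_real X powr (z - 1)) * H (X / 2 / X) - norm (complex_of_real X powr (z - 1)) * H (Y / X)))"
          unfolding M_def by (rule prime_sum_integral[OF _ _ d]) (use Y Y2 in auto)
        also have "\<dots> = 3 * M / Y * (X powr (k - 1) * (norm (step_weight z (1/2)) + (H (1/2) - H (Y / X))))"
          unfolding w_def norm_mult nX using X0 by (simp add: algebra_simps)
        also have "\<dots> \<le> 3 * M / Y * (X powr (k - 1) * V)"
        proof (intro mult_left_mono)
          have "\<sigma> \<le> Y / X" "Y / X \<le> 1/2" using \<open>X * \<sigma> \<le> Y\<close> Y2 X0 by (auto simp: field_simps)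
          hence "H \<sigma> \<le> H (Y / X)" by (intro dominated_integrals(4)[OF dom]) auto
          thus "norm (step_weight z (1/2)) + (H (1/2) - H (Y / X)) \<le> V" by (simp add: V_def)
        qed (use M Y in auto)
        also have "\<dots> \<le> 3 * M / Y * (((A + 1) powr \<bar>k - 1\<bar> * Y powr (k - 1)) * V)"
          using M Y V0 XY XA by (intro mult_left_mono mult_right_mono powr_ratio_le') auto
        also have "\<dots> = 3 * M * V * (A + 1) powr \<bar>k - 1\<bar> * Y powr (k - 2)"
          using Y by (simp add: powr_diff powr_numeral power2_eq_square field_simps)
        also have "\<dots> \<le> 3 * M * V * (A + 1) powr \<bar>k - 1\<bar> * (log_factor X * error_shape z Y)"
        proof (rule mult_left_mono)
          have "Y powr (k - 2) \<le> 1 * error_shape z Y" using Y by (simp add: error_shape_def k_def)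
          also have "\<dots> \<le> log_factor X * error_shape z Y" using lX eY by (intro mult_right_mono) auto
          finally show "Y powr (k - 2) \<le> log_factor X * error_shape z Y" .
        qed (use M V0 in auto)
        finally show ?thesis .
      qed
      define U where "U = x * (log_factor X * error_shape z Y)"
      define S1 where "S1 = (\<Sum>p\<in>log_primes Y (X/2). S_sum z (x / real p) (real p))"
      define S2 where "S2 = (\<Sum>p\<in>log_primes Y (X/2). w (ln (real p)) / of_nat p)"
      define I where "I = integral {Y..X/2} (\<lambda>v. w v / of_real v)"
      have I: "(1 - z) * I = of_real X powr (z - 1) * (scaled_m z (X / Y) - scaled_m z 2)"
        unfolding I_def w_def using Y Y2 by (intro step_integral z) auto
      have "S_sum z x y - of_real x * main_term z (ln x) (ln y) =
        (S_sum z x r - of_real x * (of_real X powr (z - 1) * scaled_m z 2)) + (1 - z) * (S1 - of_real x * S2) + of_real x * ((1 - z) * (S2 - I))"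
      proof -
        have mt: "main_term z (ln x) (ln y) = of_real X powr (z - 1) * scaled_m z 2 + (1 - z) * I"
          unfolding I by (simp add: main_term_def X_def Y_def algebra_simps)
        show ?thesis unfolding mt b S1_def[symmetric] by (simp add: algebra_simps)
      qed
      also have "norm \<dots> \<le> C * D * U + norm (1 - z) * ((C * D * U) * (ln (A + 1) + 6 * M)) + x * (norm (1 - z) * (3 * M * V * (A + 1) powr \<bar>k - 1\<bar> * (log_factor X * error_shape z Y)))"
      proof (intro norm_triangle_le add_mono)
        show "norm (S_sum z x r - of_real x * (of_real X powr (z - 1) * scaled_m z 2)) \<le> C * D * U" using e1 by (simp add: U_def)
        show "norm ((1 - z) * (S1 - of_real x * S2)) \<le> norm (1 - z) * ((C * D * U) * (ln (A + 1) + 6 * M))"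
          unfolding norm_mult using e2 by (intro mult_left_mono) (auto simp: U_def S1_def S2_def)
        show "norm (of_real x * ((1 - z) * (S2 - I))) \<le> x * (norm (1 - z) * (3 * M * V * (A + 1) powr \<bar>k - 1\<bar> * (log_factor X * error_shape z Y)))"
          unfolding norm_mult norm_of_real using e3 x0 by (intro mult_mono) (auto simp: I_def S2_def)
      qed
      also have "\<dots> = (C * D + C2 + C3) * U" by (simp add: C2_def C3_def U_def algebra_simps)
      also have "\<dots> \<le> C' * U" unfolding C'(3) U_def using C x0 lX eY by (intro mult_right_mono) auto
      finally show ?thesis by (simp add: U_def X_def Y_def)
    qed
  qed
  with C'(1) show ?thesis unfolding approx_on_def by blast
qed

section \<open>The base case\<close>

lemma of_real_powr_eq_exp: "a > 0 \<Longrightarrow> complex_of_real a powr w = exp (w * of_real (ln a))"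
  by (simp add: powr_def Ln_of_real)

lemma norm_of_real_powr: "a > 0 \<Longrightarrow> norm (complex_of_real a powr w) = a powr Re w"
  using norm_powr_real_powr[of "of_real a" w] by simp

text \<open>For X/v below 2 the substitution u = X/v turns the kernel of m_z into (X-v)^(z-1) / v,
  the density of the main terms of the full sums at x/p. The computation is carried out on
  exponents, all powers being exponentials of log X, log v and log(X-v).\<close>

lemma scaled_m_deriv_below_2:
  assumes v: "0 < v" "v < X" "X / 2 < v"
  shows "of_real X powr (z - 1) * (of_real (X / v\<^sup>2) * scaled_m_deriv z (X / v)) =
     (leading_factor z * (1 - z)) * (of_real (X - v) powr (z - 1) / of_real v)"
proof -
  define a b c where "a = complex_of_real (ln X)" and "b = complex_of_real (ln v)" and "c = complex_of_real (ln (X - v))"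
  have u: "1 < X / v" "X / v < 2" using v by (auto simp: field_simps)
  have e1: "of_real X powr (z - 1) = exp ((z - 1) * a)" using v by (simp add: of_real_powr_eq_exp a_def)
  have "complex_of_real (X / v\<^sup>2) = exp (of_real (ln (X / v\<^sup>2)))" using v by (simp add: exp_of_real)
  also have "ln (X / v\<^sup>2) = ln X - 2 * ln v" using v by (simp add: ln_div ln_realpow)
  finally have e2: "complex_of_real (X / v\<^sup>2) = exp (a - 2 * b)" by (simp add: a_def b_def)
  have "X / v - 1 = (X - v) / v" using v by (simp add: field_simps)
  hence l: "ln (X / v) = ln X - ln v" "ln (X / v - 1) = ln (X - v) - ln v" using v by (simp_all add: ln_div)
  have e3: "m_kernel z (X / v) = exp (- z * (a - b) - (1 - z) * (c - b))"
    unfolding m_kernel_eq[OF u(1)] l by (simp add: a_def b_def c_def)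
  have e4: "of_real (X - v) powr (z - 1) = exp ((z - 1) * c)"
    unfolding c_def by (rule of_real_powr_eq_exp) (use v in simp)
  have "exp b = of_real v" using v by (simp add: b_def exp_of_real)
  hence e5: "of_real (X - v) powr (z - 1) / of_real v = exp ((z - 1) * c - b)"
    unfolding e4 by (simp add: exp_diff)
  have "exp ((z - 1) * a) * (exp (a - 2 * b) * exp (- z * (a - b) - (1 - z) * (c - b))) = exp ((z - 1) * c - b)"
    unfolding exp_add[symmetric] by (rule arg_cong[where f = exp]) (simp add: algebra_simps)
  thus ?thesis using u unfolding e1 e2 e5 scaled_m_deriv_def e3 by (simp add: mult_ac)
qed

lemma base_integral:
  assumes z: "Re z > 0" and Y: "0 < Y" "X / 2 \<le> Y" "Y \<le> b" "b < X"
  shows "(leading_factor z * (1 - z)) * integral {Y..b} (\<lambda>v. of_real (X - v) powr (z - 1) / of_real v) =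
     of_real X powr (z - 1) * (scaled_m z (X / Y) - scaled_m z (X / b))"
proof -
  have I: "((\<lambda>v. of_real X powr (z - 1) * (of_real (X / v\<^sup>2) * scaled_m_deriv z (X / v))) has_integral
     (of_real X powr (z - 1) * (scaled_m z (X / Y) - scaled_m z (X / b)))) {Y..b}"
    using Y by (intro scaled_m_integral_identity z) auto
  \<comment> \<open>The end point v = Y is left out because X/v = 2 there if Y = X/2, which belongs
    to the other branch of \<open>scaled_m_deriv\<close>.\<close>
  have eq: "(leading_factor z * (1 - z)) * (of_real (X - v) powr (z - 1) / of_real v) =
      of_real X powr (z - 1) * (of_real (X / v\<^sup>2) * scaled_m_deriv z (X / v))" if "v \<in> {Y..b} - {Y}" for v
    by (rule scaled_m_deriv_below_2[symmetric]) (use Y that in auto)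
  have "((\<lambda>v. (leading_factor z * (1 - z)) * (of_real (X - v) powr (z - 1) / of_real v)) has_integral
     (of_real X powr (z - 1) * (scaled_m z (X / Y) - scaled_m z (X / b)))) {Y..b}"
    by (rule has_integral_spike_finite[where S = "{Y}", OF _ eq I]) simp_all
  hence "integral {Y..b} (\<lambda>v. (leading_factor z * (1 - z)) * (of_real (X - v) powr (z - 1) / of_real v)) =
     of_real X powr (z - 1) * (scaled_m z (X / Y) - scaled_m z (X / b))" by (rule integral_unique)
  thus ?thesis by (simp only: integral_mult_right)
qed

text \<open>With X/q = 1 + e and e = O(1/X), the kernel integral is O(e^(Re z)); the factor X^(Re z
  - 1) turns this into 1/X for every value of Re z > 0.\<close>

lemma scaled_m_near_1:
  assumes z: "Re z > 0" and q: "0 < X" "X / 2 \<le> q" "q \<le> X" "X - q \<le> 1"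
  shows "norm (of_real X powr (z - 1) * (scaled_m z (X / q) - leading_factor z)) \<le> norm (leading_factor z * (1 - z)) * 2 powr Re z / Re z * (1 / X)"
proof -
  define e where "e = (X - q) / q"
  have q0: "q > 0" using q by linarith
  have e: "0 \<le> e" "e \<le> 1" using q q0 by (auto simp: e_def field_simps)
  have "e \<le> 1 / (X / 2)" unfolding e_def using q by (intro frac_le) auto
  hence e2: "e \<le> 2 / X" by simp
  have Xq: "X / q = 1 + e" using q0 by (simp add: e_def field_simps)
  have "scaled_m z (X / q) - leading_factor z = (leading_factor z * (1 - z)) * m_kernel_integral z (1 + e)"
    using e scaled_m_low[of "1 + e" z] unfolding Xq by (simp add: algebra_simps)
  hence "norm (of_real X powr (z - 1) * (scaled_m z (X / q) - leading_factor z)) = X powr (Re z - 1) * (norm (leading_factor z * (1 - z)) * norm (m_kernel_integral z (1 + e)))"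
    using q by (simp only: norm_mult norm_of_real_powr) simp
  also have "norm (m_kernel_integral z (1 + e)) \<le> (2 / X) powr Re z / Re z"
  proof -
    have "norm (m_kernel_integral z (1 + e)) \<le> e powr Re z / Re z" by (rule m_kernel_integral_bound[OF z e])
    also have "\<dots> \<le> (2 / X) powr Re z / Re z" using e e2 z by (intro divide_right_mono powr_mono2) auto
    finally show ?thesis .
  qed
  also have "X powr (Re z - 1) * (norm (leading_factor z * (1 - z)) * ((2 / X) powr Re z / Re z)) = norm (leading_factor z * (1 - z)) * 2 powr Re z / Re z * (1 / X)"
    using q by (simp add: powr_divide powr_diff)
  finally show ?thesis using q by (simp add: mult_left_mono)
qed

text \<open>The derivative is bounded by a multiple of B / (X-v), whose primitive is a logarithm.
  This treats both signs of Re z - 1 at once, at the cost of the logarithmic factor that the error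
  carries anyway.\<close>

lemma base_dominated:
  assumes b: "b < X" and B: "\<And>v. a < v \<Longrightarrow> v < b \<Longrightarrow> (X - v) powr (Re z - 1) \<le> B"
  shows "dominated_on a b (\<lambda>v. of_real (X - v) powr (z - 1)) (\<lambda>v. of_real (- 1) * ((z - 1) * of_real (X - v) powr (z - 1 - 1)))
     (\<lambda>v. - (norm (1 - z) * B * ln (X - v))) (\<lambda>v. norm (1 - z) * B / (X - v)) {}"
  unfolding dominated_on_def
proof (intro conjI ballI)
  show "continuous_on {a..b} (\<lambda>v. complex_of_real (X - v) powr (z - 1))"
    using b by (intro continuous_intros) (auto simp: complex_nonpos_Reals_iff)
  show "continuous_on {a..b} (\<lambda>v. - (norm (1 - z) * B * ln (X - v)))"
    using b by (intro continuous_intros) auto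
  fix v assume v: "v \<in> {a<..<b} - {}"
  have Xv: "X - v > 0" using v b by auto
  show "((\<lambda>v. complex_of_real (X - v) powr (z - 1)) has_vector_derivative of_real (- 1) * ((z - 1) * of_real (X - v) powr (z - 1 - 1))) (at v)"
    using Xv by (intro of_real_powr_deriv) (auto intro!: derivative_eq_intros)
  show "((\<lambda>v. - (norm (1 - z) * B * ln (X - v))) has_vector_derivative norm (1 - z) * B / (X - v)) (at v)"
    unfolding has_real_derivative_iff_has_vector_derivative[symmetric]
    using Xv by (auto intro!: derivative_eq_intros)
  have "norm (of_real (- 1) * ((z - 1) * complex_of_real (X - v) powr (z - 1 - 1))) = norm (1 - z) * (X - v) powr (Re z - 1 - 1)"
    unfolding norm_mult norm_of_real_powr[OF Xv] by (simp add: norm_minus_commute)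
  also have "(X - v) powr (Re z - 1 - 1) = (X - v) powr (Re z - 1) / (X - v)" unfolding powr_diff[of _ _ 1] using Xv by simp
  also have "\<dots> \<le> B / (X - v)" using B[of v] v Xv by (intro divide_right_mono) auto
  finally show "norm (of_real (- 1) * ((z - 1) * complex_of_real (X - v) powr (z - 1 - 1))) \<le> norm (1 - z) * B / (X - v)"
    by (simp add: mult_left_mono)
qed simp

lemma powr_le_sum:
  fixes t X e :: real
  assumes "1/2 \<le> t" "t \<le> X"
  shows "t powr e \<le> 2 powr \<bar>e\<bar> + X powr e"
proof (cases "e \<ge> 0")
  case True
  have "t powr e \<le> X powr e" using assms True by (intro powr_mono2) auto
  thus ?thesis by (simp add: add_increasing)
next
  case False
  have "t powr e \<le> (1/2) powr e" using assms False by (intro powr_mono2') auto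
  also have "\<dots> = 2 powr \<bar>e\<bar>" using False by (simp add: powr_divide powr_minus_divide)
  finally show ?thesis by (simp add: add_increasing2)
qed

lemma neg_ln_ln2: "- ln (ln (2::real)) \<le> 1"
proof -
  have "ln (1/2) \<le> ln (ln (2::real))" using ln2_bounds by (subst ln_le_cancel_iff) auto
  thus ?thesis using ln2_bounds by (simp add: ln_div)
qed

text \<open>For y <= p < x/2 with x <= y^2 one has x/p <= p, so with at most one exception S_z(x/p,
  p) is a full sum, taken at x/p >= 2. Partial summation of its main terms and
  \<open>base_integral\<close> produce the increment of \<open>scaled_m\<close>.\<close>

lemma base_primes:
  assumes z: "Re z > 0"
  shows "\<exists>K>0. \<forall>x y. 2 \<le> y \<and> ln y \<le> ln x - ln 2 \<and> ln x \<le> 2 * ln y \<and> x > 0 \<longrightarrow>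
    norm ((1 - z) * (\<Sum>p\<in>log_primes (ln y) (ln x - ln 2). S_sum z (x / real p) (real p)) -
      of_real x * (of_real (ln x) powr (z - 1) * (scaled_m z (ln x / ln y) - scaled_m z (ln x / (ln x - ln 2)))))
      \<le> K * (x * (log_factor (ln x) * error_shape z (ln y)))"
proof -
  define k where "k = Re z"
  obtain C where C: "C > 0" "\<And>x. x \<ge> 2 \<Longrightarrow> norm (omega_sum z x - of_real x * (g_one z / Gamma z * of_real (ln x) powr (z - 1)))
     \<le> C * (x * (ln x powr (Re z - 2) + 1 / ln x))" using omega_sum_asymptotic[OF z] by blast
  define M where "M = mertens_const + 1"
  have M: "M > 0" using mertens_const(1) by (simp add: M_def)
  define c0 where "c0 = (2::real) powr \<bar>k - 1\<bar>"
  have c0: "c0 > 0" by (simp add: c0_def)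
  define K1 where "K1 = norm (1 - z) * (1 + norm z)"
  define K2 where "K2 = norm (1 - z) * (C * (c0 + 1) * (1 + 12 * M))"
  define K3 where "K3 = norm (leading_factor z * (1 - z)) * (3 * M * (1 + norm (1 - z)) * c0)"
  have K: "K1 \<ge> 0" "K2 \<ge> 0" "K3 \<ge> 0" unfolding K1_def K2_def K3_def using C(1) c0 M by auto
  define K where "K = 1 + K1 + K2 + K3"
  have K0: "K > 0" using K by (simp add: K_def)
  have "norm ((1 - z) * (\<Sum>p\<in>log_primes (ln y) (ln x - ln 2). S_sum z (x / real p) (real p)) -
      of_real x * (of_real (ln x) powr (z - 1) * (scaled_m z (ln x / ln y) - scaled_m z (ln x / (ln x - ln 2)))))
      \<le> K * (x * (log_factor (ln x) * error_shape z (ln y)))"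
    if xy: "2 \<le> y" "ln y \<le> ln x - ln 2" "ln x \<le> 2 * ln y" "x > 0" for x y
  proof -
    define X where "X = ln x"
    define Y where "Y = ln y"
    define b where "b = X - ln 2"
    define P where "P = log_primes Y b"
    have Y: "Y \<ge> 1/2"
      using ln_le_cancel_iff[of 2 y] xy(1) ln2_bounds unfolding Y_def by linarith
    have Yb: "Y \<le> b" "X \<le> 2 * Y" "b < X" using xy by (auto simp: X_def Y_def b_def)
    have X: "X > 0" using Y Yb by linarith
    have eY: "error_shape z Y \<ge> 1 / Y" "error_shape z Y \<ge> 0" using Y by (auto simp: error_shape_def)
    have lX: "log_factor X \<ge> 1" using X by (intro log_factor_ge_1) auto
    define E where "E = x * (log_factor X * error_shape z Y)"
    \<comment> \<open>Allows bounded quantities to be absorbed into the error.\<close>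
    have E1: "E \<ge> 1"
    proof -
      have "Y \<le> x" using Yb ln_le_minus_one[of x] xy by (simp add: X_def)
      hence "1 \<le> x * (1 * (1 / Y))" using Y by (simp add: field_simps)
      also have "\<dots> \<le> E" unfolding E_def using xy lX eY Y by (intro mult_left_mono mult_mono) auto
      finally show ?thesis .
    qed
    \<comment> \<open>Bounds t^(k-1) for 1/2 <= t <= X, whatever the sign of k - 1.\<close>
    define B where "B = c0 + X powr (k - 1)"
    have B0: "B > 0" using c0 by (simp add: B_def add_pos_nonneg)
    have BY: "B / Y \<le> c0 * error_shape z Y"
    proof -
      have "X powr (k - 1) \<le> c0 * Y powr (k - 1)"
        unfolding c0_def using Y Yb by (intro powr_ratio_le) auto
      hence "X powr (k - 1) / Y \<le> c0 * Y powr (k - 1) / Y" using Y by (intro divide_right_mono) auto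
      also have "\<dots> = c0 * Y powr (k - 2)" using Y by (simp add: powr_diff powr_numeral power2_eq_square)
      finally show ?thesis by (simp add: B_def error_shape_def k_def add_divide_distrib distrib_left)
    qed
    have Bt: "t powr (k - 1) \<le> B" if "1/2 \<le> t" "t \<le> X" for t
      using powr_le_sum[OF that, of "k - 1"] by (simp add: B_def c0_def)
    have lnX: "ln X - ln (ln 2) \<le> log_factor X"
    proof -
      have "ln X \<le> ln (1 + X)" using X by simp
      thus ?thesis using neg_ln_ln2 by (simp add: log_factor_def)
    qed
    define w where "w = (\<lambda>v. complex_of_real (X - v) powr (z - 1))"
    define S1 where "S1 = (\<Sum>p\<in>P. S_sum z (x / real p) (real p))"
    define S2 where "S2 = (\<Sum>p\<in>P. omega_sum z (x / real p))"
    define S3 where "S3 = (\<Sum>p\<in>P. w (ln (real p)) / of_nat p)"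
    define I where "I = integral {Y..b} (\<lambda>v. w v / of_real v)"
    have p_facts: "real p \<ge> 2" "Y \<le> ln (real p)" "ln (real p) < b" "ln (x / real p) = X - ln (real p)" "prime p"
      "x / real p \<le> real p" "x / real p \<ge> 2" if "p \<in> P" for p
    proof -
      have p: "prime p" "Y \<le> ln (real p)" "ln (real p) < b" using that by (auto simp: P_def log_primes_def)
      show p2: "real p \<ge> 2" using prime_ge_2_nat[OF p(1)] by simp
      show "Y \<le> ln (real p)" "ln (real p) < b" "prime p" by fact+
      show l: "ln (x / real p) = X - ln (real p)" using xy p2 by (simp add: X_def ln_div)
      have pos: "x / real p > 0" using xy p2 by simp
      have "ln (x / real p) \<le> ln (real p)" unfolding l using p Yb by linarith
      thus "x / real p \<le> real p" using pos p2 by (subst (asm) ln_le_cancel_iff) auto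
      have "ln 2 \<le> ln (x / real p)" unfolding l using p by (simp add: b_def)
      thus "x / real p \<ge> 2" using pos by (subst (asm) ln_le_cancel_iff) auto
    qed
    \<comment> \<open>A term differs only if x = p^2, hence for at most one prime.\<close>
    have i1: "norm (S1 - S2) \<le> 1 + norm z"
    proof -
      have "norm (\<Sum>p\<in>P. S_sum z (x / real p) (real p) - omega_sum z (x / real p)) \<le> (\<Sum>p\<in>P. if p = nat \<lfloor>sqrt x\<rfloor> then 1 + norm z else 0)"
      proof (rule sum_norm_le)
        fix p assume p: "p \<in> P"
        have "norm (S_sum z (x / real p) (real p) - omega_sum z (x / real p)) \<le> (if x / real p = real p then 1 + norm z else 0)"
          using p_facts[OF p] by (intro S_sum_minus_omega_sum) auto
        also have "\<dots> \<le> (if p = nat \<lfloor>sqrt x\<rfloor> then 1 + norm z else 0)"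
        proof (cases "x / real p = real p")
          case True
          hence "x = real p * real p" using p_facts(1)[OF p] by (simp add: field_simps)
          hence "sqrt x = real p" by simp
          hence "p = nat \<lfloor>sqrt x\<rfloor>" by simp
          thus ?thesis by simp
        qed auto
        finally show "norm (S_sum z (x / real p) (real p) - omega_sum z (x / real p)) \<le> (if p = nat \<lfloor>sqrt x\<rfloor> then 1 + norm z else 0)" .
      qed
      also have "\<dots> \<le> 1 + norm z" by (simp add: P_def)
      finally show ?thesis by (simp add: S1_def S2_def sum_subtractf)
    qed
    \<comment> \<open>Each full sum is replaced by its main term. The errors are at most B + 1 times
      x / (p (X - log p)), and \<open>sum_inverse_log_distance\<close> sums them at the price of log
      log x.\<close>
    have i2: "norm (S2 - of_real x * (leading_factor z * S3)) \<le> C * (c0 + 1) * (1 + 12 * M) * E"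
    proof -
      have "norm (\<Sum>p\<in>log_primes Y b. omega_sum z (x / real p) - of_real x * (leading_factor z * (w (ln (real p)) / of_nat p)))
        \<le> (C * x * (B + 1)) * ((ln X - ln (ln 2)) / Y + 3 * M / Y * (2 / ln 2))"
      proof (rule sum_log_primes_real_le)
        fix p assume p: "p \<in> log_primes Y b"
        note pf = p_facts[OF p[folded P_def]]
        define v where "v = ln (real p)"
        have Xv: "X - v \<ge> 1/2" using pf(3) ln2_bounds by (simp add: v_def b_def)
        have v0: "v > 0" using pf(2) Y by (simp add: v_def)
        have "of_real (x / real p) * (g_one z / Gamma z * of_real (ln (x / real p)) powr (z - 1)) = of_real x * (leading_factor z * (w (ln (real p)) / of_nat p))"
          unfolding pf(4) leading_factor_def w_def by simp
        hence "norm (omega_sum z (x / real p) - of_real x * (leading_factor z * (w (ln (real p)) / of_nat p))) \<le> C * (x / real p * ((X - v) powr (k - 2) + 1 / (X - v)))"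
          using C(2)[OF pf(7)] unfolding pf(4) v_def[symmetric] k_def by simp
        also have "\<dots> \<le> C * (x / real p * (B / (X - v) + 1 / (X - v)))"
        proof -
          have "(X - v) powr (k - 2) = (X - v) powr (k - 1) / (X - v)" using Xv by (simp add: powr_diff powr_numeral power2_eq_square)
          also have "\<dots> \<le> B / (X - v)" using Xv v0 by (intro divide_right_mono Bt) auto
          finally show ?thesis using C(1) xy by (intro mult_left_mono add_right_mono) auto
        qed
        also have "\<dots> = C * x * (B + 1) * (1 / (real p * (X - v)))" by (simp add: add_divide_distrib[symmetric])
        finally show "norm (omega_sum z (x / real p) - of_real x * (leading_factor z * (w (ln (real p)) / of_nat p))) \<le> C * x * (B + 1) * (1 / (real p * (X - ln (real p))))"
          by (simp only: v_def)
      next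
        show "(\<Sum>p\<in>log_primes Y b. 1 / (real p * (X - ln (real p)))) \<le> (ln X - ln (ln 2)) / Y + 3 * M / Y * (2 / ln 2)"
          unfolding b_def M_def using Y Yb by (intro sum_inverse_log_distance) (auto simp: b_def)
        show "C * x * (B + 1) \<ge> 0" using C(1) xy B0 by simp
      qed
      also have "\<dots> = C * x * ((B / Y + 1 / Y) * ((ln X - ln (ln 2)) + 6 * M / ln 2))" using Y by (simp add: field_simps)
      also have "\<dots> \<le> C * x * ((c0 * error_shape z Y + error_shape z Y) * (log_factor X + 12 * M))"
      proof -
        have "6 * M / ln 2 \<le> 6 * M / (1/2)" using M ln2_bounds by (intro divide_left_mono) auto
        moreover have "ln X - ln (ln 2) + 6 * M / ln 2 \<ge> 0"
        proof -
          have "ln (ln 2) \<le> ln X" using X Yb Y xy ln2_bounds by (subst ln_le_cancel_iff) (auto simp: b_def)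
          moreover have "6 * M / ln 2 \<ge> 0" using M by simp
          ultimately show ?thesis by linarith
        qed
        ultimately show ?thesis using lnX BY eY C(1) xy c0 by (intro mult_left_mono mult_mono add_mono) auto
      qed
      also have "\<dots> \<le> C * x * ((c0 * error_shape z Y + error_shape z Y) * (log_factor X * (1 + 12 * M)))"
      proof -
        have "12 * M * 1 \<le> 12 * M * log_factor X" using lX M by (intro mult_left_mono) auto
        thus ?thesis using C(1) xy c0 eY by (intro mult_left_mono) (auto simp: algebra_simps)
      qed
      also have "\<dots> = C * (c0 + 1) * (1 + 12 * M) * E" by (simp add: E_def algebra_simps)
      finally show ?thesis by (simp add: S2_def S3_def P_def sum_subtractf sum_distrib_left)
    qed
    \<comment> \<open>The variation of (X-v)^(z-1) is measured by B log(X-v), which again costs one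
      logarithmic factor.\<close>
    have i3: "norm (S3 - I) \<le> 3 * M * (1 + norm (1 - z)) * c0 * (log_factor X * error_shape z Y)"
    proof -
      have d: "dominated_on Y b w (\<lambda>v. of_real (- 1) * ((z - 1) * of_real (X - v) powr (z - 1 - 1)))
        (\<lambda>v. - (norm (1 - z) * B * ln (X - v))) (\<lambda>v. norm (1 - z) * B / (X - v)) {}"
        unfolding w_def
      proof (rule base_dominated[OF Yb(3)])
        fix v assume "Y < v" "v < b"
        thus "(X - v) powr (Re z - 1) \<le> B" using ln2_bounds Y by (intro Bt[unfolded k_def]) (auto simp: b_def)
      qed
      have "norm (S3 - I) \<le> 3 * M / Y * (norm (w b) + (- (norm (1 - z) * B * ln (X - b)) - - (norm (1 - z) * B * ln (X - Y))))"
        unfolding S3_def I_def P_def M_def by (rule prime_sum_integral[OF _ _ d]) (use Y Yb in auto)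
      also have "\<dots> = 3 * M / Y * (norm (w b) + norm (1 - z) * B * (ln (X - Y) - ln (ln 2)))" by (simp add: b_def algebra_simps)
      also have "\<dots> \<le> 3 * M / Y * (B * log_factor X + norm (1 - z) * B * log_factor X)"
      proof (intro mult_left_mono add_mono)
        have "norm (w b) = (ln 2) powr (k - 1)" unfolding w_def b_def k_def by (simp add: norm_of_real_powr)
        also have "\<dots> \<le> B * 1" using ln2_bounds X Yb Y by (simp, intro Bt) (auto simp: b_def)
        also have "\<dots> \<le> B * log_factor X" using lX B0 by (intro mult_left_mono) auto
        finally show "norm (w b) \<le> B * log_factor X" .
        have "ln (X - Y) \<le> ln X" using Yb Y by (subst ln_le_cancel_iff) auto
        thus "ln (X - Y) - ln (ln 2) \<le> log_factor X" using lnX by linarith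
      qed (use B0 M Y in auto)
      also have "\<dots> = 3 * M * (1 + norm (1 - z)) * log_factor X * (B / Y)" by (simp add: field_simps)
      also have "\<dots> \<le> 3 * M * (1 + norm (1 - z)) * log_factor X * (c0 * error_shape z Y)" using M lX BY by (intro mult_left_mono) auto
      finally show ?thesis by (simp add: mult_ac)
    qed
    have II: "(leading_factor z * (1 - z)) * I = of_real X powr (z - 1) * (scaled_m z (X / Y) - scaled_m z (X / b))"
      unfolding I_def w_def using Y Yb by (intro base_integral z) auto
    have "(1 - z) * S1 - of_real x * (of_real X powr (z - 1) * (scaled_m z (X / Y) - scaled_m z (X / b))) =
      (1 - z) * (S1 - S2) + (1 - z) * (S2 - of_real x * (leading_factor z * S3)) + of_real x * (leading_factor z * (1 - z) * (S3 - I))"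
      unfolding II[symmetric] by (simp add: algebra_simps)
    also have "norm \<dots> \<le> K1 * E + K2 * E + K3 * E"
    proof (intro norm_triangle_le add_mono)
      have "norm (S1 - S2) \<le> (1 + norm z) * E" using i1 mult_left_mono[OF E1, of "1 + norm z"] by simp
      thus "norm ((1 - z) * (S1 - S2)) \<le> K1 * E" unfolding norm_mult K1_def mult.assoc by (intro mult_left_mono) auto
      show "norm ((1 - z) * (S2 - of_real x * (leading_factor z * S3))) \<le> K2 * E"
        unfolding norm_mult[of "1 - z" "S2 - _"] K2_def mult.assoc[of "norm (1 - z)"] using i2 by (intro mult_left_mono) auto
      have "norm (of_real x * (leading_factor z * (1 - z) * (S3 - I))) = x * (norm (leading_factor z * (1 - z)) * norm (S3 - I))"
        using xy by (simp add: norm_mult)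
      also have "\<dots> \<le> x * (norm (leading_factor z * (1 - z)) * (3 * M * (1 + norm (1 - z)) * c0 * (log_factor X * error_shape z Y)))"
        using xy i3 by (intro mult_left_mono) auto
      also have "\<dots> = K3 * E" by (simp add: K3_def E_def)
      finally show "norm (of_real x * (leading_factor z * (1 - z) * (S3 - I))) \<le> K3 * E" .
    qed
    also have "\<dots> \<le> K * E" using E1 by (simp add: K_def algebra_simps)
    finally show ?thesis by (simp add: S1_def P_def E_def X_def Y_def b_def)
  qed
  with K0 show ?thesis by blast
qed

text \<open>Here x/p <= 2, so each term is bounded, and 1 <= 2x/p turns the count of primes into a
  sum of 1/p. The range has length at most 2 log 2 on the logarithmic scale, so that sum is O(1/log
  x).\<close>

lemma top_primes:
  assumes x: "x \<ge> 4" and q: "ln x - ln 2 \<le> q" "q \<le> ln x"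
  shows "norm (\<Sum>p\<in>log_primes q (ln (x + 1)). S_sum z (x / real p) (real p)) \<le> 2 * (2 + norm z) * (4 + 6 * (mertens_const + 1)) * (x / ln x)"
proof -
  define X where "X = ln x"
  define M where "M = mertens_const + 1"
  have M: "M > 0" using mertens_const(1) by (simp add: M_def)
  have "ln 4 \<le> X" unfolding X_def using x by (subst ln_le_cancel_iff) auto
  moreover have "ln 4 = 2 * ln (2::real)" using ln_realpow[of 2 2] by simp
  ultimately have X: "X \<ge> 2 * ln 2" by simp
  have q2: "q \<ge> X / 2" "q > 0" "X > 0" using X q ln2_bounds unfolding X_def by linarith+
  have "ln (x + 1) \<le> ln (2 * x)" using x by (subst ln_le_cancel_iff) auto
  hence l1: "ln (x + 1) \<le> X + ln 2" using x by (simp add: ln_mult X_def)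
  have l2: "X \<le> ln (x + 1)" unfolding X_def using x by (subst ln_le_cancel_iff) auto
  have "norm (\<Sum>p\<in>log_primes q (ln (x + 1)). S_sum z (x / real p) (real p)) \<le> (2 + norm z) * (2 * x) * (4 / X + 6 * M / X)"
  proof (rule sum_log_primes_real_le[where g = "\<lambda>p. 1 / real p"])
    fix p assume p: "p \<in> log_primes q (ln (x + 1))"
    have pp: "real p > 0" using p prime_gt_0_nat by (auto simp: log_primes_def)
    have "ln (x / 2) \<le> ln (real p)" using p q x by (simp add: log_primes_def ln_div)
    hence "x / 2 \<le> real p" using pp x by (subst (asm) ln_le_cancel_iff) auto
    hence "x / real p \<le> 2" using pp by (simp add: field_simps)
    hence "norm (S_sum z (x / real p) (real p)) \<le> (2 + norm z) * 1" using S_sum_small[of "x / real p" z "real p"] by simp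
    also have "\<dots> \<le> (2 + norm z) * (2 * x / real p)"
    proof (rule mult_left_mono)
      have "ln (real p) < ln (x + 1)" using p by (simp add: log_primes_def)
      hence "real p < x + 1" using pp x by (subst (asm) ln_less_cancel_iff) auto
      thus "1 \<le> 2 * x / real p" using pp x by (simp add: field_simps)
    qed simp
    finally show "norm (S_sum z (x / real p) (real p)) \<le> (2 + norm z) * (2 * x) * (1 / real p)" by simp
  next
    have "(\<Sum>p\<in>log_primes q (ln (x + 1)). 1 / real p) \<le> ln (ln (x + 1) / q) + 3 * M / q"
      unfolding M_def using q2 q l2 by (intro sum_inverse_log_primes) (auto simp: X_def)
    also have "ln (ln (x + 1) / q) \<le> 2 / q"
    proof -
      have "ln (ln (x + 1) / q) \<le> ln (x + 1) / q - 1" using q2 l2 by (intro ln_le_minus_one) auto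
      also have "\<dots> = (ln (x + 1) - q) / q" using q2 by (simp add: field_simps)
      also have "\<dots> \<le> 2 / q" using q2 l1 q ln2_bounds by (intro divide_right_mono) (auto simp: X_def)
      finally show ?thesis .
    qed
    also have "2 / q \<le> 2 / (X / 2)" using q2 by (intro divide_left_mono) auto
    also have "3 * M / q \<le> 3 * M / (X / 2)" using q2 M by (intro divide_left_mono) auto
    finally show "(\<Sum>p\<in>log_primes q (ln (x + 1)). 1 / real p) \<le> 4 / X + 6 * M / X" by simp
  qed (use x in auto)
  also have "\<dots> = 2 * (2 + norm z) * (4 + 6 * M) * (x / X)" by (simp add: add_divide_distrib algebra_simps)
  finally show ?thesis by (simp only: X_def M_def)
qed

lemma S_sum_le:
  assumes x: "x \<ge> 1" "x \<le> 4"
  shows "norm (S_sum z x y) \<le> exp 1 * 4 powr (1 + norm z) * x"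
proof -
  define R where "R = 1 + norm z"
  have R: "R \<ge> 1" by (simp add: R_def)
  have "norm (S_sum z x y) \<le> (\<Sum>n\<in>{n. 1 \<le> n \<and> real n \<le> x}. R ^ omega n)"
    unfolding S_sum_eq_omega_below_sum omega_below_sum_def
  proof (rule sum_norm_le)
    fix n assume n: "n \<in> {n. 1 \<le> n \<and> real n \<le> x}"
    have "norm (z ^ omega_below (nat \<lceil>y\<rceil>) n) \<le> R ^ omega_below (nat \<lceil>y\<rceil>) n" unfolding norm_power by (intro power_mono) (auto simp: R_def)
    also have "\<dots> \<le> R ^ omega n" using R n by (intro power_increasing omega_below_le_omega) auto
    finally show "norm (z ^ omega_below (nat \<lceil>y\<rceil>) n) \<le> R ^ omega n" .
  qed
  also have "\<dots> \<le> exp 1 * x * (2 + ln x) powr R" by (rule omega_moment_bound[OF R x(1)])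
  also have "\<dots> \<le> exp 1 * x * 4 powr R"
  proof -
    have "ln x \<le> ln 4" using x by (subst ln_le_cancel_iff) auto
    also have "ln 4 = 2 * ln (2::real)" using ln_realpow[of 2 2] by simp
    finally have "2 + ln x \<le> 4" using ln2_bounds by simp
    thus ?thesis using x R by (intro mult_left_mono powr_mono2) auto
  qed
  finally show ?thesis by (simp add: R_def mult_ac)
qed

text \<open>The main terms telescope: the full sum contributes \<open>leading_factor\<close>, the
  primes below x/2 an increment of \<open>scaled_m\<close>, and the gap between
  \<open>scaled_m\<close> at X/q and \<open>leading_factor\<close> is covered by
  \<open>scaled_m_near_1\<close>. For x < 4 the point x/2 would fall below sqrt x, so this bounded
  range is left to the constant.\<close>

lemma approx_on_2:
  assumes z: "Re z > 0"
  shows "approx_on z 2"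
proof -
  define k where "k = Re z"
  obtain C where C: "C > 0" "\<And>x. x \<ge> 2 \<Longrightarrow> norm (omega_sum z x - of_real x * (g_one z / Gamma z * of_real (ln x) powr (z - 1)))
     \<le> C * (x * (ln x powr (Re z - 2) + 1 / ln x))" using omega_sum_asymptotic[OF z] by blast
  obtain K where K: "K > 0" "\<And>x y. 2 \<le> y \<Longrightarrow> ln y \<le> ln x - ln 2 \<Longrightarrow> ln x \<le> 2 * ln y \<Longrightarrow> x > 0 \<Longrightarrow>
    norm ((1 - z) * (\<Sum>p\<in>log_primes (ln y) (ln x - ln 2). S_sum z (x / real p) (real p)) -
      of_real x * (of_real (ln x) powr (z - 1) * (scaled_m z (ln x / ln y) - scaled_m z (ln x / (ln x - ln 2)))))
      \<le> K * (x * (log_factor (ln x) * error_shape z (ln y)))" using base_primes[OF z] by blast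
  have "continuous_on {1..2} (scaled_m z)" by (rule m_fun_continuous_on[OF z order_refl])
  hence "bounded (scaled_m z ` {1..2})" by (intro compact_imp_bounded compact_continuous_image) auto
  then obtain BN where BN: "BN > 0" "\<And>u. u \<in> {1..2} \<Longrightarrow> norm (scaled_m z u) \<le> BN" unfolding bounded_pos by blast
  define c0 where "c0 = (2::real) powr \<bar>k - 1\<bar>"
  define T where "T = 2 * (2 + norm z) * (4 + 6 * (mertens_const + 1))"
  have T: "T \<ge> 0" using mertens_const(1) by (simp add: T_def)
  define K0 where "K0 = (exp 1 * 4 powr (1 + norm z) + c0 * BN) * 2"
  define K1 where "K1 = C * 2 powr \<bar>k - 2\<bar>"
  define K2 where "K2 = norm (1 - z) * T"
  define K3 where "K3 = norm (leading_factor z * (1 - z)) * 2 powr k / k"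
  have Ks: "K0 \<ge> 0" "K1 \<ge> 0" "K2 \<ge> 0" "K3 \<ge> 0" unfolding K0_def K1_def K2_def K3_def c0_def k_def using BN C T z by auto
  define K' where "K' = K + K0 + K1 + K2 + K3"
  have K'0: "K' > 0" using Ks K by (simp add: K'_def)
  have "norm (S_sum z x y - of_real x * main_term z (ln x) (ln y)) \<le> K' * (x * (log_factor (ln x) * error_shape z (ln y)))"
    if xy: "2 \<le> y" "y \<le> x" "ln x \<le> 2 * ln y" for x y
  proof -
    define X where "X = ln x"
    define Y where "Y = ln y"
    have x0: "x > 0" "x \<ge> 2" using xy by auto
    have Y: "Y \<ge> 1/2"
      using ln_le_cancel_iff[of 2 y] xy(1) ln2_bounds unfolding Y_def by linarith
    have XY: "Y \<le> X" "X \<le> 2 * Y" using xy by (auto simp: X_def Y_def)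
    have X: "X > 0" "X \<ge> 1/2" using Y XY by linarith+
    have eY: "error_shape z Y \<ge> 1 / Y" "error_shape z Y \<ge> 0" using Y by (auto simp: error_shape_def)
    have lX: "log_factor X \<ge> 1" using X by (intro log_factor_ge_1) auto
    define E where "E = x * (log_factor X * error_shape z Y)"
    have xee: "x * error_shape z Y \<le> E" unfolding E_def using x0 lX eY mult_right_mono[OF lX, of "error_shape z Y"] by (intro mult_left_mono) auto
    have E0: "E \<ge> 0" unfolding E_def using x0 lX eY by simp
    have low: "norm (S_sum z x y - of_real x * main_term z X Y) \<le> K' * E"
    proof (cases "x < 4")
      case True
      have "X \<le> ln 4" using True x0 by (simp add: X_def)
      also have "ln 4 = 2 * ln (2::real)" using ln_realpow[of 2 2] by simp
      finally have X2: "X \<le> 2" using ln2_bounds by simp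
      hence "1 / 2 \<le> 1 / Y" using XY Y by (intro divide_left_mono) auto
      hence "x * (1 / 2) \<le> x * error_shape z Y" using eY x0 by (intro mult_left_mono) auto
      hence xE: "x \<le> 2 * E" using xee by linarith
      have "norm (of_real X powr (z - 1)) = X powr (k - 1)" using X by (simp add: norm_of_real_powr k_def)
      also have "\<dots> \<le> c0 * 1 powr (k - 1)" unfolding c0_def using X X2 by (intro powr_ratio_le) auto
      finally have n1: "norm (complex_of_real X powr (z - 1)) \<le> c0" by simp
      have n2: "norm (scaled_m z (X / Y)) \<le> BN" using XY Y by (intro BN(2)) (auto simp: field_simps)
      have "norm (S_sum z x y - of_real x * main_term z X Y) \<le> norm (S_sum z x y) + norm (of_real x * main_term z X Y)"
        by (rule norm_triangle_ineq4)
      also have "\<dots> \<le> exp 1 * 4 powr (1 + norm z) * x + x * (c0 * BN)"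
        unfolding main_term_def norm_mult using n1 n2 x0 True
        by (intro add_mono S_sum_le mult_mono) (auto simp: c0_def)
      also have "\<dots> = (exp 1 * 4 powr (1 + norm z) + c0 * BN) * x" by (simp add: algebra_simps)
      also have "\<dots> \<le> (exp 1 * 4 powr (1 + norm z) + c0 * BN) * (2 * E)"
        using xE BN(1) by (intro mult_left_mono) (auto simp: c0_def)
      also have "\<dots> = K0 * E" by (simp add: K0_def)
      also have "\<dots> \<le> K' * E" using E0 Ks K(1) by (intro mult_right_mono) (auto simp: K'_def)
      finally show ?thesis .
    next
      case False
      hence x4: "x \<ge> 4" by simp
      have "ln 4 \<le> X" unfolding X_def using x4 by (subst ln_le_cancel_iff) auto
      moreover have "ln 4 = 2 * ln (2::real)" using ln_realpow[of 2 2] by simp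
      ultimately have X4: "X \<ge> 2 * ln 2" by simp
      \<comment> \<open>Splits at x/2, or at y if that is larger; then the lower range of primes is
        empty.\<close>
      define q where "q = max Y (X - ln 2)"
      have q: "X - ln 2 \<le> q" "q \<le> X" "Y \<le> q" "X / 2 \<le> q" "X - q \<le> 1"
        using X4 XY ln2_bounds unfolding q_def by linarith+
      have lx1: "X \<le> ln (x + 1)" unfolding X_def using x0 by (subst ln_le_cancel_iff) auto
      define S1 where "S1 = (\<Sum>p\<in>log_primes Y q. S_sum z (x / real p) (real p))"
      define S2 where "S2 = (\<Sum>p\<in>log_primes q (ln (x + 1)). S_sum z (x / real p) (real p))"
      have U: "log_primes Y (ln (x + 1)) = log_primes Y q \<union> log_primes q (ln (x + 1))" "log_primes Y q \<inter> log_primes q (ln (x + 1)) = {}"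
        using q lx1 by (auto simp: log_primes_def)
      \<comment> \<open>The cut-off x + 1 exceeds every n <= x, so S_z(x, x+1) is the full
        sum.\<close>
      have b: "S_sum z x y = omega_sum z x + (1 - z) * (S1 + S2)"
        using buchstab[of y "x + 1" z x] xy S_sum_eq_omega_sum[of x "x + 1" z]
        unfolding Y_def[symmetric] U(1) S1_def S2_def by (simp add: sum.union_disjoint U(2))
      have e1: "norm (omega_sum z x - of_real x * (leading_factor z * of_real X powr (z - 1))) \<le> K1 * E"
      proof -
        have "norm (omega_sum z x - of_real x * (leading_factor z * of_real X powr (z - 1))) \<le> C * (x * error_shape z X)"
          using C(2)[OF x0(2)] by (simp add: leading_factor_def error_shape_def X_def)
        also have "\<dots> \<le> C * (x * (2 powr \<bar>k - 2\<bar> * error_shape z Y))"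
          unfolding k_def using C(1) x0 Y XY by (intro mult_left_mono error_shape_le) auto
        also have "\<dots> = K1 * (x * error_shape z Y)" by (simp add: K1_def)
        also have "\<dots> \<le> K1 * E" using xee Ks by (intro mult_left_mono) auto
        finally show ?thesis .
      qed
      have e2: "norm ((1 - z) * S1 - of_real x * (of_real X powr (z - 1) * (scaled_m z (X / Y) - scaled_m z (X / q)))) \<le> K * E"
      proof (cases "Y \<le> X - ln 2")
        case True
        hence "q = X - ln 2" by (simp add: q_def)
        thus ?thesis using K(2)[of y x] xy x0 True by (simp add: S1_def E_def X_def Y_def)
      next
        case False
        hence "q = Y" by (simp add: q_def)
        moreover have "log_primes Y Y = {}" by (auto simp: log_primes_def)
        ultimately show ?thesis using E0 K(1) by (simp add: S1_def)
      qed
      have xX: "x * (1 / X) \<le> E"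
      proof -
        have "1 / X \<le> 1 / Y" using XY Y by (intro divide_left_mono) auto
        hence "x * (1 / X) \<le> x * error_shape z Y" using eY x0 by (intro mult_left_mono) auto
        thus ?thesis using xee by linarith
      qed
      have e3: "norm ((1 - z) * S2) \<le> K2 * E"
      proof -
        have "norm S2 \<le> T * (x / X)" unfolding S2_def T_def X_def using q x4 by (intro top_primes) (auto simp: X_def)
        also have "\<dots> \<le> T * E" using xX T by (intro mult_left_mono) auto
        finally show ?thesis unfolding norm_mult K2_def mult.assoc by (intro mult_left_mono) auto
      qed
      have e4: "norm (of_real x * (of_real X powr (z - 1) * (scaled_m z (X / q) - leading_factor z))) \<le> K3 * E"
      proof -
        have "norm (of_real x * (of_real X powr (z - 1) * (scaled_m z (X / q) - leading_factor z))) = x * norm (of_real X powr (z - 1) * (scaled_m z (X / q) - leading_factor z))"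
          unfolding norm_mult[of "of_real x"] norm_of_real using x0 by simp
        also have "\<dots> \<le> x * (K3 * (1 / X))"
          unfolding K3_def k_def using q X x0 by (intro mult_left_mono scaled_m_near_1 z) auto
        also have "\<dots> = K3 * (x * (1 / X))" by simp
        also have "\<dots> \<le> K3 * E" using xX Ks by (intro mult_left_mono) auto
        finally show ?thesis .
      qed
      have "S_sum z x y - of_real x * main_term z X Y =
        (omega_sum z x - of_real x * (leading_factor z * of_real X powr (z - 1))) +
        ((1 - z) * S1 - of_real x * (of_real X powr (z - 1) * (scaled_m z (X / Y) - scaled_m z (X / q)))) + (1 - z) * S2 -
        of_real x * (of_real X powr (z - 1) * (scaled_m z (X / q) - leading_factor z))"
        unfolding b main_term_def by (simp add: algebra_simps)
      also have "norm \<dots> \<le> K1 * E + K * E + K2 * E + K3 * E"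
        
        by (rule order_trans[OF norm_triangle_ineq4 add_mono[OF norm_triangle_le[OF add_mono[OF norm_triangle_le[OF add_mono[OF e1 e2]] e3]] e4]])
      also have "\<dots> \<le> K' * E" using E0 Ks by (simp add: K'_def algebra_simps)
      finally show ?thesis .
    qed
    thus ?thesis by (simp add: X_def Y_def E_def)
  qed
  with K'0 show ?thesis unfolding approx_on_def by blast
qed

section \<open>All \<alpha> > 2 and the statement with O-terms\<close>

lemma approx_on_all: "Re z > 0 \<Longrightarrow> approx_on z (real n + 2)"
proof (induction n)
  case 0
  thus ?case by (simp add: approx_on_2)
next
  case (Suc n)
  have "approx_on z (real n + 2 + 1)" using Suc by (intro approx_on_Suc) auto
  moreover have "real n + 2 + 1 = real (Suc n) + 2" by simp
  ultimately show ?case by metis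
qed

text \<open>For large x the comparison function is exactly x log log x times
  \<open>error_shape\<close> at log y, so only \<open>log_factor\<close> remains to be compared with
  log log x.\<close>

lemma S_sum_bigo:
  assumes z: "Re z > 0" and \<alpha>: "\<alpha> > 2"
  shows "(\<lambda>x::real. cmod (S_sum z x (x powr (1 / \<alpha>)) - of_real x * m_fun z \<alpha> / of_real (ln (x powr (1 / \<alpha>))) powr (1 - z)))
    \<in> O[at_top](\<lambda>x. cmod (of_real (x * ln (ln x)) / of_real (ln (x powr (1 / \<alpha>))) powr (2 - z)) + x * ln (ln x) / ln (x powr (1 / \<alpha>)))"
proof -
  define n where "n = nat \<lceil>\<alpha>\<rceil>"
  have n: "\<alpha> \<le> real n + 2" unfolding n_def by linarith
  obtain C where C: "C > 0" "\<And>x y. 2 \<le> y \<Longrightarrow> y \<le> x \<Longrightarrow> ln x \<le> (real n + 2) * ln y \<Longrightarrow>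
     norm (S_sum z x y - of_real x * main_term z (ln x) (ln y)) \<le> C * (x * (log_factor (ln x) * error_shape z (ln y)))"
    using approx_on_all[OF z, of n] unfolding approx_on_def by blast
  define g where "g = (\<lambda>x. cmod (of_real (x * ln (ln x)) / of_real (ln (x powr (1 / \<alpha>))) powr (2 - z)) + x * ln (ln x) / ln (x powr (1 / \<alpha>)))"
  define f where "f = (\<lambda>x. cmod (S_sum z x (x powr (1 / \<alpha>)) - of_real x * m_fun z \<alpha> / of_real (ln (x powr (1 / \<alpha>))) powr (1 - z)))"
  \<comment> \<open>From exp 3 follows X = log x >= 3, hence log X >= 1 and 1 + log(1+X) <= 3 log X;
    from 2^\<alpha> follows y >= 2.\<close>
  have main: "norm (f x) \<le> 3 * C * norm (g x)" if x: "x \<ge> max (exp 3) (2 powr \<alpha>)" for x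
  proof -
    define X where "X = ln x"
    define y where "y = x powr (1 / \<alpha>)"
    define Y where "Y = ln y"
    have x1: "x \<ge> exp 3" "x \<ge> 2 powr \<alpha>" using x by auto
    have x0: "x > 0" using x1 exp_gt_zero[of 3] by linarith
    have "ln (exp 3) \<le> ln x" using x1 x0 by (subst ln_le_cancel_iff) auto
    hence X3: "X \<ge> 3" by (simp add: X_def)
    have "(1::real) \<le> exp 3" by simp
    hence xge1: "x \<ge> 1" using x1 by linarith
    have "(2 powr \<alpha>) powr (1 / \<alpha>) \<le> y" unfolding y_def using x1 \<alpha> by (intro powr_mono2) auto
    hence y2: "y \<ge> 2" using \<alpha> by (simp add: powr_powr)
    have "y \<le> x powr 1" unfolding y_def using \<alpha> xge1 by (intro powr_mono) auto
    hence yx: "y \<le> x" using x0 by simp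
    have YX: "Y = X / \<alpha>" using x0 by (simp add: Y_def y_def X_def ln_powr)
    have Y0: "Y > 0" using YX X3 \<alpha> by simp
    have XaY: "X = \<alpha> * Y" using YX \<alpha> by simp
    have "X \<le> (real n + 2) * Y" unfolding XaY using n Y0 by (intro mult_right_mono) auto
    hence bd: "norm (S_sum z x y - of_real x * main_term z X Y) \<le> C * (x * (log_factor X * error_shape z Y))"
      using C(2)[OF y2 yx] by (simp add: X_def Y_def)
    have "main_term z X Y = of_real (\<alpha> * Y) powr (z - 1) * (of_real \<alpha> powr (1 - z) * m_fun z \<alpha>)"
      using Y0 unfolding main_term_def scaled_m_def XaY by simp
    also have "\<dots> = (of_real \<alpha> powr (z - 1) * of_real \<alpha> powr (1 - z)) * (of_real Y powr (z - 1) * m_fun z \<alpha>)"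
      using Y0 \<alpha> by (subst of_real_mult_powr) auto
    also have "\<dots> = of_real Y powr (z - 1) * m_fun z \<alpha>" using \<alpha> of_real_powr_cancel(2)[of \<alpha> z] by simp
    also have "of_real Y powr (z - 1) = 1 / of_real Y powr (1 - z)"
      using of_real_powr_cancel(2)[OF Y0, of z] Y0 by (simp add: field_simps)
    finally have mt: "of_real x * main_term z X Y = of_real x * m_fun z \<alpha> / of_real Y powr (1 - z)" by simp
    have fx: "f x \<le> C * (x * (log_factor X * error_shape z Y))"
      using bd unfolding mt f_def y_def[symmetric] Y_def[symmetric] .
    have lnX: "ln X \<ge> 1"
    proof -
      have "exp 1 \<le> X" using exp_le X3 by linarith
      hence "ln (exp 1) \<le> ln X" using X3 by (subst ln_le_cancel_iff) auto
      thus ?thesis by simp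
    qed
    have lamX: "log_factor X \<le> 3 * ln X"
    proof -
      have "3 * X \<le> X * X" using X3 by (intro mult_right_mono) auto
      hence "1 + X \<le> X * X" using X3 by linarith
      hence "ln (1 + X) \<le> ln (X * X)" using X3 by (subst ln_le_cancel_iff) auto
      also have "\<dots> = 2 * ln X" using X3 by (simp add: ln_mult)
      finally show ?thesis using lnX by (simp add: log_factor_def)
    qed
    have gx: "g x = x * (ln X * error_shape z Y)"
    proof -
      have "cmod (of_real (x * ln X) / of_real Y powr (2 - z)) = x * ln X / Y powr (2 - Re z)"
        unfolding norm_divide norm_of_real norm_of_real_powr[OF Y0] using x0 lnX by simp
      also have "\<dots> = x * ln X * Y powr (Re z - 2)" using powr_minus_divide[of Y "2 - Re z"] by simp
      finally have "g x = x * ln X * Y powr (Re z - 2) + x * ln X / Y"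
        unfolding g_def y_def[symmetric] Y_def[symmetric] X_def[symmetric] by simp
      thus ?thesis by (simp add: error_shape_def algebra_simps)
    qed
    have "C * (x * (log_factor X * error_shape z Y)) \<le> C * (x * (3 * ln X * error_shape z Y))"
      using C(1) x0 lamX Y0 by (intro mult_left_mono mult_right_mono error_shape_nonneg) auto
    also have "\<dots> = 3 * C * g x" unfolding gx by simp
    also have "\<dots> \<le> 3 * C * norm (g x)" using C(1) by (intro mult_left_mono) auto
    finally have "f x \<le> 3 * C * norm (g x)" using fx by linarith
    thus ?thesis by (simp add: f_def)
  qed
  have "f \<in> O[at_top](g)"
    using main by (intro bigoI[where c = "3 * C"] eventually_at_top_linorderI[where c = "max (exp 3) (2 powr \<alpha>)"]) auto
  thus ?thesis by (simp only: f_def g_def)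
qed

theorem theorem5:
  fixes z :: complex and \<alpha> :: real
  assumes "Re z > 0" and "\<alpha> > 2"
  shows "((\<lambda>x::real. let y = x powr (1 / \<alpha>) in
             cmod (S_sum z x y - of_real x * m_fun z \<alpha> / of_real (ln y) powr (1 - z)))
           \<in> O[at_top](\<lambda>x. let y = x powr (1 / \<alpha>); x' = x * ln (ln x) in
             cmod (of_real x' / of_real (ln y) powr (2 - z)) + x' / ln y)) \<and>
         m_fun z \<alpha> =
           2 powr (1 - z) * m_fun z 2 / of_real \<alpha> powr (1 - z) +
           (1 - z) / of_real \<alpha> powr (1 - z) *
             integral {2..\<alpha>} (\<lambda>u. m_fun z (u - 1) / of_real u powr z)"
proof
  show "(\<lambda>x::real. let y = x powr (1 / \<alpha>) in
             cmod (S_sum z x y - of_real x * m_fun z \<alpha> / of_real (ln y) powr (1 - z)))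
           \<in> O[at_top](\<lambda>x. let y = x powr (1 / \<alpha>); x' = x * ln (ln x) in
             cmod (of_real x' / of_real (ln y) powr (2 - z)) + x' / ln y)"
    unfolding Let_def by (rule S_sum_bigo[OF assms])
  show "m_fun z \<alpha> =
           2 powr (1 - z) * m_fun z 2 / of_real \<alpha> powr (1 - z) +
           (1 - z) / of_real \<alpha> powr (1 - z) *
             integral {2..\<alpha>} (\<lambda>u. m_fun z (u - 1) / of_real u powr z)"
    using assms(2) by (subst m_fun.simps) simp
qed

end
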